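(* For two matroids $\mathcal{M}_1=(U,\mathcal{I}_1)$ and $\mathcal{M}_2=(U,\mathcal{I}_2)$ with $n=|U|$ and $r$ the maximum of their ranks, a largest set $S\in\mathcal{I}_1\cap\mathcal{I}_2$ can be obtained with high probability in $\tilde O(nr^{3/4})$ time in the dynamic-independence-oracle model.
   Context: Dynamic-independence-oracle model: for each matroid, starting from $S_0=\emptyset$ and counter $k=0$, the algorithm may perform $\textsc{Insert}(v,i)$ (create $S_{k+1}:=S_i\cup\{v\}$, increment $k$), $\textsc{Delete}(v,i)$ (create $S_{k+1}:=S_i\setminus\{v\}$, increment $k$), and $\textsc{Query}(i)$ (return whether $S_i$ is independent), where $i$ may index any previously created set; "time" counts both running time and the number of such operations. $\tilde O$ hides polylogarithmic factors in $n$. *)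

theory Defs
  imports "HOL-Probability.Probability_Mass_Function" "HOL-Library.Log_Nat"
begin

locale matroid =
  fixes U :: "'a set" and I :: "'a set set"
  assumes finite_ground: "finite U"
    and indep_subset: "X \<in> I \<Longrightarrow> X \<subseteq> U"
    and indep_empty: "{} \<in> I"
    and indep_mono: "X \<in> I \<Longrightarrow> Y \<subseteq> X \<Longrightarrow> Y \<in> I"
    and augment: "X \<in> I \<Longrightarrow> Y \<in> I \<Longrightarrow> card X < card Y \<Longrightarrow> \<exists>y\<in>Y - X. insert y X \<in> I"

definition matroid_rank :: "'a set set \<Rightarrow> nat" where
  "matroid_rank I = Max (card ` I)"

text \<open>
  The algorithms are programs of a probabilistic word RAM with two dynamic independence oracles,
  one for each matroid.  Every instruction, oracle operations included, takes one unit of time, so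
  the number of steps bounds both the running time and the number of oracle operations.

  Arguments are registers, the destination first, except for the constant in \<open>Const\<close> and the
  program address that is the last argument of \<open>JumpLess\<close>.  In \<open>Load\<close> and \<open>Store\<close>
  the register \<open>a\<close> holds a memory address; in \<open>Insert\<close> and \<open>Delete\<close> the two registers
  hold an element \<open>v\<close> and a set index \<open>i\<close>.
\<close>

datatype side = Fst | Snd

datatype arith = Add | Sub | Mul | Div | Mod

datatype instr =
    Const nat nat
  | Arith arith nat nat nat
  | Load nat nat
  | Store nat nat
  | JumpLess nat nat nat
  | Flip nat
  | Insert side nat nat
  | Delete side nat nat
  | Query side nat nat
  | Halt

fun apply_arith :: "arith \<Rightarrow> nat \<Rightarrow> nat \<Rightarrow> nat" where
  "apply_arith Add x y = x + y"
| "apply_arith Sub x y = x - y"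
| "apply_arith Mul x y = x * y"
| "apply_arith Div x y = x div y"
| "apply_arith Mod x y = x mod y"

text \<open>\<open>created s j ! i\<close> is the set \<open>S\<^sub>i\<close> of the oracle for matroid \<open>j\<close>.\<close>

record 'a config =
  pc :: nat
  regs :: "nat \<Rightarrow> nat"
  mem :: "nat \<Rightarrow> nat"
  created :: "side \<Rightarrow> 'a set list"

definition set_reg :: "nat \<Rightarrow> nat \<Rightarrow> 'a config \<Rightarrow> 'a config" where
  "set_reg d x s = s\<lparr>regs := (regs s)(d := x), pc := pc s + 1\<rparr>"

definition create :: "side \<Rightarrow> 'a set \<Rightarrow> 'a config \<Rightarrow> 'a config" where
  "create j X s = s\<lparr>created := (created s)(j := created s j @ [X]), pc := pc s + 1\<rparr>"

text \<open>
  The parameter \<open>w\<close> is the word length in bits; \<open>us\<close> lists the ground set, and the program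
  refers to the element \<open>us ! v\<close> by its position \<open>v\<close>.  The independent sets \<open>\<I>\<close> are
  used by \<open>Query\<close> only.  An oracle operation whose arguments are no element or no index of a
  set created before leaves the configuration as it is: the program is stuck there and never halts.
\<close>

fun exec :: "nat \<Rightarrow> 'a list \<Rightarrow> (side \<Rightarrow> 'a set set) \<Rightarrow> instr \<Rightarrow> 'a config \<Rightarrow> 'a config pmf" where
  "exec w us \<I> (Const d x) s = return_pmf (set_reg d (x mod 2 ^ w) s)"
| "exec w us \<I> (Arith f d a b) s =
    return_pmf (set_reg d (apply_arith f (regs s a) (regs s b) mod 2 ^ w) s)"
| "exec w us \<I> (Load d a) s = return_pmf (set_reg d (mem s (regs s a)) s)"
| "exec w us \<I> (Store a b) s =
    return_pmf (s\<lparr>mem := (mem s)(regs s a := regs s b), pc := pc s + 1\<rparr>)"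
| "exec w us \<I> (JumpLess a b l) s =
    return_pmf (s\<lparr>pc := (if regs s a < regs s b then l else pc s + 1)\<rparr>)"
| "exec w us \<I> (Flip d) s = map_pmf (\<lambda>x. set_reg d (of_bool x) s) (bernoulli_pmf (1 / 2))"
| "exec w us \<I> (Insert j rv ri) s = return_pmf (
    let v = regs s rv; i = regs s ri
    in if v < length us \<and> i < length (created s j)
       then create j (created s j ! i \<union> {us ! v}) s else s)"
| "exec w us \<I> (Delete j rv ri) s = return_pmf (
    let v = regs s rv; i = regs s ri
    in if v < length us \<and> i < length (created s j)
       then create j (created s j ! i - {us ! v}) s else s)"
| "exec w us \<I> (Query j d ri) s = return_pmf (
    let i = regs s ri
    in if i < length (created s j)
       then set_reg d (of_bool (created s j ! i \<in> \<I> j)) s else s)"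
| "exec w us \<I> Halt s = return_pmf s"

definition step :: "instr list \<Rightarrow> nat \<Rightarrow> 'a list \<Rightarrow> (side \<Rightarrow> 'a set set) \<Rightarrow> 'a config \<Rightarrow> 'a config pmf" where
  "step P w us \<I> s = (if pc s < length P then exec w us \<I> (P ! pc s) s else return_pmf s)"

text \<open>The only input that is given directly is \<open>n\<close>, in register \<open>0\<close>.\<close>

definition init_config :: "nat \<Rightarrow> 'a config" where
  "init_config n = \<lparr>pc = 0, regs = (\<lambda>_. 0)(0 := n), mem = (\<lambda>_. 0), created = (\<lambda>_. [{}])\<rparr>"

text \<open>The distribution of the configuration after \<open>t\<close> steps.\<close>

primrec run :: "instr list \<Rightarrow> nat \<Rightarrow> 'a list \<Rightarrow> (side \<Rightarrow> 'a set set) \<Rightarrow> nat \<Rightarrow> 'a config pmf" where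
  "run P w us \<I> 0 = return_pmf (init_config (length us))"
| "run P w us \<I> (Suc t) = bind_pmf (run P w us \<I> t) (step P w us \<I>)"

definition halted :: "instr list \<Rightarrow> 'a config \<Rightarrow> bool" where
  "halted P s \<longleftrightarrow> pc s < length P \<and> P ! pc s = Halt"

text \<open>
  The output is written out explicitly: register \<open>0\<close> holds a number \<open>m\<close>, and the first
  \<open>m\<close> memory cells hold the names of the elements.
\<close>

definition outputs :: "'a list \<Rightarrow> 'a config \<Rightarrow> 'a set \<Rightarrow> bool" where
  "outputs us s S \<longleftrightarrow>
    (\<forall>i < regs s 0. mem s i < length us) \<and> S = (\<lambda>i. us ! mem s i) ` {..<regs s 0}"

end

theory Submission
  imports Defs
begin

text \<open>Let \<open>h\<close> be about the fourth root of the rank. A push-relabel phase with \<open>h\<close> levels comes within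
about \<open>h\<^sup>3\<close> of the optimum; augmentations along paths with at most \<open>h\<^sup>3\<close> levels, with labels that only grow,
reduce the deficit to about \<open>h\<close>; the remaining augmentations are single breadth-first searches. In these a
random sample, drawn in advance, finds the edges of elements with many undiscovered neighbours, and the edges
of the others are listed by binary search. Each phase costs \<open>n h\<^sup>3\<close> up to logarithms, in a while
language with sets as values that is compiled to the oracle machine.\<close>

section \<open>Exchange in two matroids\<close>

text \<open>With \<open>r <= h ^ 4\<close>, a labelling with \<open>d\<close> levels certifies a
  deficit of at most \<open>card S / d\<close>, because a cheapest level is a cut. For
  \<open>h\<close> levels this is \<open>h ^ 3\<close>, plus an excess that is also allowed to be
  \<open>h ^ 3\<close>; for \<open>h ^ 3\<close> levels it is \<open>h\<close>. Hence the two
  switching points. The last \<open>h\<close> searches may then cost about \<open>n * h ^ 2\<close>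
  each. A full scan for the exchange partners of one queue element costs \<open>n\<close> and is
  affordable about \<open>h ^ 2\<close> times, so it is made only when it is known to discover a
  sampled element or to end the search; the sample has about \<open>h ^ 2\<close> elements up to
  logarithms. An element whose undiscovered partners avoid the sample has at most
  \<open>n / h ^ 2\<close> of them, so all such lists together have about
  \<open>h ^ 4 * (n / h ^ 2)\<close> entries. The obstacle is that one sample serves all searches,
  and each search depends on the earlier ones. It is removed by making searches canonical: lists and
  scans discover elements in the same increasing order, so the states do not depend on the sample,
  and a union bound over at most \<open>(n + 2) ^ 3\<close> sets fixed in advance suffices.\<close>

context matroid
begin

text \<open>For independent \<open>X\<close> this is the matroid closure, phrased without a rank
  function. For dependent \<open>X\<close> it is all of \<open>U\<close>, so the lemmas below ask
  for independence where it matters.\<close>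

definition cl :: "'a set => 'a set" where
 "cl X = {e : U. e : X | insert e X ~: I}"

lemma cl_mono: "X <= Y ==> cl X <= cl Y"
 unfolding cl_def using indep_mono by blast

lemma subset_cl: "X <= U ==> X <= cl X"
 unfolding cl_def by blast

lemma finite_indep: "X : I ==> finite X"
 using finite_ground indep_subset finite_subset by metis

lemma indep_subset_cl: "X : I ==> X <= cl X"
 using indep_subset subset_cl by blast

lemma cl_I: "e : U ==> insert e X ~: I ==> e : cl X"
 unfolding cl_def by blast

lemma not_cl_D: "e : U ==> e ~: cl X ==> e ~: X & insert e X : I"
 unfolding cl_def by blast

lemma cl_D: "e : cl X ==> e ~: X ==> insert e X ~: I"
 unfolding cl_def by blast

lemma extend_indep:
 assumes "X : I" "Y : I" "card X <= card Y"
 shows "EX Z:I. X <= Z & Z <= X Un Y & card Z = card Y"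
 using assms
proof (induction "card Y - card X" arbitrary: X)
 case 0
 thus ?case by (intro bexI[of _ X]) auto
next
 case (Suc k)
 have "card X < card Y" using Suc.hyps(2) by linarith
 then obtain y where y: "y : Y - X" "insert y X : I"
  using augment[OF Suc.prems(1,2)] by blast
 have c: "card (insert y X) = Suc (card X)"
  using y finite_indep Suc.prems by auto
 from Suc(1)[of "insert y X"] obtain Z where
  "Z : I" "insert y X <= Z" "Z <= insert y X Un Y" "card Z = card Y"
  using c y Suc.prems Suc.hyps(2) by (metis Suc_diff_Suc Suc_inject Suc_leI diff_is_0_eq nat.distinct(1) not_le_imp_less)
 thus ?case using y by blast
qed

lemma card_le_of_subset_cl:
 assumes "X : I" "Y : I" "Y <= cl X"
 shows "card Y <= card X"
proof (rule ccontr)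
 assume "~ ?thesis"
 then obtain y where "y : Y - X" "insert y X : I"
  using augment[of X Y] assms by auto
 thus False using assms cl_D by blast
qed

text \<open>An element of \<open>cl X\<close> that is independent of \<open>Y\<close> would extend
  \<open>Y\<close> to an independent subset of \<open>cl X\<close> larger than
  \<open>X\<close>.\<close>

lemma cl_subset_of_card:
 assumes "X : I" "Y : I" "Y <= cl X" "card X <= card Y"
 shows "cl X <= cl Y"
proof
 fix e assume e: "e : cl X"
 show "e : cl Y"
 proof (rule ccontr)
  assume "e ~: cl Y"
  moreover have "e : U" using e cl_def by auto
  ultimately have "e ~: Y" "insert e Y : I" using not_cl_D by auto
  moreover have "insert e Y <= cl X" using e assms by auto
  ultimately have "card (insert e Y) <= card X" using card_le_of_subset_cl assms by blast
  thus False using \<open>e ~: Y\<close> assms finite_indep by simp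
 qed
qed

text \<open>When \<open>X\<close> is grown to the size of \<open>insert e Y\<close> by elements of
  \<open>insert e Y\<close>, the element \<open>e\<close> must be taken: without it the result would
  be an independent subset of \<open>cl Y\<close> that is larger than \<open>Y\<close>.\<close>

lemma cl_subset_cl:
 assumes "X : I" "Y : I" "X <= cl Y"
 shows "cl X <= cl Y"
proof
 fix e assume e: "e : cl X"
 hence eU: "e : U" using cl_def by auto
 show "e : cl Y"
 proof (rule ccontr)
  assume ne: "e ~: cl Y"
  hence eY: "e ~: Y" "insert e Y : I" using not_cl_D eU by auto
  have "card X <= card (insert e Y)"
   using card_le_of_subset_cl[OF assms(2,1,3)] eY finite_indep[OF assms(2)] by simp
  then obtain Z where Z: "Z : I" "X <= Z" "Z <= X Un insert e Y" "card Z = card (insert e Y)"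
   using extend_indep[OF assms(1) eY(2)] by blast
  have "e : Z"
  proof (rule ccontr)
   assume "e ~: Z"
   hence "Z <= cl Y" using Z assms indep_subset_cl by blast
   hence "card Z <= card Y" using card_le_of_subset_cl assms Z by blast
   thus False using Z eY finite_indep assms by simp
  qed
  hence "insert e X : I" using Z indep_mono by blast
  hence "e : X" using cl_D e by blast
  thus False using ne assms by blast
 qed
qed

text \<open>Independence of \<open>R\<close> relative to \<open>Q\<close> depends on the span of
  \<open>Q\<close> only. When \<open>X\<close> is grown by elements of \<open>Q Un R\<close>, at
  most \<open>card Q\<close> elements of the result lie in \<open>cl Q\<close>, so all of
  \<open>R\<close> has to be taken.\<close>

lemma indep_Un_of_subset_cl:
 assumes "Q Un R : I" "Q Int R = {}" "X : I" "X <= cl Q"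
 shows "X Un R : I"
proof -
 have Q: "Q : I" and fin: "finite Q" "finite R"
  using assms indep_mono finite_indep by blast+
 have "card X <= card Q" using card_le_of_subset_cl Q assms by blast
 hence "card X <= card (Q Un R)" using card_mono[of "Q Un R" Q] fin by simp
 then obtain Z where Z: "Z : I" "X <= Z" "Z <= X Un (Q Un R)" "card Z = card (Q Un R)"
  using extend_indep assms by blast
 have "Z Int (X Un Q) : I" using Z indep_mono by blast
 moreover have "Z Int (X Un Q) <= cl Q" using assms indep_subset_cl[OF Q] by blast
 ultimately have 1: "card (Z Int (X Un Q)) <= card Q" using card_le_of_subset_cl Q by blast
 have "Z = Z Int (X Un Q) Un (Z Int R)" using Z by blast
 hence "card Z <= card (Z Int (X Un Q)) + card (Z Int R)" by (metis card_Un_le)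
 moreover have "card (Q Un R) = card Q + card R" using fin assms by (simp add: card_Un_disjoint)
 ultimately have "card R <= card (Z Int R)" using 1 Z by linarith
 hence "Z Int R = R" using fin by (meson Int_lower2 card_seteq)
 hence "X Un R <= Z" using Z(2) by blast
 thus ?thesis using indep_mono[OF Z(1)] by blast
qed

text \<open>The fundamental circuit of \<open>b\<close> in \<open>S\<close> cannot lie in
  \<open>insert b A\<close>, and any of its elements outside \<open>A\<close> may be removed.
  Circuits are avoided in the proof: \<open>insert b A\<close> is extended to size
  \<open>card S\<close> inside \<open>insert b S\<close>, which leaves out exactly one element of
  \<open>S\<close>.\<close>

lemma dependent_imp_swap:
 assumes "S : I" "A <= S" "b : U" "insert b A : I" "insert b S ~: I"
 shows "EX a:S - A. insert b (S - {a}) : I"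
proof -
 have bS: "b ~: S" using assms by (metis insert_absorb)
 have fS: "finite S" using assms finite_indep by blast
 have "card (insert b A) <= card S"
 proof (rule ccontr)
  assume "~ ?thesis"
  hence "card S <= card A" using fS assms finite_subset[OF assms(2) fS] bS
   by (metis card_insert_disjoint not_less_eq_eq subsetD)
  hence "A = S" using card_seteq assms fS by blast
  thus False using assms by blast
 qed
 then obtain Z where Z: "Z : I" "insert b A <= Z" "Z <= insert b A Un S" "card Z = card S"
  using extend_indep assms by blast
 have "Z - {b} ~= S" using Z assms bS by (metis Diff_single_insert insert_Diff insert_subset)
 moreover have "Z - {b} <= S" using Z assms by blast
 ultimately obtain a where a: "a : S" "a ~: Z" using bS by blast
 have "Z - {b} <= S - {a}" using a Z assms by blast
 moreover have "card (Z - {b}) = card (S - {a})" using Z a fS finite_indep by simp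
 ultimately have "Z - {b} = S - {a}" using card_subset_eq[of "S - {a}"] fS by simp
 hence "insert b (S - {a}) = Z" using Z by blast
 thus ?thesis using Z a by blast
qed

text \<open>Exchanges in triangular position can be made at once. After removing
  \<open>pa 0\<close>, the remaining exchanges preserve the closure of \<open>X - {pa 0}\<close>,
  and \<open>pg 0\<close> is not in that closure, so it can be added last. Equality of closures, not
  only independence, is what the induction and later the labels need.\<close>

lemma exchange_chain:
 fixes k :: nat
 assumes "X : I" "!!i. i < k ==> pa i : X" "inj_on pa {..<k}"
  "!!i. i < k ==> pg i : U"
  "!!i. i < k ==> insert (pg i) (X - pa ` {..<i}) ~: I"
  "!!i. i < k ==> insert (pg i) (X - {pa i}) : I"
 shows "(X - pa ` {..<k}) Un pg ` {..<k} : I &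
  card ((X - pa ` {..<k}) Un pg ` {..<k}) = card X &
  cl ((X - pa ` {..<k}) Un pg ` {..<k}) = cl X"
 using assms
proof (induction k arbitrary: X pa pg)
 case 0
 thus ?case by simp
next
 case (Suc k)
 define X0 where "X0 = X - {pa 0}"
 define pa' pg' where "pa' = pa \<circ> Suc" and "pg' = pg \<circ> Suc"
 let ?R = "(X0 - pa' ` {..<k}) Un pg' ` {..<k}"
 have X0: "X0 : I" "X0 <= X" unfolding X0_def using Suc.prems indep_mono by blast+
 have imS: "pa ` {..<Suc i} = insert (pa 0) (pa' ` {..<i})" "pg ` {..<Suc i} = insert (pg 0) (pg' ` {..<i})" for i
  unfolding pa'_def pg'_def lessThan_Suc_eq_insert_0 by (auto simp: image_comp)
 have "?R : I & card ?R = card X0 & cl ?R = cl X0"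
 proof (rule Suc.IH[OF X0(1)])
  fix i assume i: "i < k"
  show "pa' i : X0" unfolding X0_def pa'_def using Suc.prems(2)[of "Suc i"] i
   inj_onD[OF Suc.prems(3), of "Suc i" 0] by auto
  show "pg' i : U" unfolding pg'_def using Suc.prems i by auto
  have "X0 - pa' ` {..<i} = X - pa ` {..<Suc i}" unfolding imS X0_def by blast
  thus "insert (pg' i) (X0 - pa' ` {..<i}) ~: I" using Suc.prems(5)[of "Suc i"] i pg'_def by simp
  have "insert (pg' i) (X0 - {pa' i}) <= insert (pg (Suc i)) (X - {pa (Suc i)})"
   unfolding pa'_def pg'_def using X0 by auto
  thus "insert (pg' i) (X0 - {pa' i}) : I" using Suc.prems(6)[of "Suc i"] i indep_mono by blast
 next
  show "inj_on pa' {..<k}" using Suc.prems(3) unfolding pa'_def inj_on_def by auto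
 qed
 hence R: "?R : I" "card ?R = card X0" "cl ?R = cl X0" by auto
 let ?y = "pg 0"
 have y: "?y : U" "insert ?y X ~: I" "insert ?y X0 : I"
  using Suc.prems(4)[of 0] Suc.prems(5)[of 0] Suc.prems(6)[of 0] X0_def by auto
 have yX: "?y ~: X" using y Suc.prems(1) insert_absorb by metis
 hence "?y ~: cl X0" using y X0 unfolding cl_def by blast
 hence yR: "?y ~: ?R" "insert ?y ?R : I" using R not_cl_D y by metis+
 have a0: "pa 0 : X" using Suc.prems by blast
 have cX: "card X = Suc (card X0)" unfolding X0_def
  using a0 finite_indep[OF Suc.prems(1)] by (metis card_Suc_Diff1)
 have "cl X0 <= cl X" using X0 cl_mono by blast
 hence sub: "insert ?y ?R <= cl X" using indep_subset_cl[OF R(1)] R(3) cl_I[OF y(1,2)] by blast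
 have card: "card (insert ?y ?R) = card X" using yR finite_indep[OF R(1)] R cX by simp
 have "cl X <= cl (insert ?y ?R)" using cl_subset_of_card[OF Suc.prems(1) yR(2) sub] card by simp
 moreover have "cl (insert ?y ?R) <= cl X" using cl_subset_cl[OF yR(2) Suc.prems(1) sub] .
 moreover have "(X - pa ` {..<Suc k}) Un pg ` {..<Suc k} = insert ?y ?R"
  unfolding imS X0_def by blast
 ultimately show ?case using yR card by simp
qed

text \<open>Along one path the exchanges are triangular in opposite orders for the two matroids;
  this is the order that occurs for the first one.\<close>

lemma exchange_chain_rev:
 fixes k :: nat
 assumes "X : I" "!!i. i < k ==> pa i : X" "inj_on pa {..<k}"
  "!!i. i < k ==> pg i : U"
  "!!i. i < k ==> insert (pg i) (X - pa ` {i<..<k}) ~: I"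
  "!!i. i < k ==> insert (pg i) (X - {pa i}) : I"
 shows "(X - pa ` {..<k}) Un pg ` {..<k} : I &
  card ((X - pa ` {..<k}) Un pg ` {..<k}) = card X &
  cl ((X - pa ` {..<k}) Un pg ` {..<k}) = cl X"
proof -
 define f where "f i = k - Suc i" for i
 have im: "f ` {..<k} = {..<k}"
 proof -
  have "x : f ` {..<k}" if "x < k" for x
   by (rule image_eqI[of _ _ "k - Suc x"]) (use that in \<open>auto simp: f_def\<close>)
  thus ?thesis by (auto simp: f_def)
 qed
 have im2: "f ` {..<i} = {f i<..<k}" if "i < k" for i
 proof -
  have "x : f ` {..<i}" if "x < k" "f i < x" for x
   by (rule image_eqI[of _ _ "k - Suc x"]) (use that \<open>i < k\<close> in \<open>auto simp: f_def\<close>)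
  thus ?thesis using that by (auto simp: f_def)
 qed
 have e: "(pa \<circ> f) ` {..<k} = pa ` {..<k}" "(pg \<circ> f) ` {..<k} = pg ` {..<k}"
  using im by (metis image_comp)+
 have e2: "(pa \<circ> f) ` {..<i} = pa ` {f i<..<k}" if "i < k" for i
  using im2[OF that] by (metis image_comp)
 have fk: "f i < k" if "i < k" for i using that by (auto simp: f_def)
 have inj: "inj_on (pa \<circ> f) {..<k}"
  by (rule comp_inj_on) (auto simp: im assms(3), auto simp: f_def inj_on_def)
 show ?thesis
  using exchange_chain[of X k "pa \<circ> f" "pg \<circ> f"] assms(1,2,4-6) inj e e2 fk by auto
qed

end

section \<open>Augmenting paths in two matroids and their effect on closures\<close>

locale matroid_pair = M1: matroid U I1 + M2: matroid U I2
 for U :: "'a set" and I1 I2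
begin

definition common :: "'a set => bool" where
 "common S \<longleftrightarrow> S : I1 & S : I2"

text \<open>An augmenting path visits one element \<open>pe i\<close> outside \<open>S\<close> and one element \<open>pa i\<close> of \<open>S\<close> on
 each level \<open>i\<close>; the levels make the exchanges triangular in both matroids.\<close>

definition aug_path :: "'a set => ('a => nat) => nat => (nat => 'a) => (nat => 'a) => bool" where
 "aug_path S L D pa pe \<longleftrightarrow> common S &
  (ALL i<=D. pe i : U - S & L (pe i) = i) & (ALL i<D. pa i : S & L (pa i) = i) &
  insert (pe D) S : I1 & insert (pe 0) S : I2 &
  (ALL i<D. insert (pe i) (S - {pa i}) : I1 & insert (pe i) {a : S. L a <= i} ~: I1 &
   insert (pe (Suc i)) (S - {pa i}) : I2 & insert (pe (Suc i)) {a : S. i <= L a} ~: I2)"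

context
 fixes S L D pa pe
 assumes path: "aug_path S L D pa pe"
begin

abbreviation (input) "S' == (S - pa ` {..<D}) Un pe ` {..D}"

lemma path_facts:
 "S : I1" "S : I2" "i <= D ==> pe i : U - S" "i <= D ==> L (pe i) = i"
 "i < D ==> pa i : S" "i < D ==> L (pa i) = i"
 "insert (pe D) S : I1" "insert (pe 0) S : I2"
 "i < D ==> insert (pe i) (S - {pa i}) : I1" "i < D ==> insert (pe i) {a : S. L a <= i} ~: I1"
 "i < D ==> insert (pe (Suc i)) (S - {pa i}) : I2"
 "i < D ==> insert (pe (Suc i)) {a : S. i <= L a} ~: I2"
 using path unfolding aug_path_def common_def by auto

lemma path_inj: "inj_on pa {..<D}" "inj_on pe {..D}"
 using path_facts(4,6) unfolding inj_on_def by (metis lessThan_iff, metis atMost_iff)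

text \<open>In the first matroid \<open>pe i\<close> replaces \<open>pa i\<close>. The freedom in
  \<open>X\<close> serves two purposes: \<open>S\<close> itself gives the augmentation, a lower
  level set gives the growth of closures.\<close>

lemma chain_M1:
 assumes "X <= S" "{a : S. L a < k} <= X" "k <= D"
 shows "(X - pa ` {..<k}) Un pe ` {..<k} : I1 &
  card ((X - pa ` {..<k}) Un pe ` {..<k}) = card X &
  M1.cl ((X - pa ` {..<k}) Un pe ` {..<k}) = M1.cl X"
proof (rule M1.exchange_chain_rev)
 show "X : I1" using path_facts(1) assms(1) M1.indep_mono by blast
 show "inj_on pa {..<k}" using path_inj(1) assms(3) inj_on_subset by (metis lessThan_subset_iff)
 fix i assume i: "i < k"
 hence iD: "i < D" using assms by simp
 show "pa i : X" using path_facts(5,6)[OF iD] assms(2) i by auto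
 show "pe i : U" using path_facts(3)[of i] iD by auto
 have "{a : S. L a <= i} <= X - pa ` {i<..<k}"
  using assms path_facts(6) i by fastforce
 thus "insert (pe i) (X - pa ` {i<..<k}) ~: I1"
  using path_facts(10)[OF iD] M1.indep_mono[of _ "insert (pe i) {a : S. L a <= i}"] by blast
 show "insert (pe i) (X - {pa i}) : I1"
  using path_facts(9)[OF iD] M1.indep_mono[of _ "insert (pe i) (X - {pa i})"] assms(1) by blast
qed

text \<open>In the second matroid \<open>pa i\<close> is replaced by the next element
  \<open>pe (Suc i)\<close>; hence the shift by one in the image, and \<open>pe 0\<close> is left
  over instead of \<open>pe D\<close>.\<close>

lemma chain_M2:
 assumes "X <= S" "{a : S. j <= L a} <= X"
 shows "(X - pa ` {j..<D}) Un pe ` {Suc j..<Suc D} : I2 &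
  card ((X - pa ` {j..<D}) Un pe ` {Suc j..<Suc D}) = card X &
  M2.cl ((X - pa ` {j..<D}) Un pe ` {Suc j..<Suc D}) = M2.cl X"
proof -
 define f where "f i = pa (j + i)" for i
 define g where "g i = pe (Suc (j + i))" for i
 have sh: "(%i. j + i) ` {..<i} = {j..<j + i}" for i
  by (metis add.commute atLeast0LessThan image_add_atLeastLessThan plus_nat.add_0)
 have sh1: "(%i. j + i) ` {..<D - j} = {j..<D}"
  using sh[of "D - j"] by (cases "j <= D") auto
 have im: "f ` {..<D - j} = pa ` {j..<D}"
  using sh1 unfolding f_def by (metis (no_types, lifting) image_cong image_image)
 have "g ` {..<D - j} = pe ` Suc ` (%i. j + i) ` {..<D - j}"
  unfolding g_def by (simp add: image_image)
 hence im': "g ` {..<D - j} = pe ` {Suc j..<Suc D}" using sh1 by simp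
 have imi: "f ` {..<i} = pa ` {j..<j + i}" for i
  using sh[of i] unfolding f_def by (metis (no_types, lifting) image_cong image_image)
 have "(X - f ` {..<D - j}) Un g ` {..<D - j} : I2 &
  card ((X - f ` {..<D - j}) Un g ` {..<D - j}) = card X &
  M2.cl ((X - f ` {..<D - j}) Un g ` {..<D - j}) = M2.cl X"
 proof (rule M2.exchange_chain)
  show "X : I2" using path_facts(2) assms(1) M2.indep_mono by blast
  show "inj_on f {..<D - j}"
  proof (rule inj_onI)
   fix x y assume "x : {..<D - j}" "y : {..<D - j}" "f x = f y"
   hence "j + x < D" "j + y < D" "pa (j + x) = pa (j + y)" unfolding f_def by auto
   hence "j + x = j + y" using path_facts(6) by metis
   thus "x = y" by simp
  qed
  fix i assume i: "i < D - j"
  hence iD: "j + i < D" by simp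
  show "f i : X" unfolding f_def using path_facts(5,6)[OF iD] assms(2) by auto
  show "g i : U" unfolding g_def using path_facts(3)[of "Suc (j + i)"] iD by auto
  have "{a : S. j + i <= L a} <= X - f ` {..<i}"
   unfolding imi using assms path_facts(6) iD by fastforce
  thus "insert (g i) (X - f ` {..<i}) ~: I2" unfolding g_def
   using path_facts(12)[OF iD] M2.indep_mono[of _ "insert (pe (Suc (j + i))) {a : S. j + i <= L a}"] by blast
  show "insert (g i) (X - {f i}) : I2" unfolding f_def g_def
   using path_facts(11)[OF iD] M2.indep_mono[of _ "insert (pe (Suc (j + i))) (X - {pa (j + i)})"] assms(1) by blast
 qed
 thus ?thesis unfolding im im' .
qed

text \<open>The exchanges leave the closure of \<open>S\<close> unchanged in each matroid, so the
  element left over, \<open>pe D\<close> in the first and \<open>pe 0\<close> in the second, is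
  still free and can be added.\<close>

lemma augment_common: "common S'" "card S' = Suc (card S)"
proof -
 let ?R = "(S - pa ` {..<D}) Un pe ` {..<D}"
 have R: "?R : I1" "card ?R = card S" "M1.cl ?R = M1.cl S"
  using chain_M1[of S D] by auto
 have b: "pe D : U" "pe D ~: S" using path_facts(3)[of D] by auto
 hence "pe D ~: M1.cl ?R" using R path_facts(7) unfolding M1.cl_def by blast
 hence bR: "pe D ~: ?R" "insert (pe D) ?R : I1" using M1.not_cl_D b by blast+
 have e: "S' = insert (pe D) ?R" by (auto simp: lessThan_Suc_atMost[symmetric] less_Suc_eq)
 thus "card S' = Suc (card S)" using bR R M1.finite_indep[OF R(1)] by simp
 let ?Q = "(S - pa ` {0..<D}) Un pe ` {Suc 0..<Suc D}"
 have Q: "?Q : I2" "M2.cl ?Q = M2.cl S" using chain_M2[of S 0] by auto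
 have c: "pe 0 : U" "pe 0 ~: S" using path_facts(3)[of 0] by auto
 hence "pe 0 ~: M2.cl ?Q" using Q path_facts(8) unfolding M2.cl_def by blast
 hence cR: "insert (pe 0) ?Q : I2" using M2.not_cl_D c by blast
 have "{..D} = insert 0 {Suc 0..<Suc D}" by auto
 hence "S' = insert (pe 0) ?Q" by (auto simp: atLeast0LessThan)
 thus "common S'" using cR bR e unfolding common_def by metis
qed

text \<open>An augmentation never shrinks the span of the low levels in the first matroid, nor, by
  the next lemma, that of the high levels in the second. This monotonicity is why labels survive
  augmentations.\<close>

lemma cl_levels_M1:
 "M1.cl {a : S. L a <= j} <= M1.cl {a : S'. L a <= j}"
proof -
 \<comment> \<open>The path has \<open>D\<close> exchanges in all, and \<open>min D (Suc j)\<close>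
   of them lie on levels up to \<open>j\<close>.\<close>
 let ?k = "min D (Suc j)"
 let ?X = "{a : S. L a <= j}"
 have "M1.cl ((?X - pa ` {..<?k}) Un pe ` {..<?k}) = M1.cl ?X"
  by (rule chain_M1[THEN conjunct2, THEN conjunct2]) auto
 moreover have "(?X - pa ` {..<?k}) Un pe ` {..<?k} <= {a : S'. L a <= j}"
  using path_facts(4,6) by fastforce
 ultimately show ?thesis using M1.cl_mono[of "(?X - pa ` {..<?k}) Un pe ` {..<?k}" "{a : S'. L a <= j}"] by argo
qed

lemma cl_levels_M2:
 "M2.cl {a : S. j <= L a} <= M2.cl {a : S'. j <= L a}"
proof -
 let ?X = "{a : S. j <= L a}"
 have "M2.cl ((?X - pa ` {j..<D}) Un pe ` {Suc j..<Suc D}) = M2.cl ?X"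
  by (rule chain_M2[THEN conjunct2, THEN conjunct2]) auto
 moreover have "(?X - pa ` {j..<D}) Un pe ` {Suc j..<Suc D} <= {a : S'. j <= L a}"
  using path_facts(4,6) by fastforce
 ultimately show ?thesis using M2.cl_mono[of "(?X - pa ` {j..<D}) Un pe ` {Suc j..<Suc D}" "{a : S'. j <= L a}"] by argo
qed

text \<open>An element that leaves \<open>S\<close> on level \<open>i\<close> is matched by
  \<open>pe i\<close>, which enters on the same level, so the sum only loses the term of
  \<open>pe D\<close>.\<close>

lemma augment_level_sum:
 assumes "finite U"
 shows "(SUM x:U - S'. d - L x) <= (SUM x:U - S. d - L x)"
proof -
 have fin: "finite (U - S)" "finite (U - S')" using assms by auto
 have sU: "S <= U" using path_facts(1) M1.indep_subset by blast
 have "(SUM x:pa ` {..<D}. d - L x) = (\<Sum>i<D. d - i)"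
  by (subst sum.reindex[OF path_inj(1)]) (simp add: path_facts(6))
 moreover have "(SUM x:pe ` {..<D}. d - L x) = (\<Sum>i<D. d - i)"
  by (subst sum.reindex[OF inj_on_subset[OF path_inj(2)]]) (auto simp: path_facts(4))
 ultimately have eq: "(SUM x:pa ` {..<D}. d - L x) = (SUM x:pe ` {..<D}. d - L x)" by simp
 let ?W = "(U - S) - pe ` {..D}"
 have "U - S' = ?W Un pa ` {..<D}" using path_facts(3,5) sU by fastforce
 moreover have "?W Int pa ` {..<D} = {}" using path_facts(5) by blast
 ultimately have "(SUM x:U - S'. d - L x) = (SUM x:?W. d - L x) + (SUM x:pe ` {..<D}. d - L x)"
  using fin eq by (simp add: sum.union_disjoint)
 also have "... = (SUM x:?W Un pe ` {..<D}. d - L x)"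
  using fin by (subst sum.union_disjoint) auto
 also have "... <= (SUM x:U - S. d - L x)"
  by (rule sum_mono2) (use fin path_facts(3) in auto)
 finally show ?thesis .
qed

end

text \<open>A distance labelling of the exchange graph, counted from the elements free in the second
  matroid. The circuit of a nonfree \<open>b\<close> in the first matroid is confined to levels at
  most \<open>L b\<close>, and for positive \<open>L b\<close> the circuit in the second to levels
  at least \<open>L b - 1\<close>, so labels are lower bounds on distances. The form
  \<open>L b <= L a + 1\<close> avoids truncated subtraction.\<close>

definition valid_labels :: "'a set => ('a => nat) => bool" where
 "valid_labels S L \<longleftrightarrow> common S &
  (ALL b:U - S. insert b S : I1 | insert b {a : S. L a <= L b} ~: I1) &
  (ALL b:U - S. 1 <= L b --> insert b {a : S. L b <= L a + 1} ~: I2)"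

lemma augment_valid:
 assumes p: "aug_path S L D pa pe" and v: "valid_labels S L"
  and free: "!!b. b : U - S ==> insert b S : I1 ==> D <= L b"
  and cap: "!!a. a : S ==> L a <= D"
 shows "valid_labels ((S - pa ` {..<D}) Un pe ` {..D}) L"
proof -
 let ?S = "(S - pa ` {..<D}) Un pe ` {..D}"
 note pf = path_facts[OF p]
 have cap': "L a <= D" if "a : ?S" for a using that cap pf(4) by auto
 have sU: "S <= U" using pf(1) M1.indep_subset by blast
 have "insert b ?S : I1 | insert b {a : ?S. L a <= L b} ~: I1" if b: "b : U - ?S" for b
 proof (cases "D <= L b")
  case True
  \<comment> \<open>No element of the new set lies above level \<open>D\<close>, so for such
    \<open>b\<close> the lower level set is the whole set and the two alternatives are
    complementary.\<close>
  hence "{a : ?S. L a <= L b} = ?S" using le_trans[OF cap' True] by blast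
  thus ?thesis by simp
 next
  case False
  have "b : M1.cl {a : S. L a <= L b}"
  proof (cases "b : S")
   case True
   thus ?thesis using sU unfolding M1.cl_def by auto
  next
   case F: False
   hence "insert b {a : S. L a <= L b} ~: I1"
   using v free[of b] b False unfolding valid_labels_def by auto
   thus ?thesis using b M1.cl_I by blast
  qed
  hence "b : M1.cl {a : ?S. L a <= L b}" using cl_levels_M1[OF p] by blast
  thus ?thesis using M1.cl_D b by blast
 qed
 moreover have "insert b {a : ?S. L b <= L a + 1} ~: I2" if b: "b : U - ?S" "1 <= L b" for b
 proof -
  have e: "{a : X. L b <= L a + 1} = {a : X. L b - 1 <= L a}" for X using b by auto
  have "b : M2.cl {a : S. L b - 1 <= L a}"
  proof (cases "b : S")
   case True
   thus ?thesis using sU unfolding M2.cl_def by auto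
  next
   case F: False
   hence "insert b {a : S. L b <= L a + 1} ~: I2"
   using v b unfolding valid_labels_def by blast
   hence "insert b {a : S. L b - 1 <= L a} ~: I2" unfolding e .
   thus ?thesis using b M2.cl_I by blast
  qed
  hence "b : M2.cl {a : ?S. L b - 1 <= L a}" using cl_levels_M2[OF p] by blast
  thus ?thesis using M2.cl_D[of b "{a : ?S. L b - 1 <= L a}"] b unfolding e by blast
 qed
 ultimately show ?thesis using augment_common(1)[OF p] unfolding valid_labels_def by blast
qed

text \<open>Weak duality of matroid intersection: \<open>T\<close> splits into a part spanned by
  \<open>X\<close> in the first matroid and a part spanned by \<open>Y\<close> in the
  second.\<close>

lemma card_le_two_closures:
 assumes "common T" "X : I1" "Y : I2" "!!x. x : T ==> x : M1.cl X | x : M2.cl Y"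
 shows "card T <= card X + card Y"
proof -
 have T: "T : I1" "T : I2" using assms common_def by auto
 have fin: "finite T" using T M1.finite_indep by blast
 have i: "T Int M1.cl X : I1" "T - M1.cl X : I2"
  using M1.indep_mono[OF T(1)] M2.indep_mono[OF T(2)] by auto
 have "card (T Int M1.cl X) <= card X"
  by (rule M1.card_le_of_subset_cl[OF assms(2) i(1)]) simp
 moreover have "card (T - M1.cl X) <= card Y"
  by (rule M2.card_le_of_subset_cl[OF assms(3) i(2)]) (use assms(4) in auto)
 moreover have "card T = card (T Int M1.cl X) + card (T - M1.cl X)"
  using card_Un_disjoint[of "T Int M1.cl X" "T - M1.cl X"] fin by (simp add: Int_Diff_Un Int_Diff_disjoint)
 ultimately show ?thesis by linarith
qed

end

text \<open>Pigeonhole: the \<open>d\<close> disjoint levels share at most \<open>card S\<close>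
  elements.\<close>

lemma small_level_set:
 fixes L :: "'a => nat"
 assumes "finite S" "0 < d"
 shows "EX i<d. d * card {x : S. L x = i} <= card S"
proof (rule ccontr)
 assume "~ ?thesis"
 hence *: "card S < d * card {x : S. L x = i}" if "i < d" for i using that by force
 have "d * (\<Sum>i<d. card {x : S. L x = i}) = (\<Sum>i<d. d * card {x : S. L x = i})"
  by (simp add: sum_distrib_left)
 also have "... > (\<Sum>i<d. card S)"
  by (rule sum_strict_mono) (use * assms in auto)
 finally have "d * card S < d * (\<Sum>i<d. card {x : S. L x = i})" by simp
 hence "card S < (\<Sum>i<d. card {x : S. L x = i})" by simp
 also have "... = card (\<Union>i<d. {x : S. L x = i})"
  using assms by (subst card_UN_disjoint) auto
 also have "... <= card S" by (rule card_mono) (use assms in auto)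
 finally show False by simp
qed

context matroid_pair
begin

text \<open>Cut at a cheapest level \<open>i < d\<close>. What the levels up to \<open>i\<close> do
  not span in the first matroid, the levels from \<open>i\<close> on span in the second, and the two
  sets overlap in level \<open>i\<close> alone. Elements free in the first matroid have labels at
  least \<open>d\<close> and so lie above the cut.\<close>

lemma valid_labels_bound:
 assumes v: "valid_labels S L" and T: "common T" and d: "0 < d"
  and free: "!!b. b : U - S ==> insert b S : I1 ==> d <= L b"
 shows "d * card T <= d * card S + card S"
proof -
 have S: "S : I1" "S : I2" using v unfolding valid_labels_def common_def by auto
 have fin: "finite S" using S M1.finite_indep by blast
 obtain i where i: "i < d" "d * card {x : S. L x = i} <= card S"
  using small_level_set[OF fin d] by blast
 let ?X = "{x : S. L x <= i}" and ?Y = "{x : S. i <= L x}"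
 have "card T <= card ?X + card ?Y"
 proof (rule card_le_two_closures[OF T])
  show "?X : I1" "?Y : I2" using S M1.indep_mono M2.indep_mono by auto
  fix x assume "x : T"
  hence xU: "x : U" using T M1.indep_subset unfolding common_def by blast
  show "x : M1.cl ?X | x : M2.cl ?Y"
  proof (cases "x : S")
   case True
   thus ?thesis using xU unfolding M1.cl_def M2.cl_def by auto
  next
   case False
   show ?thesis
   proof (cases "L x <= i")
   case True
   hence "insert x {a : S. L a <= L x} ~: I1"
   using v free[of x] False xU i unfolding valid_labels_def by auto
   moreover have "{a : S. L a <= L x} <= ?X" using True by auto
   ultimately show ?thesis using xU M1.cl_mono M1.cl_I by blast
   next
   case c: False
   hence "insert x {a : S. L x <= L a + 1} ~: I2"
   using v False xU unfolding valid_labels_def by auto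
   moreover have "{a : S. L x <= L a + 1} <= ?Y" using c by auto
   ultimately show ?thesis using xU M2.cl_mono M2.cl_I by blast
   qed
  qed
 qed
 also have "card ?X + card ?Y = card S + card {x : S. L x = i}"
 proof -
  have "?X Un ?Y = S" "?X Int ?Y = {x : S. L x = i}" by auto
  thus ?thesis using card_Un_Int[of ?X ?Y] fin by simp
 qed
 finally have "d * card T <= d * (card S + card {x : S. L x = i})" by simp
 thus ?thesis using i by (simp add: distrib_left)
qed

end

section \<open>A while language with oracle expressions\<close>

text \<open>Sets are ordinary values of expressions; in the machine a set value becomes the index of
  a set created before.\<close>

datatype exp =
  N nat | V nat | Sz | Op arith exp exp | Get nat exp | Get2 nat exp exp | Qry side sexp
and sexp =
  SV nat | SGet nat exp | SEmp | SIns exp sexp | SDel exp sexp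

datatype com =
  Skip
 | Assign nat exp
 | SAssign side nat sexp
 | Put nat exp exp
 | Put2 nat exp exp exp
 | SPut side nat exp sexp
 | Outp exp exp
 | Toss nat
 | Seq com com (infixr \<open>;;\<close> 60)
 | If exp com com
 | While exp com

text \<open>\<open>coins\<close> is a tape read by \<open>Toss\<close>, so the semantics itself
  needs no probabilities. \<open>clk\<close> counts commands and tests; a machine step count is
  obtained from it by a constant factor.\<close>

record st =
 rv :: "nat => nat"
 ra :: "nat => nat => nat"
 rm :: "nat => nat => nat => nat"
 sv :: "side => nat => nat set"
 sa :: "side => nat => nat => nat set"
 out :: "nat => nat"
 coins :: "bool list"
 clk :: nat

abbreviation tick :: "st => st" where
 "tick s == s(|clk := Suc (clk s)|)"

abbreviation For :: "nat => exp => com => com" where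
 "For x e c == Assign x (N 0) ;; While (Op Sub e (V x)) (c ;; Assign x (Op Add (V x) (N 1)))"

abbreviation When :: "exp => com => com" where
 "When e c == If e c Skip"

text \<open>Truncated subtraction supplies the logic: \<open>NotE e\<close> is one exactly when
  \<open>e\<close> is zero, and in \<open>EqE\<close> the two differences both vanish exactly for
  equal arguments.\<close>

abbreviation NotE :: "exp => exp" where
 "NotE e == Op Sub (N 1) e"

abbreviation EqE :: "exp => exp => exp" where
 "EqE a b == NotE (Op Add (Op Sub a b) (Op Sub b a))"

primrec mr :: "com => nat set" where
 "mr Skip = {}" | "mr (Assign x e) = {x}" | "mr (SAssign j x e) = {}" | "mr (Put a e f) = {}"
| "mr (Put2 a e f g) = {}" | "mr (SPut j a e f) = {}" | "mr (Outp e f) = {}" | "mr (Toss x) = {x}"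
| "mr (c ;; d) = mr c Un mr d" | "mr (If e c d) = mr c Un mr d" | "mr (While e c) = mr c"

primrec ma :: "com => nat set" where
 "ma Skip = {}" | "ma (Assign x e) = {}" | "ma (SAssign j x e) = {}" | "ma (Put a e f) = {a}"
| "ma (Put2 a e f g) = {}" | "ma (SPut j a e f) = {}" | "ma (Outp e f) = {}" | "ma (Toss x) = {}"
| "ma (c ;; d) = ma c Un ma d" | "ma (If e c d) = ma c Un ma d" | "ma (While e c) = ma c"

primrec mm :: "com => nat set" where
 "mm Skip = {}" | "mm (Assign x e) = {}" | "mm (SAssign j x e) = {}" | "mm (Put a e f) = {}"
| "mm (Put2 a e f g) = {a}" | "mm (SPut j a e f) = {}" | "mm (Outp e f) = {}" | "mm (Toss x) = {}"
| "mm (c ;; d) = mm c Un mm d" | "mm (If e c d) = mm c Un mm d" | "mm (While e c) = mm c"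

primrec ms :: "com => (side \<times> nat) set" where
 "ms Skip = {}" | "ms (Assign x e) = {}" | "ms (SAssign j x e) = {(j, x)}" | "ms (Put a e f) = {}"
| "ms (Put2 a e f g) = {}" | "ms (SPut j a e f) = {}" | "ms (Outp e f) = {}" | "ms (Toss x) = {}"
| "ms (c ;; d) = ms c Un ms d" | "ms (If e c d) = ms c Un ms d" | "ms (While e c) = ms c"

primrec mz :: "com => (side \<times> nat) set" where
 "mz Skip = {}" | "mz (Assign x e) = {}" | "mz (SAssign j x e) = {}" | "mz (Put a e f) = {}"
| "mz (Put2 a e f g) = {}" | "mz (SPut j a e f) = {(j, a)}" | "mz (Outp e f) = {}" | "mz (Toss x) = {}"
| "mz (c ;; d) = mz c Un mz d" | "mz (If e c d) = mz c Un mz d" | "mz (While e c) = mz c"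

primrec mo :: "com => bool" where
 "mo Skip = False" | "mo (Assign x e) = False" | "mo (SAssign j x e) = False" | "mo (Put a e f) = False"
| "mo (Put2 a e f g) = False" | "mo (SPut j a e f) = False" | "mo (Outp e f) = True" | "mo (Toss x) = False"
| "mo (c ;; d) = (mo c | mo d)" | "mo (If e c d) = (mo c | mo d)" | "mo (While e c) = mo c"

primrec mt :: "com => bool" where
 "mt Skip = False" | "mt (Assign x e) = False" | "mt (SAssign j x e) = False" | "mt (Put a e f) = False"
| "mt (Put2 a e f g) = False" | "mt (SPut j a e f) = False" | "mt (Outp e f) = False" | "mt (Toss x) = True"
| "mt (c ;; d) = (mt c | mt d)" | "mt (If e c d) = (mt c | mt d)" | "mt (While e c) = mt c"

text \<open>The syntactic write sets \<open>mr\<close> to \<open>mt\<close> give every program its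
  frame, so that later specifications need to mention only what changes.\<close>

definition fr :: "com => st => st => bool" where
 "fr c s s' \<longleftrightarrow> (ALL x. x ~: mr c --> rv s' x = rv s x) & (ALL a. a ~: ma c --> ra s' a = ra s a) &
  (ALL a. a ~: mm c --> rm s' a = rm s a) & (ALL j x. (j, x) ~: ms c --> sv s' j x = sv s j x) &
  (ALL j a. (j, a) ~: mz c --> sa s' j a = sa s j a) & (~ mo c --> out s' = out s) &
  (~ mt c --> coins s' = coins s) & clk s <= clk s'"

lemma fr_refl: "fr c s s"
 by (simp add: fr_def)

lemma fr_trans: "fr c s t ==> fr c t u ==> fr c s u"
 by (simp add: fr_def)

lemma fr_sub:
 "fr c s t ==> mr c <= mr d ==> ma c <= ma d ==> mm c <= mm d ==> ms c <= ms d ==> mz c <= mz d ==>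
  (mo c --> mo d) ==> (mt c --> mt d) ==> fr d s t"
 unfolding fr_def by blast

lemma fr_pre_tick: "fr c (tick s) t ==> fr c s t"
 unfolding fr_def by auto

locale lang =
 fixes n B :: nat and J :: "side => nat set set"
begin

primrec ev :: "exp => st => nat" and sev :: "sexp => side => st => nat set" where
 "ev (N c) s = c"
| "ev (V x) s = rv s x"
| "ev Sz s = n"
| "ev (Op f a b) s = apply_arith f (ev a s) (ev b s)"
| "ev (Get a e) s = ra s a (ev e s)"
| "ev (Get2 a e f) s = rm s a (ev e s) (ev f s)"
| "ev (Qry j q) s = of_bool (sev q j s : J j)"
| "sev (SV x) j s = sv s j x"
| "sev (SGet a e) j s = sa s j a (ev e s)"
| "sev SEmp j s = {}"
| "sev (SIns e q) j s = insert (ev e s) (sev q j s)"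
| "sev (SDel e q) j s = sev q j s - {ev e s}"

text \<open>The bound \<open>B\<close> on sums, products and array indices excludes overflow and overlapping arrays.\<close>

primrec ok :: "exp => st => bool" and sok :: "sexp => side => st => bool" where
 "ok (N c) s = True"
| "ok (V x) s = True"
| "ok Sz s = True"
| "ok (Op f a b) s = (ok a s & ok b s &
  (case f of Add => ev a s + ev b s < B | Mul => ev a s * ev b s < B | _ => True))"
| "ok (Get a e) s = (ok e s & ev e s < B)"
| "ok (Get2 a e f) s = (ok e s & ok f s & ev e s < B & ev f s < n)"
| "ok (Qry j q) s = sok q j s"
| "sok (SV x) j s = True"
| "sok (SGet a e) j s = (ok e s & ev e s < B)"
| "sok SEmp j s = True"
| "sok (SIns e q) j s = (ok e s & sok q j s & ev e s < n)"
| "sok (SDel e q) j s = (ok e s & sok q j s & ev e s < n)"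

inductive big :: "com => st => st => bool" where
 Skip: "big Skip s s"
| Assign: "ok e s ==> big (Assign x e) s (s(|rv := (rv s)(x := ev e s), clk := Suc (clk s)|))"
| SAssign: "sok q j s ==>
  big (SAssign j x q) s (s(|sv := (sv s)(j := (sv s j)(x := sev q j s)), clk := Suc (clk s)|))"
| Put: "ok e s ==> ok f s ==> ev e s < B ==>
  big (Put a e f) s (s(|ra := (ra s)(a := (ra s a)(ev e s := ev f s)), clk := Suc (clk s)|))"
| Put2: "ok e s ==> ok f s ==> ok g s ==> ev e s < B ==> ev f s < n ==>
  big (Put2 a e f g) s (s(|rm := (rm s)(a := (rm s a)(ev e s := (rm s a (ev e s))(ev f s := ev g s))), clk := Suc (clk s)|))"
| SPut: "ok e s ==> sok q j s ==> ev e s < B ==>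
  big (SPut j a e q) s (s(|sa := (sa s)(j := (sa s j)(a := (sa s j a)(ev e s := sev q j s))), clk := Suc (clk s)|))"
| Outp: "ok e s ==> ok f s ==> ev e s < n ==>
  big (Outp e f) s (s(|out := (out s)(ev e s := ev f s), clk := Suc (clk s)|))"
| Toss: "coins s = z # zs ==>
  big (Toss x) s (s(|rv := (rv s)(x := of_bool z), coins := zs, clk := Suc (clk s)|))"
| Seq: "big c s t ==> big d t u ==> big (c ;; d) s u"
| IfT: "ok e s ==> ev e s ~= 0 ==> big c (tick s) t ==> big (If e c d) s t"
| IfF: "ok e s ==> ev e s = 0 ==> big d (tick s) t ==> big (If e c d) s t"
| WhileT: "ok e s ==> ev e s ~= 0 ==> big c (tick s) t ==> big (While e c) t u ==> big (While e c) s u"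
| WhileF: "ok e s ==> ev e s = 0 ==> big (While e c) s (tick s)"

lemma big_fr: "big c s t ==> fr c s t"
proof (induction rule: big.induct)
 case (Seq c s t d u)
 have "fr (c ;; d) s t" by (rule fr_sub[OF Seq.IH(1)]) auto
 moreover have "fr (c ;; d) t u" by (rule fr_sub[OF Seq.IH(2)]) auto
 ultimately show ?case by (rule fr_trans)
next
 case (IfT e s c t d)
 show ?case by (rule fr_sub[OF fr_pre_tick[OF IfT.IH]]) auto
next
 case (IfF e s d t c)
 show ?case by (rule fr_sub[OF fr_pre_tick[OF IfF.IH]]) auto
next
 case (WhileT e s c t u)
 have "fr (While e c) s t" by (rule fr_sub[OF fr_pre_tick[OF WhileT.IH(1)]]) auto
 thus ?case using WhileT.IH(2) by (rule fr_trans)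
qed (auto simp: fr_def)

text \<open>Total correctness by way of some terminating run. As a predicate on start states it
  behaves like a weakest precondition, and \<open>T_simps\<close> lets the simplifier execute
  straight-line code.\<close>

definition T :: "com => st => (st => bool) => bool" where
 "T c s Q \<longleftrightarrow> (EX t. big c s t & Q t)"

inductive_cases big_cases:
 "big Skip s t" "big (Assign x e) s t" "big (SAssign j x q) s t" "big (Put a e f) s t"
 "big (Put2 a e f g) s t" "big (SPut j a e q) s t" "big (Outp e f) s t" "big (Toss x) s t"
 "big (c ;; d) s t" "big (If e c d) s t"

lemma T_simps [simp]:
 "T Skip s Q = Q s"
 "T (Assign x e) s Q = (ok e s & Q (s(|rv := (rv s)(x := ev e s), clk := Suc (clk s)|)))"
 "T (SAssign j x q) s Q = (sok q j s &
  Q (s(|sv := (sv s)(j := (sv s j)(x := sev q j s)), clk := Suc (clk s)|)))"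
 "T (Put a e f) s Q = (ok e s & ok f s & ev e s < B &
  Q (s(|ra := (ra s)(a := (ra s a)(ev e s := ev f s)), clk := Suc (clk s)|)))"
 "T (Put2 a e f g) s Q = (ok e s & ok f s & ok g s & ev e s < B & ev f s < n &
  Q (s(|rm := (rm s)(a := (rm s a)(ev e s := (rm s a (ev e s))(ev f s := ev g s))), clk := Suc (clk s)|)))"
 "T (SPut j a e q) s Q = (ok e s & sok q j s & ev e s < B &
  Q (s(|sa := (sa s)(j := (sa s j)(a := (sa s j a)(ev e s := sev q j s))), clk := Suc (clk s)|)))"
 "T (Outp e f) s Q = (ok e s & ok f s & ev e s < n &
  Q (s(|out := (out s)(ev e s := ev f s), clk := Suc (clk s)|)))"
 "T (c ;; d) s Q = T c s (%t. T d t Q)"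
 "T (If e c d) s Q = (ok e s & (if ev e s ~= 0 then T c (tick s) Q else T d (tick s) Q))"
 unfolding T_def by (auto intro: big.intros elim!: big_cases)

lemma T_Toss: "coins s = z # zs ==>
  Q (s(|rv := (rv s)(x := of_bool z), coins := zs, clk := Suc (clk s)|)) ==> T (Toss x) s Q"
 unfolding T_def using Toss by blast

lemma T_conseq: "T c s P ==> (!!t. P t ==> fr c s t ==> Q t) ==> T c s Q"
 unfolding T_def using big_fr by blast

text \<open>The clock is the variant: each iteration advances it and the invariant keeps it at most
  \<open>K\<close>. A time bound thus proves termination as well.\<close>

lemma T_While:
 assumes "I s"
  and test: "!!t. I t ==> fr (While e c) s t ==> ok e t & clk t <= K"
  and body: "!!t. I t ==> fr (While e c) s t ==> ev e t ~= 0 ==> T c (tick t) I"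
  and final: "!!t. I t ==> fr (While e c) s t ==> ev e t = 0 ==> Q (tick t)"
 shows "T (While e c) s Q"
proof -
 have "I t ==> fr (While e c) s t ==> T (While e c) t Q" for t
 proof (induction "K - clk t" arbitrary: t rule: less_induct)
  case less
  note it = less.prems
  show ?case
  proof (cases "ev e t = 0")
   case True
   thus ?thesis using test[OF it] final[OF it] WhileF unfolding T_def by blast
  next
   case False
   from body[OF it False] obtain u where u: "big c (tick t) u" "I u" unfolding T_def by blast
   have f: "fr c (tick t) u" using big_fr[OF u(1)] .
   have "fr (While e c) t u" by (rule fr_sub[OF fr_pre_tick[OF f]]) auto
   hence f2: "fr (While e c) s u" using it(2) fr_trans by blast
   have "clk t < clk u" using f unfolding fr_def by simp
   moreover have "clk u <= K" using test[OF u(2) f2] by simp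
   ultimately have "T (While e c) u Q" using less.hyps[OF _ u(2) f2] by simp
   thus ?thesis using WhileT[OF _ False u(1)] test[OF it] unfolding T_def by blast
  qed
 qed
 thus ?thesis using assms(1) fr_refl by blast
qed

text \<open>The bound \<open>e\<close> is evaluated again before each iteration, hence the demand
  that its value stays \<open>m\<close>. The condition \<open>m < B\<close> excludes overflow of the
  counter.\<close>

lemma T_For:
 assumes x: "x ~: mr c" and m: "m < B"
  and init: "P 0 (s(|rv := (rv s)(x := 0), clk := Suc (clk s)|))"
  and test: "!!i t. P i t ==> fr (For x e c) s t ==> rv t x = i ==> i <= m ==> ok e t & ev e t = m"
  and body: "!!i t. P i t ==> fr (For x e c) s t ==> rv t x = i ==> i < m ==>
   T c (tick t) (%u. P (Suc i) (u(|rv := (rv u)(x := Suc i), clk := Suc (clk u)|)))"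
  and final: "!!t. P m t ==> fr (For x e c) s t ==> rv t x = m ==> Q (tick t)"
 shows "T (For x e c) s Q"
proof -
 let ?W = "While (Op Sub e (V x)) (c ;; Assign x (Op Add (V x) (N 1)))"
 have "P i t ==> fr (For x e c) s t ==> rv t x = i ==> i <= m ==> T ?W t Q" for i t
 proof (induction "m - i" arbitrary: i t)
  case 0
  hence i: "i = m" by simp
  have "ok e t & ev e t = m" using test[OF 0(2-5)] .
  moreover have "Q (tick t)" using final 0 i by blast
  ultimately show ?case using WhileF[of "Op Sub e (V x)" t] 0 i unfolding T_def by auto
 next
  case (Suc k)
  hence i: "i < m" by simp
  have tst: "ok e t & ev e t = m" using test[OF Suc(3-6)] .
  obtain u where u: "big c (tick t) u" "P (Suc i) (u(|rv := (rv u)(x := Suc i), clk := Suc (clk u)|))"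
   using body[OF Suc(3-5) i] unfolding T_def by blast
  have ux: "rv u x = i" using big_fr[OF u(1)] x Suc unfolding fr_def by simp
  let ?u = "u(|rv := (rv u)(x := Suc i), clk := Suc (clk u)|)"
  have asg: "big (Assign x (Op Add (V x) (N 1))) u ?u"
   using Assign[of "Op Add (V x) (N 1)" u x] ux i m by simp
  have b: "big (c ;; Assign x (Op Add (V x) (N 1))) (tick t) ?u"
   using Seq[OF u(1) asg] .
  have "fr (For x e c) t ?u" by (rule fr_sub[OF fr_pre_tick[OF big_fr[OF b]]]) auto
  hence f: "fr (For x e c) s ?u" using Suc(4) fr_trans by blast
  have "T ?W ?u Q" by (rule Suc(1)[OF _ u(2) f]) (use Suc i in auto)
  then obtain v where v: "big ?W ?u v" "Q v" unfolding T_def by blast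
  have "big ?W t v" by (rule WhileT[OF _ _ b v(1)]) (use tst Suc i in auto)
  thus ?case using v(2) unfolding T_def by blast
 qed
 from this[of 0, OF init] show ?thesis by (auto simp: fr_def)
qed

end

section \<open>Compilation to the machine\<close>

text \<open>Modulo six, number variables have residue \<open>4\<close> and set variables the
  residues \<open>0\<close> and \<open>2\<close>; all of them are even and lie above the reserved
  registers \<open>0\<close> to \<open>6\<close>.\<close>

fun vs :: "side => nat => nat" where
 "vs Fst x = 6 * x + 12"
| "vs Snd x = 6 * x + 14"

fun kr :: "side => nat" where
 "kr Fst = 1"
| "kr Snd = 2"

text \<open>Four arrays are interleaved for each array name: offset \<open>0\<close> for numbers,
  \<open>1\<close> and \<open>2\<close> for the sets of the two oracles, and \<open>3\<close> for a
  matrix.\<close>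

fun sc :: "side => nat" where
 "sc Fst = 1"
| "sc Snd = 2"

definition vr :: "nat => nat" where "vr x = 6 * x + 10"
definition tp :: "nat => nat" where "tp i = 2 * i + 11"

text \<open>Registers: \<open>0\<close> holds \<open>n\<close>, \<open>1\<close> and \<open>2\<close> the indices of the last created sets, \<open>3\<close> the number
 of interleaved arrays, \<open>4\<close> and \<open>5\<close> the constants one and zero, \<open>6\<close> holds \<open>n + 1\<close>; variables live in
 even registers and temporaries in odd ones.\<close>

definition adr2_code :: "nat => nat => instr list" where
 "adr2_code k d = [Arith Mul (tp d) (tp d) 6, Arith Add (tp d) (tp d) (tp (Suc d)), Arith Mul (tp d) (tp d) 3,
  Const (tp (Suc d)) k, Arith Add (tp d) (tp d) (tp (Suc d)), Arith Add (tp d) (tp d) 0]"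

definition adr_code :: "nat => nat => instr list" where
 "adr_code k d = Const (tp (Suc d)) 0 # adr2_code k d"

text \<open>\<open>SEmp\<close> becomes index \<open>0\<close>, where every oracle starts with the
  empty set. After an insertion or deletion the last-index register of that side is increased
  (register \<open>4\<close> holds one) and its value is the result.\<close>

primrec cexp :: "exp => nat => instr list" and csexp :: "sexp => side => nat => instr list" where
 "cexp (N c) d = [Const (tp d) c]"
| "cexp (V x) d = [Arith Add (tp d) (vr x) 5]"
| "cexp Sz d = [Arith Add (tp d) 0 5]"
| "cexp (Op f a b) d = cexp a d @ cexp b (Suc d) @ [Arith f (tp d) (tp d) (tp (Suc d))]"
| "cexp (Get a e) d = cexp e d @ adr_code (4 * a) d @ [Load (tp d) (tp d)]"
| "cexp (Get2 a e f) d = cexp e d @ cexp f (Suc d) @ adr2_code (4 * a + 3) d @ [Load (tp d) (tp d)]"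
| "cexp (Qry j q) d = csexp q j d @ [Query j (tp d) (tp d)]"
| "csexp (SV x) j d = [Arith Add (tp d) (vs j x) 5]"
| "csexp (SGet a e) j d = cexp e d @ adr_code (4 * a + sc j) d @ [Load (tp d) (tp d)]"
| "csexp SEmp j d = [Const (tp d) 0]"
| "csexp (SIns e q) j d = cexp e d @ csexp q j (Suc d) @
  [Insert j (tp d) (tp (Suc d)), Arith Add (kr j) (kr j) 4, Arith Add (tp d) (kr j) 5]"
| "csexp (SDel e q) j d = cexp e d @ csexp q j (Suc d) @
  [Delete j (tp d) (tp (Suc d)), Arith Add (kr j) (kr j) 4, Arith Add (tp d) (kr j) 5]"

text \<open>Jump targets are absolute, so the start address \<open>l\<close> is passed down.
  \<open>JumpLess 5 4\<close> always jumps, since registers \<open>5\<close> and \<open>4\<close>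
  hold zero and one.\<close>

primrec comp :: "nat => com => instr list" where
 "comp l Skip = []"
| "comp l (Assign x e) = cexp e 0 @ [Arith Add (vr x) (tp 0) 5]"
| "comp l (SAssign j x q) = csexp q j 0 @ [Arith Add (vs j x) (tp 0) 5]"
| "comp l (Put a e f) = cexp e 0 @ adr_code (4 * a) 0 @ cexp f (Suc 0) @ [Store (tp 0) (tp (Suc 0))]"
| "comp l (Put2 a e f g) =
  cexp e 0 @ cexp f (Suc 0) @ adr2_code (4 * a + 3) 0 @ cexp g (Suc 0) @ [Store (tp 0) (tp (Suc 0))]"
| "comp l (SPut j a e q) =
  cexp e 0 @ adr_code (4 * a + sc j) 0 @ csexp q j (Suc 0) @ [Store (tp 0) (tp (Suc 0))]"
| "comp l (Outp e f) = cexp e 0 @ cexp f (Suc 0) @ [Store (tp 0) (tp (Suc 0))]"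
| "comp l (Toss x) = [Flip (vr x)]"
| "comp l (c ;; d) = (let cc = comp l c in cc @ comp (l + length cc) d)"
| "comp l (If e c d) = (let t = cexp e 0; l1 = l + length t + 1; cd = comp l1 d; l2 = l1 + length cd + 1;
  cc = comp l2 c in t @ [JumpLess 5 (tp 0) l2] @ cd @ [JumpLess 5 4 (l2 + length cc)] @ cc)"
| "comp l (While e c) = (let t = cexp e 0; l1 = l + length t + 2; cc = comp l1 c
  in t @ [JumpLess 5 (tp 0) l1, JumpLess 5 4 (l1 + length cc + 1)] @ cc @ [JumpLess 5 4 l])"

primrec wfe :: "nat => nat => exp => bool" and wfs :: "nat => nat => sexp => bool" where
 "wfe M K (N c) = (c < K)"
| "wfe M K (V x) = True"
| "wfe M K Sz = True"
| "wfe M K (Op f a b) = (wfe M K a & wfe M K b)"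
| "wfe M K (Get a e) = (a < M & wfe M K e)"
| "wfe M K (Get2 a e f) = (a < M & wfe M K e & wfe M K f)"
| "wfe M K (Qry j q) = wfs M K q"
| "wfs M K (SV x) = True"
| "wfs M K (SGet a e) = (a < M & wfe M K e)"
| "wfs M K SEmp = True"
| "wfs M K (SIns e q) = (wfe M K e & wfs M K q)"
| "wfs M K (SDel e q) = (wfe M K e & wfs M K q)"

primrec wf :: "nat => nat => com => bool" where
 "wf M K Skip = True"
| "wf M K (Assign x e) = wfe M K e"
| "wf M K (SAssign j x q) = wfs M K q"
| "wf M K (Put a e f) = (a < M & wfe M K e & wfe M K f)"
| "wf M K (Put2 a e f g) = (a < M & wfe M K e & wfe M K f & wfe M K g)"
| "wf M K (SPut j a e q) = (a < M & wfe M K e & wfs M K q)"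
| "wf M K (Outp e f) = (wfe M K e & wfe M K f)"
| "wf M K (Toss x) = True"
| "wf M K (c ;; d) = (wf M K c & wf M K d)"
| "wf M K (If e c d) = (wfe M K e & wf M K c & wf M K d)"
| "wf M K (While e c) = (wfe M K e & wf M K c)"

text \<open>The largest number of machine steps charged to one clock tick. The two extra steps of a
  test are its own conditional jump and one unconditional jump.\<close>

primrec kc :: "com => nat" where
 "kc Skip = 0"
| "kc (Assign x e) = length (comp 0 (Assign x e))"
| "kc (SAssign j x q) = length (comp 0 (SAssign j x q))"
| "kc (Put a e f) = length (comp 0 (Put a e f))"
| "kc (Put2 a e f g) = length (comp 0 (Put2 a e f g))"
| "kc (SPut j a e q) = length (comp 0 (SPut j a e q))"
| "kc (Outp e f) = length (comp 0 (Outp e f))"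
| "kc (Toss x) = 1"
| "kc (c ;; d) = max (kc c) (kc d)"
| "kc (If e c d) = max (length (cexp e 0) + 2) (max (kc c) (kc d))"
| "kc (While e c) = max (length (cexp e 0) + 2) (kc c)"

lemma wfe_mono:
 "M <= M' ==> K <= K' ==> wfe M K e ==> wfe M' K' e"
 "M <= M' ==> K <= K' ==> wfs M K q ==> wfs M' K' q"
 by (induction e and q) auto

lemma wf_mono: "M <= M' ==> K <= K' ==> wf M K c ==> wf M' K' c"
 using wfe_mono by (induction c) auto

text \<open>A program names finitely many arrays and constants, so one large number bounds both; the
  word length is chosen afterwards.\<close>

lemma wf_ev: "EX M0. ALL M>=M0. wf M M c"
proof -
 have mx: "EX M0. ALL M>=M0. P M & Q M" if "EX M0. ALL M>=M0. P M" "EX M0. ALL M>=M0. Q M" for P Q :: "nat => bool"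
  using that by (meson dual_order.trans nle_le)
 have lt: "EX M0. ALL M>=M0. a < M" for a :: nat by (rule exI[of _ "Suc a"]) auto
 have "EX M0. ALL M>=M0. wfe M M e" "EX M0. ALL M>=M0. wfs M M q" for e q
  by (induction e and q) (auto intro!: mx lt)
 thus ?thesis by (induction c) (auto intro!: mx lt)
qed

lemma tp_ne [simp]:
 "tp d ~= vr x" "vr x ~= tp d" "tp d ~= vs j x" "vs j x ~= tp d" "tp d ~= kr j" "kr j ~= tp d"
 "tp d ~= 0" "tp d ~= 3" "tp d ~= 4" "tp d ~= 5" "tp d ~= 6"
 "0 ~= tp d" "3 ~= tp d" "4 ~= tp d" "5 ~= tp d" "6 ~= tp d"
 unfolding tp_def vr_def by (cases j; simp?; presburger)+

lemma tp_inj [simp]: "tp i = tp k \<longleftrightarrow> i = k"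
 unfolding tp_def by auto

lemma vr_ne [simp]:
 "vr x = vr y \<longleftrightarrow> x = y" "vr x ~= vs j y" "vs j y ~= vr x" "vr x ~= kr j" "kr j ~= vr x"
 "vr x ~= 0" "vr x ~= 3" "vr x ~= 4" "vr x ~= 5" "vr x ~= 6"
 "0 ~= vr x" "3 ~= vr x" "4 ~= vr x" "5 ~= vr x" "6 ~= vr x"
 unfolding vr_def by (cases j; simp?; presburger)+

lemma vs_ne [simp]:
 "vs j x = vs j' y \<longleftrightarrow> j = j' & x = y" "vs j x ~= kr j'" "kr j' ~= vs j x"
 "vs j x ~= 0" "vs j x ~= 3" "vs j x ~= 4" "vs j x ~= 5" "vs j x ~= 6"
 "0 ~= vs j x" "3 ~= vs j x" "4 ~= vs j x" "5 ~= vs j x" "6 ~= vs j x"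
 by (cases j; cases j'; simp; presburger)+

lemma kr_ne [simp]: "kr j = kr j' \<longleftrightarrow> j = j'" "kr j ~= 0" "kr j ~= 3" "kr j ~= 4" "kr j ~= 5" "kr j ~= 6"
 "0 ~= kr j" "3 ~= kr j" "4 ~= kr j" "5 ~= kr j" "6 ~= kr j"
 by (cases j; cases j'; simp)+

section \<open>Machine runs on a fixed coin tape and their probability\<close>

lemma prob_bind_pmf:
 "measure_pmf.prob (bind_pmf p f) A = (\<integral>x. measure_pmf.prob (f x) A \<partial>measure_pmf p)"
proof -
 have "emeasure (measure_pmf (bind_pmf p f)) A = (\<integral>\<^sup>+x. ennreal (measure_pmf.prob (f x) A) \<partial>measure_pmf p)"
  by (subst emeasure_bind_pmf) (simp add: measure_pmf.emeasure_eq_measure)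
 also have "... = ennreal (\<integral>x. measure_pmf.prob (f x) A \<partial>measure_pmf p)"
  by (intro nn_integral_eq_integral measure_pmf.integrable_const_bound[where B = 1]) auto
 finally show ?thesis
  by (simp add: measure_pmf.emeasure_eq_measure integral_nonneg_AE)
qed

locale machine =
 fixes P :: "instr list" and w :: nat and us :: "'a list" and \<I> :: "side => 'a set set"
begin

inductive reach :: "'a config => bool list => nat => 'a config => bool list => bool" where
 reach_refl: "reach H zs 0 H zs"
| reach_det: "pc H < length P ==> (!!d. P ! pc H ~= Flip d) ==> exec w us \<I> (P ! pc H) H = return_pmf H1 ==>
  reach H1 zs t H2 zs2 ==> reach H zs (Suc t) H2 zs2"
| reach_flip: "pc H < length P ==> P ! pc H = Flip d ==>
  reach (set_reg d (of_bool z) H) zs t H2 zs2 ==> reach H (z # zs) (Suc t) H2 zs2"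

lemma reach_trans: "reach H zs t H1 zs1 ==> reach H1 zs1 t' H2 zs2 ==> reach H zs (t + t') H2 zs2"
proof (induction rule: reach.induct)
 case (reach_det H H1 zs t H2 zs2)
 thus ?case using reach.reach_det by simp
next
 case (reach_flip H d z zs t H2 zs2)
 thus ?case using reach.reach_flip by simp
qed simp

definition code_at :: "nat => instr list => bool" where
 "code_at l cs \<longleftrightarrow> (EX xs ys. P = xs @ cs @ ys & length xs = l)"

lemma code_at_append [simp]: "code_at l (a @ b) \<longleftrightarrow> code_at l a & code_at (l + length a) b"
proof
 assume "code_at l (a @ b)"
 then obtain xs ys where *: "P = xs @ (a @ b) @ ys" "length xs = l" unfolding code_at_def by blast
 have "P = xs @ a @ (b @ ys)" "P = (xs @ a) @ b @ ys" "length (xs @ a) = l + length a" using * by auto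
 thus "code_at l a & code_at (l + length a) b" using *(2) unfolding code_at_def by blast
next
 assume "code_at l a & code_at (l + length a) b"
 then obtain xs ys xs' ys' where *: "P = xs @ a @ ys" "length xs = l" "P = xs' @ b @ ys'"
  "length xs' = l + length a" unfolding code_at_def by blast
 have "take (length xs') P = xs'" using *(3) by simp
 moreover have "take (length xs') P = xs @ a" using * by simp
 ultimately have "xs' = xs @ a" by simp
 hence "P = xs @ (a @ b) @ ys'" using * by simp
 thus "code_at l (a @ b)" using *(2) unfolding code_at_def by blast
qed

lemma code_at_Cons: "code_at l (i # cs) \<longleftrightarrow> l < length P & P ! l = i & code_at (Suc l) cs"
proof
 assume "code_at l (i # cs)"
 then obtain xs ys where *: "P = xs @ (i # cs) @ ys" "length xs = l" unfolding code_at_def by blast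
 have "P = (xs @ [i]) @ cs @ ys" "length (xs @ [i]) = Suc l" using * by auto
 hence "code_at (Suc l) cs" unfolding code_at_def by blast
 thus "l < length P & P ! l = i & code_at (Suc l) cs" using * by (auto simp: nth_append)
next
 assume a: "l < length P & P ! l = i & code_at (Suc l) cs"
 then obtain xs ys where *: "P = xs @ cs @ ys" "length xs = Suc l" unfolding code_at_def by blast
 hence "xs ~= []" by auto
 then obtain xs' x where x: "xs = xs' @ [x]" by (metis append_butlast_last_id)
 hence "x = i" using a * by (auto simp: nth_append)
 hence "P = xs' @ (i # cs) @ ys" "length xs' = l" using * x by auto
 thus "code_at l (i # cs)" unfolding code_at_def by blast
qed

lemma reach_exec:
 assumes "code_at (pc H) (i # cs)" "!!d. i ~= Flip d" "exec w us \<I> i H = return_pmf H1"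
  "reach H1 zs t H2 zs2"
 shows "reach H zs (Suc t) H2 zs2"
 using assms reach_det[of H] by (auto simp: code_at_Cons)

lemma reach_exec1:
 assumes "pc H < length P & P ! pc H = i" "exec w us \<I> i H = return_pmf H1"
  "reach H1 zs t H2 zs2" "!!d. i ~= Flip d"
 shows "reach H zs (Suc t) H2 zs2"
 using assms reach_det[of H] by auto

text \<open>A step creates at most one set per oracle. This is how the running time bounds set
  indices, which must fit into a word.\<close>

lemma reach_created: "reach H zs t H' zs' ==> length (created H' j) <= length (created H j) + t"
proof (induction rule: reach.induct)
 case (reach_det H H1 zs t H2 zs2)
 have "length (created H1 j) <= Suc (length (created H j))"
  using reach_det(2,3)
  by (cases "P ! pc H")
   (auto simp: set_reg_def create_def Let_def dest!: return_pmf_inj[THEN iffD1] split: if_splits)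
 thus ?case using reach_det by simp
next
 case (reach_flip H d z zs t H2 zs2)
 thus ?case by (simp add: set_reg_def)
qed simp

text \<open>\<open>run\<close> appends a step at the end, while an induction along a tape needs the
  first step in front.\<close>

primrec runs :: "nat => 'a config => 'a config pmf" where
 "runs 0 H = return_pmf H"
| "runs (Suc t) H = bind_pmf (step P w us \<I> H) (runs t)"

lemma runs_Suc_right: "runs (Suc t) H = bind_pmf (runs t H) (step P w us \<I>)"
proof (induction t arbitrary: H)
 case 0
 have "runs 0 = return_pmf" by auto
 thus ?case by (simp add: bind_return_pmf bind_return_pmf')
next
 case (Suc t)
 have "runs (Suc (Suc t)) H = bind_pmf (step P w us \<I> H) (runs (Suc t))" by (rule runs.simps(2))
 also have "... = bind_pmf (step P w us \<I> H) (%H1. bind_pmf (runs t H1) (step P w us \<I>))"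
  by (intro bind_pmf_cong refl Suc.IH)
 also have "... = bind_pmf (runs (Suc t) H) (step P w us \<I>)"
  by (simp only: runs.simps(2) bind_assoc_pmf)
 finally show ?case .
qed

lemma run_eq_runs: "run P w us \<I> t = runs t (init_config (length us))"
 by (induction t) (simp_all del: runs.simps(2) add: runs_Suc_right)

lemma runs_halted:
 assumes "halted P H"
 shows "runs t H = return_pmf H"
proof (induction t)
 case (Suc t)
 have "step P w us \<I> H = return_pmf H" using assms unfolding step_def halted_def by simp
 thus ?case using Suc by (simp add: bind_return_pmf)
qed simp

text \<open>Induction on the number of steps. A \<open>Flip\<close> takes the first coin and splits
  the distribution of tapes in the same way as that of runs; every other instruction leaves the tape
  alone. Configurations in \<open>G\<close> must be halted because a tape may lead into
  \<open>G\<close> before the last step.\<close>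

lemma prob_runs_ge:
 assumes "!!H. H : G ==> halted P H"
 shows "measure_pmf.prob (replicate_pmf L (bernoulli_pmf (1/2)))
   {zs. EX t<=tt. EX H':G. EX zs'. reach H zs t H' zs'} <= measure_pmf.prob (runs tt H) G"
proof (induction tt arbitrary: H L)
 case 0
 show ?case
 proof (cases "H : G")
  case True
  thus ?thesis by simp
 next
  case False
  hence "{zs. EX t<=0. EX H':G. EX zs'. reach H zs t H' zs'} = {}"
   by (auto elim: reach.cases)
  thus ?thesis by (metis measure_empty measure_nonneg)
 qed
next
 case (Suc tt)
 let ?A = "%tt H. {zs. EX t<=tt. EX H':G. EX zs'. reach H zs t H' zs'}"
 consider "H : G" | "H ~: G" "~ pc H < length P"
  | d where "H ~: G" "pc H < length P" "P ! pc H = Flip d"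
  | "H ~: G" "pc H < length P" "!!d. P ! pc H ~= Flip d" by blast
 thus ?case
 proof cases
  case 1
  hence "runs (Suc tt) H = return_pmf H" using runs_halted assms by blast
  hence "measure_pmf.prob (runs (Suc tt) H) G = 1" using 1 by simp
  thus ?thesis by simp
 next
  case 2
  hence "?A (Suc tt) H = {}" by (auto elim: reach.cases)
  thus ?thesis by (metis measure_empty measure_nonneg)
 next
  case 3
  let ?s = "%z. set_reg d (of_bool z) H"
  have st: "step P w us \<I> H = map_pmf ?s (bernoulli_pmf (1/2))"
   using 3 unfolding step_def by simp
  have sub: "?A (Suc tt) H <= {z # zs | z zs. zs : ?A tt (?s z)}"
  proof
   fix zs assume "zs : ?A (Suc tt) H"
   then obtain t H' zs' where r: "t <= Suc tt" "H' : G" "reach H zs t H' zs'" by blast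
   from r(3) show "zs : {z # zs | z zs. zs : ?A tt (?s z)}"
   proof cases
   case reach_refl
   thus ?thesis using r 3 by simp
   next
   case (reach_det H1 t)
   hence False using 3(3) by blast
   thus ?thesis ..
   next
   case (reach_flip d' z zs0 t0)
   have "t0 <= tt" using reach_flip r by simp
   moreover have "reach (?s z) zs0 t0 H' zs'" using reach_flip 3(3) by simp
   ultimately show ?thesis using reach_flip(1) r(2) by blast
   qed
  qed
  show ?thesis
  proof (cases L)
   case 0
   \<comment> \<open>An exhausted tape cannot pass a \<open>Flip\<close>, so the left side is
     zero.\<close>
   have "[] ~: ?A (Suc tt) H" using sub by blast
   hence "measure_pmf.prob (replicate_pmf L (bernoulli_pmf (1/2))) (?A (Suc tt) H) = 0"
   using 0 by (simp add: indicator_def)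
   thus ?thesis by simp
  next
   case (Suc L')
   let ?p = "replicate_pmf L' (bernoulli_pmf (1/2))"
   have "measure_pmf.prob (replicate_pmf L (bernoulli_pmf (1/2))) (?A (Suc tt) H)
   <= measure_pmf.prob (replicate_pmf L (bernoulli_pmf (1/2))) {z # zs | z zs. zs : ?A tt (?s z)}"
   by (rule measure_pmf.finite_measure_mono[OF sub]) simp
   also have "... = measure_pmf.prob (bind_pmf (bernoulli_pmf (1/2)) (%z. map_pmf (%zs. z # zs) ?p))
   {z # zs | z zs. zs : ?A tt (?s z)}"
   using Suc by (simp add: map_pmf_def)
   also have "... = (\<integral>z. measure_pmf.prob ?p (?A tt (?s z)) \<partial>bernoulli_pmf (1/2))"
   unfolding prob_bind_pmf measure_map_pmf by (intro Bochner_Integration.integral_cong) (auto intro!: arg_cong[where f = "measure_pmf.prob ?p"])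
   also have "... <= (\<integral>z. measure_pmf.prob (runs tt (?s z)) G \<partial>bernoulli_pmf (1/2))"
   using Suc.IH[of L' "?s True"] Suc.IH[of L' "?s False"] by simp
   also have "... = measure_pmf.prob (runs (Suc tt) H) G"
   by (simp add: st prob_bind_pmf bind_map_pmf)
   finally show ?thesis .
  qed
 next
  case 4
  obtain H1 where s1: "exec w us \<I> (P ! pc H) H = return_pmf H1"
   using 4(3) by (cases "P ! pc H") (auto simp: Let_def)
  have "?A (Suc tt) H <= ?A tt H1"
  proof
   fix zs assume "zs : ?A (Suc tt) H"
   then obtain t H' zs' where r: "t <= Suc tt" "H' : G" "reach H zs t H' zs'" by blast
   from r(3) show "zs : ?A tt H1"
   proof cases
   case reach_refl
   thus ?thesis using r 4 by simp
   next
   case (reach_det H1' t)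
   thus ?thesis using r s1 by auto
   next
   case (reach_flip d' z zs0 t0)
   thus ?thesis using 4 by simp
   qed
  qed
  hence "measure_pmf.prob (replicate_pmf L (bernoulli_pmf (1/2))) (?A (Suc tt) H)
   <= measure_pmf.prob (replicate_pmf L (bernoulli_pmf (1/2))) (?A tt H1)"
   by (rule measure_pmf.finite_measure_mono) simp
  also have "... <= measure_pmf.prob (runs tt H1) G" by (rule Suc.IH)
  also have "runs tt H1 = runs (Suc tt) H" using 4 s1 unfolding runs.simps step_def by (simp add: bind_return_pmf)
  finally show ?thesis .
 qed
qed

end

section \<open>The compiled code simulates the while language\<close>

locale compiled = machine P w us \<I>
 for P :: "instr list" and w :: nat and us :: "'a list" and \<I> :: "side => 'a set set" +
 fixes M B :: nat
 assumes dist: "distinct us" and M: "0 < M" and B: "0 < B"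
  and WB: "length us + B * Suc (length us) * (4 * M) < 2 ^ w"
begin

sublocale lang "length us" B "%j. {X. X <= {..<length us} & (!) us ` X : \<I> j}" .

text \<open>Row-major addressing with \<open>n + 1\<close> columns, scaled by the number
  \<open>4 * M\<close> of interleaved arrays and shifted by \<open>n\<close>, because the first
  \<open>n\<close> cells are reserved for the output.\<close>

definition adr :: "nat => nat => nat => nat" where
 "adr k i j = (i * Suc (length us) + j) * (4 * M) + k + length us"

text \<open>Mixed-radix uniqueness; the row index is the leading digit and therefore needs no
  bound.\<close>

lemma adr_inj:
 assumes "k < 4 * M" "k' < 4 * M" "j <= length us" "j' <= length us"
 shows "adr k i j = adr k' i' j' \<longleftrightarrow> k = k' & i = i' & j = j'"
proof
 assume "adr k i j = adr k' i' j'"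
 hence *: "(i * Suc (length us) + j) * (4 * M) + k = (i' * Suc (length us) + j') * (4 * M) + k'"
  unfolding adr_def by simp
 have "((i * Suc (length us) + j) * (4 * M) + k) mod (4 * M) = k"
  "((i' * Suc (length us) + j') * (4 * M) + k') mod (4 * M) = k'"
  "((i * Suc (length us) + j) * (4 * M) + k) div (4 * M) = i * Suc (length us) + j"
  "((i' * Suc (length us) + j') * (4 * M) + k') div (4 * M) = i' * Suc (length us) + j'"
  using assms M by auto
 hence 1: "k = k'" "i * Suc (length us) + j = i' * Suc (length us) + j'" using * by metis+
 have "(i * Suc (length us) + j) mod Suc (length us) = j" "(i' * Suc (length us) + j') mod Suc (length us) = j'"
  "(i * Suc (length us) + j) div Suc (length us) = i" "(i' * Suc (length us) + j') div Suc (length us) = i'"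
  using assms by (auto simp del: mult_Suc_right)
 thus "k = k' & i = i' & j = j'" using 1 by metis
qed simp

lemma adr_ge: "length us <= adr k i j"
 unfolding adr_def by simp

lemma adr_bounds:
 assumes "i < B" "j <= length us" "k < 4 * M"
 shows "adr k i j < 2 ^ w" "i * Suc (length us) < 2 ^ w" "i * Suc (length us) + j < 2 ^ w"
  "(i * Suc (length us) + j) * (4 * M) < 2 ^ w" "(i * Suc (length us) + j) * (4 * M) + k < 2 ^ w" "k < 2 ^ w"
proof -
 let ?n = "Suc (length us)"
 have "i * ?n + ?n <= B * ?n" using assms by (metis Suc_leI add.commute mult_Suc mult_le_mono1)
 hence 1: "i * ?n + j < B * ?n" using assms by linarith
 hence 2: "(i * ?n + j) * (4 * M) + 4 * M <= B * ?n * (4 * M)"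
  by (metis Suc_leI add.commute mult_Suc mult_le_mono1)
 have 3: "i * ?n + j <= (i * ?n + j) * (4 * M)" using M by simp
 show a: "adr k i j < 2 ^ w" unfolding adr_def using 2 assms WB by linarith
 thus "(i * ?n + j) * (4 * M) + k < 2 ^ w" "(i * ?n + j) * (4 * M) < 2 ^ w" "k < 2 ^ w"
  unfolding adr_def by linarith+
 thus "i * ?n + j < 2 ^ w" using 3 by linarith
 thus "i * ?n < 2 ^ w" by linarith
qed

lemma small_bounds: "length us < 2 ^ w" "Suc (length us) < 2 ^ w" "4 * M < 2 ^ w" "1 < (2::nat) ^ w" "B <= 2 ^ w"
proof -
 have "1 * 1 * (4 * M) <= B * Suc (length us) * (4 * M)" "1 * Suc (length us) * (4 * 1) <= B * Suc (length us) * (4 * M)"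
  "B * 1 * 1 <= B * Suc (length us) * (4 * M)"
  using B M by (intro mult_le_mono; simp)+
 hence "EX X. 4 * M <= X & Suc (length us) * 4 <= X & B <= X & length us + X < 2 ^ w"
  using WB by (intro exI[of _ "B * Suc (length us) * (4 * M)"]) simp
 then obtain X where *: "4 * M <= X" "Suc (length us) * 4 <= X" "B <= X" "length us + X < 2 ^ w" by blast
 show "length us < 2 ^ w" using *(4) by linarith
 show sz: "Suc (length us) < 2 ^ w" using *(2,4) by auto
 thus "1 < (2::nat) ^ w" by (metis Suc_lessD less_one linorder_neqE_nat not_less_zero zero_less_Suc less_trans One_nat_def not_less_eq)
 show "B <= 2 ^ w" using *(3,4) by linarith
 show "4 * M < 2 ^ w" using *(1,4) by linarith
qed

definition hrep :: "('a set list) => nat => nat set => bool" where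
 "hrep cr x X \<longleftrightarrow> x < length cr & cr ! x = (!) us ` X & X <= {..<length us}"

lemma hrep_append: "hrep cr x X ==> hrep (cr @ ys) x X"
 unfolding hrep_def by (auto simp: nth_append)

text \<open>Array entries are related for all row indices, not only those in use. Untouched cells
  hold zero, and set index zero is the empty set, so a freshly prepared configuration is related to
  the all-zero state.\<close>

definition rel :: "st => 'a config => bool" where
 "rel s H \<longleftrightarrow> regs H 0 = length us & (ALL j. length (created H j) = Suc (regs H (kr j))) &
  (ALL j. created H j ! 0 = {}) &
  regs H 3 = 4 * M & regs H 4 = 1 & regs H 5 = 0 & regs H 6 = Suc (length us) &
  (ALL x. regs H (vr x) = rv s x & rv s x < 2 ^ w) &
  (ALL j x. hrep (created H j) (regs H (vs j x)) (sv s j x)) &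
  (ALL a<M. ALL i. mem H (adr (4 * a) i 0) = ra s a i & ra s a i < 2 ^ w) &
  (ALL j. ALL a<M. ALL i. hrep (created H j) (mem H (adr (4 * a + sc j) i 0)) (sa s j a i)) &
  (ALL a<M. ALL i. ALL k<length us. mem H (adr (4 * a + 3) i k) = rm s a i k & rm s a i k < 2 ^ w) &
  (ALL i<length us. mem H i = out s i)"

lemma rel_tp: "rel s H ==> rel s (set_reg (tp d) v H)"
 unfolding rel_def set_reg_def by simp

lemma rel_pc: "rel s H ==> rel s (H(|pc := p|))"
 unfolding rel_def by simp

lemma rel_tick: "rel s H ==> rel (tick s) H"
 unfolding rel_def by simp

text \<open>The contract of expression code: memory and the temporaries below \<open>d\<close>
  survive, so operands evaluated earlier are safe, and no coin is consumed.\<close>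

definition ED :: "instr list => nat => st => bool list => 'a config => 'a config => bool" where
 "ED cs d s zs H H' \<longleftrightarrow> reach H zs (length cs) H' zs & rel s H' & pc H' = pc H + length cs &
  mem H' = mem H & (ALL i<d. regs H' (tp i) = regs H (tp i))"

lemma ED_append: "ED cs d s zs H H1 ==> ED cs' d' s zs H1 H2 ==> d <= d' ==> ED (cs @ cs') d s zs H H2"
 unfolding ED_def using reach_trans by auto

lemma ED_Nil: "rel s H ==> ED [] d s zs H H"
 unfolding ED_def by (simp add: reach_refl)

lemma ED_Cons:
 assumes "code_at (pc H) (i # cs)" "!!d. i ~= Flip d" "exec w us \<I> i H = return_pmf (set_reg (tp d') v H)" "d <= d'"
  "EX H'. ED cs d s zs (set_reg (tp d') v H) H' & Q H'"
 shows "EX H'. ED (i # cs) d s zs H H' & Q H'"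
proof -
 obtain H' where *: "ED cs d s zs (set_reg (tp d') v H) H'" "Q H'" using assms(5) by blast
 have "reach H zs (Suc (length cs)) H' zs"
  using reach_exec[OF assms(1-3)] *(1) unfolding ED_def by blast
 hence "ED (i # cs) d s zs H H'"
  using *(1) assms(4) unfolding ED_def by (auto simp: set_reg_def)
 thus ?thesis using *(2) by blast
qed

lemma ED_last:
 assumes "ED cs d s zs H H1" "code_at (pc H + length cs) [i]" "!!d. i ~= Flip d"
  "exec w us \<I> i H1 = return_pmf (set_reg (tp d) v H1)"
 shows "ED (cs @ [i]) d s zs H (set_reg (tp d) v H1)"
proof -
 have "code_at (pc H1) [i]" using assms unfolding ED_def by simp
 hence "EX H'. ED [i] d s zs H1 H' & H' = set_reg (tp d) v H1"
  by (rule ED_Cons[OF _ assms(3,4)]) (use assms(1) in \<open>auto simp: ED_def intro!: ED_Nil rel_tp reach_refl\<close>)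
 thus ?thesis using ED_append[OF assms(1)] by blast
qed

lemma ED_single:
 assumes "rel s H" "code_at (pc H) [i]" "exec w us \<I> i H = return_pmf (set_reg (tp d) v H)" "!!d. i ~= Flip d"
 shows "ED [i] d s zs H (set_reg (tp d) v H)"
 using ED_last[OF ED_Nil[OF assms(1)], of i d] assms by simp

lemma adr2_code_ED:
 assumes "rel s H" "regs H (tp d) = i" "regs H (tp (Suc d)) = j" "i < B" "j <= length us" "k < 4 * M"
  "code_at (pc H) (adr2_code k d)"
 shows "EX H'. ED (adr2_code k d) d s zs H H' & regs H' (tp d) = adr k i j"
proof -
 note b = adr_bounds[OF assms(4-6)]
 have r: "regs H 6 = Suc (length us)" "regs H 3 = 4 * M" "regs H 0 = length us"
  using assms(1) unfolding rel_def by auto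
 define H1 where "H1 = set_reg (tp d) (i * Suc (length us)) H"
 define H2 where "H2 = set_reg (tp d) (i * Suc (length us) + j) H1"
 define H3 where "H3 = set_reg (tp d) ((i * Suc (length us) + j) * (4 * M)) H2"
 define H4 where "H4 = set_reg (tp (Suc d)) k H3"
 define H5 where "H5 = set_reg (tp d) ((i * Suc (length us) + j) * (4 * M) + k) H4"
 define H6 where "H6 = set_reg (tp d) (adr k i j) H5"
 note defs = H1_def H2_def H3_def H4_def H5_def H6_def
 have rel6: "rel s H6" unfolding defs using assms(1) by (intro rel_tp)
 have e1: "exec w us \<I> (Arith Mul (tp d) (tp d) 6) H = return_pmf H1"
  using assms(2) r b(2) unfolding H1_def by (simp del: mult_Suc_right)
 have e2: "exec w us \<I> (Arith Add (tp d) (tp d) (tp (Suc d))) H1 = return_pmf H2"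
  using assms(3) b(3) unfolding H2_def by (simp add: H1_def set_reg_def del: mult_Suc_right)
 have e3: "exec w us \<I> (Arith Mul (tp d) (tp d) 3) H2 = return_pmf H3"
  using r b(4) unfolding H3_def by (simp add: H1_def H2_def set_reg_def del: mult_Suc_right)
 have e4: "exec w us \<I> (Const (tp (Suc d)) k) H3 = return_pmf H4"
  using b(6) unfolding H4_def by simp
 have e5: "exec w us \<I> (Arith Add (tp d) (tp d) (tp (Suc d))) H4 = return_pmf H5"
  using b(5) unfolding H5_def by (simp add: H4_def H3_def set_reg_def del: mult_Suc_right)
 have r5: "regs H5 0 = length us" "regs H5 (tp d) = (i * Suc (length us) + j) * (4 * M) + k"
  using r unfolding defs by (auto simp: set_reg_def)
 have e6: "exec w us \<I> (Arith Add (tp d) (tp d) 0) H5 = return_pmf H6"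
  using b(1) r5 unfolding H6_def adr_def by (simp del: mult_Suc_right)
 have pcs: "pc H1 = Suc (pc H)" "pc H2 = Suc (Suc (pc H))" "pc H3 = Suc (Suc (Suc (pc H)))"
  "pc H4 = Suc (Suc (Suc (Suc (pc H))))" "pc H5 = Suc (Suc (Suc (Suc (Suc (pc H)))))"
  "pc H6 = Suc (Suc (Suc (Suc (Suc (Suc (pc H))))))"
  unfolding defs by (auto simp: set_reg_def)
 note ca = assms(7)[unfolded adr2_code_def code_at_Cons]
 have "reach H zs (Suc (Suc (Suc (Suc (Suc (Suc 0)))))) H6 zs"
  by (rule reach_exec1[OF _ e1] reach_exec1[OF _ e2] reach_exec1[OF _ e3] reach_exec1[OF _ e4]
   reach_exec1[OF _ e5] reach_exec1[OF _ e6] reach_refl | (use ca pcs in simp; fail))+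
 hence "ED (adr2_code k d) d s zs H H6"
  using rel6 pcs unfolding ED_def adr2_code_def by (simp add: defs set_reg_def)
 moreover have "regs H6 (tp d) = adr k i j" unfolding H6_def by (simp add: set_reg_def)
 ultimately show ?thesis by blast
qed

lemma adr_code_ED:
 assumes "rel s H" "regs H (tp d) = i" "i < B" "k < 4 * M" "code_at (pc H) (adr_code k d)"
 shows "EX H'. ED (adr_code k d) d s zs H H' & regs H' (tp d) = adr k i 0"
 unfolding adr_code_def
proof (rule ED_Cons)
 let ?H = "set_reg (tp (Suc d)) 0 H"
 show "code_at (pc H) (Const (tp (Suc d)) 0 # adr2_code k d)" using assms(5) unfolding adr_code_def .
 hence "code_at (pc ?H) (adr2_code k d)" by (simp add: code_at_Cons set_reg_def)
 thus "EX H'. ED (adr2_code k d) d s zs ?H H' & regs H' (tp d) = adr k i 0"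
  using assms by (intro adr2_code_ED rel_tp) (auto simp: set_reg_def)
 show "exec w us \<I> (Const (tp (Suc d)) 0) H = return_pmf ?H" by simp
qed auto

lemma bound_le: "ALL j. (f j :: nat) + a <= K ==> b <= a ==> ALL j. f j + b <= K"
 by (meson add_left_mono le_trans)

lemma created_bound:
 assumes "ED cs d s zs H H'" "ALL j. length (created H j) + (length cs + m) <= 2 ^ w"
 shows "ALL j. length (created H' j) + m <= 2 ^ w"
proof
 fix j
 have "length (created H' j) <= length (created H j) + length cs"
  using assms(1) reach_created unfolding ED_def by blast
 thus "length (created H' j) + m <= 2 ^ w" using assms(2)[rule_format, of j] by linarith
qed

text \<open>Deletion commutes with the passage from positions to elements only because
  \<open>us\<close> is distinct; insertion needs no such argument.\<close>

lemma create_ED: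
 assumes r: "rel s H1" and h: "hrep (created H1 j) (regs H1 (tp (Suc d))) X" and v: "regs H1 (tp d) = v" "v < length us"
  and i: "i = Insert j (tp d) (tp (Suc d)) & Y = insert v X | i = Delete j (tp d) (tp (Suc d)) & Y = X - {v}"
  and ca: "code_at (pc H1) [i, Arith Add (kr j) (kr j) 4, Arith Add (tp d) (kr j) 5]"
  and cr: "length (created H1 j) < 2 ^ w"
 shows "EX H'. ED [i, Arith Add (kr j) (kr j) 4, Arith Add (tp d) (kr j) 5] d s zs H1 H' &
  hrep (created H' j) (regs H' (tp d)) Y"
proof -
 have X: "regs H1 (tp (Suc d)) < length (created H1 j)" "created H1 j ! regs H1 (tp (Suc d)) = (!) us ` X"
  "X <= {..<length us}" using h unfolding hrep_def by auto
 have inj: "inj_on ((!) us) {..<length us}" using dist by (auto intro: inj_on_nth)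
 have del: "(!) us ` (X - {v}) = (!) us ` X - {us ! v}"
  using inj_on_image_set_diff[OF inj, of X "{v}"] X(3) v(2) by auto
 define H2 where "H2 = create j ((!) us ` Y) H1"
 have e1: "exec w us \<I> i H1 = return_pmf H2"
  using i X v del unfolding H2_def by auto
 have k: "regs H1 4 = 1" "regs H1 5 = 0" "length (created H1 j) = Suc (regs H1 (kr j))"
  using r unfolding rel_def by auto
 define H3 where "H3 = set_reg (kr j) (length (created H1 j)) H2"
 have e2: "exec w us \<I> (Arith Add (kr j) (kr j) 4) H2 = return_pmf H3"
  using k cr unfolding H3_def by (simp add: H2_def create_def)
 define H4 where "H4 = set_reg (tp d) (length (created H1 j)) H3"
 have e3: "exec w us \<I> (Arith Add (tp d) (kr j) 5) H3 = return_pmf H4"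
  using k cr unfolding H4_def by (simp add: H3_def H2_def create_def set_reg_def)
 have pcs: "pc H2 = Suc (pc H1)" "pc H3 = Suc (Suc (pc H1))"
  unfolding H3_def H2_def by (auto simp: set_reg_def create_def)
 note ca' = ca[unfolded code_at_Cons]
 have nf: "!!d. i ~= Flip d" using i by blast
 have "reach H1 zs (Suc (Suc (Suc 0))) H4 zs"
  by (rule nf reach_exec1[OF _ e1] reach_exec1[OF _ e2] reach_exec1[OF _ e3] reach_refl
   | (use ca' pcs in simp; fail))+
 moreover have "rel s H4"
  using r unfolding rel_def H4_def H3_def H2_def
  by (auto simp: set_reg_def create_def nth_append intro: hrep_append)
 ultimately have "ED [i, Arith Add (kr j) (kr j) 4, Arith Add (tp d) (kr j) 5] d s zs H1 H4"
  unfolding ED_def by (simp add: H4_def H3_def H2_def create_def set_reg_def)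
 moreover have "hrep (created H4 j) (regs H4 (tp d)) Y"
  using i X v unfolding hrep_def by (auto simp: H4_def H3_def H2_def create_def set_reg_def nth_append)
 ultimately show ?thesis by blast
qed

definition run_to :: "instr list => nat => st => ('a config => bool) => ('a config => bool) => bool" where
 "run_to cs d s A Q \<longleftrightarrow> (ALL H zs. rel s H & A H & code_at (pc H) cs & (ALL j. length (created H j) + length cs <= 2 ^ w) -->
  (EX H'. ED cs d s zs H H' & Q H'))"

lemma run_toD:
 assumes "run_to cs d s A Q" "rel s H" "A H" "code_at (pc H) cs" "ALL j. length (created H j) + length cs <= 2 ^ w"
 shows "EX H'. ED cs d s zs H H' & Q H'"
 using assms unfolding run_to_def by blast

lemma run_to_append:
 assumes "run_to cs d s A Q" "run_to cs' d' s Q R" "d <= d'"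
 shows "run_to (cs @ cs') d s A R"
 unfolding run_to_def
proof (intro allI impI, elim conjE)
 fix H zs assume a: "rel s H" "A H" "code_at (pc H) (cs @ cs')" "ALL j. length (created H j) + length (cs @ cs') <= 2 ^ w"
 have "ALL j. length (created H j) + length cs <= 2 ^ w" by (rule bound_le[OF a(4)]) simp
 then obtain H1 where 1: "ED cs d s zs H H1" "Q H1" using run_toD[OF assms(1) a(1,2)] a(3) by auto
 have "code_at (pc H1) cs'" "rel s H1" using a(3) 1(1) unfolding ED_def by auto
 moreover have "ALL j. length (created H1 j) + length cs' <= 2 ^ w" using created_bound[OF 1(1)] a(4) by simp
 ultimately obtain H2 where "ED cs' d' s zs H1 H2" "R H2" using run_toD[OF assms(2) _ 1(2)] by blast
 thus "EX H'. ED (cs @ cs') d s zs H H' & R H'" using ED_append[OF 1(1) _ assms(3)] by blast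
qed

lemma run_to_frame:
 assumes "run_to cs d s (%_. True) Q" "!!H H'. R H ==> (ALL i<d. regs H' (tp i) = regs H (tp i)) ==> R H'"
 shows "run_to cs d s R (%H. Q H & R H)"
 using assms unfolding run_to_def ED_def by meson

lemma run_to_single:
 assumes "!!H. rel s H ==> A H ==> ALL j. length (created H j) < 2 ^ w ==>
  EX v. exec w us \<I> i H = return_pmf (set_reg (tp d) v H) & Q (set_reg (tp d) v H)" "!!d. i ~= Flip d"
 shows "run_to [i] d s A Q"
 unfolding run_to_def
proof (intro allI impI, elim conjE)
 fix H zs assume a: "rel s H" "A H" "code_at (pc H) [i]" "ALL j. length (created H j) + length [i] <= 2 ^ w"
 then obtain v where "exec w us \<I> i H = return_pmf (set_reg (tp d) v H)" "Q (set_reg (tp d) v H)" using assms(1)[OF a(1,2)] by (auto simp: less_eq_Suc_le)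
 thus "EX H'. ED [i] d s zs H H' & Q H'" using ED_single[OF a(1,3) _ assms(2)] by blast
qed

lemma adr2_run:
 assumes "i < B" "j <= length us" "k < 4 * M"
 shows "run_to (adr2_code k d) d s (%H. regs H (tp (Suc d)) = j & regs H (tp d) = i) (%H. regs H (tp d) = adr k i j)"
 using adr2_code_ED assms unfolding run_to_def by blast

lemma adr_run:
 assumes "i < B" "k < 4 * M"
 shows "run_to (adr_code k d) d s (%H. regs H (tp d) = i) (%H. regs H (tp d) = adr k i 0)"
 using adr_code_ED assms unfolding run_to_def by blast

lemma create_run:
 assumes "v < length us"
  "i = Insert j (tp d) (tp (Suc d)) & Y = insert v X | i = Delete j (tp d) (tp (Suc d)) & Y = X - {v}"
 shows "run_to [i, Arith Add (kr j) (kr j) 4, Arith Add (tp d) (kr j) 5] d s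
  (%H. hrep (created H j) (regs H (tp (Suc d))) X & regs H (tp d) = v) (%H. hrep (created H j) (regs H (tp d)) Y)"
 unfolding run_to_def
proof (intro allI impI, elim conjE)
 let ?cs = "[i, Arith Add (kr j) (kr j) 4, Arith Add (tp d) (kr j) 5]"
 fix H zs assume a: "rel s H" "hrep (created H j) (regs H (tp (Suc d))) X" "regs H (tp d) = v" "code_at (pc H) ?cs"
  and b: "ALL j. length (created H j) + length ?cs <= 2 ^ w"
 have "length (created H j) < 2 ^ w" using b[rule_format, of j] by simp
 thus "EX H'. ED ?cs d s zs H H' & hrep (created H' j) (regs H' (tp d)) Y" using create_ED[OF a(1-3) assms a(4)] by blast
qed

definition val :: "exp => nat => st => 'a config => bool" where
 "val e d s H \<longleftrightarrow> regs H (tp d) = ev e s & ev e s < 2 ^ w"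

lemma sc_code [simp]:
 "a < M ==> 4 * a + sc j < 4 * M" "4 * a + sc j = 4 * b + sc j' \<longleftrightarrow> a = b & j = j'"
 "4 * a + sc j ~= 4 * b" "4 * b ~= 4 * a + sc j" "4 * a + sc j ~= 4 * b + 3" "4 * b + 3 ~= 4 * a + sc j"
 "4 * a + 3 ~= 4 * (b::nat)" "4 * b ~= 4 * a + (3::nat)" "a < M ==> 4 * a + 3 < 4 * M"
 by (cases j; cases j'; simp?; presburger)+

lemma two_args:
 assumes "run_to c1 d s (%_. True) (val e d s)" "run_to c2 (Suc d) s (%_. True) Q"
 shows "run_to (c1 @ c2) d s (%_. True) (%H. Q H & val e d s H)"
 by (rule run_to_append[OF assms(1) run_to_frame[OF assms(2)]]) (auto simp: val_def)

lemma run_to_weaken: "run_to cs d s A Q ==> (!!H. A' H ==> A H) ==> run_to cs d s A' Q"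
 unfolding run_to_def by blast

text \<open>Sums and products fit into a word by the bound in \<open>ok\<close>; differences,
  quotients and remainders do not exceed their left argument; set indices fit because
  \<open>run_to\<close> limits the number of created sets.\<close>

lemma cexp_correct:
 "ok e s ==> wfe M (2 ^ w) e ==> run_to (cexp e d) d s (%_. True) (val e d s)"
 "sok q j s ==> wfs M (2 ^ w) q ==> run_to (csexp q j d) d s (%_. True) (%H. hrep (created H j) (regs H (tp d)) (sev q j s))"
proof (induction e and q arbitrary: d and d j)
 case (Op f a b)
 have bd: "apply_arith f (ev a s) (ev b s) < 2 ^ w" if "ev a s < 2 ^ w"
 proof (cases f)
  case Div
  thus ?thesis using le_less_trans[OF div_le_dividend that] by simp
 next
  case Mod
  thus ?thesis using le_less_trans[OF mod_less_eq_dividend that] by simp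
 qed (use Op.prems(1) small_bounds(5) that in auto)
 have "run_to (cexp a d @ cexp b (Suc d)) d s (%_. True) (%H. val b (Suc d) s H & val a d s H)"
  by (rule two_args) (use Op in auto)
 hence "run_to ((cexp a d @ cexp b (Suc d)) @ [Arith f (tp d) (tp d) (tp (Suc d))]) d s (%_. True) (val (Op f a b) d s)"
  by (rule run_to_append) (auto intro!: run_to_single simp: val_def set_reg_def bd)
 thus ?case by simp
next
 case (Get a e)
 have "run_to (cexp e d @ adr_code (4 * a) d) d s (%_. True) (%H. regs H (tp d) = adr (4 * a) (ev e s) 0)"
  by (rule run_to_append[OF Get.IH run_to_weaken[OF adr_run]]) (use Get.prems in \<open>auto simp: val_def\<close>)
 hence "run_to ((cexp e d @ adr_code (4 * a) d) @ [Load (tp d) (tp d)]) d s (%_. True) (val (Get a e) d s)"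
  by (rule run_to_append) (use Get.prems in \<open>auto intro!: run_to_single simp: val_def set_reg_def rel_def\<close>)
 thus ?case by simp
next
 case (Get2 a e f)
 have "run_to (cexp e d @ cexp f (Suc d)) d s (%_. True) (%H. val f (Suc d) s H & val e d s H)"
  by (rule two_args) (use Get2 in auto)
 hence "run_to ((cexp e d @ cexp f (Suc d)) @ adr2_code (4 * a + 3) d) d s (%_. True) (%H. regs H (tp d) = adr (4 * a + 3) (ev e s) (ev f s))"
  by (rule run_to_append[OF _ run_to_weaken[OF adr2_run]]) (use Get2.prems in \<open>auto simp: val_def\<close>)
 hence "run_to (((cexp e d @ cexp f (Suc d)) @ adr2_code (4 * a + 3) d) @ [Load (tp d) (tp d)]) d s (%_. True) (val (Get2 a e f) d s)"
  by (rule run_to_append) (use Get2.prems in \<open>auto intro!: run_to_single simp: val_def set_reg_def rel_def\<close>)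
 thus ?case by simp
next
 case (Qry j q)
 have "run_to (csexp q j d @ [Query j (tp d) (tp d)]) d s (%_. True) (val (Qry j q) d s)"
  by (rule run_to_append[OF Qry.IH]) (use Qry.prems small_bounds in \<open>auto intro!: run_to_single simp: val_def set_reg_def hrep_def\<close>)
 thus ?case by simp
next
 case (SGet a e)
 have "run_to (cexp e d @ adr_code (4 * a + sc j) d) d s (%_. True) (%H. regs H (tp d) = adr (4 * a + sc j) (ev e s) 0)"
  by (rule run_to_append[OF SGet.IH run_to_weaken[OF adr_run]]) (use SGet.prems in \<open>auto simp: val_def\<close>)
 hence "run_to ((cexp e d @ adr_code (4 * a + sc j) d) @ [Load (tp d) (tp d)]) d s (%_. True)
   (%H. hrep (created H j) (regs H (tp d)) (sa s j a (ev e s)))"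
  by (rule run_to_append) (use SGet.prems in \<open>auto intro!: run_to_single simp: set_reg_def rel_def\<close>)
 thus ?case by simp
next
 case (SIns e q)
 have "run_to (cexp e d @ csexp q j (Suc d)) d s (%_. True) (%H. hrep (created H j) (regs H (tp (Suc d))) (sev q j s) & val e d s H)"
  by (rule two_args) (use SIns in auto)
 hence "run_to ((cexp e d @ csexp q j (Suc d)) @ [Insert j (tp d) (tp (Suc d)), Arith Add (kr j) (kr j) 4, Arith Add (tp d) (kr j) 5]) d s
   (%_. True) (%H. hrep (created H j) (regs H (tp d)) (insert (ev e s) (sev q j s)))"
  by (rule run_to_append[OF _ run_to_weaken[OF create_run[where v = "ev e s" and X = "sev q j s"]]]) (use SIns.prems in \<open>auto simp: val_def\<close>)
 thus ?case by simp
next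
 case (SDel e q)
 have "run_to (cexp e d @ csexp q j (Suc d)) d s (%_. True) (%H. hrep (created H j) (regs H (tp (Suc d))) (sev q j s) & val e d s H)"
  by (rule two_args) (use SDel in auto)
 hence "run_to ((cexp e d @ csexp q j (Suc d)) @ [Delete j (tp d) (tp (Suc d)), Arith Add (kr j) (kr j) 4, Arith Add (tp d) (kr j) 5]) d s
   (%_. True) (%H. hrep (created H j) (regs H (tp d)) (sev q j s - {ev e s}))"
  by (rule run_to_append[OF _ run_to_weaken[OF create_run[where v = "ev e s" and X = "sev q j s"]]]) (use SDel.prems in \<open>auto simp: val_def\<close>)
 thus ?case by simp
next
 case (SV x)
 have "regs H (vs j x) < 2 ^ w" if "rel s H" "ALL j. length (created H j) < 2 ^ w" for H
  using that less_trans[of "regs H (vs j x)" "length (created H j)" "2 ^ w"] unfolding rel_def hrep_def by auto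
 thus ?case by (auto intro!: run_to_single simp: rel_def set_reg_def)
qed (use small_bounds in \<open>auto intro!: run_to_single simp: val_def rel_def set_reg_def hrep_def\<close>)

lemma adr_ne_out [simp]: "i < length us ==> adr k i' j ~= i" "i < length us ==> i ~= adr k i' j"
 using adr_ge[of k i' j] by auto

lemma ED_reach: "ED cs d s zs H H' ==> reach H zs (length cs) H' zs"
 unfolding ED_def by simp

lemma basic_step:
 assumes "run_to cs 0 s (%_. True) Q" and r: "rel s H" "code_at (pc H) (cs @ [i])" "length cs < KP" "ALL j. length (created H j) + KP <= 2 ^ w"
  and i: "!!d. i ~= Flip d" and e: "!!H1. Q H1 ==> rel s H1 ==> ALL j. length (created H1 j) <= 2 ^ w ==>
   EX H2. exec w us \<I> i H1 = return_pmf H2 & rel s' H2 & pc H2 = Suc (pc H1)"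
 shows "EX t H'. t <= KP & reach H zs t H' zs & rel s' H' & pc H' = pc H + length (cs @ [i])"
proof -
 have "ALL j. length (created H j) + length cs <= 2 ^ w" by (rule bound_le[OF r(4)]) (use r(3) in simp)
 then obtain H1 where 1: "ED cs 0 s zs H H1" "Q H1" using run_toD[OF assms(1) r(1)] r(2) by auto
 have p: "pc H1 = pc H + length cs" "rel s H1" using 1 unfolding ED_def by simp_all
 have "ALL j. length (created H1 j) + 0 <= 2 ^ w" by (rule created_bound[OF 1(1)], rule bound_le[OF r(4)]) (use r(3) in simp)
 then obtain H2 where 2: "exec w us \<I> i H1 = return_pmf H2" "rel s' H2" "pc H2 = Suc (pc H1)" using e[OF 1(2) p(2)] by auto
 have "reach H1 zs (Suc 0) H2 zs" using r(2) i p by (intro reach_exec1[OF _ 2(1) reach_refl]) (auto simp: code_at_Cons)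
 hence "reach H zs (length cs + Suc 0) H2 zs" using reach_trans ED_reach[OF 1(1)] by blast
 thus ?thesis using 2 p r(3) by (intro exI[of _ "length cs + Suc 0"] exI[of _ H2]) auto
qed

lemma test_step:
 assumes "ok e s" "wfe M (2 ^ w) e" and r: "rel s H" "code_at (pc H) (cexp e 0 @ [JumpLess 5 (tp 0) l])" "length (cexp e 0) + 2 <= KP"
  "ALL j. length (created H j) + KP <= 2 ^ w"
 shows "EX H'. reach H zs (length (cexp e 0) + 1) H' zs & rel (tick s) H' &
  pc H' = (if ev e s = 0 then pc H + length (cexp e 0) + 1 else l)"
proof -
 have "ALL j. length (created H j) + length (cexp e 0) <= 2 ^ w" by (rule bound_le[OF r(4)]) (use r(3) in simp)
 then obtain H1 where 1: "ED (cexp e 0) 0 s zs H H1" "val e 0 s H1" using run_toD[OF cexp_correct(1)[OF assms(1,2), of 0] r(1)] r(2) by (auto simp del: ex_simps)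
 have p: "pc H1 = pc H + length (cexp e 0)" "rel s H1" using 1 unfolding ED_def by simp_all
 hence "regs H1 5 = 0" unfolding rel_def by simp
 note p = p this
 let ?H = "H1(|pc := if ev e s = 0 then pc H + length (cexp e 0) + 1 else l|)"
 have "reach H1 zs (Suc 0) ?H zs" using r(2) p 1(2)
  by (intro reach_exec1[OF _ _ reach_refl, of _ "JumpLess 5 (tp 0) l"]) (auto simp: code_at_Cons val_def)
 hence "reach H zs (length (cexp e 0) + Suc 0) ?H zs" using reach_trans ED_reach[OF 1(1)] by blast
 moreover have "rel (tick s) ?H" using rel_tick rel_pc p(2) by blast
 ultimately show ?thesis by (intro exI[of _ ?H]) auto
qed

lemma jump_step:
 assumes "rel s H" "code_at (pc H) [JumpLess 5 4 l]"
 shows "reach H zs (Suc 0) (H(|pc := l|)) zs" "rel s (H(|pc := l|))"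
proof -
 have "regs H 5 = 0" "regs H 4 = 1" using assms(1) unfolding rel_def by simp_all
 thus "reach H zs (Suc 0) (H(|pc := l|)) zs"
  by (intro reach_exec1[OF _ _ reach_refl, of _ "JumpLess 5 4 l"]) (use assms(2) in \<open>auto simp: code_at_Cons\<close>)
qed (rule rel_pc[OF assms(1)])

lemma reach_bound:
 assumes "reach H zs t H' zs'" "ALL j. length (created H j) + K <= 2 ^ w" "t + K' <= K"
 shows "ALL j. length (created H' j) + K' <= 2 ^ w"
proof
 fix j show "length (created H' j) + K' <= 2 ^ w" using reach_created[OF assms(1), of j] assms(2)[rule_format, of j] assms(3) by linarith
qed

text \<open>Every tick is paid with at most \<open>KP\<close> machine steps. The same budget limits
  the number of created sets and thereby keeps their indices within a word.\<close>

lemma comp_correct: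
 assumes "big c s s'"
 shows "[|wf M (2 ^ w) c; rel s H; code_at (pc H) (comp (pc H) c); kc c <= KP;
  ALL j. length (created H j) + KP * (clk s' - clk s) <= 2 ^ w|] ==>
  EX t H'. t <= KP * (clk s' - clk s) & reach H (coins s) t H' (coins s') & rel s' H' &
   pc H' = pc H + length (comp (pc H) c)"
 using assms
proof (induction arbitrary: H rule: big.induct)
 case (Skip s)
 thus ?case by (auto intro: reach_refl)
next
 case (Assign e s x)
 have "EX t H'. t <= KP & reach H (coins s) t H' (coins s) & rel (s(|rv := (rv s)(x := ev e s), clk := Suc (clk s)|)) H' &
   pc H' = pc H + length (cexp e 0 @ [Arith Add (vr x) (tp 0) 5])"
  by (rule basic_step[OF cexp_correct(1)]) (use Assign in \<open>auto simp: val_def rel_def set_reg_def\<close>)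
 thus ?case by simp
next
 case (SAssign q j s x)
 have "EX t H'. t <= KP & reach H (coins s) t H' (coins s) & rel (s(|sv := (sv s)(j := (sv s j)(x := sev q j s)), clk := Suc (clk s)|)) H' &
   pc H' = pc H + length (csexp q j 0 @ [Arith Add (vs j x) (tp 0) 5])"
 proof (rule basic_step[OF cexp_correct(2)[where d = 0 and s = s and q = q and j = j]], goal_cases)
  case (8 H1)
  have "regs H1 (tp 0) < 2 ^ w" using 8(1,3) unfolding hrep_def by (meson less_le_trans)
  moreover have "rel (s(|sv := (sv s)(j := (sv s j)(x := sev q j s)), clk := Suc (clk s)|)) (set_reg (vs j x) (regs H1 (tp 0)) H1)"
   using 8(1,2) unfolding rel_def set_reg_def by simp
  ultimately show ?case using 8(2) by (auto simp: rel_def set_reg_def)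
 qed (use SAssign in auto)
 thus ?case by simp
next
 case (Put e s f a)
 let ?cs = "(cexp e 0 @ adr_code (4 * a) 0) @ cexp f (Suc 0)"
 have "run_to ?cs 0 s (%_. True) (%H. val f (Suc 0) s H & regs H (tp 0) = adr (4 * a) (ev e s) 0)"
  by (rule run_to_append[OF run_to_append[OF cexp_correct(1) run_to_weaken[OF adr_run]] run_to_frame[OF cexp_correct(1)]])
   (use Put in \<open>auto simp: val_def\<close>)
 hence "EX t H'. t <= KP & reach H (coins s) t H' (coins s) & rel (s(|ra := (ra s)(a := (ra s a)(ev e s := ev f s)), clk := Suc (clk s)|)) H' &
   pc H' = pc H + length (?cs @ [Store (tp 0) (tp (Suc 0))])"
  by (rule basic_step) (use Put in \<open>auto simp: val_def rel_def adr_inj\<close>)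
 thus ?case by simp
next
 case (Put2 e s f g a)
 let ?cs = "((cexp e 0 @ cexp f (Suc 0)) @ adr2_code (4 * a + 3) 0) @ cexp g (Suc 0)"
 have "run_to ?cs 0 s (%_. True) (%H. val g (Suc 0) s H & regs H (tp 0) = adr (4 * a + 3) (ev e s) (ev f s))"
  by (rule run_to_append[OF run_to_append[OF two_args[OF cexp_correct(1) cexp_correct(1)] run_to_weaken[OF adr2_run]] run_to_frame[OF cexp_correct(1)]])
   (use Put2 in \<open>auto simp: val_def\<close>)
 hence "EX t H'. t <= KP & reach H (coins s) t H' (coins s) &
   rel (s(|rm := (rm s)(a := (rm s a)(ev e s := (rm s a (ev e s))(ev f s := ev g s))), clk := Suc (clk s)|)) H' &
   pc H' = pc H + length (?cs @ [Store (tp 0) (tp (Suc 0))])"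
  by (rule basic_step) (use Put2 in \<open>auto simp: val_def rel_def adr_inj\<close>)
 thus ?case by simp
next
 case (SPut e s q j a)
 let ?cs = "(cexp e 0 @ adr_code (4 * a + sc j) 0) @ csexp q j (Suc 0)"
 have "run_to ?cs 0 s (%_. True) (%H. hrep (created H j) (regs H (tp (Suc 0))) (sev q j s) & regs H (tp 0) = adr (4 * a + sc j) (ev e s) 0)"
  by (rule run_to_append[OF run_to_append[OF cexp_correct(1) run_to_weaken[OF adr_run]] run_to_frame[OF cexp_correct(2)]])
   (use SPut in \<open>auto simp: val_def\<close>)
 hence "EX t H'. t <= KP & reach H (coins s) t H' (coins s) &
   rel (s(|sa := (sa s)(j := (sa s j)(a := (sa s j a)(ev e s := sev q j s))), clk := Suc (clk s)|)) H' &
   pc H' = pc H + length (?cs @ [Store (tp 0) (tp (Suc 0))])"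
  by (rule basic_step) (use SPut in \<open>auto simp: rel_def adr_inj\<close>)
 thus ?case by simp
next
 case (Outp e s f)
 have "run_to (cexp e 0 @ cexp f (Suc 0)) 0 s (%_. True) (%H. val f (Suc 0) s H & val e 0 s H)"
  by (rule two_args[OF cexp_correct(1) cexp_correct(1)]) (use Outp in auto)
 hence "EX t H'. t <= KP & reach H (coins s) t H' (coins s) & rel (s(|out := (out s)(ev e s := ev f s), clk := Suc (clk s)|)) H' &
   pc H' = pc H + length ((cexp e 0 @ cexp f (Suc 0)) @ [Store (tp 0) (tp (Suc 0))])"
  by (rule basic_step) (use Outp in \<open>auto simp: val_def rel_def\<close>)
 thus ?case by simp
next
 case (Toss s z zs x)
 have "rel (s(|rv := (rv s)(x := of_bool z), coins := zs, clk := Suc (clk s)|)) (set_reg (vr x) (of_bool z) H)"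
  using Toss.prems(2) small_bounds unfolding rel_def set_reg_def by simp
 moreover have "reach H (z # zs) (Suc 0) (set_reg (vr x) (of_bool z) H) zs"
  by (rule reach_flip[OF _ _ reach_refl]) (use Toss.prems(3) in \<open>simp_all add: code_at_Cons\<close>)
 ultimately show ?case using Toss
  by (intro exI[of _ "Suc 0"] exI[of _ "set_reg (vr x) (of_bool z) H"]) (auto simp: set_reg_def)
next
 case (Seq c s t d u)
 have "clk s <= clk t" "clk t <= clk u" using big_fr[OF Seq.hyps(1)] big_fr[OF Seq.hyps(2)] unfolding fr_def by auto
 hence eq: "KP * (clk u - clk s) = KP * (clk t - clk s) + KP * (clk u - clk t)"
  by (metis (no_types) diff_add_inverse le_add_diff_inverse add.assoc distrib_left)
 let ?c = "comp (pc H) c"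
 have ca: "code_at (pc H) ?c" "code_at (pc H + length ?c) (comp (pc H + length ?c) d)"
  using Seq.prems(3) by (auto simp: Let_def)
 have "ALL j. length (created H j) + KP * (clk t - clk s) <= 2 ^ w" by (rule bound_le[OF Seq.prems(5)]) (simp add: eq)
 then obtain t1 H1 where 1: "t1 <= KP * (clk t - clk s)" "reach H (coins s) t1 H1 (coins t)" "rel t H1" "pc H1 = pc H + length ?c"
  using Seq.IH(1)[of H] Seq.prems ca by auto
 have "ALL j. length (created H1 j) + KP * (clk u - clk t) <= 2 ^ w" by (rule reach_bound[OF 1(2) Seq.prems(5)]) (use 1(1) eq in simp)
 then obtain t2 H2 where 2: "t2 <= KP * (clk u - clk t)" "reach H1 (coins t) t2 H2 (coins u)" "rel u H2"
  "pc H2 = pc H1 + length (comp (pc H1) d)"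
  using Seq.IH(2)[of H1] Seq.prems ca 1 by auto
 show ?case using reach_trans[OF 1(2) 2(2)] 1 2 eq
  by (intro exI[of _ "t1 + t2"] exI[of _ H2]) (auto simp: Let_def)
next
 case (IfT e s c t d)
 define l1 where "l1 = pc H + length (cexp e 0) + 1"
 define l2 where "l2 = l1 + length (comp l1 d) + 1"
 have comp: "comp (pc H) (If e c d) = (cexp e 0 @ [JumpLess 5 (tp 0) l2]) @ comp l1 d @ [JumpLess 5 4 (l2 + length (comp l2 c))] @ comp l2 c"
  by (simp add: Let_def l1_def l2_def)
 have ca: "code_at (pc H) (cexp e 0 @ [JumpLess 5 (tp 0) l2])" "code_at l2 (comp l2 c)"
  using IfT.prems(3) unfolding comp code_at_append by (auto simp: l1_def l2_def add.assoc)
 have "clk s < clk t" using big_fr[OF IfT.hyps(3)] unfolding fr_def by simp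
 hence eq: "KP * (clk t - clk s) = KP + KP * (clk t - clk (tick s))"
  by (metis Suc_diff_Suc mult_Suc_right select_convs(8) surjective update_convs(8))
 have kp: "length (cexp e 0) + 2 <= KP" using IfT.prems(4) by simp
 have "ALL j. length (created H j) + KP <= 2 ^ w" by (rule bound_le[OF IfT.prems(5)]) (use eq in simp)
 then obtain H2 where 2: "reach H (coins s) (length (cexp e 0) + 1) H2 (coins s)" "rel (tick s) H2" "pc H2 = l2"
  using test_step[OF IfT.hyps(1) _ IfT.prems(2) ca(1) kp, of "coins s"] IfT.prems(1) IfT.hyps(2) by auto
 have "ALL j. length (created H2 j) + KP * (clk t - clk (tick s)) <= 2 ^ w" by (rule reach_bound[OF 2(1) IfT.prems(5)]) (use kp eq in simp)
 then obtain t3 H3 where 3: "t3 <= KP * (clk t - clk (tick s))" "reach H2 (coins s) t3 H3 (coins t)" "rel t H3" "pc H3 = l2 + length (comp l2 c)"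
  using IfT.IH[of H2] IfT.prems 2 ca by auto
 have "l2 + length (comp l2 c) = pc H + length (comp (pc H) (If e c d))" unfolding comp by (simp add: l1_def l2_def)
 thus ?case using reach_trans[OF 2(1) 3(2)] 3 eq kp
  by (intro exI[of _ "length (cexp e 0) + 1 + t3"] exI[of _ H3]) auto
next
 case (IfF e s d t c)
 define l1 where "l1 = pc H + length (cexp e 0) + 1"
 define l2 where "l2 = l1 + length (comp l1 d) + 1"
 define le where "le = l2 + length (comp l2 c)"
 have comp: "comp (pc H) (If e c d) = (cexp e 0 @ [JumpLess 5 (tp 0) l2]) @ comp l1 d @ [JumpLess 5 4 le] @ comp l2 c"
  by (simp add: Let_def l1_def l2_def le_def)
 have ca: "code_at (pc H) (cexp e 0 @ [JumpLess 5 (tp 0) l2])" "code_at l1 (comp l1 d)" "code_at (l1 + length (comp l1 d)) [JumpLess 5 4 le]"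
  using IfF.prems(3) unfolding comp code_at_append by (auto simp: l1_def l2_def add.assoc)
 have "clk s < clk t" using big_fr[OF IfF.hyps(3)] unfolding fr_def by simp
 hence eq: "KP * (clk t - clk s) = KP + KP * (clk t - clk (tick s))"
  by (metis Suc_diff_Suc mult_Suc_right select_convs(8) surjective update_convs(8))
 have kp: "length (cexp e 0) + 2 <= KP" using IfF.prems(4) by simp
 have "ALL j. length (created H j) + KP <= 2 ^ w" by (rule bound_le[OF IfF.prems(5)]) (use eq in simp)
 then obtain H2 where 2: "reach H (coins s) (length (cexp e 0) + 1) H2 (coins s)" "rel (tick s) H2" "pc H2 = l1"
  using test_step[OF IfF.hyps(1) _ IfF.prems(2) ca(1) kp, of "coins s"] IfF.prems(1) IfF.hyps(2) by (auto simp: l1_def)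
 have "ALL j. length (created H2 j) + KP * (clk t - clk (tick s)) <= 2 ^ w" by (rule reach_bound[OF 2(1) IfF.prems(5)]) (use kp eq in simp)
 then obtain t3 H3 where 3: "t3 <= KP * (clk t - clk (tick s))" "reach H2 (coins s) t3 H3 (coins t)" "rel t H3" "pc H3 = l1 + length (comp l1 d)"
  using IfF.IH[of H2] IfF.prems 2 ca by auto
 note j = jump_step[OF 3(3), unfolded 3(4), OF ca(3)]
 have "le = pc H + length (comp (pc H) (If e c d))" unfolding comp by (simp add: l1_def l2_def le_def)
 thus ?case using reach_trans[OF reach_trans[OF 2(1) 3(2)] j(1)] j(2) 3 eq kp
  by (intro exI[of _ "length (cexp e 0) + 1 + t3 + Suc 0"] exI[of _ "H3(|pc := le|)"]) auto
next
 case (WhileT e s c t u)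
 define l1 where "l1 = pc H + length (cexp e 0) + 2"
 have comp: "comp (pc H) (While e c) = (cexp e 0 @ [JumpLess 5 (tp 0) l1]) @ [JumpLess 5 4 (l1 + length (comp l1 c) + 1)] @ comp l1 c @ [JumpLess 5 4 (pc H)]"
  by (simp add: Let_def l1_def)
 have ca: "code_at (pc H) (cexp e 0 @ [JumpLess 5 (tp 0) l1])" "code_at l1 (comp l1 c)" "code_at (l1 + length (comp l1 c)) [JumpLess 5 4 (pc H)]"
  using WhileT.prems(3) unfolding comp code_at_append by (auto simp: l1_def add.assoc)
 have "clk s < clk t" "clk t <= clk u" using big_fr[OF WhileT.hyps(3)] big_fr[OF WhileT.hyps(4)] unfolding fr_def by auto
 hence "clk u - clk s = 1 + (clk t - clk (tick s)) + (clk u - clk t)" by simp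
 hence eq: "KP * (clk u - clk s) = KP + KP * (clk t - clk (tick s)) + KP * (clk u - clk t)"
  by (metis distrib_left mult.right_neutral)
 have kp: "length (cexp e 0) + 2 <= KP" using WhileT.prems(4) by simp
 have "ALL j. length (created H j) + KP <= 2 ^ w" by (rule bound_le[OF WhileT.prems(5)]) (use eq in simp)
 then obtain H2 where 2: "reach H (coins s) (length (cexp e 0) + 1) H2 (coins s)" "rel (tick s) H2" "pc H2 = l1"
  using test_step[OF WhileT.hyps(1) _ WhileT.prems(2) ca(1) kp, of "coins s"] WhileT.prems(1) WhileT.hyps(2) by auto
 have "ALL j. length (created H2 j) + KP * (clk t - clk (tick s)) <= 2 ^ w" by (rule reach_bound[OF 2(1) WhileT.prems(5)]) (use kp eq in simp)
 then obtain t3 H3 where 3: "t3 <= KP * (clk t - clk (tick s))" "reach H2 (coins s) t3 H3 (coins t)" "rel t H3" "pc H3 = l1 + length (comp l1 c)"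
  using WhileT.IH(1)[of H2] WhileT.prems 2 ca by auto
 note j = jump_step[OF 3(3), unfolded 3(4), OF ca(3)]
 let ?H4 = "H3(|pc := pc H|)"
 have 4: "reach H (coins s) (length (cexp e 0) + 1 + t3 + Suc 0) ?H4 (coins t)" using reach_trans[OF reach_trans[OF 2(1) 3(2)] j(1)] .
 have f4: "length (cexp e 0) + 1 + t3 + Suc 0 <= KP + KP * (clk t - clk (tick s))" using 3 kp by simp
 have "ALL j. length (created ?H4 j) + KP * (clk u - clk t) <= 2 ^ w" by (rule reach_bound[OF 4 WhileT.prems(5)]) (use f4 eq in simp)
 then obtain t5 H5 where 5: "t5 <= KP * (clk u - clk t)" "reach ?H4 (coins t) t5 H5 (coins u)" "rel u H5"
  "pc H5 = pc H + length (comp (pc H) (While e c))"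
  using WhileT.IH(2)[of ?H4] WhileT.prems j(2) by auto
 show ?case
  by (rule exI[of _ "length (cexp e 0) + 1 + t3 + Suc 0 + t5"], rule exI[of _ H5])
   (use reach_trans[OF 4 5(2)] 5 f4 eq in auto)
next
 case (WhileF e s c)
 define l1 where "l1 = pc H + length (cexp e 0) + 2"
 define le where "le = l1 + length (comp l1 c) + 1"
 have comp: "comp (pc H) (While e c) = (cexp e 0 @ [JumpLess 5 (tp 0) l1]) @ [JumpLess 5 4 le] @ comp l1 c @ [JumpLess 5 4 (pc H)]"
  by (simp add: Let_def l1_def le_def)
 have ca: "code_at (pc H) (cexp e 0 @ [JumpLess 5 (tp 0) l1])" "code_at (pc H + length (cexp e 0) + 1) [JumpLess 5 4 le]"
  using WhileF.prems(3) unfolding comp code_at_append by (auto simp: l1_def add.assoc)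
 have kp: "length (cexp e 0) + 2 <= KP" "ALL j. length (created H j) + KP <= 2 ^ w" using WhileF.prems(4,5) by simp_all
 obtain H2 where 2: "reach H (coins s) (length (cexp e 0) + 1) H2 (coins s)" "rel (tick s) H2" "pc H2 = pc H + length (cexp e 0) + 1"
  using test_step[OF WhileF.hyps(1) _ WhileF.prems(2) ca(1) kp, of "coins s"] WhileF.prems(1) WhileF.hyps(2) by auto
 note j = jump_step[OF 2(2), unfolded 2(3), OF ca(2)]
 have "le = pc H + length (comp (pc H) (While e c))" unfolding comp by (simp add: l1_def le_def)
 thus ?case using reach_trans[OF 2(1) j(1)] j(2) kp
  by (intro exI[of _ "length (cexp e 0) + 1 + Suc 0"] exI[of _ "H2(|pc := le|)"]) auto
qed

end

section \<open>Search trees for exchange edges\<close>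

context matroid
begin

text \<open>A single query, with all of \<open>R\<close> deleted, tells whether \<open>R\<close>
  contains an exchange partner of \<open>b\<close>. Binary search rests on this.\<close>

lemma swap_iff:
 assumes "S : I" "b : U" "insert b S ~: I" "R <= S"
 shows "insert b (S - R) : I \<longleftrightarrow> (EX a:R. insert b (S - {a}) : I)"
proof
 assume "insert b (S - R) : I"
 thus "EX a:R. insert b (S - {a}) : I"
  using dependent_imp_swap[OF assms(1) _ assms(2) _ assms(3), of "S - R"] assms(4) by blast
next
 assume "EX a:R. insert b (S - {a}) : I"
 then obtain a where a: "a : R" "insert b (S - {a}) : I" by blast
 hence "insert b (S - R) <= insert b (S - {a})" by blast
 thus "insert b (S - R) : I" using indep_mono[OF a(2)] by blast
qed

end

context lang
begin

text \<open>Here the variant is the number of iterations, to which the invariant may refer; this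
  suits loops whose time is accounted for by a potential.\<close>

lemma T_Loop:
 assumes "I 0 s"
  and test: "!!k t. I k t ==> fr (While e c) s t ==> ok e t & k <= K"
  and body: "!!k t. I k t ==> fr (While e c) s t ==> ev e t ~= 0 ==> T c (tick t) (I (Suc k))"
  and final: "!!k t. I k t ==> fr (While e c) s t ==> ev e t = 0 ==> Q (tick t)"
 shows "T (While e c) s Q"
proof -
 have "I k t ==> fr (While e c) s t ==> T (While e c) t Q" for k t
 proof (induction "Suc K - k" arbitrary: k t rule: less_induct)
  case less
  note it = less.prems
  show ?case
  proof (cases "ev e t = 0")
   case True
   thus ?thesis using test[OF it] final[OF it] WhileF unfolding T_def by blast
  next
   case False
   from body[OF it False] obtain u where u: "big c (tick t) u" "I (Suc k) u" unfolding T_def by blast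
   have "fr (While e c) t u" by (rule fr_sub[OF fr_pre_tick[OF big_fr[OF u(1)]]]) auto
   hence f2: "fr (While e c) s u" using it(2) fr_trans by blast
   have "Suc K - Suc k < Suc K - k" using test[OF it] by auto
   hence "T (While e c) u Q" using less.hyps[OF _ u(2) f2] by blast
   thus ?thesis using WhileT[OF _ False u(1)] test[OF it] unfolding T_def by blast
  qed
 qed
 thus ?thesis using assms(1) fr_refl by blast
qed

end

text \<open>Heap numbering: the root is node \<open>1\<close>, element \<open>a\<close> has the leaf
  \<open>Z + a\<close>, and halving leads to the parent; variable \<open>2\<close> holds
  \<open>Z\<close>. Set array \<open>3\<close> stores at each node \<open>S\<close> without the
  active elements below it, so inserting an element into the stored sets deactivates it and deleting
  it activates it.\<close>

definition tupd :: "side => bool => com" where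
 "tupd j ins = Assign 14 (Op Add (V 2) (V 12)) ;;
  While (V 14) (SPut j 3 (V 14) (if ins then SIns (V 12) (SGet 3 (V 14)) else SDel (V 12) (SGet 3 (V 14))) ;;
   Assign 14 (Op Div (V 14) (N 2)))"

text \<open>A successful query at the left child means that an active exchange partner of variable
  \<open>13\<close> lies below it. If it fails, the right child has one, since the current node
  does.\<close>

definition tfind :: "side => com" where
 "tfind j = Assign 14 (N 1) ;;
  While (Op Sub (V 2) (V 14)) (Assign 14 (Op Mul (N 2) (V 14)) ;;
   When (NotE (Qry j (SIns (V 13) (SGet 3 (V 14))))) (Assign 14 (Op Add (V 14) (N 1)))) ;;
  Assign 12 (Op Sub (V 14) (V 2))"

text \<open>Each partner is deactivated as soon as it is found, so partners appear in increasing
  order, and the query at the root tells when none is left.\<close>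

definition enum :: "side => com" where
 "enum j = Assign 15 (N 0) ;;
  While (Qry j (SIns (V 13) (SGet 3 (N 1)))) (tfind j ;; tupd j True ;;
   Put 14 (V 15) (V 12) ;; Assign 15 (Op Add (V 15) (N 1)))"

lemma mods_tree [simp]:
 "mr (tupd j ins) = {14}" "ma (tupd j ins) = {}" "mm (tupd j ins) = {}" "ms (tupd j ins) = {}"
 "mz (tupd j ins) = {(j, 3)}" "~ mo (tupd j ins)" "~ mt (tupd j ins)"
 "mr (tfind j) = {12, 14}" "ma (tfind j) = {}" "mm (tfind j) = {}" "ms (tfind j) = {}"
 "mz (tfind j) = {}" "~ mo (tfind j)" "~ mt (tfind j)"
 "mr (enum j) = {12, 14, 15}" "ma (enum j) = {14}" "mm (enum j) = {}" "ms (enum j) = {}"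
 "mz (enum j) = {(j, 3)}" "~ mo (enum j)" "~ mt (enum j)"
 by (auto simp: tupd_def tfind_def enum_def)

definition upd :: "bool => nat => nat set => nat set" where
 "upd ins a X = (if ins then insert a X else X - {a})"

lemma div_pow_bounds:
 assumes "2 ^ m <= v" "v < 2 ^ Suc m" "i <= m"
 shows "2 ^ (m - i) <= v div 2 ^ i" "v div 2 ^ i < (2::nat) ^ Suc (m - i)"
proof -
 have e: "2 ^ m = 2 ^ (m - i) * (2::nat) ^ i" using assms by (simp add: power_add[symmetric])
 have "2 ^ (m - i) * 2 ^ i <= v" using assms(1) e by simp
 thus "2 ^ (m - i) <= v div 2 ^ i" by (simp add: less_eq_div_iff_mult_less_eq)
 have "v < 2 ^ Suc (m - i) * 2 ^ i" using assms(2) e by simp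
 thus "v div 2 ^ i < 2 ^ Suc (m - i)" using less_mult_imp_div_less by blast
qed

lemma pow_interval_unique:
 assumes "(2::nat) ^ i <= x" "x < 2 ^ Suc i" "2 ^ k <= x" "x < 2 ^ Suc k"
 shows "i = k"
proof -
 have "(2::nat) ^ i < 2 ^ Suc k" "(2::nat) ^ k < 2 ^ Suc i" using assms by linarith+
 hence "i < Suc k" "k < Suc i" by (simp_all only: power_strict_increasing_iff one_less_numeral_iff semiring_norm(76))
 thus ?thesis by simp
qed

text \<open>\<open>Z\<close> is the number of leaves of the search tree. The bound \<open>B\<close>
  leaves room for node numbers, for levels below \<open>(n + 2) ^ 3\<close> and for the power
  \<open>h ^ 4\<close> with \<open>h <= n + 1\<close>.\<close>

locale prog = lang n B J + matroid_pair "{..<n}" "J Fst" "J Snd"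
 for n B :: nat and J +
 fixes m Z :: nat
 assumes Z: "Z = 2 ^ m" "n <= Z" "Z <= 2 * n + 1" and Bn: "(n + 2) ^ 4 * 8 < B"
begin

lemma matJ: "matroid {..<n} (J j)"
 using M1.matroid_axioms M2.matroid_axioms by (cases j) auto

lemma B_lin: "8 * n + 16 < B" "n * n < B"
proof -
 have "n + 2 <= (n + 2) ^ 4" by (rule self_le_power) auto
 hence "8 * (n + 2) < B" using Bn by (metis less_le_trans linorder_not_le mult.commute mult_le_mono2)
 thus "8 * n + 16 < B" by simp
 have "n * n <= (n + 2) ^ 2" by (simp add: power2_eq_square)
 also have "... <= (n + 2) ^ 4" by (rule power_increasing) auto
 also have "... < B" using Bn by linarith
 finally show "n * n < B" .
qed

lemma B_Z: "4 * Z < B" "n < B" "Z < B" "2 * Z < B" "0 < Z"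
 using B_lin Z by auto

definition anc :: "nat => nat => nat" where "anc t c = (Z + c) div 2 ^ t"

lemma anc_bounds: "c < n ==> t <= m ==> 2 ^ (m - t) <= anc t c & anc t c < 2 ^ Suc (m - t)"
 using div_pow_bounds[of m "Z + c" t] Z unfolding anc_def by auto

definition tree :: "st => side => nat set => nat set => bool" where
 "tree s j S R \<longleftrightarrow> R <= S & S <= {..<n} & (ALL t<=m. ALL x. 2 ^ (m - t) <= x & x < 2 ^ Suc (m - t) -->
  sa s j 3 x = S - {c : R. anc t c = x})"

lemma tree_cong: "sa s j 3 = sa t j 3 ==> tree s j S R = tree t j S R"
 unfolding tree_def by simp

lemma tree_upd [simp]:
 "tree (s(|rv := f|)) j S R = tree s j S R" "tree (s(|ra := f2|)) j S R = tree s j S R"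
 "tree (s(|rm := f3|)) j S R = tree s j S R" "tree (s(|sv := f4|)) j S R = tree s j S R"
 "tree (s(|clk := k|)) j S R = tree s j S R" "tree (s(|coins := cs|)) j S R = tree s j S R"
 by (simp_all add: tree_def)

lemma tree_root: "tree s j S R ==> sa s j 3 (Suc 0) = S - R"
proof -
 assume t: "tree s j S R"
 hence "sa s j 3 1 = S - {c : R. anc m c = 1}" unfolding tree_def by auto
 moreover have "anc m c = 1" if "c : R" for c
  using anc_bounds[of c m] that t unfolding tree_def by auto
 ultimately show ?thesis by auto
qed

lemma tupd_T:
 assumes "rv s 2 = Z" "rv s 12 = a" "a < n"
 shows "T (tupd j ins) s (%t. (ALL y. sa t j 3 y = (if EX i<=m. y = anc i a then upd ins a (sa s j 3 y) else sa s j 3 y)) &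
  clk t <= clk s + 3 * m + 5)"
proof -
 have a: "a < n" "Z + a < 2 * Z" using assms Z by auto
 show ?thesis unfolding tupd_def T_simps
 proof (intro conjI, goal_cases)
  case 1
  thus ?case using assms a B_Z by auto
 next
  case 2
  show ?case
  proof (rule T_Loop[where I = "%k t. k <= Suc m & rv t 14 = anc k a & clk t = Suc (clk s) + 3 * k &
   sa t j 3 = (%y. if EX i<k. y = anc i a then upd ins a (sa s j 3 y) else sa s j 3 y)" and K = "Suc m"], goal_cases)
   case 1
   thus ?case using assms by (simp add: anc_def)
  next
   case (2 k t)
   thus ?case by simp
  next
   case (3 k t)
   have ra: "rv t 12 = a" using 3(2) assms unfolding fr_def by simp
   have "k ~= Suc m"
   proof
   assume "k = Suc m"
   hence "anc k a = 0" unfolding anc_def using a Z by simp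
   thus False using 3 by simp
   qed
   moreover have "anc k a <= Z + a" unfolding anc_def by simp
   hence "anc k a < B" using a B_Z by linarith
   moreover have "anc k a div 2 = anc (Suc k) a" unfolding anc_def by (simp add: power_Suc2 div_mult2_eq del: power_Suc)
   moreover have "(%y. if EX i<k. y = anc i a then upd ins a (sa s j 3 y) else sa s j 3 y)
   (anc k a := upd ins a (if EX i<k. anc k a = anc i a then upd ins a (sa s j 3 (anc k a)) else sa s j 3 (anc k a))) =
   (%y. if EX i<Suc k. y = anc i a then upd ins a (sa s j 3 y) else sa s j 3 y)"
   by (auto simp: fun_eq_iff less_Suc_eq upd_def)
   ultimately show ?case using 3(1) ra a by (cases ins) (simp_all add: upd_def)
  next
   case (4 k t)
   have "k = Suc m"
   proof (rule ccontr)
   assume "k ~= Suc m"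
   hence "2 ^ (m - k) <= anc k a" using anc_bounds[OF a(1), of k] 4 by simp
   thus False using 4 by simp
   qed
   thus ?case using 4 by (simp add: less_Suc_eq_le)
  qed
 qed
qed

text \<open>A node number lies in just one interval between consecutive powers of two, which
  determines its height.\<close>

lemma anc_eq_height:
 assumes "a < n" "i <= m" "t <= m" "2 ^ (m - t) <= x" "x < 2 ^ Suc (m - t)" "x = anc i a"
 shows "i = t"
proof -
 have "m - i = m - t" using pow_interval_unique[of "m - i" x] anc_bounds[OF assms(1,2)] assms by blast
 thus ?thesis using assms by simp
qed

lemma tupd_tree:
 assumes "rv s 2 = Z" "rv s 12 = a" "tree s j S R" "if ins then a : R else a : S"
 shows "T (tupd j ins) s (%t. tree t j S (if ins then R - {a} else insert a R) & clk t <= clk s + 3 * m + 5)"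
proof -
 have R: "R <= S" "S <= {..<n}" using assms(3) unfolding tree_def by auto
 hence a: "a < n" using assms(4) by (auto split: if_splits)
 show ?thesis
 proof (rule T_conseq[OF tupd_T[OF assms(1,2) a]])
  fix t :: st assume t: "(ALL y. sa t j 3 y = (if EX i<=m. y = anc i a then upd ins a (sa s j 3 y) else sa s j 3 y)) &
   clk t <= clk s + 3 * m + 5"
  have "sa t j 3 x = S - {c : (if ins then R - {a} else insert a R). anc h c = x}"
   if x: "h <= m" "2 ^ (m - h) <= x" "x < 2 ^ Suc (m - h)" for h x
  proof -
   have "(EX i<=m. x = anc i a) \<longleftrightarrow> anc h a = x" using anc_eq_height[OF a _ x] x by auto
   moreover have "sa s j 3 x = S - {c : R. anc h c = x}" using assms(3) x unfolding tree_def by blast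
   ultimately show ?thesis using t assms(4) R by (auto simp: upd_def split: if_splits)
  qed
  thus "tree t j S (if ins then R - {a} else insert a R) & clk t <= clk s + 3 * m + 5"
   using t R assms(4) unfolding tree_def by auto
 qed
qed

definition circ :: "side => nat set => nat => nat set" where
 "circ j S b = {a : S. insert b (S - {a}) : J j}"

text \<open>The stored set has exactly the active elements below the node deleted, so this is
  \<open>swap_iff\<close> for that set of elements.\<close>

lemma tree_query:
 assumes "tree s j S R" "S : J j" "b < n" "insert b S ~: J j" "t <= m" "2 ^ (m - t) <= x" "x < 2 ^ Suc (m - t)"
 shows "insert b (sa s j 3 x) : J j \<longleftrightarrow> (EX c:circ j S b Int R. anc t c = x)"
proof -
 have "sa s j 3 x = S - {c : R. anc t c = x}" "R <= S" using assms unfolding tree_def by auto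
 thus ?thesis using matroid.swap_iff[OF matJ assms(2) _ assms(4), of "{c : R. anc t c = x}"] assms(3)
  unfolding circ_def by auto
qed

lemma tfind_T:
 assumes "rv s 2 = Z" "rv s 13 = b" "b < n" "tree s j S R" "S : J j" "insert b S ~: J j" "circ j S b Int R ~= {}"
 shows "T (tfind j) s (%t. rv t 12 = Min (circ j S b Int R) & clk t <= clk s + 4 * m + 4)"
proof -
 let ?X = "circ j S b Int R"
 have X: "?X <= {..<n}" "finite ?X" using assms(4) finite_subset[of ?X "{..<n}"] unfolding tree_def by auto
 show ?thesis unfolding tfind_def T_simps
 proof (intro conjI, goal_cases)
  case 1
  thus ?case by simp
 next
  case 2
  show ?case
  \<comment> \<open>After \<open>k\<close> steps the node is the leftmost one of its depth with a
    partner below it; at a leaf this is the smallest partner.\<close>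
  proof (rule T_Loop[where I = "%k t. k <= m & clk t <= Suc (clk s) + 4 * k &
   2 ^ k <= rv t 14 & rv t 14 < 2 ^ Suc k & (EX c:?X. anc (m - k) c = rv t 14) & (ALL c:?X. rv t 14 <= anc (m - k) c)" and K = m], goal_cases)
   case 1
   have "anc m c = 1" if "c : ?X" for c using anc_bounds[of c m] that X by auto
   thus ?case using assms(7) by auto
  next
   case (2 k t)
   thus ?case by simp
  next
   case (3 k t)
   have f: "rv t 2 = Z" "rv t 13 = b" "sa t j 3 = sa s j 3" using 3(2) assms unfolding fr_def by auto
   have km: "k < m"
   proof (rule ccontr)
   assume "~ k < m"
   hence "k = m" using 3 by simp
   thus False using 3 f Z by simp
   qed
   define x where "x = rv t 14"
   have x: "x < Z" "2 ^ k <= x" "x < 2 ^ Suc k" using 3 f unfolding x_def by auto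
   have rx: "rv t 14 = x" using x_def by simp
   have half: "anc (m - Suc k) c div 2 = anc (m - k) c" for c
   proof -
   have "m - k = Suc (m - Suc k)" using km by simp
   thus ?thesis unfolding anc_def by (simp add: power_Suc2 div_mult2_eq del: power_Suc)
   qed
   have tr: "tree t j S R" using assms(4) tree_cong[OF f(3)] by simp
   have h: "m - Suc k <= m" "2 ^ (m - (m - Suc k)) <= 2 * x" "2 * x < 2 ^ Suc (m - (m - Suc k))"
   using x km by auto
   have q: "insert b (sa t j 3 (2 * x)) : J j \<longleftrightarrow> (EX c:?X. anc (m - Suc k) c = 2 * x)"
   using tree_query[OF tr assms(5,3,6) h] .
   obtain c0 where c0: "c0 : ?X" "anc (m - k) c0 = x" using 3 unfolding x_def by auto
   hence c0': "anc (m - Suc k) c0 = 2 * x | anc (m - Suc k) c0 = 2 * x + 1" using half[of c0] by linarith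
   have ge: "2 * x <= anc (m - Suc k) c" if "c : ?X" for c
   proof -
   have "x <= anc (m - k) c" using 3 that unfolding x_def by auto
   thus ?thesis using half[of c] by linarith
   qed
   have ok: "2 * x < B" "Suc (2 * x) < B" using x B_Z by linarith+
   show ?case
   proof (cases "EX c:?X. anc (m - Suc k) c = 2 * x")
   case True
   thus ?thesis using 3(1) f q ok ge x km assms(3) rx by simp
   next
   case False
   hence "2 * x + 1 <= anc (m - Suc k) c" if "c : ?X" for c using ge[OF that] that
   by (metis Suc_eq_plus1 Suc_leI le_neq_implies_less)
   moreover have "EX c:?X. anc (m - Suc k) c = Suc (2 * x)" using False c0 c0' by auto
   ultimately show ?thesis using 3(1) f q ok False x km assms(3) rx by simp
   qed
  next
   case (4 k t)
   have f: "rv t 2 = Z" using 4(2) assms unfolding fr_def by auto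
   have "k = m"
   proof (rule ccontr)
   assume "k ~= m"
   hence "Suc k <= m" using 4 by simp
   hence "(2::nat) ^ Suc k <= 2 ^ m" by (intro power_increasing) auto
   thus False using 4 f Z by simp
   qed
   then obtain c where c: "c : ?X" "Z + c = rv t 14" "ALL c':?X. rv t 14 <= Z + c'" using 4 by (auto simp: anc_def)
   have "c <= y" if "y : ?X" for y using c(2) bspec[OF c(3) that] by linarith
   hence "Min ?X = c" by (intro Min_eqI X c)
   thus ?case using c 4 f \<open>k = m\<close> by simp
  qed
 qed
qed

lemma enum_T:
 assumes "rv s 2 = Z" "rv s 13 = b" "b < n" "tree s j S R" "S : J j" "insert b S ~: J j"
 defines "L == sorted_list_of_set (circ j S b Int R)"
 shows "T (enum j) s (%t. tree t j S (R - set L) & rv t 15 = length L & (ALL i<length L. ra t 14 i = L ! i) &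
  clk t <= clk s + 3 + length L * (7 * m + 12))"
proof -
 have RS: "R <= S" "S <= {..<n}" using assms(4) unfolding tree_def by auto
 have fin: "finite (circ j S b Int R)" using RS finite_subset[of "circ j S b Int R" "{..<n}"] by auto
 have L: "set L = circ j S b Int R" "distinct L" "sorted L" unfolding L_def using fin by auto
 have len: "length L <= n"
 proof -
  have "length L = card (circ j S b Int R)" unfolding L_def using fin by simp
  also have "... <= card {..<n}" by (rule card_mono) (use RS in auto)
  finally show ?thesis by simp
 qed
 have rest: "circ j S b Int (R - set (take k L)) = set (drop k L)" if "k <= length L" for k
 proof -
  have "set L = set (take k L) Un set (drop k L)" by (metis append_take_drop_id set_append)
  moreover have "set (take k L) Int set (drop k L) = {}" using set_take_disj_set_drop_if_distinct[OF L(2), of k k] by simp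
  ultimately show ?thesis using L(1) by blast
 qed
 have Mn: "Min (set (drop k L)) = L ! k" "L ! k : set (drop k L)" if "k < length L" for k
 proof -
  have e: "drop k L = L ! k # drop (Suc k) L" using that Cons_nth_drop_Suc by metis
  have "sorted (drop k L)" using L(3) sorted_wrt_drop by blast
  thus "Min (set (drop k L)) = L ! k" unfolding e by (intro Min_eqI) auto
  show "L ! k : set (drop k L)" unfolding e by simp
 qed
 show ?thesis unfolding enum_def T_simps
 proof (intro conjI, goal_cases)
  case 2
  show ?case
  proof (rule T_Loop[where I = "%k t. k <= length L & rv t 15 = k & tree t j S (R - set (take k L)) &
   (ALL i<k. ra t 14 i = L ! i) & clk t <= Suc (clk s) + k * (7 * m + 12)" and K = "length L"], goal_cases)
   case 1
   thus ?case using assms(4) by simp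
  next
   case (2 k t)
   thus ?case using assms(2,3) B_Z unfolding fr_def by auto
  next
   case (3 k t)
   have f: "rv t 2 = Z" "rv t 13 = b" using 3(2) assms unfolding fr_def by auto
   have tr: "tree t j S (R - set (take k L))" using 3 by simp
   have "insert b (S - (R - set (take k L))) : J j" using 3(3) f tree_root[OF tr] by (simp split: if_splits)
   hence "circ j S b Int (R - set (take k L)) ~= {}"
   using matroid.swap_iff[OF matJ assms(5) _ assms(6), of "R - set (take k L)"] RS assms(3) unfolding circ_def by auto
   hence kl: "k < length L" using rest[of k] 3 by (cases "k = length L") auto
   have ne: "circ j S b Int (R - set (take k L)) ~= {}" using rest[of k] Mn[OF kl] kl by auto
   have Rk: "R - set (take k L) - {L ! k} = R - set (take (Suc k) L)" using kl by (auto simp: take_Suc_conv_app_nth)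
   have inR: "L ! k : R - set (take k L)" using rest[of k] Mn[OF kl] kl by auto
   have kB: "k < B" "Suc k < B" using kl len B_lin by linarith+
   show ?case unfolding T_simps
   proof (rule T_conseq[OF tfind_T[of "tick t" b j S "R - set (take k L)"]], goal_cases)
   case (8 u)
   have u: "rv u 12 = L ! k" using 8(1) rest[of k] Mn[OF kl] kl by simp
   have "tree u j S (R - set (take k L))" using 8(2) tr tree_cong[of u j t] unfolding fr_def by simp
   hence tu: "T (tupd j True) u (%w. tree w j S (R - set (take (Suc k) L)) & clk w <= clk u + 3 * m + 5)"
   using tupd_tree[of u "L ! k" j S "R - set (take k L)" True] 8(2) f u inR Rk by (simp add: fr_def)
   show ?case
   proof (rule T_conseq[OF tu], goal_cases)
   case (1 w)
   have "rv w 15 = k" "rv w 12 = L ! k" "ra w 14 = ra t 14" using 1(2) 8(2) u 3(1) by (auto simp: fr_def)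
   thus ?case using 1(1) 8(1) 3(1) kB kl by (auto simp: less_Suc_eq)
   qed
   qed (use f tr assms ne in auto)
  next
   case (4 k t)
   have f: "rv t 13 = b" using 4(2) assms unfolding fr_def by auto
   have tr: "tree t j S (R - set (take k L))" using 4 by simp
   have nq: "insert b (S - (R - set (take k L))) ~: J j" using 4(3) f tree_root[OF tr] by (simp split: if_splits)
   have "k = length L"
   proof (rule ccontr)
   assume "k ~= length L"
   hence "k < length L" using 4 by simp
   hence "L ! k : circ j S b Int (R - set (take k L))" using rest[of k] Mn[of k] by auto
   thus False
   using nq matroid.swap_iff[OF matJ assms(5) _ assms(6), of "R - set (take k L)"] RS assms(3) unfolding circ_def by auto
   qed
   thus ?case using 4 by simp
  qed
 qed simp
qed

definition tinit :: "side => com" where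
 "tinit j = For 7 (Op Mul (N 2) (V 2)) (SPut j 3 (V 7) (SV 2))"

lemma mods_tinit [simp]:
 "mr (tinit j) = {7}" "ma (tinit j) = {}" "mm (tinit j) = {}" "ms (tinit j) = {}"
 "mz (tinit j) = {(j, 3)}" "~ mo (tinit j)" "~ mt (tinit j)"
 by (auto simp: tinit_def)

lemma tinit_T:
 assumes "rv s 2 = Z" "sv s j 2 = S" "S <= {..<n}"
 shows "T (tinit j) s (%t. tree t j S {} & clk t <= clk s + 2 + 6 * Z)"
 unfolding tinit_def
proof (rule T_For[where m = "2 * Z" and P = "%i t. (ALL x<i. sa t j 3 x = S) & clk t = Suc (clk s) + 3 * i"], goal_cases)
 case (4 i t)
 thus ?case using assms B_Z by (auto simp: fr_def)
next
 case (5 i t)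
 thus ?case using assms B_Z by (auto simp: fr_def less_Suc_eq)
next
 case (6 t)
 have "x < 2 * Z" if "x < 2 ^ Suc (m - h)" for h x
 proof -
  have "(2::nat) ^ Suc (m - h) <= 2 ^ Suc m" by (rule power_increasing) auto
  hence "x < 2 ^ Suc m" using that less_le_trans by blast
  thus ?thesis using Z(1) by simp
 qed
 thus ?case using 6 assms by (auto simp: tree_def)
qed (use B_Z in auto)

end

section \<open>Breadth-first search\<close>

text \<open>The search runs from elements free in the second matroid towards one free in the first.
  \<open>bQ\<close> lists the reached elements of \<open>S\<close> in order, \<open>bD\<close> the
  reached elements outside \<open>S\<close>, and \<open>bnxt a\<close> is the outside element that
  brought \<open>a\<close> into the queue.\<close>

record bst =
 bQ :: "nat list"
 bD :: "nat list"
 blev :: "nat => nat"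
 bnxt :: "nat => nat"
 bfnd :: "nat option"

context prog
begin

definition bnew :: "nat set => nat => bst => nat list" where
 "bnew S b st = sorted_list_of_set (circ Fst S b - set (bQ st))"

text \<open>A reached element passes its level unchanged to its circuit in the first matroid; only
  exchanges in the second matroid raise the level.\<close>

definition bdisc :: "nat set => nat => nat => bst => bst" where
 "bdisc S b l st = (if bfnd st ~= None then st
  else if insert b S : J Fst then st(|bD := bD st @ [b], blev := (blev st)(b := l), bfnd := Some b|)
  else st(|bQ := bQ st @ bnew S b st, bD := bD st @ [b],
   blev := (%x. if x : set (bnew S b st) then l else if x = b then l else blev st x),
   bnxt := (%x. if x : set (bnew S b st) then b else bnxt st x)|))"

text \<open>The last condition says that no queue element below level \<open>k - 1\<close> is a
  partner of \<open>b\<close>, so no arc into \<open>b\<close> skips a level. This is the triangular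
  shape in the second matroid.\<close>

definition reach2 :: "nat set => nat list => (nat => nat) => nat => nat => bool" where
 "reach2 S Q lev b k \<longleftrightarrow> (k = 0 --> insert b S : J Snd) &
  (ALL i. k = Suc i --> (EX a:set Q. lev a = i & insert b (S - {a}) : J Snd) &
   insert b (S - {x : set Q. lev x < i}) ~: J Snd)"

definition bfs_inv :: "nat set => bst => nat => bool" where
 "bfs_inv S st l \<longleftrightarrow> common S & distinct (bQ st) & set (bQ st) <= S & distinct (bD st) & set (bD st) <= {..<n} - S &
  (ALL a:set (bQ st). bnxt st a : set (bD st) & blev st (bnxt st a) = blev st a &
   insert (bnxt st a) (S - {a}) : J Fst & insert (bnxt st a) S ~: J Fst) &
  (ALL b:set (bD st). bfnd st ~= Some b --> insert b S ~: J Fst & insert b {a : set (bQ st). blev st a <= blev st b} ~: J Fst) &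
  sorted (map (blev st) (bQ st)) & (ALL a:set (bQ st). blev st a <= l) & (ALL b:set (bD st). blev st b <= l) &
  (ALL b. bfnd st = Some b --> b : set (bD st) & insert b S : J Fst & blev st b = l) &
  (ALL b:set (bD st). reach2 S (bQ st) (blev st) b (blev st b))"

lemma bfs_invD:
 assumes "bfs_inv S st l"
 shows "common S" "distinct (bQ st)" "set (bQ st) <= S" "distinct (bD st)" "set (bD st) <= {..<n} - S"
  "!!a. a : set (bQ st) ==> bnxt st a : set (bD st)"
  "!!a. a : set (bQ st) ==> blev st (bnxt st a) = blev st a"
  "!!a. a : set (bQ st) ==> insert (bnxt st a) (S - {a}) : J Fst"
  "!!a. a : set (bQ st) ==> insert (bnxt st a) S ~: J Fst"
  "!!b. b : set (bD st) ==> bfnd st ~= Some b ==> insert b S ~: J Fst"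
  "!!b. b : set (bD st) ==> bfnd st ~= Some b ==> insert b {a : set (bQ st). blev st a <= blev st b} ~: J Fst"
  "sorted (map (blev st) (bQ st))" "!!a. a : set (bQ st) ==> blev st a <= l" "!!b. b : set (bD st) ==> blev st b <= l"
  "!!b. bfnd st = Some b ==> b : set (bD st) & insert b S : J Fst & blev st b = l"
  "!!b. b : set (bD st) ==> reach2 S (bQ st) (blev st) b (blev st b)"
 using assms unfolding bfs_inv_def by simp_all

lemma common_sub: "common S ==> S <= {..<n}" "common S ==> S : J j" "common S ==> finite S"
 using M1.indep_subset M1.finite_indep unfolding common_def by (auto, cases j, auto)

lemma J_mono: "X : J j ==> Y <= X ==> Y : J j"
 using matroid.indep_mono[OF matJ] .

lemma bnew_set: "common S ==> set (bnew S b st) = circ Fst S b - set (bQ st)" "distinct (bnew S b st)"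
 "common S ==> set (bnew S b st) <= S"
 using common_sub(3)[of S] unfolding bnew_def circ_def by auto

lemma bfs_inv_mono: "bfs_inv S st l ==> l <= l' ==> bfnd st = None ==> bfs_inv S st l'"
 unfolding bfs_inv_def by (elim conjE, intro conjI) (auto intro: le_trans)

lemma bdisc_inv:
 assumes i: "bfs_inv S st l" and nf: "bfnd st = None" and b: "b < n" "b ~: S" "b ~: set (bD st)"
  and r: "reach2 S (bQ st) (blev st) b l"
 shows "bfs_inv S (bdisc S b l st) l"
proof -
 note I = i[unfolded bfs_inv_def]
 have c: "common S" and Q: "set (bQ st) <= S" using I by auto
 have D: "set (bD st) <= {..<n} - S" using I by blast
 show ?thesis
 proof (cases "insert b S : J Fst")
  case True
  let ?st = "st(|bD := bD st @ [b], blev := (blev st)(b := l), bfnd := Some b|)"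
  have e: "bdisc S b l st = ?st" using nf True unfolding bdisc_def by simp
  have bQ: "b ~: set (bQ st)" using Q b by blast
  have lv: "((blev st)(b := l)) x = blev st x" if "x : set (bQ st) | x : set (bD st)" for x
   using that b bQ by auto
  have s1: "{a : set (bQ st). ((blev st)(b := l)) a <= k} = {a : set (bQ st). blev st a <= k}"
   "{a : set (bQ st). ((blev st)(b := l)) a < k} = {a : set (bQ st). blev st a < k}" for k
   using bQ by auto
  have s2: "map ((blev st)(b := l)) (bQ st) = map (blev st) (bQ st)" using lv by simp
  have r2: "reach2 S (bQ st) ((blev st)(b := l)) x k" if "reach2 S (bQ st) (blev st) x k" for x k
  proof -
   have "(EX a:set (bQ st). ((blev st)(b := l)) a = i & R a) \<longleftrightarrow> (EX a:set (bQ st). blev st a = i & R a)" for i R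
   using lv by (intro bex_cong) auto
   thus ?thesis using that unfolding reach2_def s1 by (simp only:)
  qed
  show ?thesis unfolding e bfs_inv_def
  proof (intro conjI)
   show "ALL a:set (bQ ?st). bnxt ?st a : set (bD ?st) & blev ?st (bnxt ?st a) = blev ?st a &
   insert (bnxt ?st a) (S - {a}) : J Fst & insert (bnxt ?st a) S ~: J Fst" using I lv b by auto
   show "ALL x:set (bD ?st). bfnd ?st ~= Some x --> insert x S ~: J Fst & insert x {a : set (bQ ?st). blev ?st a <= blev ?st x} ~: J Fst"
   proof (intro ballI impI)
   fix x assume "x : set (bD ?st)" "bfnd ?st ~= Some x"
   hence x: "x : set (bD st)" "x ~= b" by auto
   have "((blev st)(b := l)) x = blev st x" using x by simp
   thus "insert x S ~: J Fst & insert x {a : set (bQ ?st). blev ?st a <= blev ?st x} ~: J Fst"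
   using bfs_invD(10,11)[OF i x(1)] nf s1(1)[of "blev st x"] by (simp del: fun_upd_apply)
   qed
   have "blev ?st = (blev st)(b := l)" "bQ ?st = bQ st" by simp_all
   thus "sorted (map (blev ?st) (bQ ?st))" using bfs_invD(12)[OF i] s2 by (simp only:)
   show "ALL x:set (bD ?st). reach2 S (bQ ?st) (blev ?st) x (blev ?st x)" using I r r2 b by auto
  qed (use I b bQ True in auto)
 next
  case False
  let ?L = "bnew S b st"
  let ?lev = "%x. if x : set ?L then l else if x = b then l else blev st x"
  let ?nxt = "%x. if x : set ?L then b else bnxt st x"
  let ?st = "st(|bQ := bQ st @ ?L, bD := bD st @ [b], blev := ?lev, bnxt := ?nxt|)"
  note L = bnew_set(1,3)[OF c, of b st] bnew_set(2)[of S b st]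
  have e: "bdisc S b l st = ?st" using nf False unfolding bdisc_def by simp
  have Lc: "set ?L <= circ Fst S b" "set ?L Int set (bQ st) = {}" using L by auto
  have lv: "?lev x = blev st x" if "x : set (bQ st) | x : set (bD st)" for x
   using that b Q D Lc L by auto
  have lvL: "?lev x = l" if "x : set ?L" for x using that by simp
  have lvb: "?lev b = l" by simp
  have s1: "{a : set (bQ st @ ?L). ?lev a < k} = {a : set (bQ st). blev st a < k}" if "k <= l" for k
   using Q b(2) Lc that by auto
  have r2: "reach2 S (bQ st @ ?L) ?lev x k" if x: "reach2 S (bQ st) (blev st) x k" "k <= l" for x k
   unfolding reach2_def
  proof (intro conjI allI impI)
   fix i assume k: "k = Suc i"
   obtain a where a: "a : set (bQ st)" "blev st a = i" "insert x (S - {a}) : J Snd"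
   using x k unfolding reach2_def by blast
   thus "EX a:set (bQ st @ ?L). ?lev a = i & insert x (S - {a}) : J Snd"
   using lv[of a] by (intro bexI[of _ a]) auto
   have "insert x (S - {y : set (bQ st). blev st y < i}) ~: J Snd" using x k unfolding reach2_def by blast
   thus "insert x (S - {y : set (bQ st @ ?L). ?lev y < i}) ~: J Snd" using s1[of i] x k by simp
  qed (use x in \<open>auto simp: reach2_def\<close>)
  have up: "insert x X ~: J Fst" if "insert x Y ~: J Fst" "Y <= X" for x X Y
   using that J_mono[of "insert x X" Fst "insert x Y"] by blast
  have all: "{a : set (bQ st @ ?L). ?lev a <= l} = S - (S - set (bQ st @ ?L))"
   using I lv lvL Q L by auto
  \<comment> \<open>The whole circuit of \<open>b\<close> in the first matroid is now in the queue,
    so by \<open>swap_iff\<close> deleting all unqueued elements of \<open>S\<close> cannot free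
    \<open>b\<close>.\<close>
  have new: "insert b {a : set (bQ st @ ?L). ?lev a <= l} ~: J Fst"
   unfolding all using matroid.swap_iff[OF matJ common_sub(2)[OF c] _ False, of "S - set (bQ st @ ?L)"] b L
   by (auto simp: circ_def)
  show ?thesis unfolding e bfs_inv_def
  proof (intro conjI)
   show "ALL a:set (bQ ?st). bnxt ?st a : set (bD ?st) & blev ?st (bnxt ?st a) = blev ?st a &
   insert (bnxt ?st a) (S - {a}) : J Fst & insert (bnxt ?st a) S ~: J Fst"
   proof
   fix a assume "a : set (bQ ?st)"
   then consider "a : set ?L" | "a : set (bQ st)" "a ~: set ?L" by auto
   thus "bnxt ?st a : set (bD ?st) & blev ?st (bnxt ?st a) = blev ?st a &
   insert (bnxt ?st a) (S - {a}) : J Fst & insert (bnxt ?st a) S ~: J Fst"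
   proof cases
   case 1
   thus ?thesis using Lc False by (auto simp: circ_def)
   next
   case 2
   hence n: "bnxt st a : set (bD st)" "blev st (bnxt st a) = blev st a" using I by auto
   thus ?thesis using 2 I lv[of a] lv[of "bnxt st a"] by simp
   qed
   qed
   show "ALL x:set (bD ?st). bfnd ?st ~= Some x --> insert x S ~: J Fst & insert x {a : set (bQ ?st). blev ?st a <= blev ?st x} ~: J Fst"
   proof (intro ballI impI)
   fix x assume "x : set (bD ?st)"
   then consider "x = b" | "x : set (bD st)" by auto
   thus "insert x S ~: J Fst & insert x {a : set (bQ ?st). blev ?st a <= blev ?st x} ~: J Fst"
   proof cases
   case 1
   thus ?thesis using new False lvb by simp
   next
   case 2
   have "insert x {a : set (bQ st). blev st a <= blev st x} ~: J Fst" "insert x S ~: J Fst" using 2 I nf by auto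
   moreover have "{a : set (bQ st). blev st a <= blev st x} <= {a : set (bQ st @ ?L). ?lev a <= ?lev x}"
   unfolding lv[OF disjI2[OF 2]] using Q b(2) Lc by auto
   ultimately show ?thesis using up by simp
   qed
   qed
   have me: "map ?lev (bQ st @ ?L) = map (blev st) (bQ st) @ map (%_. l) ?L" using lv by simp
   have "sorted (map (%_. l) ?L)" by (simp add: sorted_wrt_map)
   hence "sorted (map ?lev (bQ st @ ?L))" unfolding me using bfs_invD(12,13)[OF i] by (simp add: sorted_append)
   moreover have "blev ?st = ?lev" "bQ ?st = bQ st @ ?L" by simp_all
   ultimately show "sorted (map (blev ?st) (bQ ?st))" by (simp only:)
   show "ALL x:set (bD ?st). reach2 S (bQ ?st) (blev ?st) x (blev ?st x)"
   proof
   fix x assume "x : set (bD ?st)"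
   then consider "x = b" | "x : set (bD st)" by auto
   thus "reach2 S (bQ ?st) (blev ?st) x (blev ?st x)"
   proof cases
   case 1
   thus ?thesis using r2[OF r] lvb by simp
   next
   case 2
   thus ?thesis using r2[of x "blev st x"] I lv[of x] by simp
   qed
   qed
   show "ALL a:set (bQ ?st). blev ?st a <= l" "ALL x:set (bD ?st). blev ?st x <= l" using I lv lvL lvb by auto
  qed (use I b L nf in auto)
 qed
qed

text \<open>No predecessors are stored for elements outside \<open>S\<close>. One backward pass over
  the queue recovers them: the first queue element met that is one level lower and exchanges with
  the current element is taken.\<close>

definition wstep :: "nat set => bst => nat => nat \<times> nat set => nat \<times> nat set" where
 "wstep S st a p = (if blev st a + 1 = blev st (fst p) & insert (fst p) (S - {a}) : J Snd
  then (bnxt st a, insert (fst p) (snd p - {a})) else p)"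

definition bwalk :: "nat set => bst => nat set" where
 "bwalk S st = (let p = fold (wstep S st) (rev (bQ st)) (the (bfnd st), S) in insert (fst p) (snd p))"

definition half_path :: "nat set => bst => nat => (nat => nat) => (nat => nat) => bool" where
 "half_path S st e pa pe \<longleftrightarrow> (ALL i<=e. pe i : set (bD st) & blev st (pe i) = i) &
  (ALL i<e. pa i : set (bQ st) & blev st (pa i) = i & pe i = bnxt st (pa i) & insert (pe (Suc i)) (S - {pa i}) : J Snd)"

text \<open>Induction on the part of the queue still to be scanned. Levels are sorted along the
  queue, so the partner of the next path element stands before the queue element just used.\<close>

lemma walk_path:
 assumes I: "bfs_inv S st l"
 shows "p <= length (bQ st) ==> cur : set (bD st) ==>
  (ALL i. blev st cur = Suc i --> (EX a:set (take p (bQ st)). blev st a = i & insert cur (S - {a}) : J Snd)) ==>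
  EX pa pe. half_path S st (blev st cur) pa pe & pe (blev st cur) = cur &
   (let r = fold (wstep S st) (rev (take p (bQ st))) (cur, X) in insert (fst r) (snd r)) =
   (X - pa ` {..<blev st cur}) Un pe ` {..blev st cur}"
proof (induction p arbitrary: cur X)
 case 0
 hence "blev st cur = 0" by (cases "blev st cur") auto
 thus ?case using 0 by (intro exI[of _ "%_. cur"]) (auto simp: half_path_def)
next
 case (Suc p)
 note I' = I[unfolded bfs_inv_def]
 let ?a = "bQ st ! p"
 have pl: "p < length (bQ st)" using Suc.prems by simp
 have tk: "take (Suc p) (bQ st) = take p (bQ st) @ [?a]" using pl by (simp add: take_Suc_conv_app_nth)
 have aQ: "?a : set (bQ st)" using pl by simp
 show ?case
 proof (cases "blev st ?a + 1 = blev st cur & insert cur (S - {?a}) : J Snd")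
  case True
  let ?c = "bnxt st ?a"
  have c: "?c : set (bD st)" "blev st ?c = blev st ?a" using I' aQ by auto
  have nx: "EX a:set (take p (bQ st)). blev st a = i & insert ?c (S - {a}) : J Snd" if i: "blev st ?c = Suc i" for i
  proof -
   have "reach2 S (bQ st) (blev st) ?c (blev st ?c)" using I' c by blast
   then obtain a where a: "a : set (bQ st)" "blev st a = i" "insert ?c (S - {a}) : J Snd"
   using i unfolding reach2_def by blast
   then obtain k where k: "k < length (bQ st)" "bQ st ! k = a" by (auto simp: in_set_conv_nth)
   have "k < p"
   proof (rule ccontr)
   assume "~ k < p"
   hence "blev st ?a <= blev st a"
   using sorted_nth_mono[of "map (blev st) (bQ st)" p k] I' k pl by auto
   thus False using a i c by simp
   qed
   hence "a : set (take p (bQ st))" using k pl by (auto simp: in_set_conv_nth)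
   thus ?thesis using a by blast
  qed
  obtain pa pe where h: "half_path S st (blev st ?a) pa pe" "pe (blev st ?a) = ?c"
   "(let r = fold (wstep S st) (rev (take p (bQ st))) (?c, insert cur (X - {?a})) in insert (fst r) (snd r)) =
   (insert cur (X - {?a}) - pa ` {..<blev st ?a}) Un pe ` {..blev st ?a}"
   using Suc.IH[of ?c "insert cur (X - {?a})"] pl c nx by auto
  define e where "e = blev st ?a"
  have ea: "blev st ?a = e" by (simp add: e_def)
  note h = h[unfolded ea]
  have ce: "blev st cur = Suc e" using True ea by simp
  let ?al = "pa(e := ?a)" and ?be = "pe(Suc e := cur)"
  have "half_path S st (Suc e) ?al ?be"
   using h(1,2) True Suc.prems(2) aQ ce ea unfolding half_path_def
   by (auto simp: less_Suc_eq le_Suc_eq)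
  moreover have "cur ~: pa ` {..<e}"
  proof
   assume "cur : pa ` {..<e}"
   hence "cur : S" using h(1) I' unfolding half_path_def by auto
   thus False using Suc.prems(2) I' by auto
  qed
  hence "(insert cur (X - {?a}) - pa ` {..<e}) Un pe ` {..e} = (X - ?al ` {..<Suc e}) Un ?be ` {..Suc e}"
   by (auto simp: less_Suc_eq le_Suc_eq image_iff)
  moreover have "wstep S st ?a (cur, X) = (?c, insert cur (X - {?a}))" using True unfolding wstep_def by simp
  ultimately have "half_path S st (Suc e) ?al ?be & ?be (Suc e) = cur &
   (let r = fold (wstep S st) (rev (take (Suc p) (bQ st))) (cur, X) in insert (fst r) (snd r)) =
   (X - ?al ` {..<Suc e}) Un ?be ` {..Suc e}" using h(3) unfolding tk
   by (simp only: rev_append rev.simps append.simps fold.simps fold_Cons comp_apply fun_upd_same simp_thms)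
  thus ?thesis unfolding ce by blast
 next
  case False
  hence "wstep S st ?a (cur, X) = (cur, X)" unfolding wstep_def by auto
  moreover have "EX a:set (take p (bQ st)). blev st a = i & insert cur (S - {a}) : J Snd" if "blev st cur = Suc i" for i
   using Suc.prems(3) that False unfolding tk by auto
  ultimately show ?thesis using Suc.IH[of cur X] pl Suc.prems unfolding tk by auto
 qed
qed

text \<open>Unreached elements of \<open>S\<close> are put on the last level \<open>l\<close>. They
  are then outside every lower level set and inside every upper level set that the path conditions
  mention, which makes the labels of the search those of an augmenting path.\<close>

lemma bwalk_aug:
 assumes I: "bfs_inv S st l" and f: "bfnd st = Some b"
  and L: "!!x. x : {..<n} - S ==> L x = blev st x" "!!a. a : set (bQ st) ==> L a = blev st a"
   "!!a. a : S - set (bQ st) ==> L a = l"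
 shows "EX pa pe. aug_path S L l pa pe & bwalk S st = (S - pa ` {..<l}) Un pe ` {..l}"
proof -
 note I' = I[unfolded bfs_inv_def]
 have b: "b : set (bD st)" "insert b S : J Fst" "blev st b = l" using I' f by auto
 have r: "EX a:set (bQ st). blev st a = i & insert x (S - {a}) : J Snd" "insert x (S - {y : set (bQ st). blev st y < i}) ~: J Snd"
  if "x : set (bD st)" "blev st x = Suc i" for x i using I' that unfolding reach2_def by blast+
 obtain pa pe where h: "half_path S st l pa pe" "pe l = b" "bwalk S st = (S - pa ` {..<l}) Un pe ` {..l}"
  using walk_path[OF I, of "length (bQ st)" b S] b r f unfolding bwalk_def by auto
 have D: "set (bD st) <= {..<n} - S" using I' by blast
 have be: "pe i : set (bD st)" "blev st (pe i) = i" "pe i : {..<n} - S" if "i <= l" for i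
  using h(1) that D unfolding half_path_def by (simp, simp, blast)
 have al: "pa i : set (bQ st)" "blev st (pa i) = i" "pe i = bnxt st (pa i)" "insert (pe (Suc i)) (S - {pa i}) : J Snd" if "i < l" for i
  using h(1) that unfolding half_path_def by simp_all
 have "aug_path S L l pa pe" unfolding aug_path_def
 proof (intro conjI allI impI)
  show "common S" using I' by blast
  show "insert (pe l) S : J Fst" using h b by simp
  have "reach2 S (bQ st) (blev st) (pe 0) (blev st (pe 0))" using be(1)[of 0] I' by simp
  hence "reach2 S (bQ st) (blev st) (pe 0) 0" using be(2)[of 0] by simp
  thus "insert (pe 0) S : J Snd" unfolding reach2_def by blast
 next
  fix i assume i: "i <= l"
  thus "pe i : {..<n} - S" "L (pe i) = i" using be[OF i] L by auto
 next
  fix i assume i: "i < l"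
  thus "pa i : S" "L (pa i) = i" using al[OF i] L I' by auto
  show "insert (pe i) (S - {pa i}) : J Fst" using al[OF i] I' by auto
  show "insert (pe (Suc i)) (S - {pa i}) : J Snd" using al[OF i] by blast
  have "insert (pe i) S ~: J Fst" using al[OF i] I' by auto
  hence "bfnd st ~= Some (pe i)" using bfs_invD(15)[OF I] by blast
  hence "insert (pe i) {a : set (bQ st). blev st a <= i} ~: J Fst"
   using bfs_invD(11)[OF I be(1)[of i]] be(2)[of i] i by simp
  moreover have "{a : set (bQ st). blev st a <= i} = {a : S. L a <= i}"
  proof -
   have "L a <= i ==> a : S ==> a : set (bQ st)" for a using L(3)[of a] i by force
   hence "a : set (bQ st) & blev st a <= i \<longleftrightarrow> a : S & L a <= i" for a
   using L(2) bfs_invD(3)[OF I] by (metis subsetD)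
   thus ?thesis by blast
  qed
  ultimately show "insert (pe i) {a : S. L a <= i} ~: J Fst" by simp
  have "S - {y : set (bQ st). blev st y < i} = {a : S. i <= L a}"
  proof -
   have "i <= L a" if "a : S" "a ~: set (bQ st)" for a using L(3)[of a] i that by simp
   thus ?thesis using L(2) by fastforce
  qed
  thus "insert (pe (Suc i)) {a : S. i <= L a} ~: J Snd" using r(2)[of "pe (Suc i)" i] be[of "Suc i"] i by simp
 qed
 thus ?thesis using h by blast
qed

text \<open>Storage of a search: array \<open>2\<close> is membership in \<open>S\<close>,
  \<open>5\<close> the levels, \<open>7\<close> the queue, \<open>8\<close> the pointers
  \<open>bnxt\<close>, \<open>9\<close> marks reached elements and elements of \<open>S\<close>.
  Variable \<open>13\<close> is the element to process, \<open>16\<close> the queue length,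
  \<open>17\<close> and \<open>18\<close> the found flag and element, \<open>19\<close> the current
  level.\<close>

definition disc :: com where
 "disc = When (NotE (V 17)) (Put 9 (V 13) (N 1) ;; Put 5 (V 13) (V 19) ;;
  If (Qry Fst (SIns (V 13) (SV 2))) (Assign 17 (N 1) ;; Assign 18 (V 13))
   (enum Fst ;; For 24 (V 15) (Assign 12 (Get 14 (V 24)) ;; Put 7 (V 16) (V 12) ;;
   Assign 16 (Op Add (V 16) (N 1)) ;; Put 8 (V 12) (V 13) ;; Put 5 (V 12) (V 19))))"

text \<open>At the end all of \<open>S\<close> is active in the tree of the first oracle, since
  nothing is in the queue yet.\<close>

definition bsetup :: com where
 "bsetup = SAssign Fst 2 SEmp ;; SAssign Snd 2 SEmp ;;
  For 7 Sz (Put 9 (V 7) (Get 2 (V 7)) ;;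
   When (Get 2 (V 7)) (SAssign Fst 2 (SIns (V 7) (SV 2)) ;; SAssign Snd 2 (SIns (V 7) (SV 2)))) ;;
  tinit Fst ;;
  For 7 Sz (When (Get 2 (V 7)) (Assign 12 (V 7) ;; tupd Fst False)) ;;
  Assign 16 (N 0) ;; Assign 17 (N 0)"

definition walk :: com where
 "walk = Assign 21 (V 16) ;;
  While (V 21) (Assign 21 (Op Sub (V 21) (N 1)) ;; Assign 12 (Get 7 (V 21)) ;;
   When (EqE (Op Add (Get 5 (V 12)) (N 1)) (Get 5 (V 18)))
   (When (Qry Snd (SIns (V 18) (SDel (V 12) (SV 2))))
   (Put 2 (V 12) (N 0) ;; Put 2 (V 18) (N 1) ;; Assign 18 (Get 8 (V 12))))) ;;
  Put 2 (V 18) (N 1)"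

lemma mods_bfs [simp]:
 "mr disc = {12, 14, 15, 16, 17, 18, 24}" "ma disc = {5, 7, 8, 9, 14}" "mm disc = {}" "ms disc = {}"
 "mz disc = {(Fst, 3)}" "~ mo disc" "~ mt disc"
 "mr bsetup = {7, 12, 14, 16, 17}" "ma bsetup = {9}" "mm bsetup = {}" "ms bsetup = {(Fst, 2), (Snd, 2)}"
 "mz bsetup = {(Fst, 3)}" "~ mo bsetup" "~ mt bsetup"
 "mr walk = {12, 18, 21}" "ma walk = {2}" "mm walk = {}" "ms walk = {}"
 "mz walk = {}" "~ mo walk" "~ mt walk"
 by (auto simp: disc_def bsetup_def walk_def)

definition brel :: "nat set => bst => st => bool" where
 "brel S st s \<longleftrightarrow> common S & rv s 2 = Z & sv s Fst 2 = S & sv s Snd 2 = S & (ALL v<n. ra s 2 v = of_bool (v : S)) &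
  tree s Fst S (S - set (bQ st)) & rv s 16 = length (bQ st) & (ALL i<length (bQ st). ra s 7 i = bQ st ! i) &
  (ALL v<n. ra s 5 v = blev st v & blev st v < (n + 2) ^ 3) & (ALL a:set (bQ st). ra s 8 a = bnxt st a & bnxt st a < n) &
  (ALL v<n. ra s 9 v = of_bool (v : S Un set (bD st))) &
  rv s 17 = of_bool (bfnd st ~= None) & (ALL b. bfnd st = Some b --> rv s 18 = b & b < n) &
  distinct (bQ st) & set (bQ st) <= S"

lemma brelD:
 assumes "brel S st s"
 shows "common S" "rv s 2 = Z" "sv s Fst 2 = S" "sv s Snd 2 = S" "!!v. v < n ==> ra s 2 v = of_bool (v : S)"
  "tree s Fst S (S - set (bQ st))" "rv s 16 = length (bQ st)" "!!i. i < length (bQ st) ==> ra s 7 i = bQ st ! i"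
  "!!v. v < n ==> ra s 5 v = blev st v" "!!v. v < n ==> blev st v < (n + 2) ^ 3"
  "!!a. a : set (bQ st) ==> ra s 8 a = bnxt st a" "!!a. a : set (bQ st) ==> bnxt st a < n"
  "!!v. v < n ==> ra s 9 v = of_bool (v : S Un set (bD st))"
  "rv s 17 = of_bool (bfnd st ~= None)" "!!b. bfnd st = Some b ==> rv s 18 = b & b < n"
  "distinct (bQ st)" "set (bQ st) <= S" "length (bQ st) <= card S" "card S <= n" "S <= {..<n}" "finite S"
proof -
 show c: "common S" and s: "set (bQ st) <= S" and d: "distinct (bQ st)" using assms unfolding brel_def by auto
 show f: "finite S" and Sn: "S <= {..<n}" using common_sub c by auto
 show "length (bQ st) <= card S" using card_mono[OF f s] distinct_card[OF d] by simp
 show "card S <= n" using card_mono[OF _ Sn] by simp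
qed (use assms in \<open>auto simp: brel_def\<close>)

lemma brel_cong:
 assumes "brel S st s" "rv t 2 = rv s 2" "rv t 16 = rv s 16" "rv t 17 = rv s 17" "rv t 18 = rv s 18"
  "sv t = sv s" "sa t Fst 3 = sa s Fst 3" "ra t 2 = ra s 2" "ra t 5 = ra s 5" "ra t 7 = ra s 7" "ra t 8 = ra s 8" "ra t 9 = ra s 9"
 shows "brel S st t"
 using assms(1) unfolding brel_def tree_def by (simp add: assms(2-))

lemma brel_clk [simp]: "brel S st (s(|clk := k|)) = brel S st s"
 by (simp add: brel_def)

lemma LB: "2 * (n + 2) ^ 3 + 4 < B" "(n + 2) ^ 3 + 4 < B"
proof -
 have "(n + 2) ^ 3 * 2 <= (n + 2) ^ 3 * (n + 2)" by (rule mult_le_mono2) simp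
 also have "x ^ 3 * x = x ^ 4" for x :: nat by (simp add: eval_nat_numeral)
 finally have 1: "(n + 2) ^ 3 * 2 <= (n + 2) ^ 4" .
 have "(1::nat) <= (n + 2) ^ 4" by simp
 thus "2 * (n + 2) ^ 3 + 4 < B" using 1 Bn by linarith
 thus "(n + 2) ^ 3 + 4 < B" by linarith
qed

text \<open>Each element of \<open>S\<close> enters the queue at most once, for one tree search, one
  tree update and some bookkeeping; the potential prepays this.\<close>

definition pot :: "nat set => bst => nat" where
 "pot S st = (7 * m + 30) * (card S - length (bQ st))"

lemma disc_T:
 assumes r: "brel S st s" and b: "rv s 13 = b" "b < n" "b ~: S" and l: "rv s 19 = l" "l < (n + 2) ^ 3"
 shows "T disc s (%t. brel S (bdisc S b l st) t & clk t + pot S (bdisc S b l st) <= clk s + 12 + pot S st)"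
proof (cases "bfnd st = None")
 case False
 thus ?thesis using brelD(14)[OF r] r unfolding disc_def
  by (auto simp: bdisc_def intro!: brel_cong[OF r])
next
 case True
 note R = brelD[OF r]
 have nB: "n < B" using B_Z by simp
 have f17: "rv s 17 = 0" using R(14) True by simp
 show ?thesis
 proof (cases "insert b S : J Fst")
  case free: True
  let ?st = "st(|bD := bD st @ [b], blev := (blev st)(b := l), bfnd := Some b|)"
  have e: "bdisc S b l st = ?st" using True free unfolding bdisc_def by simp
  have bQ: "b ~: set (bQ st)" using R(17) b by blast
  show ?thesis unfolding disc_def e using f17 b l nB R free
   by (simp add: brel_def pot_def)
 next
  case nf: False
  let ?L = "bnew S b st"
  let ?st = "bdisc S b l st"
  have e: "?st = st(|bQ := bQ st @ ?L, bD := bD st @ [b],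
   blev := (%x. if x : set ?L then l else if x = b then l else blev st x),
   bnxt := (%x. if x : set ?L then b else bnxt st x)|)" using True nf unfolding bdisc_def by simp
  have L: "set ?L = circ Fst S b - set (bQ st)" "set ?L <= S" "distinct ?L" using bnew_set R(1) by auto
  have Leq: "sorted_list_of_set (circ Fst S b Int (S - set (bQ st))) = ?L"
   unfolding bnew_def by (rule arg_cong[of _ _ sorted_list_of_set]) (auto simp: circ_def)
  have Ln: "x < n" if "x : set ?L" for x using that L R(20) by auto
  have len: "length (bQ st) + length ?L <= card S"
  proof -
   have "distinct (bQ st @ ?L)" "set (bQ st @ ?L) <= S" using L R(16,17) by auto
   thus ?thesis using card_mono[OF R(21)] distinct_card by (metis length_append)
  qed
  define s1 where "s1 = s(|ra := (ra s)(9 := (ra s 9)(b := 1), 5 := (ra s 5)(b := l)), clk := Suc (Suc (Suc (Suc (clk s))))|)"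
  have en: "T (enum Fst) s1 (%t. tree t Fst S (S - set (bQ st) - set ?L) & rv t 15 = length ?L &
   (ALL i<length ?L. ra t 14 i = ?L ! i) & clk t <= clk s1 + 3 + length ?L * (7 * m + 12))"
   using enum_T[of s1 b Fst S "S - set (bQ st)"] R b nf common_sub(2)[OF R(1), of Fst] unfolding Leq s1_def by simp
  have main: "T (enum Fst ;; For 24 (V 15) (Assign 12 (Get 14 (V 24)) ;; Put 7 (V 16) (V 12) ;;
   Assign 16 (Op Add (V 16) (N 1)) ;; Put 8 (V 12) (V 13) ;; Put 5 (V 12) (V 19))) s1
   (%t. brel S ?st t & clk t + pot S ?st <= clk s + 12 + pot S st)"
   unfolding T_simps(8)[of "enum Fst"]
  proof (rule T_conseq[OF en], goal_cases)
   case (1 u)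
   note u = 1(1)[THEN conjunct1] 1(1)[THEN conjunct2, THEN conjunct1]
   1(1)[THEN conjunct2, THEN conjunct2, THEN conjunct1] 1(1)[THEN conjunct2, THEN conjunct2, THEN conjunct2]
   have fu: "rv u 2 = Z" "rv u 13 = b" "rv u 19 = l" "rv u 16 = length (bQ st)" "rv u 17 = 0" "rv u 18 = rv s 18"
   "sv u = sv s" "ra u 2 = ra s 2" "ra u 7 = ra s 7" "ra u 8 = ra s 8"
   "ra u 9 = (ra s 9)(b := 1)" "ra u 5 = (ra s 5)(b := l)"
   using 1(2) R b l f17 unfolding fr_def s1_def by (auto simp: fun_eq_iff)
   show ?case
   proof (rule T_For[where m = "length ?L" and P = "%i t. clk t <= Suc (clk u) + 7 * i & rv t 16 = length (bQ st) + i &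
   (ALL k<length (bQ st) + i. ra t 7 k = (bQ st @ ?L) ! k) &
   (ALL x<n. ra t 5 x = (if x : set (take i ?L) then l else ra u 5 x)) &
   (ALL x. ra t 8 x = (if x : set (take i ?L) then b else ra u 8 x))"], goal_cases)
   case 2
   thus ?case using len R(19) nB by linarith
   next
   case 3
   thus ?case using fu R(8) by (simp add: nth_append)
   next
   case (4 i t)
   thus ?case using u by (simp add: fr_def)
   next
   case (5 i t)
   have g: "ra t 14 = ra u 14" "rv t 13 = b" "rv t 19 = l" using 5(2) fu by (auto simp: fr_def)
   have Li: "?L ! i < n" using 5(4) Ln by simp
   have q: "length (bQ st) + i < B" "Suc (length (bQ st) + i) < B" using 5(4) len R(19) B_lin by linarith+
   have tk: "set (take (Suc i) ?L) = insert (?L ! i) (set (take i ?L))" using 5(4) by (simp add: take_Suc_conv_app_nth)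
   show ?case using 5 g u(3) Li q nB b tk by (auto simp: less_Suc_eq nth_append)
   next
   case (6 t)
   have g: "rv t 2 = Z" "rv t 17 = 0" "rv t 18 = rv s 18" "sv t = sv s" "ra t 2 = ra s 2" "ra t 9 = ra u 9" "sa t Fst 3 = sa u Fst 3"
   using 6(2) fu by (auto simp: fr_def fun_eq_iff)
   have tr: "tree t Fst S (S - set (bQ st @ ?L))" using u(1) tree_cong[OF g(7)] by (simp add: Diff_eq Int_assoc)
   have "ALL i<length (bQ st @ ?L). ra t 7 i = (bQ st @ ?L) ! i" using 6(1) by simp
   moreover have "ALL v<n. ra t 5 v = (if v : set ?L then l else if v = b then l else blev st v) &
   (if v : set ?L then l else if v = b then l else blev st v) < (n + 2) ^ 3"
   using 6(1) fu(12) R(9,10) l by simp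
   moreover have "ALL a:set (bQ st @ ?L). ra t 8 a = (if a : set ?L then b else bnxt st a) &
   (if a : set ?L then b else bnxt st a) < n"
   using 6(1) fu(10) R(11,12) b by auto
   moreover have "ALL v<n. ra t 9 v = of_bool (v : S Un set (bD st @ [b]))" using g(6) fu(11) R(13) by simp
   moreover have "distinct (bQ st @ ?L)" "set (bQ st @ ?L) <= S" using L R(16,17) by auto
   moreover have "rv t 16 = length (bQ st @ ?L)" using 6(1) by simp
   ultimately have "brel S ?st t" unfolding brel_def e using g tr R(1-5) True by simp
   moreover have p: "pot S st = pot S ?st + (7 * m + 30) * length ?L"
   proof -
   have "card S - length (bQ st) = (card S - length (bQ ?st)) + length ?L" using len unfolding e by simp
   thus ?thesis unfolding pot_def by (simp add: distrib_left)
   qed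
   have "length ?L * (7 * m + 12) + 7 * length ?L <= (7 * m + 30) * length ?L" by (simp add: algebra_simps)
   moreover have "clk s1 = clk s + 4" by (simp add: s1_def)
   moreover have "clk t <= Suc (clk u) + 7 * length ?L" using 6(1) by blast
   ultimately have "Suc (clk t) + pot S ?st <= clk s + 12 + pot S st" using u(4) p by linarith
   thus ?case using \<open>brel S ?st t\<close> by simp
   qed auto
  qed
  have "(ra s)(9 := (ra s 9)(b := Suc 0), 5 := ((ra s)(9 := (ra s 9)(b := Suc 0))) 5) = (ra s)(9 := (ra s 9)(b := Suc 0))" by auto
  thus ?thesis unfolding disc_def using f17 b l nB R nf main unfolding s1_def by simp
 qed
qed

lemma bsetup_T:
 assumes "common S" "ALL v<n. ra s 2 v = of_bool (v : S)" "rv s 2 = Z" "ALL v<n. ra s 5 v < (n + 2) ^ 3"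
 shows "T bsetup s (%t. brel S (|bQ = [], bD = [], blev = ra s 5, bnxt = ra s 8, bfnd = None|) t &
  clk t <= clk s + (n + 1) * (3 * m + 40))"
proof -
 have S: "S <= {..<n}" using common_sub assms by auto
 have SS: "S Int {..<n} = S" using S by auto
 have nB: "n < B" using B_Z by simp
 show ?thesis unfolding bsetup_def T_simps(8)[of "For a b c" for a b c] T_simps(8)[of "SAssign a b c" for a b c]
  T_simps(8)[of "tinit j" for j] T_simps(3)
 proof (intro conjI, goal_cases)
  case 3
  show ?case
  proof (rule T_For[where m = n and P = "%i t. sv t Fst 2 = S Int {..<i} & sv t Snd 2 = S Int {..<i} &
   (ALL v<i. ra t 9 v = of_bool (v : S)) & clk t <= clk s + 3 + 6 * i"], goal_cases)
   case (5 i t)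
   have g: "ra t 2 i = of_bool (i : S)" using 5 assms by (auto simp: fr_def)
   show ?case using 5 g nB by (auto simp: lessThan_Suc less_Suc_eq)
  next
   case (6 t)
   hence sv: "sv t Fst 2 = S" "sv t Snd 2 = S" using SS by auto
   have g: "ra t 2 = ra s 2" "ra t 5 = ra s 5" "ra t 8 = ra s 8" "rv t 2 = Z" using 6(2) assms by (auto simp: fr_def)
   show ?case
   proof (rule T_conseq[OF tinit_T[of "tick t" Fst S]], goal_cases)
   case (4 u)
   have h: "ra u 2 = ra s 2" "ra u 5 = ra s 5" "ra u 8 = ra s 8" "ra u 9 = ra t 9" "rv u 2 = Z" "sv u Fst 2 = S" "sv u Snd 2 = S"
   using 4(2) g sv by (auto simp: fr_def)
   show ?case
   proof (rule T_For[where m = n and P = "%i t. tree t Fst S (S Int {..<i}) & clk t <= Suc (clk u) + (3 * m + 9) * i"], goal_cases)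
   case (5 i w)
   have k: "ra w 2 i = of_bool (i : S)" "rv w 2 = Z" using 5 assms h by (auto simp: fr_def)
   show ?case
   proof (cases "i : S")
   case True
   let ?w = "w(|rv := (rv w)(12 := i), clk := Suc (Suc (Suc (clk w)))|)"
   have tu: "T (tupd Fst False) ?w (%t. tree t Fst S (insert i (S Int {..<i})) & clk t <= clk ?w + 3 * m + 5)"
   using tupd_tree[of ?w i Fst S "S Int {..<i}" False] 5 k True by simp
   have eq: "insert i (S Int {..<i}) = S Int {..<Suc i}" using True by auto
   show ?thesis using k True 5(1,3,4) nB by (simp, intro T_conseq[OF tu[unfolded eq]], simp)
   next
   case False
   hence "S Int {..<Suc i} = S Int {..<i}" by (auto simp: less_Suc_eq)
   thus ?thesis using k False 5 nB by simp
   qed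
   next
   case (6 w)
   have k: "ra w 2 = ra s 2" "ra w 5 = ra s 5" "ra w 8 = ra s 8" "ra w 9 = ra t 9" "rv w 2 = Z" "sv w Fst 2 = S" "sv w Snd 2 = S"
   using 6(2) h by (auto simp: fr_def)
   have "clk w + 3 <= clk s + (n + 1) * (3 * m + 40)"
   using 6(1) 4(1) \<open>sv t Fst 2 = _ & _\<close> Z(3) by (auto simp: algebra_simps)
   thus ?case using 6(1) k assms SS \<open>sv t Fst 2 = _ & _\<close> by (auto simp: brel_def)
   qed (use h 4 nB in \<open>auto simp: fr_def\<close>)
   qed (use g sv S in auto)
  qed (use nB in auto)
 qed auto
qed

lemma walk_T:
 assumes r: "brel S st s" and f: "bfnd st = Some b"
 shows "T walk s (%t. (ALL v<n. ra t 2 v = of_bool (v : bwalk S st)) & clk t <= clk s + 10 * n + 10)"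
proof -
 note R = brelD[OF r]
 let ?Q = "bQ st"
 define q where "q = length ?Q"
 define F where "F k = fold (wstep S st) (rev (drop k ?Q)) (b, S)" for k
 have qn: "q <= n" using R(18,19) q_def by simp
 have Fq: "F q = (b, S)" unfolding F_def q_def by simp
 have FS: "F k = wstep S st (?Q ! k) (F (Suc k))" if "k < q" for k
 proof -
  have "drop k ?Q = ?Q ! k # drop (Suc k) ?Q" using that unfolding q_def by (metis Cons_nth_drop_Suc)
  thus ?thesis unfolding F_def by simp
 qed
 have F0: "bwalk S st = insert (fst (F 0)) (snd (F 0))" unfolding bwalk_def F_def f by (simp add: Let_def)
 show ?thesis unfolding walk_def T_simps(8)[of "Assign a b" for a b] T_simps(2)
 proof (intro conjI, goal_cases)
  case 1
  thus ?case by simp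
 next
  case 2
  show ?case unfolding T_simps(8)[of "While a b" for a b]
  proof (rule T_Loop[where K = q and I = "%k t. k <= q & rv t 21 = q - k & rv t 18 = fst (F (q - k)) & rv t 18 < n &
   (ALL v<n. ra t 2 v = of_bool (v : snd (F (q - k)))) & clk t <= Suc (clk s) + 9 * k"], goal_cases)
   case 1
   thus ?case using R(5,7,15) f Fq q_def by simp
  next
   case (2 k t)
   thus ?case by simp
  next
   case (3 k t)
   have g: "ra t 7 = ra s 7" "ra t 5 = ra s 5" "ra t 8 = ra s 8" "sv t = sv s" using 3(2) by (auto simp: fr_def fun_eq_iff)
   have k: "k < q" using 3 by simp
   define p where "p = q - Suc k"
   have p: "q - k = Suc p" "p < q" "q - Suc k = p" using k unfolding p_def by auto
   define a where "a = ?Q ! p"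
   have aQ: "a : set ?Q" using p unfolding a_def q_def by simp
   hence a: "ra t 7 p = a" "a : set ?Q" "a < n" using g R(8,17,20) p unfolding a_def q_def by (simp, simp, blast)
   have pB: "p < B" using p qn B_Z by linarith
   let ?c = "fst (F (Suc p))"
   have c: "rv t 18 = ?c" "?c < n" "rv t 21 = Suc p" "ALL v<n. ra t 2 v = of_bool (v : snd (F (Suc p)))" "clk t <= Suc (clk s) + 9 * k"
   using 3(1) p by auto
   have lv: "ra t 5 a = blev st a" "ra t 5 ?c = blev st ?c" "blev st a < (n + 2) ^ 3" "blev st ?c < (n + 2) ^ 3"
   using g R(9,10) a c by auto
   have nx: "ra t 8 a = bnxt st a" "bnxt st a < n" using g R(11,12) a by auto
   have lB: "Suc (blev st a) < B" "Suc (blev st a) - blev st ?c + (blev st ?c - Suc (blev st a)) < B" "a < B" "?c < B"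
   using lv LB a c B_Z by linarith+
   have sv: "sv t Snd 2 = S" using g R(4) by simp
   have Fp: "F p = (if blev st a + 1 = blev st ?c & insert ?c (S - {a}) : J Snd
   then (bnxt st a, insert ?c (snd (F (Suc p)) - {a})) else F (Suc p))"
   using FS[OF p(2)] unfolding wstep_def a_def by simp
   have eqz: "Suc 0 - (Suc (blev st a) - blev st ?c + (blev st ?c - Suc (blev st a))) = 0 \<longleftrightarrow> Suc (blev st a) ~= blev st ?c"
   by linarith
   show ?case
   proof (cases "blev st a + 1 = blev st ?c & insert ?c (S - {a}) : J Snd")
   case True
   have eq2: "blev st ?c = Suc (blev st a)" using True by simp
   have "insert ?c (sv t Snd 2 - {a}) : J Snd" using True sv by simp
   thus ?thesis using c a lv nx lB pB sv Fp True k eq2 unfolding p(3) by auto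
   next
   case False
   hence F1: "F p = F (Suc p)" using Fp by auto
   show ?thesis
   proof (cases "Suc (blev st a) = blev st ?c")
   case True
   have "insert ?c (sv t Snd 2 - {a}) ~: J Snd" using True False sv by simp
   thus ?thesis using c a lv nx lB pB F1 True[symmetric] k unfolding p(3) by auto
   next
   case F: False
   hence "Suc 0 - (Suc (blev st a) - blev st ?c + (blev st ?c - Suc (blev st a))) = 0" using eqz by simp
   thus ?thesis using c a lv nx lB pB F1 k unfolding p(3) by auto
   qed
   qed
  next
   case (4 k t)
   hence "k = q" by simp
   thus ?case using 4 F0 qn B_Z by (auto simp: less_Suc_eq)
  qed
 qed
qed

end

section \<open>Push-relabel phase\<close>

context matroid_pair
begin

text \<open>\<open>Bs\<close> acts as a base of the first matroid chosen by increasing level among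
  the elements not retired to level \<open>h\<close>. In use, \<open>Bs - S\<close> consists of the
  elements dropped in the last round, and \<open>mu\<close> still gives them the level before the
  drop.\<close>

definition lift_old :: "'a set => ('a => nat) => nat => 'a set => ('a => nat) => bool" where
 "lift_old S lv h Bs mu \<longleftrightarrow> Bs : I1 & S <= Bs & (ALL x:S. mu x = lv x) &
  (ALL g:U. lv g < h --> g : M1.cl {x : Bs. mu x <= lv g})"

text \<open>Invariant of the push-relabel phase with \<open>h\<close> levels: \<open>S\<close> extends to a set \<open>Bs\<close> that is optimal for
 the first matroid with respect to the (lagged) levels, and \<open>e\<close> bounds the excess \<open>Bs - S\<close>.\<close>

definition A_inv :: "nat => 'a set => ('a => nat) => nat => bool" where
 "A_inv h S lv e \<longleftrightarrow> S : I2 & (ALL x:S. lv x < h) & (ALL g:U. lv g <= h) &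
  (ALL g:U - S. 1 <= lv g --> g : M2.cl {x : S. lv g <= lv x + 1}) &
  (EX Bs mu. lift_old S lv h Bs mu & card (Bs - S) <= e)"

text \<open>The state inside a round that treats levels upwards: \<open>A\<close> collects the
  accepted elements, \<open>l\<close> is the level in progress, and \<open>W\<close> is what has
  been scanned on it. The sets required to be in \<open>I2\<close>, one for each level, will measure
  the progress of the round.\<close>

definition A_mid :: "nat => 'a set => ('a => nat) => nat => 'a set => 'a set => ('a => nat) => bool" where
 "A_mid h S lv0 l W A lv \<longleftrightarrow> A <= U - S & (ALL x:S. lv x = lv0 x) & (ALL x:U. lv0 x <= lv x & lv x <= h) &
  (ALL x:A. lv x <= l) & {x : S Un A. lv x <= l} : I1 &
  (ALL g:U. lv g < l | lv g = l & (g : W | g : S) --> g : M1.cl {x : S Un A. lv x <= lv g}) &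
  (ALL i<=l. {x : S. i <= lv x} Un {x : A. lv x = i} : I2) &
  (ALL g:U - S - A. 1 <= lv g --> g : M2.cl ({x : S. lv g <= lv x + 1} Un {x : A. lv x + 1 = lv g}))"

lemma A_midD:
 assumes "A_mid h S lv0 l W A lv"
 shows "A <= U - S" "!!x. x : S ==> lv x = lv0 x" "!!x. x : U ==> lv0 x <= lv x" "!!x. x : U ==> lv x <= h"
  "!!x. x : A ==> lv x <= l" "{x : S Un A. lv x <= l} : I1"
  "!!g. g : U ==> lv g < l | lv g = l & (g : W | g : S) ==> g : M1.cl {x : S Un A. lv x <= lv g}"
  "!!i. i <= l ==> {x : S. i <= lv x} Un {x : A. lv x = i} : I2"
  "!!g. g : U - S - A ==> 1 <= lv g ==> g : M2.cl ({x : S. lv g <= lv x + 1} Un {x : A. lv x + 1 = lv g})"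
 using assms unfolding A_mid_def by blast+

text \<open>The delicate point is that the elements of \<open>S\<close> on level
  \<open>l + 1\<close> stay independent, in the first matroid, of the changed lower levels. These
  are spanned by the levels up to \<open>l\<close> of the old \<open>Bs\<close>, of which the
  elements in question are independent, so \<open>indep_Un_of_subset_cl\<close> applies.\<close>

lemma A_mid_next:
 assumes m: "A_mid h S lv0 l U A lv" and o: "lift_old S lv0 h Bs mu" and S2: "S : I2" and l: "Suc l <= h"
 shows "A_mid h S lv0 (Suc l) {} A lv"
proof -
 note D = A_midD[OF m]
 have Bs: "Bs : I1" "S <= Bs" "!!x. x : S ==> mu x = lv0 x" "!!g. g : U ==> lv0 g < h ==> g : M1.cl {x : Bs. mu x <= lv0 g}"
  using o unfolding lift_old_def by auto
 have SU: "S <= U" using M2.indep_subset[OF S2] .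
 let ?Y = "{x : S Un A. lv x <= l}" and ?R = "{x : S. lv0 x = Suc l}" and ?Q = "{x : Bs. mu x <= l}"
 have YR: "{x : S Un A. lv x <= Suc l} = ?Y Un ?R" using D(2,5) by (auto simp: le_Suc_eq)
 have "?Y Un ?R : I1"
 proof (rule M1.indep_Un_of_subset_cl)
  show "?Q Un ?R : I1" using Bs(2) by (intro M1.indep_mono[OF Bs(1)]) auto
  show "?Q Int ?R = {}" using Bs(3) by fastforce
  show "?Y : I1" by (rule D(6))
  show "?Y <= M1.cl ?Q"
  proof
   fix g assume g: "g : ?Y"
   hence gU: "g : U" using SU D(1) by blast
   hence "lv0 g <= l" using g D(3)[of g] by simp
   hence "g : M1.cl {x : Bs. mu x <= lv0 g}" "{x : Bs. mu x <= lv0 g} <= ?Q" using Bs(4)[OF gU] l by auto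
   thus "g : M1.cl ?Q" using M1.cl_mono by blast
  qed
 qed
 moreover have "{x : S. Suc l <= lv x} Un {x : A. lv x = Suc l} : I2"
  by (rule M2.indep_mono[OF S2]) (use D(5) in fastforce)
 moreover have "g : M1.cl {x : S Un A. lv x <= lv g}" if "g : U" "lv g < Suc l | lv g = Suc l & g : S" for g
 proof (cases "lv g <= l")
  case True
  hence "lv g < l | lv g = l & (g : U | g : S)" using that(1) by auto
  thus ?thesis using D(7)[OF that(1)] by blast
 next
  case False
  thus ?thesis using that unfolding M1.cl_def by auto
 qed
 ultimately show ?thesis unfolding A_mid_def YR using D(1-5,8,9) by (auto simp: le_Suc_eq)
qed

lemma A_mid_start:
 assumes a: "A_inv h S lv e" and o: "lift_old S lv h Bs mu"
 shows "A_mid h S lv 0 {} {} lv"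
proof -
 have S2: "S : I2" using a unfolding A_inv_def by blast
 have S1: "S : I1" using o M1.indep_mono unfolding lift_old_def by blast
 have "{x : S. lv x = 0} : I1" by (rule M1.indep_mono[OF S1]) auto
 moreover have "g : M1.cl {x : S. lv x = 0}" if "g : U" "g : S" "lv g = 0" for g using that unfolding M1.cl_def by auto
 ultimately show ?thesis using a S2 unfolding A_mid_def A_inv_def by simp
qed

lemma A_mid_skip:
 assumes m: "A_mid h S lv0 l W A lv" and v: "v : S Un A | lv v ~= l | insert v {x : S Un A. lv x <= l} ~: I1"
 shows "A_mid h S lv0 l (insert v W) A lv"
proof -
 note D = A_midD[OF m]
 have "g : M1.cl {x : S Un A. lv x <= lv g}" if "g : U" "lv g = l" "g = v" for g
  using that v unfolding M1.cl_def by auto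
 hence "ALL g:U. lv g < l | lv g = l & (g : insert v W | g : S) --> g : M1.cl {x : S Un A. lv x <= lv g}"
  using D(7) by blast
 thus ?thesis using m unfolding A_mid_def by blast
qed

lemma A_mid_accept:
 assumes m: "A_mid h S lv0 l W A lv" and v: "v : U" "v ~: S" "lv v = l" "insert v {x : S Un A. lv x <= l} : I1"
  "insert v ({x : S. l <= lv x} Un {x : A. lv x = l}) : I2"
 shows "A_mid h S lv0 l (insert v W) (insert v A) lv"
proof -
 note D = A_midD[OF m]
 have e: "{x : S Un insert v A. lv x <= l} = insert v {x : S Un A. lv x <= l}" using v by auto
 have "{x : S. i <= lv x} Un {x : insert v A. lv x = i} : I2" if "i <= l" for i
 proof (cases "i = l")
  case True
  hence "{x : S. i <= lv x} Un {x : insert v A. lv x = i} = insert v ({x : S. l <= lv x} Un {x : A. lv x = l})" using v by auto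
  thus ?thesis using v by simp
 next
  case False
  hence "{x : insert v A. lv x = i} = {x : A. lv x = i}" using v by auto
  thus ?thesis using D(8)[OF that] by simp
 qed
 moreover have "g : M1.cl {x : S Un insert v A. lv x <= lv g}"
  if "g : U" "lv g < l | lv g = l & (g : insert v W | g : S)" for g
 proof (cases "g = v")
  case True
  thus ?thesis using v unfolding M1.cl_def by auto
 next
  case False
  hence "g : M1.cl {x : S Un A. lv x <= lv g}" using D(7)[of g] that by auto
  thus ?thesis using M1.cl_mono[of "{x : S Un A. lv x <= lv g}" "{x : S Un insert v A. lv x <= lv g}"] by blast
 qed
 moreover have "g : M2.cl ({x : S. lv g <= lv x + 1} Un {x : insert v A. lv x + 1 = lv g})"
  if "g : U - S - insert v A" "1 <= lv g" for g
 proof -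
  have "g : M2.cl ({x : S. lv g <= lv x + 1} Un {x : A. lv x + 1 = lv g})" using D(9)[of g] that by auto
  moreover have "{x : S. lv g <= lv x + 1} Un {x : A. lv x + 1 = lv g} <=
   {x : S. lv g <= lv x + 1} Un {x : insert v A. lv x + 1 = lv g}" by auto
  ultimately show ?thesis using M2.cl_mono by blast
 qed
 ultimately show ?thesis unfolding A_mid_def e using D(1-5) v by auto
qed

text \<open>The failed test puts \<open>v\<close> into the span, in the second matroid, of exactly
  the set that the invariant names for level \<open>l + 1\<close>. Once \<open>v\<close> is above
  level \<open>l\<close>, the first matroid asks nothing of it yet.\<close>

lemma A_mid_demote:
 assumes m: "A_mid h S lv0 l W A lv" and v: "v : U" "v ~: S" "v ~: A" "lv v = l" "l < h"
  "insert v ({x : S. l <= lv x} Un {x : A. lv x = l}) ~: I2"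
 shows "A_mid h S lv0 l (insert v W) A (lv(v := Suc l))"
proof -
 note D = A_midD[OF m]
 let ?lv = "lv(v := Suc l)"
 have s: "{x : S Un A. ?lv x <= k} = {x : S Un A. lv x <= k}" "{x : S. k <= ?lv x} = {x : S. k <= lv x}"
  "{x : S. k <= ?lv x + 1} = {x : S. k <= lv x + 1}" "{x : A. ?lv x = k} = {x : A. lv x = k}"
  "{x : A. ?lv x + 1 = k} = {x : A. lv x + 1 = k}" for k
  using v by auto
 have vc: "v : M2.cl ({x : S. Suc l <= lv x + 1} Un {x : A. lv x + 1 = Suc l})" using v M2.cl_I by simp
 have 9: "g : M2.cl ({x : S. ?lv g <= lv x + 1} Un {x : A. lv x + 1 = ?lv g})" if "g : U - S - A" "1 <= ?lv g" for g
  using that vc D(9)[of g] by (cases "g = v") auto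
 have 7: "g : M1.cl {x : S Un A. lv x <= ?lv g}" if "g : U" "?lv g < l | ?lv g = l & (g : insert v W | g : S)" for g
  using that D(7)[of g] by (cases "g = v") auto
 have c: "ALL x:S. ?lv x = lv0 x" "ALL x:U. lv0 x <= ?lv x & ?lv x <= h" "ALL x:A. ?lv x <= l"
  using D(2-5) v D(3)[OF v(1)] by auto
 show ?thesis unfolding A_mid_def s using D(1,6,8) 9 7 c by blast
qed

text \<open>The result of a greedy selection in the second matroid by decreasing level, restricted
  to the part \<open>P\<close> treated so far.\<close>

definition A_sel :: "'a set => ('a => nat) => 'a set => 'a set => 'a set => bool" where
 "A_sel T lv P Kp Dr \<longleftrightarrow> Kp Un Dr = T Int P & Kp Int Dr = {} & Kp : I2 & (ALL x:Dr. x : M2.cl {y : Kp. lv x <= lv y})"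

text \<open>For each level \<open>i\<close> the \<open>I2\<close> set of \<open>A_mid\<close> is
  spanned by the kept elements of level at least \<open>i\<close>, so these have grown by the
  accepted elements of level \<open>i\<close>; summing over the levels gives the gain
  \<open>card A\<close>. Since \<open>Kp\<close> also spans \<open>S\<close>, at most
  \<open>card A\<close> elements are dropped.\<close>

lemma A_round:
 assumes m: "A_mid h S lv0 l U A lv" and h: "Suc l = h" and S: "S : I2" "ALL x:S. lv x < h"
  and s: "A_sel (S Un A) lv UNIV Kp Dr"
 defines "lv' == %x. lv x + of_bool (x : Dr)"
 shows "A_inv h Kp lv' (card A)" "lift_old Kp lv' h (S Un A) lv" "card (S Un A - Kp) <= card A"
  "(\<Sum>i<h. card {x : S. i <= lv x}) + card A <= (\<Sum>i<h. card {x : Kp. i <= lv' x})"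
proof -
 note D = A_midD[OF m]
 have K: "Kp Un Dr = S Un A" "Kp Int Dr = {}" "Kp : I2" "!!x. x : Dr ==> x : M2.cl {y : Kp. lv x <= lv y}"
  using s unfolding A_sel_def by auto
 have SU: "S <= U" using S M2.indep_subset by blast
 have TU: "S Un A <= U" using SU D(1) by blast
 have fin: "finite S" "finite A" "finite Kp" "finite Dr"
  using TU K M2.finite_ground finite_subset[of _ U] by (metis Un_subset_iff)+
 have lvT: "lv x < h" if "x : S Un A" for x using that S(2) D(5)[of x] h by auto
 have T1: "S Un A : I1"
 proof -
  have "{x : S Un A. lv x <= l} = S Un A" using lvT h by fastforce
  thus ?thesis using D(6) by simp
 qed
 have lvK: "lv' x = lv x" if "x : Kp" for x using that K(2) unfolding lv'_def by auto
 have sub: "x : M2.cl {y : Kp. i <= lv y}" if "x : S Un A" "i <= lv x" for x i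
 proof (cases "x : Kp")
  case True
  thus ?thesis using that TU unfolding M2.cl_def by auto
 next
  case False
  hence "x : M2.cl {y : Kp. lv x <= lv y}" using that K by blast
  moreover have "{y : Kp. lv x <= lv y} <= {y : Kp. i <= lv y}" using that by auto
  ultimately show ?thesis using M2.cl_mono by blast
 qed
 have KI: "{y : Kp. i <= lv y} : I2" for i by (rule M2.indep_mono[OF K(3)]) auto
 let ?X = "%i. {x : S. i <= lv x} Un {x : A. lv x = i}"
 have XI: "?X i : I2" if "i < h" for i using D(8)[of i] that h by simp
 have Xsub: "?X i <= M2.cl {y : Kp. i <= lv y}" for i using sub by auto
 have M2': "g : M2.cl {x : Kp. lv' g <= lv' x + 1}" if g: "g : U - Kp" "1 <= lv' g" for g
 proof -
  have e: "{x : Kp. lv' g <= lv' x + 1} = {x : Kp. lv' g - 1 <= lv x}" using lvK g(2) by auto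
  show ?thesis
  proof (cases "g : Dr")
   case True
   hence lg: "lv' g - 1 = lv g" unfolding lv'_def by simp
   show ?thesis using K(4)[OF True] unfolding e lg .
  next
   case False
   hence gT: "g : U - S - A" using g K(1) by blast
   have lg: "lv' g = lv g" using False unfolding lv'_def by simp
   have "g : M2.cl (?X (lv g - 1))"
   proof -
   have "{x : S. lv g <= lv x + 1} Un {x : A. lv x + 1 = lv g} = ?X (lv g - 1)" using g(2) lg by auto
   thus ?thesis using D(9)[OF gT] g(2) lg by simp
   qed
   moreover have "lv g - 1 < h" using D(4)[of g] g lg by auto
   ultimately have "g : M2.cl {y : Kp. lv g - 1 <= lv y}"
   using M2.cl_subset_cl[OF XI KI Xsub] by blast
   moreover have "{x : Kp. lv' g <= lv' x + 1} = {y : Kp. lv g - 1 <= lv y}" using e lg by simp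
   ultimately show ?thesis by simp
  qed
 qed
 show lo: "lift_old Kp lv' h (S Un A) lv" unfolding lift_old_def
 proof (intro conjI ballI impI)
  fix g assume g: "g : U" "lv' g < h"
  have "lv g <= l" using g h unfolding lv'_def by simp
  hence "g : M1.cl {x : S Un A. lv x <= lv g}" using D(7)[OF g(1)] g(1) by (cases "lv g = l") auto
  moreover have "{x : S Un A. lv x <= lv g} <= {x : S Un A. lv x <= lv' g}" unfolding lv'_def by auto
  ultimately show "g : M1.cl {x : S Un A. lv x <= lv' g}" using M1.cl_mono by blast
 qed (use T1 K lvK in auto)
 have "S <= M2.cl Kp" using sub[of _ 0] by auto
 hence "card S <= card Kp" using M2.card_le_of_subset_cl[OF K(3) S(1)] by blast
 moreover have "card (S Un A) = card S + card A" using fin D(1) by (intro card_Un_disjoint) auto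
 moreover have "card (S Un A - Kp) = card (S Un A) - card Kp" using K(1) fin by (intro card_Diff_subset) auto
 ultimately show ex: "card (S Un A - Kp) <= card A" by linarith
 have "ALL g:U. lv' g <= h"
 proof
  fix g assume g: "g : U"
  have "g : Dr ==> lv g < h" using lvT K(1) by blast
  thus "lv' g <= h" using D(4)[OF g] unfolding lv'_def by (cases "g : Dr") auto
 qed
 moreover have "ALL x:Kp. lv' x < h"
 proof
  fix x assume x: "x : Kp"
  hence "x : S Un A" using K(1) by blast
  thus "lv' x < h" using lvT lvK[OF x] by simp
 qed
 moreover have "EX Bs mu. lift_old Kp lv' h Bs mu & card (Bs - Kp) <= card A" using lo ex by blast
 ultimately show "A_inv h Kp lv' (card A)" unfolding A_inv_def using K(3) M2' by blast
 have "card {x : S. i <= lv x} + card {x : A. lv x = i} <= card {x : Kp. i <= lv' x}" if "i < h" for i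
 proof -
  have "card (?X i) = card {x : S. i <= lv x} + card {x : A. lv x = i}"
   using fin D(1) by (intro card_Un_disjoint) auto
  moreover have "card (?X i) <= card {y : Kp. i <= lv y}" by (rule M2.card_le_of_subset_cl[OF KI XI[OF that] Xsub])
  moreover have "{y : Kp. i <= lv y} = {x : Kp. i <= lv' x}" using lvK by auto
  ultimately show ?thesis by simp
 qed
 hence "(\<Sum>i<h. card {x : S. i <= lv x} + card {x : A. lv x = i}) <= (\<Sum>i<h. card {x : Kp. i <= lv' x})"
  by (intro sum_mono) auto
 moreover have "(\<Sum>i<h. card {x : A. lv x = i}) = card A"
 proof -
  have "(\<Sum>i<h. card {x : A. lv x = i}) = card (\<Union>i<h. {x : A. lv x = i})" using fin by (subst card_UN_disjoint) auto
  also have "(\<Union>i<h. {x : A. lv x = i}) = A" using lvT by auto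
  finally show ?thesis .
 qed
 ultimately show "(\<Sum>i<h. card {x : S. i <= lv x}) + card A <= (\<Sum>i<h. card {x : Kp. i <= lv' x})"
  by (simp add: sum.distrib)
qed

text \<open>The cut at a cheapest level again. Its lower side is now a part of \<open>Bs\<close>
  instead of \<open>S\<close>, which costs up to \<open>e\<close> more.\<close>

lemma A_bound:
 assumes a: "A_inv h S lv e" and T: "common T" and h: "0 < h"
 shows "common S" "h * card T <= h * card S + card S + h * e"
proof -
 obtain Bs mu where o: "lift_old S lv h Bs mu" "card (Bs - S) <= e" using a unfolding A_inv_def by blast
 have Bs: "Bs : I1" "S <= Bs" "!!x. x : S ==> mu x = lv x" "!!g. g : U ==> lv g < h ==> g : M1.cl {x : Bs. mu x <= lv g}"
  using o unfolding lift_old_def by auto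
 have S2: "S : I2" "!!g. g : U - S ==> 1 <= lv g ==> g : M2.cl {x : S. lv g <= lv x + 1}"
  using a unfolding A_inv_def by auto
 show "common S" unfolding common_def using S2 M1.indep_mono[OF Bs(1,2)] by blast
 have fin: "finite S" "finite Bs" using S2 Bs M1.finite_indep M2.finite_indep by auto
 obtain i where i: "i < h" "h * card {x : S. lv x = i} <= card S" using small_level_set[OF fin(1) h] by blast
 let ?X = "{x : Bs. mu x <= i}" and ?Y = "{x : S. i <= lv x}"
 have "card T <= card ?X + card ?Y"
 proof (rule card_le_two_closures[OF T])
  show "?X : I1" by (rule M1.indep_mono[OF Bs(1)]) auto
  show "?Y : I2" by (rule M2.indep_mono[OF S2(1)]) auto
  fix x assume "x : T"
  hence xU: "x : U" using T M1.indep_subset unfolding common_def by blast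
  show "x : M1.cl ?X | x : M2.cl ?Y"
  proof (cases "lv x <= i")
   case True
   hence "x : M1.cl {y : Bs. mu y <= lv x}" "{y : Bs. mu y <= lv x} <= ?X" using Bs(4)[OF xU] i by auto
   thus ?thesis using M1.cl_mono by blast
  next
   case False
   show ?thesis
   proof (cases "x : S")
   case True
   thus ?thesis using False xU unfolding M2.cl_def by auto
   next
   case F: False
   hence "x : M2.cl {y : S. lv x <= lv y + 1}" "{y : S. lv x <= lv y + 1} <= ?Y" using S2(2)[of x] xU False by auto
   thus ?thesis using M2.cl_mono by blast
   qed
  qed
 qed
 also have "card ?X <= card {x : S. lv x <= i} + card (Bs - S)"
 proof -
  have "card ?X <= card ({x : S. lv x <= i} Un (Bs - S))" by (rule card_mono) (use fin Bs(3) in auto)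
  also have "... <= card {x : S. lv x <= i} + card (Bs - S)" by (rule card_Un_le)
  finally show ?thesis .
 qed
 finally have "card T <= card {x : S. lv x <= i} + card ?Y + e" using o(2) by linarith
 moreover have "card {x : S. lv x <= i} + card ?Y = card S + card {x : S. lv x = i}"
 proof -
  have "{x : S. lv x <= i} Un ?Y = S" "{x : S. lv x <= i} Int ?Y = {x : S. lv x = i}" by auto
  thus ?thesis using card_Un_Int[of "{x : S. lv x <= i}" ?Y] fin by simp
 qed
 ultimately have "h * card T <= h * (card S + card {x : S. lv x = i} + e)" by simp
 thus "h * card T <= h * card S + card S + h * e" using i by (simp add: distrib_left)
qed

text \<open>A maximum independent set of the first matroid serves as \<open>Bs\<close>. The excess
  is large at first; the first round replaces it by the number of elements accepted.\<close>

lemma A_init: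
 shows "A_inv h {} (%_. 0) (card U)"
proof -
 obtain Bs where B: "Bs : I1" "!!X. X : I1 ==> card X <= card Bs"
 proof -
  have "ALL y. y : I1 --> card y <= card U"
   using M1.indep_subset card_mono[OF M1.finite_ground] by blast
  hence "EX x. x : I1 & (ALL y. y : I1 --> card y <= card x)"
   by (intro ex_has_greatest_nat[where k = "{}" and b = "Suc (card U)"]) (use M1.indep_empty in \<open>auto simp: less_Suc_eq_le\<close>)
  thus ?thesis using that by blast
 qed
 have "g : M1.cl Bs" if "g : U" for g
 proof (rule ccontr)
  assume "g ~: M1.cl Bs"
  hence "g ~: Bs" "insert g Bs : I1" using M1.not_cl_D that by auto
  thus False using B(2)[of "insert g Bs"] M1.finite_indep[OF B(1)] by simp
 qed
 hence "lift_old {} (%_. 0) h Bs (%_. 0)" using B unfolding lift_old_def by simp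
 moreover have "card (Bs - {}) <= card U" using M1.indep_subset[OF B(1)] card_mono[OF M1.finite_ground] by simp
 ultimately show ?thesis unfolding A_inv_def using M2.indep_empty by auto
qed

end

text \<open>Storage of the phase: arrays \<open>2\<close>, \<open>3\<close>, \<open>4\<close> for
  \<open>S\<close>, the levels and \<open>A\<close>; set array \<open>2\<close> of the second oracle
  for the parts of \<open>S\<close> on levels at least \<open>i\<close>. Variable \<open>8\<close>
  is the level, \<open>10\<close> counts acceptances, \<open>5\<close> and \<open>6\<close> hold
  \<open>h\<close> and \<open>h ^ 3\<close>.\<close>

definition lvlA :: com where
 "lvlA = For 7 Sz (When (Get 2 (V 7)) (When (EqE (Get 3 (V 7)) (V 8)) (SAssign Fst 3 (SIns (V 7) (SV 3))))) ;;
  SAssign Snd 3 (SGet 2 (V 8)) ;;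
  For 7 Sz (When (NotE (Op Add (Get 2 (V 7)) (Get 4 (V 7)))) (When (EqE (Get 3 (V 7)) (V 8))
   (When (Qry Fst (SIns (V 7) (SV 3))) (If (Qry Snd (SIns (V 7) (SV 3)))
   (Put 4 (V 7) (N 1) ;; SAssign Fst 3 (SIns (V 7) (SV 3)) ;; SAssign Snd 3 (SIns (V 7) (SV 3)) ;;
   Assign 10 (Op Add (V 10) (N 1)))
   (Put 3 (V 7) (Op Add (Get 3 (V 7)) (N 1)))))))"

text \<open>Variable \<open>9\<close> counts up, so the level runs down from \<open>h - 1\<close>. A
  dropped element moves one level up and is not met again in this sweep.\<close>

definition lvlB :: com where
 "lvlB = Assign 8 (Op Sub (Op Sub (V 5) (N 1)) (V 9)) ;;
  For 7 Sz (When (Op Add (Get 2 (V 7)) (Get 4 (V 7))) (When (EqE (Get 3 (V 7)) (V 8))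
   (Put 4 (V 7) (N 0) ;; If (Qry Snd (SIns (V 7) (SV 3)))
   (SAssign Snd 3 (SIns (V 7) (SV 3)) ;; Put 2 (V 7) (N 1))
   (Put 2 (V 7) (N 0) ;; Put 3 (V 7) (Op Add (Get 3 (V 7)) (N 1)))))) ;;
  SPut Snd 2 (V 8) (SV 3)"

definition roundA :: com where
 "roundA = Assign 10 (N 0) ;; SAssign Fst 3 SEmp ;; For 8 (V 5) lvlA ;; SAssign Snd 3 SEmp ;; For 9 (V 5) lvlB"

text \<open>By truncated subtraction the flag becomes zero as soon as a round accepts at most
  \<open>h ^ 3\<close> elements.\<close>

definition phaseA :: com where
 "phaseA = Assign 11 (N 1) ;; While (V 11) (roundA ;; Assign 11 (Op Sub (V 10) (V 6)))"

lemma mods_A [simp]: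
 "mr lvlA = {7, 10}" "ma lvlA = {3, 4}" "mm lvlA = {}" "ms lvlA = {(Fst, 3), (Snd, 3)}" "mz lvlA = {}" "~ mo lvlA" "~ mt lvlA"
 "mr lvlB = {7, 8}" "ma lvlB = {2, 3, 4}" "mm lvlB = {}" "ms lvlB = {(Snd, 3)}" "mz lvlB = {(Snd, 2)}" "~ mo lvlB" "~ mt lvlB"
 "mr roundA = {7, 8, 9, 10}" "ma roundA = {2, 3, 4}" "mm roundA = {}" "ms roundA = {(Fst, 3), (Snd, 3)}"
 "mz roundA = {(Snd, 2)}" "~ mo roundA" "~ mt roundA"
 "mr phaseA = {7, 8, 9, 10, 11}" "ma phaseA = {2, 3, 4}" "mm phaseA = {}" "ms phaseA = {(Fst, 3), (Snd, 3)}"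
 "mz phaseA = {(Snd, 2)}" "~ mo phaseA" "~ mt phaseA"
 unfolding phaseA_def roundA_def lvlB_def lvlA_def by (auto simp: insert_commute)

context lang
begin

lemma T_AssignSeq: "ok e s ==> T c (s(|rv := (rv s)(x := ev e s), clk := Suc (clk s)|)) Q ==> T (Assign x e ;; c) s Q"
 by simp

lemma T_SAssignSeq: "sok q j s ==> T c (s(|sv := (sv s)(j := (sv s j)(x := sev q j s)), clk := Suc (clk s)|)) Q ==>
  T (SAssign j x q ;; c) s Q"
 by simp

lemma T_SeqI: "T c s (%t. T d t Q) ==> T (c ;; d) s Q"
 by simp

end

section \<open>Correctness and cost of the push-relabel programs\<close>

context prog
begin

definition arrA :: "st => nat set => nat set => (nat => nat) => bool" where
 "arrA s S A lv \<longleftrightarrow> (ALL v<n. ra s 2 v = of_bool (v : S) & ra s 4 v = of_bool (v : A) & ra s 3 v = lv v)"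

lemma arrA_clk [simp]: "arrA (s(|clk := k|)) S A lv = arrA s S A lv" "arrA (s(|rv := f|)) S A lv = arrA s S A lv"
 "arrA (s(|sv := g|)) S A lv = arrA s S A lv" "arrA (s(|sa := z|)) S A lv = arrA s S A lv"
 by (simp_all add: arrA_def)

lemma eqE_val: "Suc 0 - (a - b + (b - a)) = of_bool (a = (b::nat))"
 by auto

lemma lvlA_T:
 assumes a: "arrA s S A lv" and m: "A_mid h S lv0 l {} A lv" and S: "S <= {..<n}" and h: "h <= n + 1" "l < h"
  and Y: "sv s Fst 3 = {x : S Un A. lv x < l}" and H: "sa s Snd 2 l = {x : S. l <= lv x}"
  and Al: "ALL x:A. lv x < l" and c: "rv s 10 = card A" and l: "rv s 8 = l"
 shows "T lvlA s (%t. EX A' lv'. arrA t S A' lv' & A_mid h S lv0 l {..<n} A' lv' &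
  sv t Fst 3 = {x : S Un A'. lv' x <= l} & rv t 10 = card A' & clk t <= clk s + 15 * n + 5)" (is "T _ _ ?Q")
proof -
 have nB: "n < B" "2 * n + 10 < B" using B_lin by linarith+
 have lvn: "!!x. x < n ==> lv x <= h" using A_midD(4)[OF m] by simp
 have eqB: "!!x. x <= h ==> x - l + (l - x) < B" using h nB by linarith
 have lS: "lv x >= l ==> x : S Un A ==> x : S" for x using Al by auto
 show ?thesis unfolding lvlA_def T_simps(8)[of "For a b c" for a b c]
 proof (rule T_For[where m = n and P = "%i t. sv t Fst 3 = {x : S Un A. lv x < l | lv x = l & x < i} & clk t <= Suc (clk s) + 5 * i"], goal_cases)
  case (5 i t)
  have g: "ra t 2 i = of_bool (i : S)" "ra t 3 i = lv i" "rv t 8 = l" using 5 a l by (auto simp: fr_def arrA_def)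
  have i: "lv i <= h" using lvn 5(4) by simp
  show ?case
  proof (cases "i : S & lv i = l")
   case True
   hence "insert i {x : S Un A. lv x < l | lv x = l & x < i} = {x : S Un A. lv x < l | lv x = l & x < Suc i}" by auto
   thus ?thesis using 5(1,3,4) g eqB[OF i] True nB by (simp add: eqE_val)
  next
   case False
   hence "{x : S Un A. lv x < l | lv x = l & x < Suc i} = {x : S Un A. lv x < l | lv x = l & x < i}"
   using lS by (auto simp: less_Suc_eq)
   thus ?thesis using 5(1,3,4) g eqB[OF i] False nB by (simp add: eqE_val)
  qed
 next
  case (6 t)
  have Yt: "sv t Fst 3 = {x : S Un A. lv x <= l}"
  proof -
   have "{x : S Un A. lv x < l | lv x = l & x < n} = {x : S Un A. lv x <= l}" using S A_midD(1)[OF m] by auto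
   thus ?thesis using 6(1) by simp
  qed
  have at: "arrA t S A lv" using a 6(2) by (simp add: fr_def arrA_def)
  have g: "rv t 8 = l" "sa t Snd 2 = sa s Snd 2" "rv t 10 = card A" using 6(2) l c by (auto simp: fr_def)
  define t1 where "t1 = t(|sv := (sv t)(Snd := (sv t Snd)(3 := sa s Snd 2 l)), clk := Suc (Suc (clk t))|)"
  have main: "T (For 7 Sz (When (NotE (Op Add (Get 2 (V 7)) (Get 4 (V 7)))) (When (EqE (Get 3 (V 7)) (V 8))
   (When (Qry Fst (SIns (V 7) (SV 3))) (If (Qry Snd (SIns (V 7) (SV 3)))
   (Put 4 (V 7) (N 1) ;; SAssign Fst 3 (SIns (V 7) (SV 3)) ;; SAssign Snd 3 (SIns (V 7) (SV 3)) ;;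
   Assign 10 (Op Add (V 10) (N 1)))
   (Put 3 (V 7) (Op Add (Get 3 (V 7)) (N 1)))))))) t1 ?Q"
  proof (rule T_For[where m = n and P = "%i t. EX A' lv'. arrA t S A' lv' & A_mid h S lv0 l {..<i} A' lv' &
   sv t Fst 3 = {x : S Un A'. lv' x <= l} & sv t Snd 3 = {x : S. l <= lv' x} Un {x : A'. lv' x = l} &
   (ALL x:A'. x < i | x : A) & rv t 10 = card A' & clk t <= clk s + 5 * n + 4 + 10 * i"], goal_cases)
   case 3
   have "{x : A. lv x = l} = {}" using Al by auto
   hence "sa s Snd 2 l = {x : S. l <= lv x} Un {x : A. lv x = l}" using H by auto
   thus ?case using at m Yt g 6(1) by (intro exI[of _ A] exI[of _ lv]) (simp add: t1_def)
  next
   case (4 i u)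
   thus ?case by simp
  next
   case (5 i u)
   then obtain A' lv' where u: "arrA u S A' lv'" "A_mid h S lv0 l {..<i} A' lv'" "sv u Fst 3 = {x : S Un A'. lv' x <= l}"
   "sv u Snd 3 = {x : S. l <= lv' x} Un {x : A'. lv' x = l}" "ALL x:A'. x < i | x : A" "rv u 10 = card A'"
   "clk u <= clk s + 5 * n + 4 + 10 * i" by blast
   note D = A_midD[OF u(2)]
   have q: "ra u 2 i = of_bool (i : S)" "ra u 4 i = of_bool (i : A')" "ra u 3 i = lv' i" "rv u 8 = l" "rv u 7 = i" "i < n"
   using u(1) 5 g by (auto simp: fr_def arrA_def t1_def)
   have i: "lv' i <= h" using D(4) q by simp
   have A'n: "A' <= {..<n}" using D(1) by blast
   hence cA: "card A' <= n" using card_mono[of "{..<n}" A'] by simp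
   have ins: "insert i {..<i} = {..<Suc i}" by auto
   let ?Y = "{x : S Un A'. lv' x <= l}" and ?Z = "{x : S. l <= lv' x} Un {x : A'. lv' x = l}"
   have bnd: "i < B" "of_bool (i : S) + of_bool (i : A') < B" "Suc (card A') < B" "Suc (lv' i) < B"
   using q(6) nB cA i h by (auto intro: le_less_trans[of _ 2])
   consider (skip) "i : S Un A' | lv' i ~= l | insert i ?Y ~: J Fst"
   | (acc) "i ~: S" "i ~: A'" "lv' i = l" "insert i ?Y : J Fst" "insert i ?Z : J Snd"
   | (dem) "i ~: S" "i ~: A'" "lv' i = l" "insert i ?Y : J Fst" "insert i ?Z ~: J Snd" by blast
   thus ?case
   proof cases
   case skip
   have "A_mid h S lv0 l {..<Suc i} A' lv'" using A_mid_skip[OF u(2) skip] ins by simp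
   hence "EX A'' lv''. arrA u S A'' lv'' & A_mid h S lv0 l {..<Suc i} A'' lv'' &
   sv u Fst 3 = {x : S Un A''. lv'' x <= l} & sv u Snd 3 = {x : S. l <= lv'' x} Un {x : A''. lv'' x = l} &
   (ALL x:A''. x < Suc i | x : A) & rv u 10 = card A''" using u by (intro exI[of _ A'] exI[of _ lv']) auto
   thus ?thesis using u(3,4,7) q bnd eqB[OF i] skip by (auto simp: eqE_val)
   next
   case acc
   have mid: "A_mid h S lv0 l {..<Suc i} (insert i A') lv'" using A_mid_accept[OF u(2) _ acc(1,3,4,5)] q ins by simp
   have e1: "insert i ?Y = {x : S Un insert i A'. lv' x <= l}" using acc by auto
   have e2: "insert i ?Z = {x : S. l <= lv' x} Un {x : insert i A'. lv' x = l}" using acc by auto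
   have cd: "card (insert i A') = Suc (card A')" using acc finite_subset[OF A'n] by simp
   have "ALL v<n. ra u 2 v = of_bool (v : S) & ((ra u 4)(i := Suc 0)) v = of_bool (v : insert i A') & ra u 3 v = lv' v"
   using u(1) unfolding arrA_def by simp
   thus ?thesis using u(3,4,7) q bnd eqB[OF i] acc mid e1 e2 cd u(5,6)
   by (simp add: eqE_val) (rule exI[of _ "insert i A'"], rule exI[of _ lv'], auto simp: arrA_def)
   next
   case dem
   have mid: "A_mid h S lv0 l {..<Suc i} A' (lv'(i := Suc l))" using A_mid_demote[OF u(2) _ dem(1,2,3) h(2) dem(5)] q ins by simp
   have e1: "?Y = {x : S Un A'. (lv'(i := Suc l)) x <= l}" using dem by auto
   have e2: "?Z = {x : S. l <= (lv'(i := Suc l)) x} Un {x : A'. (lv'(i := Suc l)) x = l}" using dem by auto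
   have "ALL v<n. ra u 2 v = of_bool (v : S) & ra u 4 v = of_bool (v : A') & ((ra u 3)(i := Suc l)) v = (lv'(i := Suc l)) v"
   using u(1) unfolding arrA_def by simp
   thus ?thesis using u(3,4,7) q bnd eqB[OF i] dem mid e1 e2 u(5,6)
   by (simp add: eqE_val del: fun_upd_apply) (rule exI[of _ A'], rule exI[of _ "lv'(i := Suc l)"], auto simp: arrA_def)
   qed
  next
   case (6 u)
   then obtain A' lv' where "arrA u S A' lv' & A_mid h S lv0 l {..<n} A' lv' & sv u Fst 3 = {x : S Un A'. lv' x <= l} &
   rv u 10 = card A'" "clk u <= clk s + 5 * n + 4 + 10 * n" by blast
   thus ?case by (intro exI[of _ A'] exI[of _ lv']) simp
  qed (use nB in auto)
  show ?case using main g h nB unfolding t1_def by simp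
 qed (use nB Y in auto)
qed

text \<open>The sweep changes the arrays in place, so they describe a mixture of the old and the new
  \<open>S\<close> and of old and raised levels.\<close>

definition arrB :: "st => nat set => nat set => (nat => nat) => nat set => nat set => bool" where
 "arrB s S A lv Kp Dr \<longleftrightarrow> (ALL v<n. ra s 2 v = of_bool (v : Kp | v : S & v ~: Dr) &
  ra s 4 v = of_bool (v : A & v ~: Kp & v ~: Dr) & ra s 3 v = lv v + of_bool (v : Dr))"

lemma arrB_upd [simp]: "arrB (s(|clk := k|)) S A lv Kp Dr = arrB s S A lv Kp Dr" "arrB (s(|rv := f|)) S A lv Kp Dr = arrB s S A lv Kp Dr"
 "arrB (s(|sv := g|)) S A lv Kp Dr = arrB s S A lv Kp Dr" "arrB (s(|sa := z|)) S A lv Kp Dr = arrB s S A lv Kp Dr"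
 by (simp_all add: arrB_def)

lemma lvlB_T:
 assumes a: "arrB s S A lv Kp Dr" and sel: "A_sel (S Un A) lv {x. l < lv x} Kp Dr" and SA: "S Un A <= {..<n}"
  and h: "h <= n + 1" "l < h" "rv s 5 = h" "h - 1 - rv s 9 = l" and lvn: "ALL v<n. lv v <= h"
  and K: "sv s Snd 3 = Kp"
 shows "T lvlB s (%t. EX Kp' Dr'. arrB t S A lv Kp' Dr' & A_sel (S Un A) lv {x. l <= lv x} Kp' Dr' & sv t Snd 3 = Kp' &
  {y : Kp'. l < lv y} = Kp & sa t Snd 2 = (sa s Snd 2)(l := Kp') & clk t <= clk s + 9 * n + 4)"
proof -
 have nB: "n < B" "2 * n + 10 < B" using B_lin by linarith+
 have eqB: "!!x. x <= Suc h ==> x - l + (l - x) < B" using h nB by linarith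
 have KT: "Kp Un Dr <= S Un A" "Kp Un Dr = {x : S Un A. l < lv x}" using sel unfolding A_sel_def by auto
 show ?thesis unfolding lvlB_def
  proof (rule T_AssignSeq, simp, rule T_SeqI, rule T_For[where m = n and P = "%i t. EX Kp' Dr'. arrB t S A lv Kp' Dr' &
   A_sel (S Un A) lv {x. l < lv x | lv x = l & x < i} Kp' Dr' & sv t Snd 3 = Kp' & {y : Kp'. l < lv y} = Kp &
   clk t <= clk s + 2 + 9 * i"], goal_cases)
   case 3
   have "{y : Kp. l < lv y} = Kp" using KT by auto
   thus ?case using a sel K by (intro exI[of _ Kp] exI[of _ Dr]) simp
  next
   case (4 i t)
   thus ?case by simp
  next
   case (5 i t)
   then obtain Kp' Dr' where u: "arrB t S A lv Kp' Dr'" "A_sel (S Un A) lv {x. l < lv x | lv x = l & x < i} Kp' Dr'"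
   "sv t Snd 3 = Kp'" "{y : Kp'. l < lv y} = Kp" "clk t <= clk s + 2 + 9 * i" by blast
   have sl: "Kp' Un Dr' = (S Un A) Int {x. l < lv x | lv x = l & x < i}" "Kp' Int Dr' = {}" "Kp' : J Snd"
   "!!x. x : Dr' ==> x : M2.cl {y : Kp'. lv x <= lv y}" using u(2) unfolding A_sel_def by auto
   have q: "ra t 2 i = of_bool (i : Kp' | i : S & i ~: Dr')" "ra t 4 i = of_bool (i : A & i ~: Kp' & i ~: Dr')"
   "ra t 3 i = lv i + of_bool (i : Dr')" "rv t 8 = l" "rv t 7 = i" "i < n"
   using u(1) 5(2-4) h unfolding arrB_def by (simp_all add: fr_def)
   have lvi: "lv i <= h" "lv i + of_bool (i : Dr') <= Suc h" using lvn q(6) by auto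
   have bnd: "i < B" "ra t 2 i + ra t 4 i < B" "Suc (lv i) < B" using q nB lvi h by auto
   have new: "(S Un A) Int {x. l < lv x | lv x = l & x < Suc i} = (if i : S Un A & lv i = l then insert i (Kp' Un Dr') else Kp' Un Dr')"
   unfolding sl by (auto simp: less_Suc_eq)
   show ?case
   proof (cases "i : S Un A & lv i = l")
   case False
   have sel': "A_sel (S Un A) lv {x. l < lv x | lv x = l & x < Suc i} Kp' Dr'" unfolding A_sel_def new using False sl by auto
   have ex: "EX Kp'' Dr''. arrB t S A lv Kp'' Dr'' & A_sel (S Un A) lv {x. l < lv x | lv x = l & x < Suc i} Kp'' Dr'' &
   sv t Snd 3 = Kp'' & {y : Kp''. l < lv y} = Kp" using u sel' by blast
   have "ra t 2 i + ra t 4 i = 0 | ra t 3 i ~= l"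
   proof (cases "i : Kp' Un Dr'")
   case True
   hence "l < lv i | lv i = l" "i : S Un A" using sl by auto
   thus ?thesis using False q by auto
   next
   case F: False
   thus ?thesis using False q by auto
   qed
   then consider "ra t 2 i + ra t 4 i = 0" | "ra t 2 i + ra t 4 i ~= 0" "ra t 3 i ~= l" by (cases "ra t 2 i + ra t 4 i = 0") auto
   moreover have "ra t 3 i - l + (l - ra t 3 i) < B" using eqB[OF lvi(2)] q(3) by simp
   ultimately show ?thesis using q(4-6) u(5) bnd(1,2) ex by cases (simp_all add: eqE_val)
   next
   case True
   have iK: "i ~: Kp'" "i ~: Dr'" using sl True by auto
   have r1: "ra t 2 i + ra t 4 i ~= 0" "ra t 3 i = l" using True iK q by auto
   have all: "{y : Kp'. l <= lv y} = Kp'" using Un_upper1[of Kp' Dr'] unfolding sl(1) by auto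
   show ?thesis
   proof (cases "insert i Kp' : J Snd")
   case T: True
   have "x : M2.cl {y : insert i Kp'. lv x <= lv y}" if "x : Dr'" for x
   using sl(4)[OF that] M2.cl_mono[of "{y : Kp'. lv x <= lv y}" "{y : insert i Kp'. lv x <= lv y}"] by blast
   hence sel': "A_sel (S Un A) lv {x. l < lv x | lv x = l & x < Suc i} (insert i Kp') Dr'"
   unfolding A_sel_def new using True sl iK T by auto
   have arr: "arrB (t(|ra := (ra t)(4 := (ra t 4)(i := 0), 2 := (ra t 2)(i := Suc 0))|)) S A lv (insert i Kp') Dr'"
   using u(1) iK unfolding arrB_def by simp
   have k: "{y : insert i Kp'. l < lv y} = Kp" using u(4) True by auto
   have ar2: "(ra t)(4 := (ra t 4)(i := 0), 2 := ((ra t)(4 := (ra t 4)(i := 0))) 2) = (ra t)(4 := (ra t 4)(i := 0))" by auto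
   show ?thesis using q(4-6) u(3,5) bnd eqB[of l] r1 T sel' arr k h
   by (simp add: eqE_val) (rule exI[of _ Dr'], simp add: arrB_def)
   next
   case F: False
   have "i : M2.cl Kp'" using F q(6) M2.cl_I[of i Kp'] by simp
   hence "i : M2.cl {y : Kp'. lv i <= lv y}" using all True by simp
   hence sel': "A_sel (S Un A) lv {x. l < lv x | lv x = l & x < Suc i} Kp' (insert i Dr')"
   unfolding A_sel_def new using True sl iK by auto
   have lvi2: "lv i = l" using True by simp
   hence "Suc l < B" using bnd(3) by simp
   thus ?thesis using q(4-6) u(3,4,5) bnd eqB[of l] r1 F sel' h
   by (simp add: eqE_val) (rule exI[of _ "insert i Dr'"], use u(1) iK lvi2 in \<open>simp add: arrB_def\<close>)
   qed
   qed
  next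
   case (6 t)
   then obtain Kp' Dr' where u: "arrB t S A lv Kp' Dr'" "A_sel (S Un A) lv {x. l < lv x | lv x = l & x < n} Kp' Dr'"
   "sv t Snd 3 = Kp'" "{y : Kp'. l < lv y} = Kp" "clk t <= clk s + 2 + 9 * n" by blast
   have "(S Un A) Int {x. l < lv x | lv x = l & x < n} = (S Un A) Int {x. l <= lv x}" using SA by auto
   hence sel': "A_sel (S Un A) lv {x. l <= lv x} Kp' Dr'" using u(2) unfolding A_sel_def by simp
   have g: "rv t 8 = l" "sa t Snd 2 = sa s Snd 2" using 6(2) h by (simp_all add: fr_def)
   have lB: "l < B" using h nB by linarith
   show ?case using u sel' g lB by (simp, intro exI[of _ Dr'], simp)
  qed (use nB in simp_all)
qed

text \<open>For levels below \<open>h\<close> this is the sum of \<open>lv x + 1\<close> over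
  \<open>S\<close>, counted level by level. It is at most \<open>h * h ^ 4\<close> when
  \<open>card S <= h ^ 4\<close>.\<close>

definition Phi :: "nat => nat set => (nat => nat) => nat" where
 "Phi h S lv = (\<Sum>i<h. card {x : S. i <= lv x})"

lemma roundA_T:
 assumes a: "arrA s S {} lv" and inv: "A_inv h S lv e" and h: "1 <= h" "h <= n + 1" "rv s 5 = h"
  and H: "ALL i<h. sa s Snd 2 i = {x : S. i <= lv x}"
 shows "T roundA s (%t. EX S' lv'. arrA t S' {} lv' & A_inv h S' lv' (rv t 10) & (ALL i<h. sa t Snd 2 i = {x : S'. i <= lv' x}) &
  Phi h S lv + rv t 10 <= Phi h S' lv' & clk t <= clk s + 8 + h * (24 * n + 13))"
proof -
 have nB: "n < B" "2 * n + 10 < B" using B_lin by linarith+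
 have hB: "h < B" using h nB by linarith
 obtain Bs mu where o: "lift_old S lv h Bs mu" using inv unfolding A_inv_def by blast
 have S2: "S : J Snd" "ALL x:S. lv x < h" using inv unfolding A_inv_def by auto
 have Sn: "S <= {..<n}" using M2.indep_subset[OF S2(1)] .
 show ?thesis unfolding roundA_def
  proof (rule T_AssignSeq, simp, rule T_SAssignSeq, simp, rule T_SeqI, rule T_For[where m = h and P = "%i t. EX A lv'. arrA t S A lv' &
   (if i = 0 then A = {} & lv' = lv & sv t Fst 3 = {} else A_mid h S lv (i - 1) {..<n} A lv' & sv t Fst 3 = {x : S Un A. lv' x <= i - 1}) &
   rv t 10 = card A & clk t <= clk s + 3 + (15 * n + 7) * i"], goal_cases)
   case 3
   show ?case using a by (intro exI[of _ "{}"] exI[of _ lv]) simp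
  next
   case (4 i t)
   thus ?case using h by (simp add: fr_def)
  next
   case (5 i t)
   then obtain A lv' where u: "arrA t S A lv'" "if i = 0 then A = {} & lv' = lv & sv t Fst 3 = {} else A_mid h S lv (i - 1) {..<n} A lv' & sv t Fst 3 = {x : S Un A. lv' x <= i - 1}"
   "rv t 10 = card A" "clk t <= clk s + 3 + (15 * n + 7) * i" by blast
   have mid: "A_mid h S lv i {} A lv'" "sv t Fst 3 = {x : S Un A. lv' x < i}" "ALL x:A. lv' x < i" "ALL x:S. lv' x = lv x"
   proof -
   have "A_mid h S lv i {} A lv' & sv t Fst 3 = {x : S Un A. lv' x < i} & (ALL x:A. lv' x < i) & (ALL x:S. lv' x = lv x)"
   proof (cases i)
   case 0
   thus ?thesis using u(2) A_mid_start[OF inv o] by simp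
   next
   case (Suc l)
   hence m: "A_mid h S lv l {..<n} A lv'" "sv t Fst 3 = {x : S Un A. lv' x <= l}" using u(2) by auto
   show ?thesis using A_mid_next[OF m(1) o S2(1)] A_midD(2,5)[OF m(1)] m(2) 5(4) Suc by (auto simp: less_Suc_eq_le)
   qed
   thus "A_mid h S lv i {} A lv'" "sv t Fst 3 = {x : S Un A. lv' x < i}" "ALL x:A. lv' x < i" "ALL x:S. lv' x = lv x" by auto
   qed
   have "sa t Snd 2 i = {x : S. i <= lv' x}" using 5(2,4) H mid(4) by (auto simp: fr_def)
   hence "T lvlA (tick t) (%t'. EX A' lv'. arrA t' S A' lv' & A_mid h S lv i {..<n} A' lv' &
   sv t' Fst 3 = {x : S Un A'. lv' x <= i} & rv t' 10 = card A' & clk t' <= clk (tick t) + 15 * n + 5)"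
   by (intro lvlA_T[of "tick t" S A lv' h lv i]) (use u mid Sn h 5 in simp_all)
   thus ?case
   proof (rule T_conseq, goal_cases)
   case (1 w)
   then obtain A' lv'' where w: "arrA w S A' lv''" "A_mid h S lv i {..<n} A' lv''" "sv w Fst 3 = {x : S Un A'. lv'' x <= i}"
   "rv w 10 = card A'" "clk w <= clk (tick t) + 15 * n + 5" by blast
   thus ?case using u(4) by (intro exI[of _ A'] exI[of _ lv'']) simp
   qed
  next
   case (6 t)
   then obtain A lv1 where u: "arrA t S A lv1" "A_mid h S lv (h - 1) {..<n} A lv1" "rv t 10 = card A" "clk t <= clk s + 3 + (15 * n + 7) * h"
   using h(1) by auto
   note D = A_midD[OF u(2)]
   have SA: "S Un A <= {..<n}" using Sn D(1) by blast
   have lvS: "ALL x:S. lv1 x < h" using S2 D(2) by simp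
   have lvh: "lv1 x < h" if "x : S Un A" for x using lvS D(5)[of x] h(1) that by auto
   have HS: "ALL i<h. sa t Snd 2 i = {x : S. i <= lv x}" "rv t 5 = h" using 6(2) H h by (auto simp: fr_def)
   show ?case
   proof (rule T_SAssignSeq, simp, rule T_For[where m = h and P = "%i t. EX Kp Dr. arrB t S A lv1 Kp Dr &
   A_sel (S Un A) lv1 {x. h - i <= lv1 x} Kp Dr & sv t Snd 3 = Kp &
   (ALL k. h - i <= k & k < h --> sa t Snd 2 k = {y : Kp. k <= lv1 y}) & clk t <= clk s + 6 + (15 * n + 7) * h + (9 * n + 6) * i"], goal_cases)
   case 3
   have "(S Un A) Int {x. h <= lv1 x} = {}" using lvh by fastforce
   hence "A_sel (S Un A) lv1 {x. h <= lv1 x} {} {}" using M2.indep_empty unfolding A_sel_def by simp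
   moreover have "arrB t S A lv1 {} {}" using u(1) unfolding arrA_def arrB_def by simp
   ultimately show ?case using u(4) by (intro exI[of _ "{}"] exI[of _ "{}"]) auto
   next
   case (4 i w)
   thus ?case using HS(2) by (simp add: fr_def)
   next
   case (5 i w)
   then obtain Kp Dr where w: "arrB w S A lv1 Kp Dr" "A_sel (S Un A) lv1 {x. h - i <= lv1 x} Kp Dr" "sv w Snd 3 = Kp"
   "ALL k. h - i <= k & k < h --> sa w Snd 2 k = {y : Kp. k <= lv1 y}" "clk w <= clk s + 6 + (15 * n + 7) * h + (9 * n + 6) * i" by blast
   define l where "l = h - 1 - i"
   have l: "l < h" "h - i = Suc l" "h - Suc i = l" using 5(4) unfolding l_def by auto
   have w5: "rv w 5 = h" "rv w 9 = i" using 5(2,3) HS(2) by (simp_all add: fr_def)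
   have "T lvlB (tick w) (%t. EX Kp' Dr'. arrB t S A lv1 Kp' Dr' & A_sel (S Un A) lv1 {x. l <= lv1 x} Kp' Dr' & sv t Snd 3 = Kp' &
   {y : Kp'. l < lv1 y} = Kp & sa t Snd 2 = (sa (tick w) Snd 2)(l := Kp') & clk t <= clk (tick w) + 9 * n + 4)"
   proof (rule lvlB_T)
   show "arrB (tick w) S A lv1 Kp Dr" using w(1) by simp
   show "A_sel (S Un A) lv1 {x. l < lv1 x} Kp Dr" using w(2) unfolding l(2) Suc_le_eq .
   show "h - 1 - rv (tick w) 9 = l" using w5 unfolding l_def by simp
   show "ALL v<n. lv1 v <= h" using D(4) by simp
   qed (use SA h(2) l(1) w5 w(3) in simp_all)
   thus ?case
   proof (rule T_conseq, goal_cases)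
   case (1 x)
   then obtain Kp' Dr' where x: "arrB x S A lv1 Kp' Dr'" "A_sel (S Un A) lv1 {x. l <= lv1 x} Kp' Dr'" "sv x Snd 3 = Kp'"
   "{y : Kp'. l < lv1 y} = Kp" "sa x Snd 2 = (sa (tick w) Snd 2)(l := Kp')" "clk x <= clk (tick w) + 9 * n + 4" by blast
   have K': "Kp' <= {x. l <= lv1 x}" using x(2) unfolding A_sel_def by blast
   have "sa x Snd 2 k = {y : Kp'. k <= lv1 y}" if "l <= k" "k < h" for k
   proof (cases "k = l")
   case True
   thus ?thesis using x(5) K' by auto
   next
   case False
   hence "sa x Snd 2 k = {y : Kp. k <= lv1 y}" using x(5) w(4) l that by simp
   moreover have "{y : Kp. k <= lv1 y} = {y : Kp'. k <= lv1 y}" using x(4) False that by auto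
   ultimately show ?thesis by simp
   qed
   note sax = this
   have ck: "Suc (clk x) <= clk s + 6 + (15 * n + 7) * h + (9 * n + 6) * Suc i" using x(6) w(5) by simp
   show ?case
   by (rule exI[of _ Kp'], rule exI[of _ Dr'], intro conjI) (use x(1-3) ck sax in \<open>simp_all add: l(3)\<close>)
   qed
   next
   case (6 w)
   then obtain Kp Dr where w: "arrB w S A lv1 Kp Dr" "A_sel (S Un A) lv1 UNIV Kp Dr"
   "ALL k<h. sa w Snd 2 k = {y : Kp. k <= lv1 y}" "clk w <= clk s + 6 + (15 * n + 7) * h + (9 * n + 6) * h" by auto
   define lv' where "lv' = (%x. lv1 x + of_bool (x : Dr))"
   have hh: "Suc (h - 1) = h" using h by simp
   note R = A_round[OF u(2) hh S2(1) lvS w(2), folded lv'_def]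
   have KD: "Kp Un Dr = S Un A" "Kp Int Dr = {}" using w(2) unfolding A_sel_def by auto
   have "ALL v<n. ra w 2 v = of_bool (v : Kp) & ra w 4 v = 0 & ra w 3 v = lv' v"
   using w(1) KD unfolding arrB_def lv'_def by auto
   hence arr: "arrA w Kp {} lv'" unfolding arrA_def by simp
   have lvK: "lv' x = lv1 x" if "x : Kp" for x using that KD unfolding lv'_def by auto
   have "{x : S. i <= lv1 x} = {x : S. i <= lv x}" for i using D(2) by auto
   hence "Phi h S lv + card A <= Phi h Kp lv'" using R(4) unfolding Phi_def by (simp add: lv'_def)
   moreover have "rv w 10 = card A" using 6(2) u(3) by (simp add: fr_def)
   moreover have "{y : Kp. k <= lv1 y} = {y : Kp. k <= lv' y}" for k using lvK by auto
   moreover have "Suc (clk w) <= clk s + 8 + h * (24 * n + 13)" using w(4) by (simp add: algebra_simps)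
   ultimately show ?case using arr R(1) w(3) by (intro exI[of _ Kp] exI[of _ lv']) simp
   qed (use hB in simp_all)
  qed (use hB in simp_all)
qed

text \<open>With \<open>card S <= h ^ 4\<close> and a final excess of at most \<open>h ^ 3\<close>,
  the two error terms of \<open>A_bound\<close> contribute \<open>h ^ 3\<close> each to the
  deficit.\<close>

lemma phaseA_T:
 assumes z: "ALL v<n. ra s 2 v = 0" "ALL v<n. ra s 3 v = 0" "ALL v<n. ra s 4 v = 0" "ALL i. sa s Snd 2 i = {}"
  and h: "1 <= h" "h <= n + 1" "rv s 5 = h" "rv s 6 = h ^ 3" and r: "!!X. X : J Snd ==> card X <= h ^ 4"
 shows "T phaseA s (%t. EX S. (ALL v<n. ra t 2 v = of_bool (v : S)) & common S & (ALL X. common X --> card X <= card S + 2 * h ^ 3) &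
  clk t <= clk s + 3 + (h ^ 2 + 1) * (h * (24 * n + 13) + 10))"
proof -
 have PB: "Phi h X lv <= h * h ^ 4" if "X : J Snd" for X lv
 proof -
  have "card {x : X. i <= lv x} <= h ^ 4" for i by (rule r, rule M2.indep_mono[OF that]) auto
  hence "Phi h X lv <= (\<Sum>i<h. h ^ 4)" unfolding Phi_def by (intro sum_mono) auto
  thus ?thesis by simp
 qed
 have AI: "X : J Snd" if "A_inv h X lv e" for X lv e using that unfolding A_inv_def by blast
 have kb: "k <= h ^ 2" if "k * (h ^ 3 + 1) <= h * h ^ 4" for k
 proof -
  have "k * h ^ 3 <= k * (h ^ 3 + 1)" by simp
  also have "... <= h * h ^ 4" by (rule that)
  also have "... = h ^ 2 * h ^ 3" by (simp add: eval_nat_numeral)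
  finally show ?thesis using mult_le_cancel2[of k "h ^ 3" "h ^ 2"] h(1) by simp
 qed
 show ?thesis unfolding phaseA_def
 \<comment> \<open>Every round but the last raises \<open>Phi\<close> by at least
   \<open>h ^ 3 + 1\<close>, and \<open>Phi\<close> is at most \<open>h * h ^ 4\<close>; hence at
   most \<open>h ^ 2 + 1\<close> rounds. The factor \<open>k - 1\<close> leaves out the last
   round.\<close>
 proof (rule T_AssignSeq, simp, rule T_Loop[where K = "h ^ 2 + 1" and I = "%k t. EX S lv e. arrA t S {} lv & A_inv h S lv e &
   (ALL i<h. sa t Snd 2 i = {x : S. i <= lv x}) & clk t <= clk s + 1 + k * (h * (24 * n + 13) + 10) &
   (if rv t 11 = 0 then 1 <= k & (k - 1) * (h ^ 3 + 1) <= Phi h S lv & e <= h ^ 3 else k * (h ^ 3 + 1) <= Phi h S lv)"], goal_cases)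
  case 1
  show ?case using z A_init[of h] by (intro exI[of _ "{}"] exI[of _ "%_. 0"] exI[of _ "card {..<n}"]) (simp add: arrA_def)
 next
  case (2 k t)
  then obtain S lv e where u: "A_inv h S lv e" "if rv t 11 = 0 then 1 <= k & (k - 1) * (h ^ 3 + 1) <= Phi h S lv & e <= h ^ 3 else k * (h ^ 3 + 1) <= Phi h S lv"
   by blast
  have "(k - 1) * (h ^ 3 + 1) <= k * (h ^ 3 + 1)" by (rule mult_le_mono1) simp
  hence "(k - 1) * (h ^ 3 + 1) <= Phi h S lv" using u(2) le_trans by (cases "rv t 11 = 0") presburger+
  hence "k - 1 <= h ^ 2" using kb PB[OF AI[OF u(1)]] le_trans by blast
  thus ?case by simp
 next
  case (3 k t)
  then obtain S lv e where u: "arrA t S {} lv" "A_inv h S lv e" "ALL i<h. sa t Snd 2 i = {x : S. i <= lv x}"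
   "clk t <= clk s + 1 + k * (h * (24 * n + 13) + 10)" "k * (h ^ 3 + 1) <= Phi h S lv" by (auto split: if_splits)
  have g: "rv t 5 = h" "rv t 6 = h ^ 3" using 3(2) h by (simp_all add: fr_def)
  have "T roundA (tick t) (%x. EX S' lv'. arrA x S' {} lv' & A_inv h S' lv' (rv x 10) & (ALL i<h. sa x Snd 2 i = {x : S'. i <= lv' x}) &
   Phi h S lv + rv x 10 <= Phi h S' lv' & clk x <= clk (tick t) + 8 + h * (24 * n + 13))"
   by (rule roundA_T) (use u g h in simp_all)
  thus ?case unfolding T_simps(8)
  proof (rule T_conseq, goal_cases)
   case (1 x)
   then obtain S' lv' where x: "arrA x S' {} lv'" "A_inv h S' lv' (rv x 10)" "ALL i<h. sa x Snd 2 i = {x : S'. i <= lv' x}"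
   "Phi h S lv + rv x 10 <= Phi h S' lv'" "clk x <= clk (tick t) + 8 + h * (24 * n + 13)" by blast
   have x6: "rv x 6 = h ^ 3" using 1(2) g by (simp add: fr_def)
   have e: "k * (h ^ 3 + 1) <= Phi h S' lv'" "rv x 10 > h ^ 3 ==> Suc k * (h ^ 3 + 1) <= Phi h S' lv'"
   using u(5) x(4) by auto
   show ?case using x x6 e u(4)
   by (simp, intro exI[of _ S'] exI[of _ lv'], simp, intro exI[of _ "rv x 10"], simp)
  qed
 next
  case (4 k t)
  then obtain S lv e where u: "arrA t S {} lv" "A_inv h S lv e" "clk t <= clk s + 1 + k * (h * (24 * n + 13) + 10)"
   "(k - 1) * (h ^ 3 + 1) <= Phi h S lv" "e <= h ^ 3" by (auto split: if_splits)
  have "k - 1 <= h ^ 2" using kb PB[OF AI[OF u(2)]] u(4) le_trans by blast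
  hence "k * (h * (24 * n + 13) + 10) <= (h ^ 2 + 1) * (h * (24 * n + 13) + 10)" by (intro mult_le_mono1) simp
  hence ck: "Suc (clk t) <= clk s + 3 + (h ^ 2 + 1) * (h * (24 * n + 13) + 10)" using u(3) by linarith
  have c: "common S" using A_bound(1)[OF u(2), of "{}"] h M1.indep_empty M2.indep_empty unfolding common_def by auto
  have "card X <= card S + 2 * h ^ 3" if X: "common X" for X
  proof -
   have "h * card X <= h * card S + card S + h * e" using A_bound(2)[OF u(2) X] h by simp
   moreover have "card S <= h * h ^ 3" using r[OF AI[OF u(2)]] by (simp add: eval_nat_numeral)
   moreover have "h * e <= h * h ^ 3" using u(5) by simp
   moreover have "h * (card S + 2 * h ^ 3) = h * card S + (h * h ^ 3 + h * h ^ 3)" by (simp add: distrib_left)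
   ultimately have "h * card X <= h * (card S + 2 * h ^ 3)" by linarith
   thus ?thesis using h by simp
  qed
  thus ?case using u(1) c ck by (intro exI[of _ S]) (simp add: arrA_def)
 qed
qed

end

section \<open>Labelled augmentation phase\<close>

context prog
begin

text \<open>The labels \<open>L\<close> at the start of a search from the sink bound the levels found by it from below; an
 element that fails the test on its level is moved to the next one.\<close>

definition BI :: "nat set => (nat => nat) => bst => nat => bool" where
 "BI S L st i \<longleftrightarrow> bfs_inv S st i & (ALL a:set (bQ st). L a <= blev st a) &
  (ALL b:{..<n} - S. blev st b = L b |
   L b < blev st b & blev st b <= Suc i & insert b (S - {a : set (bQ st). Suc (blev st a) < blev st b}) ~: J Snd) &
  (ALL b:{..<n} - S. blev st b < i --> b : set (bD st))"

lemma BID: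
 assumes "BI S L st i"
 shows "bfs_inv S st i" "!!a. a : set (bQ st) ==> L a <= blev st a"
  "!!b. b : {..<n} - S ==> blev st b ~= L b ==> L b < blev st b & blev st b <= Suc i & insert b (S - {a : set (bQ st). Suc (blev st a) < blev st b}) ~: J Snd"
  "!!b. b : {..<n} - S ==> L b <= blev st b"
  "!!b. b : {..<n} - S ==> blev st b < i ==> b : set (bD st)"
 using assms unfolding BI_def by (blast, blast, blast, force, blast)

lemma up2: "insert x Y ~: J j ==> Y <= X ==> insert x X ~: J j"
 using J_mono[of "insert x X" j "insert x Y"] by blast

text \<open>Arcs into \<open>b\<close> that skip a level have to be excluded. If the level of
  \<open>b\<close> is still its label, validity of the labels excludes them, as queue levels are
  never below labels; if the level was raised, the failed test recorded in \<open>BI\<close>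
  does.\<close>

lemma BI_reach2:
 assumes B: "BI S L st i" and v: "valid_labels S L" and b: "b : {..<n} - S" "blev st b = i"
  and t: "insert b (S - {a : set (bQ st). blev st a < i}) : J Snd"
 shows "reach2 S (bQ st) (blev st) b i"
 unfolding reach2_def
proof (intro conjI allI impI)
 assume "i = 0"
 thus "insert b S : J Snd" using t by simp
next
 fix k assume k: "i = Suc k"
 note D = BID[OF B]
 have c: "common S" using bfs_invD(1)[OF D(1)] .
 show nq: "insert b (S - {x : set (bQ st). blev st x < k}) ~: J Snd"
 proof (cases "blev st b = L b")
  case True
  hence "insert b {a : S. L b <= L a + 1} ~: J Snd" using v b k unfolding valid_labels_def by auto
  moreover have "{a : S. L b <= L a + 1} <= S - {x : set (bQ st). blev st x < k}"
   using D(2) True b k by fastforce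
  ultimately show ?thesis using up2 by blast
 next
  case False
  thus ?thesis using D(3)[OF b(1) False] b k by simp
 qed
 have nS: "insert b S ~: J Snd" using up2[OF nq] by blast
 have "EX a:{a : set (bQ st). blev st a < i}. insert b (S - {a}) : J Snd"
  using matroid.swap_iff[OF matJ common_sub(2)[OF c] _ nS, of "{a : set (bQ st). blev st a < i}"] t b bfs_invD(3)[OF D(1)] by auto
 then obtain a where a: "a : set (bQ st)" "blev st a < i" "insert b (S - {a}) : J Snd" by blast
 have "blev st a = k"
 proof (rule ccontr)
  assume "blev st a ~= k"
  hence "S - {x : set (bQ st). blev st x < k} <= S - {a}" using a k by auto
  thus False using up2[OF nq] a(3) by blast
 qed
 thus "EX a:set (bQ st). blev st a = k & insert b (S - {a}) : J Snd" using a by blast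
qed

text \<open>A new queue element \<open>a\<close> lies on the circuit of \<open>b\<close> in the
  first matroid, so validity gives \<open>L a <= L b <= i\<close>. Its level \<open>i\<close> is
  therefore not below its label.\<close>

lemma BI_disc:
 assumes B: "BI S L st i" and v: "valid_labels S L" and b: "b : {..<n} - S" "blev st b = i" "b ~: set (bD st)"
  and t: "insert b (S - {a : set (bQ st). blev st a < i}) : J Snd" and nf: "bfnd st = None"
 shows "BI S L (bdisc S b i st) i" "!!x. x : {..<n} - S ==> blev (bdisc S b i st) x = blev st x"
proof -
 note D = BID[OF B]
 have c: "common S" using bfs_invD(1)[OF D(1)] .
 have inv: "bfs_inv S (bdisc S b i st) i"
  by (rule bdisc_inv[OF D(1) nf _ _ b(3) BI_reach2[OF B v b(1,2) t]]) (use b in auto)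
 let ?st = "bdisc S b i st"
 note L = bnew_set(1)[OF c, of b st] bnew_set(3)[OF c, of b st]
 show lev: "blev ?st x = blev st x" if "x : {..<n} - S" for x
  using that b L unfolding bdisc_def by auto
 have Q: "set (bQ st) <= S" using bfs_invD(3)[OF D(1)] .
 have levQ: "blev ?st a = blev st a" if "a : set (bQ st)" for a
  using that b Q L unfolding bdisc_def by auto
 have new: "blev ?st a = i & L a <= i" if a: "a : set (bQ ?st)" "a ~: set (bQ st)" for a
 proof -
  have nfr: "insert b S ~: J Fst" using a nf unfolding bdisc_def by (auto split: if_splits)
  have an: "a : set (bnew S b st)" using a nf nfr unfolding bdisc_def by auto
  hence ac: "a : S" "insert b (S - {a}) : J Fst" using L unfolding circ_def by auto
  have "L a <= L b"
  proof (rule ccontr)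
   assume "~ L a <= L b"
   hence "{x : S. L x <= L b} <= S - {a}" by auto
   moreover have "insert b {x : S. L x <= L b} ~: J Fst" using v b nfr unfolding valid_labels_def by auto
   ultimately show False using up2 ac(2) by blast
  qed
  moreover have "blev ?st a = i" using an nf nfr unfolding bdisc_def by simp
  ultimately show ?thesis using D(4)[OF b(1)] b(2) by simp
 qed
 have sub: "set (bQ st) <= set (bQ ?st)" "set (bD st) <= set (bD ?st)" unfolding bdisc_def by auto
 show "BI S L ?st i" unfolding BI_def
 proof (intro conjI ballI impI)
  show "bfs_inv S ?st i" by (rule inv)
  show "L a <= blev ?st a" if "a : set (bQ ?st)" for a
   using new[OF that] D(2)[of a] levQ[of a] by (cases "a : set (bQ st)") auto
  fix x assume x: "x : {..<n} - S"
  show "blev ?st x = L x | L x < blev ?st x & blev ?st x <= Suc i & insert x (S - {a : set (bQ ?st). Suc (blev ?st a) < blev ?st x}) ~: J Snd"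
  proof (cases "blev st x = L x")
   case True
   thus ?thesis using lev[OF x] by simp
  next
   case False
   note d = D(3)[OF x False]
   have "{a : set (bQ ?st). Suc (blev ?st a) < blev st x} = {a : set (bQ st). Suc (blev st a) < blev st x}"
   using new levQ d sub(1) by fastforce
   thus ?thesis using d lev[OF x] by simp
  qed
  show "blev ?st x < i ==> x : set (bD ?st)" using D(5)[OF x] lev[OF x] sub by auto
 qed
qed

lemma bfs_inv_relabel:
 assumes "bfs_inv S st i" "b ~: set (bQ st)" "b ~: set (bD st)"
 shows "bfs_inv S (st(|blev := (blev st)(b := k)|)) i"
proof -
 let ?lev = "(blev st)(b := k)"
 note D = bfs_invD[OF assms(1)]
 have lQ: "?lev a = blev st a" if "a : set (bQ st) | a : set (bD st)" for a using that assms by auto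
 have s: "{a : set (bQ st). ?lev a <= e} = {a : set (bQ st). blev st a <= e}" "{a : set (bQ st). ?lev a < e} = {a : set (bQ st). blev st a < e}" for e
  using assms(2) by auto
 have m: "map ?lev (bQ st) = map (blev st) (bQ st)" using lQ by simp
 have e: "(EX a:set (bQ st). ?lev a = e & R a) \<longleftrightarrow> (EX a:set (bQ st). blev st a = e & R a)" for e R
  using lQ by (intro bex_cong) auto
 have r: "reach2 S (bQ st) ?lev x e = reach2 S (bQ st) (blev st) x e" for x e unfolding reach2_def s e ..
 have "blev (st(|blev := ?lev|)) = ?lev" by simp
 thus ?thesis unfolding bfs_inv_def
 proof (intro conjI, goal_cases)
  case 6
  thus ?case using D(6,7,8,9) lQ by (simp del: fun_upd_apply)
 next
  case 7
  thus ?case using D(10,11) lQ s by (simp del: fun_upd_apply)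
 next
  case 8
  thus ?case using D(12) m by (simp del: fun_upd_apply map_eq_conv)
 next
  case 12
  thus ?case using D(16) lQ r by (simp del: fun_upd_apply)
 qed (use D assms in \<open>auto\<close>)
qed

text \<open>The failed test is exactly what \<open>BI\<close> records for an element on level
  \<open>i + 1\<close>: deleting the queue elements below level \<open>i\<close> does not free
  it.\<close>

lemma BI_relabel:
 assumes B: "BI S L st i" and b: "b : {..<n} - S" "blev st b = i" "b ~: set (bD st)"
  and t: "insert b (S - {a : set (bQ st). blev st a < i}) ~: J Snd"
 shows "BI S L (st(|blev := (blev st)(b := Suc i)|)) i"
proof -
 note D = BID[OF B]
 have Q: "b ~: set (bQ st)" using bfs_invD(3)[OF D(1)] b by blast
 have s: "{a : set (bQ st). Suc (((blev st)(b := Suc i)) a) < e} = {a : set (bQ st). Suc (blev st a) < e}" for e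
  using Q by auto
 have "bfs_inv S (st(|blev := (blev st)(b := Suc i)|)) i" using bfs_inv_relabel[OF D(1) Q b(3)] .
 moreover have "L b < Suc i" using D(4)[OF b(1)] b(2) by simp
 ultimately show ?thesis unfolding BI_def
 proof (intro conjI ballI impI, goal_cases)
  case (3 x)
  show ?case
  proof (cases "x = b")
   case True
   thus ?thesis using t \<open>L b < Suc i\<close> s[of "Suc i"] by (simp del: fun_upd_apply) simp
  next
   case False
   thus ?thesis using D(3)[OF 3(3)] s[of "blev st x"] by (simp del: fun_upd_apply) auto
  qed
 qed (use D Q b in \<open>auto split: if_splits\<close>)
qed

lemma BI_next:
 assumes "BI S L st i" "bfnd st = None" "{b : {..<n} - S - set (bD st). blev st b = i} = {}"
 shows "BI S L st (Suc i)"
 using assms bfs_inv_mono[of S st i "Suc i"] unfolding BI_def by (auto simp: less_Suc_eq)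

text \<open>These are the labels required by \<open>bwalk_aug\<close>: unreached elements of
  \<open>S\<close> are put on the level where the search stopped.\<close>

definition capL :: "nat set => bst => nat => nat => nat" where
 "capL S st i x = (if x : S - set (bQ st) then i else blev st x)"

text \<open>The labels for the next search are the levels of this one. An element left unreached has
  level at least \<open>i\<close>, where the lower level set is all of \<open>S\<close>; for a
  raised element the failed test gives the condition in the second matroid.\<close>

lemma BI_valid:
 assumes B: "BI S L st i" and v: "valid_labels S L" and Li: "ALL b:{..<n} - S. L b <= Suc i"
 shows "valid_labels S (capL S st i)" "!!a. a : S ==> capL S st i a <= i"
  "!!b. b : {..<n} - S ==> insert b S : J Fst ==> i <= blev st b"
  "!!b. b : {..<n} - S ==> blev st b <= Suc i"
proof -
 note D = BID[OF B] and I = bfs_invD[OF BID(1)[OF B]]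
 have cap: "capL S st i x = blev st x" if "x ~: S" for x using that unfolding capL_def by simp
 show le: "capL S st i a <= i" if "a : S" for a using I(13)[of a] that unfolding capL_def by auto
 show free: "i <= blev st b" if b: "b : {..<n} - S" "insert b S : J Fst" for b
 proof (rule ccontr)
  assume l: "~ i <= blev st b"
  hence bD: "b : set (bD st)" using D(5)[OF b(1)] by simp
  hence "bfnd st = Some b" using I(10)[OF bD] b(2) by blast
  thus False using I(15) l by blast
 qed
 show "blev st b <= Suc i" if "b : {..<n} - S" for b
  using D(3)[OF that] bspec[OF Li that] by (cases "blev st b = L b") auto
 show "valid_labels S (capL S st i)" unfolding valid_labels_def
 proof (intro conjI ballI impI)
  show "common S" by (rule I(1))
  fix b assume b: "b : {..<n} - S"
  hence cb: "capL S st i b = blev st b" using cap by simp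
  show "insert b S : J Fst | insert b {a : S. capL S st i a <= capL S st i b} ~: J Fst"
  proof (cases "i <= blev st b")
   case True
   hence "{a : S. capL S st i a <= capL S st i b} = S" using le cb by fastforce
   thus ?thesis by auto
  next
   case False
   hence bD: "b : set (bD st)" using D(5)[OF b] by simp
   have "bfnd st ~= Some b" using I(15)[of b] False by auto
   hence "insert b {a : set (bQ st). blev st a <= blev st b} ~: J Fst" using I(11)[OF bD] by blast
   moreover have "{a : set (bQ st). blev st a <= blev st b} <= {a : S. capL S st i a <= capL S st i b}"
   unfolding cb using I(3) by (auto simp: capL_def)
   ultimately show ?thesis using up2 by blast
  qed
  show "insert b {a : S. capL S st i b <= capL S st i a + 1} ~: J Snd" if "1 <= capL S st i b"
  proof (cases "blev st b = L b")
   case True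
   hence "insert b {a : S. L b <= L a + 1} ~: J Snd" using v b that cb unfolding valid_labels_def by auto
   moreover have "{a : S. L b <= L a + 1} <= {a : S. capL S st i b <= capL S st i a + 1}"
   unfolding cb True using D(2) bspec[OF Li b] unfolding capL_def by fastforce
   ultimately show ?thesis using up2 by blast
  next
   case False
   note d = D(3)[OF b False]
   have "S - {a : set (bQ st). Suc (blev st a) < blev st b} <= {a : S. capL S st i b <= capL S st i a + 1}"
   unfolding cb using d unfolding capL_def by auto
   thus ?thesis using up2 d by blast
  qed
 qed
qed

text \<open>After an augmentation, \<open>k\<close> is the level at which the search ended: elements
  free in the first matroid are labelled at least \<open>k\<close> and no label exceeds
  \<open>k + 1\<close>. The next search that finds a path ends at some level \<open>i >= k\<close>,
  so no label exceeds \<open>i + 1\<close> then.\<close>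

definition Bok :: "nat set => (nat => nat) => nat => bool" where
 "Bok S L d \<longleftrightarrow> valid_labels S L & (ALL b:{..<n} - S. L b <= d) &
  (EX k. ALL b:{..<n} - S. L b <= Suc k & (insert b S : J Fst --> k <= L b))"

definition lsum :: "nat => nat set => (nat => nat) => nat" where
 "lsum d S L = (SUM x:{..<n} - S. d - L x)"

lemma B_augment:
 assumes B: "BI S L st i" and k: "Bok S L d" and i: "i < d" and f: "bfnd st = Some b"
  and ld: "!!x. x : {..<n} - S ==> blev st x <= d"
 shows "EX L'. Bok (bwalk S st) L' d & (ALL x:{..<n} - bwalk S st. L' x = blev st x) &
  card (bwalk S st) = Suc (card S) & lsum d (bwalk S st) L' <= lsum d S (blev st)"
proof -
 note D = BID[OF B] and I = bfs_invD[OF BID(1)[OF B]]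
 obtain k0 where v: "valid_labels S L" and k0: "!!b. b : {..<n} - S ==> L b <= Suc k0 & (insert b S : J Fst --> k0 <= L b)"
  using k unfolding Bok_def by blast
 have b: "b : {..<n} - S" "insert b S : J Fst" "blev st b = i" using I(5,15) f by auto
 have "k0 <= i" using k0[OF b(1)] b D(4)[OF b(1)] by auto
 hence Li: "ALL b:{..<n} - S. L b <= Suc i" using k0 by force
 note V = BI_valid[OF B v Li]
 let ?L = "capL S st i"
 have L1: "?L x = blev st x" if "x : {..<n} - S" for x using that unfolding capL_def by auto
 have L2: "?L a = blev st a" if "a : set (bQ st)" for a using that unfolding capL_def by auto
 have L3: "?L a = i" if "a : S - set (bQ st)" for a using that unfolding capL_def by auto
 obtain pa pe where p: "aug_path S ?L i pa pe" "bwalk S st = (S - pa ` {..<i}) Un pe ` {..i}"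
  using bwalk_aug[OF D(1) f L1 L2 L3] by blast
 note pf = path_facts[OF p(1)]
 have free: "i <= ?L x" if "x : {..<n} - S" "insert x S : J Fst" for x using V(3)[OF that] L1[OF that(1)] by simp
 have v': "valid_labels (bwalk S st) ?L" unfolding p(2) by (rule augment_valid[OF p(1) V(1) free V(2)])
 have Lb: "?L x = blev st x" if "x : {..<n} - bwalk S st" for x
 proof (cases "x : S")
  case True
  hence "x : pa ` {..<i}" using that p(2) by blast
  then obtain t where t: "t < i" "x = pa t" by blast
  hence "?L x = t" using pf(6)[OF t(1)] by simp
  hence "x : set (bQ st)" using t L3[of x] True by (cases "x : set (bQ st)") auto
  thus ?thesis using L2 by simp
 next
  case False
  thus ?thesis using that L1 by simp
 qed
 have Lle: "?L x <= d" "?L x <= Suc i" if "x : {..<n} - bwalk S st" for x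
  using V(2)[of x] V(4)[of x] ld[of x] L1[of x] that i by (cases "x : S"; auto)+
 \<comment> \<open>The span of \<open>S\<close> in the first matroid does not shrink by the
   augmentation, so an element that is free afterwards was free and outside \<open>S\<close>
   before.\<close>
 have fr: "i <= ?L x" if x: "x : {..<n} - bwalk S st" "insert x (bwalk S st) : J Fst" for x
 proof -
  have c: "{a : S. ?L a <= i} = S" using V(2) by auto
  have "?L a <= i" if "a : bwalk S st" for a using that V(2) pf(4) unfolding p(2) by auto
  hence c': "{a : bwalk S st. ?L a <= i} = bwalk S st" by auto
  have "M1.cl S <= M1.cl (bwalk S st)" using cl_levels_M1[OF p(1), of i] c c' unfolding p(2) by simp
  moreover have "x ~: M1.cl (bwalk S st)" using x unfolding M1.cl_def by blast
  ultimately have "x ~: M1.cl S" by blast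
  hence "x : {..<n} - S" "insert x S : J Fst" using M1.not_cl_D[of x S] x by auto
  thus ?thesis using free by blast
 qed
 have "Bok (bwalk S st) ?L d" unfolding Bok_def using v' Lle fr by blast
 moreover have "card (bwalk S st) = Suc (card S)" unfolding p(2) using augment_common(2)[OF p(1)] .
 moreover have "lsum d (bwalk S st) ?L <= lsum d S (blev st)"
 proof -
  have "lsum d (bwalk S st) ?L <= lsum d S ?L" unfolding lsum_def p(2) using augment_level_sum[OF p(1)] by simp
  also have "lsum d S ?L = lsum d S (blev st)" unfolding lsum_def using L1 by (intro sum.cong) auto
  finally show ?thesis .
 qed
 ultimately show ?thesis using Lb by blast
qed

lemma B_final:
 assumes B: "BI S L st d" and k: "Bok S L d" and T: "common X" and d: "0 < d"
 shows "d * card X <= d * card S + card S"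
proof -
 have v: "valid_labels S L" "ALL b:{..<n} - S. L b <= Suc d" using k unfolding Bok_def by (blast, force)
 note V = BI_valid[OF B v]
 have "d <= capL S st d b" if "b : {..<n} - S" "insert b S : J Fst" for b
  using V(3)[OF that] that unfolding capL_def by auto
 thus ?thesis using valid_labels_bound[OF V(1) T d] by blast
qed

text \<open>Row \<open>k\<close> of matrix \<open>2\<close> is the bucket of the elements outside
  \<open>S\<close> on level \<open>k\<close>, and array \<open>6\<close> holds its length. A raised
  element is appended to the next bucket; its old entry has been passed and is not read again in
  this search.\<close>

definition bfill :: com where
 "bfill = For 7 (Op Add (V 6) (N 1)) (Put 6 (V 7) (N 0)) ;;
  For 7 Sz (When (NotE (Get 2 (V 7))) (Put2 2 (Get 5 (V 7)) (Get 6 (Get 5 (V 7))) (V 7) ;;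
   Put 6 (Get 5 (V 7)) (Op Add (Get 6 (Get 5 (V 7))) (N 1))))"

text \<open>Set variable \<open>4\<close> of the second oracle is \<open>S\<close> without the queue
  elements below the current level, so one query decides between reaching the element and raising
  it.\<close>

definition bbody :: com where
 "bbody = Assign 13 (Get2 2 (V 20) (V 22)) ;; Assign 22 (Op Add (V 22) (N 1)) ;;
  If (Qry Snd (SIns (V 13) (SV 4))) disc
   (Put 5 (V 13) (Op Add (V 20) (N 1)) ;;
   Put2 2 (Op Add (V 20) (N 1)) (Get 6 (Op Add (V 20) (N 1))) (V 13) ;;
   Put 6 (Op Add (V 20) (N 1)) (Op Add (Get 6 (Op Add (V 20) (N 1))) (N 1)))"

definition blevel :: com where
 "blevel = Assign 23 (V 16) ;; Assign 19 (V 20) ;; Assign 22 (N 0) ;;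
  While (Op Mul (Op Sub (Get 6 (V 20)) (V 22)) (NotE (V 17))) bbody ;;
  While (Op Sub (V 16) (V 23)) (SAssign Snd 4 (SDel (Get 7 (V 23)) (SV 4)) ;; Assign 23 (Op Add (V 23) (N 1))) ;;
  Assign 20 (Op Add (V 20) (N 1))"

definition bbfs :: com where
 "bbfs = bsetup ;; SAssign Snd 4 (SV 2) ;; bfill ;; Assign 20 (N 0) ;;
  While (Op Mul (Op Sub (V 6) (V 20)) (NotE (V 17))) blevel"

definition phaseB :: com where
 "phaseB = Assign 11 (N 1) ;; While (V 11) (bbfs ;; If (V 17) walk (Assign 11 (N 0)))"

lemma mods_B [simp]:
 "mr bfill = {7}" "ma bfill = {6}" "mm bfill = {2}" "ms bfill = {}" "mz bfill = {}" "~ mo bfill" "~ mt bfill"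
 "mr bbody = {12, 13, 14, 15, 16, 17, 18, 22, 24}" "ma bbody = {5, 6, 7, 8, 9, 14}" "mm bbody = {2}" "ms bbody = {}"
 "mz bbody = {(Fst, 3)}" "~ mo bbody" "~ mt bbody"
 "mr blevel = {12, 13, 14, 15, 16, 17, 18, 19, 20, 22, 23, 24}" "ma blevel = {5, 6, 7, 8, 9, 14}" "mm blevel = {2}" "ms blevel = {(Snd, 4)}"
 "mz blevel = {(Fst, 3)}" "~ mo blevel" "~ mt blevel"
 "mr bbfs = {7, 12, 13, 14, 15, 16, 17, 18, 19, 20, 22, 23, 24}" "ma bbfs = {5, 6, 7, 8, 9, 14}" "mm bbfs = {2}"
 "ms bbfs = {(Fst, 2), (Snd, 2), (Snd, 4)}" "mz bbfs = {(Fst, 3)}" "~ mo bbfs" "~ mt bbfs"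
 "mr phaseB = {7, 11, 12, 13, 14, 15, 16, 17, 18, 19, 20, 21, 22, 23, 24}" "ma phaseB = {2, 5, 6, 7, 8, 9, 14}" "mm phaseB = {2}"
 "ms phaseB = {(Fst, 2), (Snd, 2), (Snd, 4)}" "mz phaseB = {(Fst, 3)}" "~ mo phaseB" "~ mt phaseB"
 unfolding phaseB_def bbfs_def blevel_def bbody_def bfill_def by auto

definition bkt :: "st => nat set => bst => nat => nat => nat => bool" where
 "bkt s S st i j d \<longleftrightarrow> (EX bk. (ALL k. i <= k & k <= d --> distinct (bk k) & set (bk k) <= {..<n} - S & length (bk k) = ra s 6 k &
   (ALL x<length (bk k). rm s 2 k x = bk k ! x)) &
  (ALL k. i < k & k <= d --> set (bk k) = {b : {..<n} - S. blev st b = k}) &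
  j <= length (bk i) & set (drop j (bk i)) = {b : {..<n} - S - set (bD st). blev st b = i})"

lemma bktE:
 assumes "bkt s S st i j d"
 obtains bk where "!!k. i <= k ==> k <= d ==> distinct (bk k) & set (bk k) <= {..<n} - S & length (bk k) = ra s 6 k &
   (ALL x<length (bk k). rm s 2 k x = bk k ! x)"
  and "!!k. i < k ==> k <= d ==> set (bk k) = {b : {..<n} - S. blev st b = k}"
  and "j <= length (bk i)" and "set (drop j (bk i)) = {b : {..<n} - S - set (bD st). blev st b = i}"
 using assms unfolding bkt_def
 apply (elim exE conjE)
 subgoal for bk by (rule that[of bk]) simp_all
 done

lemma bkt_cong: "ra t 6 = ra s 6 ==> rm t 2 = rm s 2 ==> bkt s S st i j d ==> bkt t S st i j d"
 unfolding bkt_def by simp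

lemma nSlen: "distinct xs ==> set xs <= {..<n} - S ==> length xs <= n"
 using distinct_card[of xs] card_mono[of "{..<n}" "set xs"] by auto

lemma bfill_T:
 assumes r: "brel S st s" and D: "bD st = []" and l: "ALL b:{..<n} - S. blev st b <= d" and d: "rv s 6 = d" "d < (n + 2) ^ 3"
 shows "T bfill s (%t. bkt t S st 0 0 d & clk t <= clk s + 8 + 3 * d + 5 * n)"
proof -
 have nB: "n < B" "d + 4 < B" using B_Z LB d by linarith+
 note R = brelD[OF r]
 define F where "F k v = filter (%b. b ~: S & blev st b = k) [0..<v]" for k v
 have FS: "F k (Suc v) = F k v @ (if v ~: S & blev st v = k then [v] else [])" for k v unfolding F_def by simp
 have Fl: "length (F k v) <= v" for k v unfolding F_def by (metis length_filter_le length_upt minus_nat.diff_0)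
 show ?thesis unfolding bfill_def
 proof (rule T_SeqI, rule T_For[where m = "d + 1" and P = "%i t. (ALL k<i. ra t 6 k = 0) & clk t <= Suc (clk s) + 3 * i"], goal_cases)
  case (4 i t)
  thus ?case using d nB by (simp add: fr_def)
 next
  case (5 i t)
  thus ?case using nB by (auto simp: less_Suc_eq)
 next
  case (6 t)
  have g: "ra t 5 = ra s 5" "ra t 2 = ra s 2" using 6(2) by (simp_all add: fr_def)
  show ?case
  proof (rule T_For[where m = n and P = "%v t'. (ALL k<=d. ra t' 6 k = length (F k v) & (ALL x<length (F k v). rm t' 2 k x = F k v ! x)) &
   clk t' <= clk s + 6 + 3 * d + 5 * v"], goal_cases)
   case 3
   thus ?case using 6(1) by (auto simp: F_def)
  next
   case (5 v u)
   have q: "ra u 5 v = blev st v" "ra u 2 v = of_bool (v : S)" "v < n" "rv u 7 = v" using 5(2-4) g R(5,9) by (simp_all add: fr_def)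
   have f: "ra u 6 k = length (F k v)" "!!x. x < length (F k v) ==> rm u 2 k x = F k v ! x" if "k <= d" for k using 5(1) that by auto
   show ?case
   proof (cases "v : S")
   case True
   thus ?thesis using 5(1) q nB FS by simp
   next
   case False
   hence lv: "blev st v <= d" using l q by simp
   have "length (F (blev st v) v) < n" using Fl[of "blev st v" v] q by simp
   thus ?thesis using 5(1) q nB False lv f[OF lv] by (auto simp: FS nth_append less_Suc_eq)
   qed
  next
   case (6 u)
   have "bkt u S st 0 0 d" unfolding bkt_def
   proof (rule exI[of _ "%k. F k n"], intro conjI)
   show "ALL k. 0 <= k & k <= d --> distinct (F k n) & set (F k n) <= {..<n} - S & length (F k n) = ra u 6 k &
   (ALL x<length (F k n). rm u 2 k x = F k n ! x)" using 6(1) by (auto simp: F_def)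
   qed (use D in \<open>auto simp: F_def\<close>)
   thus ?case using 6(1) bkt_cong[of "tick u" u] by simp
  qed (use nB in \<open>simp_all add: fr_def\<close>)
 qed (use nB in simp_all)
qed

text \<open>Each iteration of \<open>bbody\<close> either reaches an element or raises a label. The
  factor \<open>20\<close> exceeds the cost of an iteration and its call of \<open>disc\<close>; the
  tree searches in that call are paid by \<open>pot\<close>.\<close>

definition Psi :: "nat => nat set => bst => nat" where
 "Psi d S st = pot S st + 20 * (n - length (bD st)) + 20 * lsum d S (blev st)"

definition Binv :: "nat set => (nat => nat) => nat => nat => bst => st => bool" where
 "Binv S L d i st t \<longleftrightarrow> brel S st t & BI S L st i & (ALL b:{..<n} - S. blev st b <= d) & rv t 20 = i &
  sv t Snd 4 = S - {a : set (bQ st). blev st a < i}"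

lemma bbody_T:
 assumes I: "Binv S L d i st s" and nf: "bfnd st = None" and k: "bkt s S st i j d" and j: "rv s 22 = j" "j < ra s 6 i"
  and l: "rv s 19 = i" and i: "i < d" "d < (n + 2) ^ 3" and v: "valid_labels S L"
 shows "T bbody s (%t. EX st'. brel S st' t & BI S L st' i & (ALL b:{..<n} - S. blev st' b <= d) & rv t 22 = Suc j & bkt t S st' i (Suc j) d &
  clk t + Psi d S st' + 1 <= clk s + Psi d S st &
  {a : set (bQ st'). blev st' a < i} = {a : set (bQ st). blev st a < i} & length (bQ st) <= length (bQ st') &
  (ALL x. length (bQ st) <= x & x < length (bQ st') --> blev st' (bQ st' ! x) = i) & (ALL x<length (bQ st). bQ st' ! x = bQ st ! x & blev st' (bQ st ! x) = blev st (bQ st ! x)))" (is "T _ _ ?Q")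
proof -
 have nB: "n < B" "d + 4 < B" "2 * n + 10 < B" using B_Z LB i B_lin by linarith+
 have r: "brel S st s" and BI: "BI S L st i" and ld: "ALL b:{..<n} - S. blev st b <= d" and s20: "rv s 20 = i"
  and H: "sv s Snd 4 = S - {a : set (bQ st). blev st a < i}" using I unfolding Binv_def by auto
 note R = brelD[OF r] and D = BID[OF BI] and BF = bfs_invD[OF BID(1)[OF BI]]
 obtain bk where bk1: "!!k. i <= k ==> k <= d ==> distinct (bk k) & set (bk k) <= {..<n} - S & length (bk k) = ra s 6 k &
   (ALL x<length (bk k). rm s 2 k x = bk k ! x)"
  and bk2: "!!k. i < k ==> k <= d ==> set (bk k) = {b : {..<n} - S. blev st b = k}"
  and bk3: "set (drop j (bk i)) = {b : {..<n} - S - set (bD st). blev st b = i}"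
  by (rule bktE[OF k]) blast
 have li: "length (bk i) = ra s 6 i" "distinct (bk i)" "j < length (bk i)" "length (bk i) <= n"
  using bk1[of i] i j nSlen[of "bk i" S] by auto
 define b where "b = bk i ! j"
 have dr: "drop j (bk i) = b # drop (Suc j) (bk i)" unfolding b_def using li(3) by (metis Cons_nth_drop_Suc)
 have b: "b : {..<n} - S" "b ~: set (bD st)" "blev st b = i" "b < n" using bk3 unfolding dr by auto
 have dr2: "set (drop (Suc j) (bk i)) = {x : {..<n} - S - set (bD st). blev st x = i} - {b}"
  using bk3 distinct_drop[OF li(2), of j] unfolding dr by auto
 have rb: "rm s 2 i j = b" using bk1[of i] i li b_def by auto
 have jn: "j < n" using li by linarith
 let ?H = "S - {a : set (bQ st). blev st a < i}"
 define s1 where "s1 = s(|rv := (rv s)(13 := b, 22 := Suc j), clk := Suc (Suc (Suc (clk s)))|)"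
 have r1: "brel S st s1" by (rule brel_cong[OF r]) (simp_all add: s1_def)
 have lD: "length (bD st) < n"
 proof -
  have "distinct (b # bD st)" "set (b # bD st) <= {..<n} - S" using BF(4,5) b by auto
  thus ?thesis using nSlen[of "b # bD st" S] by simp
 qed
 show ?thesis
 proof (cases "insert b ?H : J Snd")
  case True
  note BD = BI_disc[OF BI v b(1,3,2) True nf]
  let ?st = "bdisc S b i st"
  have lD': "bD ?st = bD st @ [b]" using nf unfolding bdisc_def by auto
  have Qx: "bQ ?st = bQ st @ (if insert b S : J Fst then [] else bnew S b st)" using nf unfolding bdisc_def by auto
  have Q: "set (bQ st) <= S" using BF(3) .
  note L = bnew_set(1)[OF BF(1), of b st] bnew_set(3)[OF BF(1), of b st]
  have levQ: "blev ?st a = blev st a" if "a : set (bQ st)" for a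
   using that b Q L nf unfolding bdisc_def by auto
  have levN: "blev ?st a = i" if "a : set (bnew S b st)" "insert b S ~: J Fst" for a
   using that nf unfolding bdisc_def by auto
  have eqH: "{a : set (bQ ?st). blev ?st a < i} = {a : set (bQ st). blev st a < i}"
   unfolding Qx using levQ levN by auto
  have ls: "lsum d S (blev ?st) = lsum d S (blev st)" unfolding lsum_def using BD(2) by (intro sum.cong) auto
  have "T disc s1 (%t. brel S ?st t & clk t + pot S ?st <= clk s1 + 12 + pot S st)"
   by (rule disc_T[OF r1]) (use b l i in \<open>simp_all add: s1_def\<close>)
  hence "T disc s1 ?Q"
  proof (rule T_conseq, goal_cases)
   case (1 t)
   have f: "rv t 22 = Suc j" "ra t 6 = ra s 6" "rm t 2 = rm s 2" using 1(2) by (simp_all add: fr_def s1_def)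
   have "bkt t S ?st i (Suc j) d" unfolding bkt_def
   proof (rule exI[of _ bk], intro conjI allI impI)
   fix k assume "i < k & k <= d"
   thus "set (bk k) = {b : {..<n} - S. blev ?st b = k}" using bk2[of k] BD(2) by auto
   next
   show "set (drop (Suc j) (bk i)) = {b : {..<n} - S - set (bD ?st). blev ?st b = i}"
   unfolding dr2 lD' using BD(2) by auto
   qed (use bk1 f li in simp_all)
   moreover have "clk t + Psi d S ?st + 1 <= clk s + Psi d S st"
   using 1(1)[THEN conjunct2] lD unfolding Psi_def ls lD' s1_def by simp
   moreover have "ALL x. length (bQ st) <= x & x < length (bQ ?st) --> blev ?st (bQ ?st ! x) = i"
   unfolding Qx using levN by (auto simp: nth_append split: if_splits)
   moreover have "ALL x<length (bQ st). bQ ?st ! x = bQ st ! x & blev ?st (bQ st ! x) = blev st (bQ st ! x)"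
   unfolding Qx using levQ by (auto simp: nth_append)
   moreover have "length (bQ st) <= length (bQ ?st)" unfolding Qx by simp
   moreover have "ALL b:{..<n} - S. blev ?st b <= d" using ld BD(2) by simp
   ultimately show ?case using 1(1)[THEN conjunct1] BD(1) f(1) eqH by (intro exI[of _ ?st] conjI)
  qed
  thus ?thesis unfolding bbody_def s1_def using s20 j rb jn nB i b H True by simp
 next
  case False
  let ?st = "st(|blev := (blev st)(b := Suc i)|)"
  have BR: "BI S L ?st i" by (rule BI_relabel[OF BI b(1,3,2) False])
  have bQ: "b ~: set (bQ st)" using BF(3) b by blast
  define c where "c = ra s 6 (Suc i)"
  have bs: "distinct (bk (Suc i))" "set (bk (Suc i)) = {b : {..<n} - S. blev st b = Suc i}" "length (bk (Suc i)) = c"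
   "ALL x<c. rm s 2 (Suc i) x = bk (Suc i) ! x"
   using bk1[of "Suc i"] bk2[of "Suc i"] i unfolding c_def by auto
  have cn: "c < n"
  proof -
   have "distinct (b # bk (Suc i))" "set (b # bk (Suc i)) <= {..<n} - S" using bs b by auto
   thus ?thesis using nSlen[of "b # bk (Suc i)" S] bs(3) by simp
  qed
  define t where "t = s(|rv := (rv s)(13 := b, 22 := Suc j),
   ra := (ra s)(5 := (ra s 5)(b := Suc i), 6 := (ra s 6)(Suc i := Suc c)),
   rm := (rm s)(2 := (rm s 2)(Suc i := (rm s 2 (Suc i))(c := b))), clk := clk s + 6|)"
  have "brel S ?st t"
  proof -
   have "Suc i < (n + 2) ^ 3" using i by linarith
   thus ?thesis using r b(4) unfolding brel_def t_def by (simp add: tree_def)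
  qed
  moreover have "bkt t S ?st i (Suc j) d" unfolding bkt_def
  proof (rule exI[of _ "bk(Suc i := bk (Suc i) @ [b])"], intro conjI allI impI, goal_cases)
   case (1 k)
   thus ?case using bk1[of k] bs b by (cases "k = Suc i") (auto simp: t_def)
  next
   case (2 k)
   thus ?case using bk1[of k] bs b by (cases "k = Suc i") (auto simp: t_def)
  next
   case (3 k)
   thus ?case using bk1[of k] bs b by (cases "k = Suc i") (auto simp: t_def)
  next
   case (4 k x)
   thus ?case using bk1[of k] bs b by (cases "k = Suc i") (auto simp: t_def nth_append less_Suc_eq)
  next
   case (5 k)
   thus ?case using bk2[of k] bs b by (cases "k = Suc i") auto
  next
   case 6
   thus ?case using li by simp
  next
   case 7
   thus ?case using dr2 b by auto
  qed
  moreover have "lsum d S (blev st) = Suc (lsum d S (blev ?st))"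
  proof -
   have "lsum d S (blev st) = (d - i) + (SUM x:{..<n} - S - {b}. d - blev st x)"
   unfolding lsum_def using sum.remove[of "{..<n} - S" b "%x. d - blev st x"] b by simp
   moreover have "lsum d S (blev ?st) = (d - Suc i) + (SUM x:{..<n} - S - {b}. d - blev st x)"
   unfolding lsum_def using sum.remove[of "{..<n} - S" b "%x. d - blev ?st x"] b by simp
   ultimately show ?thesis using i by simp
  qed
  hence "clk t + Psi d S ?st + 1 <= clk s + Psi d S st" unfolding Psi_def pot_def t_def by simp
  moreover have "{a : set (bQ ?st). blev ?st a < i} = {a : set (bQ st). blev st a < i}" using bQ by auto
  moreover have "ALL x<length (bQ st). bQ ?st ! x = bQ st ! x & blev ?st (bQ st ! x) = blev st (bQ st ! x)" using bQ by auto
  moreover have "ALL b:{..<n} - S. blev ?st b <= d" using ld i by simp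
  moreover have "rv t 22 = Suc j" unfolding t_def by simp
  ultimately have "EX st'. brel S st' t & BI S L st' i & (ALL b:{..<n} - S. blev st' b <= d) & rv t 22 = Suc j & bkt t S st' i (Suc j) d &
  clk t + Psi d S st' + 1 <= clk s + Psi d S st &
  {a : set (bQ st'). blev st' a < i} = {a : set (bQ st). blev st a < i} & length (bQ st) <= length (bQ st') &
  (ALL x. length (bQ st) <= x & x < length (bQ st') --> blev st' (bQ st' ! x) = i) & (ALL x<length (bQ st). bQ st' ! x = bQ st ! x & blev st' (bQ st ! x) = blev st (bQ st ! x))"
   using BR by (intro exI[of _ ?st]) simp
  moreover have "T bbody s (%x. x = t)" unfolding bbody_def t_def using s20 j rb jn nB i b H False cn c_def
   by (simp add: fun_upd_twist)
  ultimately show ?thesis by (elim T_conseq) simp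
 qed
qed

lemma blevel_T:
 assumes I: "Binv S L d i st s" and nf: "bfnd st = None" and k: "bkt s S st i 0 d" and q: "ALL a:set (bQ st). blev st a < i"
  and i: "i < d" "d < (n + 2) ^ 3" and v: "valid_labels S L"
 shows "T blevel s (%t. EX st'. brel S st' t & (ALL b:{..<n} - S. blev st' b <= d) & rv t 20 = Suc i & BI S L st' i &
  (bfnd st' = None --> Binv S L d (Suc i) st' t & bkt t S st' (Suc i) 0 d & (ALL a:set (bQ st'). blev st' a < Suc i)) &
  length (bQ st) <= length (bQ st') & clk t + Psi d S st' <= clk s + Psi d S st + 7 + 3 * (length (bQ st') - length (bQ st)))" (is "T _ _ ?Q")
proof -
 have nB: "n < B" "d + 4 < B" "2 * n + 10 < B" using B_Z LB i B_lin by linarith+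
 have r: "brel S st s" and BI: "BI S L st i" and ld: "ALL b:{..<n} - S. blev st b <= d" and s20: "rv s 20 = i"
  and H: "sv s Snd 4 = S - {a : set (bQ st). blev st a < i}" using I unfolding Binv_def by auto
 have qe: "{a : set (bQ st). blev st a < i} = set (bQ st)" using q by auto
 define q0 where "q0 = length (bQ st)"
 define s1 where "s1 = s(|rv := (rv s)(23 := q0, 19 := i, 22 := 0), clk := clk s + 3|)"
 define W where "W t st' = (brel S st' t & BI S L st' i & (ALL b:{..<n} - S. blev st' b <= d) & bkt t S st' i (rv t 22) d &
  clk t + Psi d S st' <= clk s + 3 + Psi d S st & {a : set (bQ st'). blev st' a < i} = set (bQ st) & q0 <= length (bQ st') &
  (ALL x<q0. bQ st' ! x = bQ st ! x))" for t :: st and st'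
 have len: "ra t 6 i <= n" "rv t 22 <= ra t 6 i" if "W t st'" for t st'
 proof -
  have k: "bkt t S st' i (rv t 22) d" using that unfolding W_def by blast
  show "ra t 6 i <= n" "rv t 22 <= ra t 6 i" by (rule bktE[OF k]; use i nSlen in force)+
 qed
 have W0: "W s1 st"
 proof -
  have "brel S st s1" by (rule brel_cong[OF r]) (simp_all add: s1_def)
  moreover have "bkt s1 S st i 0 d" by (rule bkt_cong[OF _ _ k]) (simp_all add: s1_def)
  ultimately show ?thesis unfolding W_def using BI ld qe by (simp add: s1_def q0_def)
 qed
 \<comment> \<open>The last, failing test ticks the clock; subtracting one recovers the state for
   which the invariant was established.\<close>
 have loop1: "T (While (Op Mul (Op Sub (Get 6 (V 20)) (V 22)) (NotE (V 17))) bbody) s1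
  (%t. EX st'. W (t(|clk := clk t - 1|)) st' & 0 < clk t & (bfnd st' = None --> ra t 6 i <= rv t 22))"
 proof (rule T_While[where I = "%t. EX st'. W t st'" and K = "clk s + 3 + Psi d S st"], goal_cases)
  case 1
  thus ?case using W0 by blast
 next
  case (2 t)
  then obtain st' where w: "W t st'" by blast
  have c: "clk t + Psi d S st' <= clk s + 3 + Psi d S st" using w unfolding W_def by blast
  have f: "rv t 20 = i" using 2(2) s20 by (simp add: fr_def s1_def)
  have "(ra t 6 i - rv t 22) * (Suc 0 - rv t 17) <= n * 1" using len[OF w] by (intro mult_le_mono) auto
  thus ?case using c f nB i by (simp)
 next
  case (3 t)
  then obtain st' where w: "W t st'" by blast
  note w' = w[unfolded W_def]
  have f: "rv t 20 = i" "rv t 19 = i" "sv t Snd 4 = S - set (bQ st)" using 3(2) s20 H qe by (simp_all add: fr_def s1_def)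
  have nf': "bfnd st' = None" using 3(3) w' brelD(14)[of S st' t] by (cases "bfnd st'") auto
  have j: "rv t 22 < ra t 6 i" using 3(3) f by auto
  have Bi: "Binv S L d i st' (tick t)" unfolding Binv_def using w' f by simp
  have bk: "bkt (tick t) S st' i (rv t 22) d" by (rule bkt_cong[of _ t]) (use w' in simp_all)
  show ?case
  proof (rule T_conseq[OF bbody_T[OF Bi nf' bk _ _ _ i v]], goal_cases)
   case (4 u)
   then obtain st2 where u: "brel S st2 u" "BI S L st2 i" "ALL b:{..<n} - S. blev st2 b <= d" "rv u 22 = Suc (rv t 22)"
   "bkt u S st2 i (Suc (rv t 22)) d" "clk u + Psi d S st2 + 1 <= Suc (clk t) + Psi d S st'"
   "{a : set (bQ st2). blev st2 a < i} = {a : set (bQ st'). blev st' a < i}" "length (bQ st') <= length (bQ st2)"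
   "ALL x<length (bQ st'). bQ st2 ! x = bQ st' ! x & blev st2 (bQ st' ! x) = blev st' (bQ st' ! x)" by (auto simp del: mem_Collect_eq)
   have "W u st2" unfolding W_def using u w' by simp
   thus ?case by blast
  qed (use f j in simp_all)
 next
  case (4 t)
  then obtain st' where w: "W t st'" by blast
  have f: "rv t 20 = i" using 4(2) s20 by (simp add: fr_def s1_def)
  have "bfnd st' = None --> ra t 6 i <= rv t 22" using 4(3) f w[unfolded W_def] brelD(14)[of S st' t] by auto
  thus ?case using w by auto
 qed
 have es1: "s1 = s(|rv := (rv s)(23 := rv s 16, 19 := rv s 20, 22 := 0), clk := Suc (Suc (Suc (clk s)))|)"
  unfolding s1_def q0_def using s20 brelD(7)[OF r] by simp
 have "T (While (Op Mul (Op Sub (Get 6 (V 20)) (V 22)) (NotE (V 17))) bbody) s1 (%t. T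
  (While (Op Sub (V 16) (V 23)) (SAssign Snd 4 (SDel (Get 7 (V 23)) (SV 4)) ;; Assign 23 (Op Add (V 23) (N 1))) ;;
  Assign 20 (Op Add (V 20) (N 1))) t ?Q)"
 proof (rule T_conseq[OF loop1], goal_cases)
  case (1 u)
  from 1(1) obtain st' where w: "W (u(|clk := clk u - 1|)) st'" "0 < clk u" and ex: "bfnd st' = None --> ra u 6 i <= rv u 22"
   by (elim exE conjE)
  note w' = w(1)[unfolded W_def]
  have u: "brel S st' u" "BI S L st' i" "ALL b:{..<n} - S. blev st' b <= d" "{a : set (bQ st'). blev st' a < i} = set (bQ st)"
   "q0 <= length (bQ st')" "ALL x<q0. bQ st' ! x = bQ st ! x" using w' by simp_all
  have uk: "bkt u S st' i (rv u 22) d" by (rule bkt_cong[of _ "u(|clk := clk u - 1|)"]) (use w' in simp_all)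
  have uc: "clk u + Psi d S st' <= clk s + 4 + Psi d S st" using w'[THEN conjunct2, THEN conjunct2, THEN conjunct2, THEN conjunct2, THEN conjunct1] w(2) by simp
  have f: "rv u 20 = i" "rv u 23 = q0" "sv u Snd 4 = S - set (bQ st)" using 1(2) s20 H qe by (simp_all add: fr_def s1_def)
  note R = brelD[OF u(1)]
  have tk: "take q0 (bQ st') = bQ st" using u(5,6) unfolding q0_def by (intro nth_equalityI) auto
  show ?case
  proof (rule T_SeqI, rule T_Loop[where K = "length (bQ st') - q0" and I = "%k t. q0 + k <= length (bQ st') & rv t 23 = q0 + k &
   sv t Snd 4 = S - set (take (q0 + k) (bQ st')) & (ALL x. x ~= 4 --> sv t Snd x = sv u Snd x) & clk t = clk u + 3 * k"], goal_cases)
   case 1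
   thus ?case using f tk u(5) by simp
  next
   case (2 k t)
   thus ?case by auto
  next
   case (3 k t)
   have g: "rv t 16 = length (bQ st')" "ra t 7 = ra u 7" using 3(2) R(7) by (simp_all add: fr_def)
   have kl: "q0 + k < length (bQ st')" using 3 g by simp
   have a: "ra u 7 (q0 + k) = bQ st' ! (q0 + k)" using R(8)[OF kl] .
   have "bQ st' ! (q0 + k) : S" using R(17) kl by auto
   hence an: "bQ st' ! (q0 + k) < n" using R(20) by auto
   have kB: "Suc (q0 + k) < B" using kl R(18,19) nB by linarith
   have "S - set (take (q0 + k) (bQ st')) - {bQ st' ! (q0 + k)} = S - set (take (Suc (q0 + k)) (bQ st'))"
   using kl by (auto simp: take_Suc_conv_app_nth)
   thus ?case using 3(1) g a an kB kl by simp
  next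
   case (4 k t)
   have g: "rv t 16 = length (bQ st')" "rv t 20 = i" "rv t 2 = rv u 2" "rv t 17 = rv u 17" "rv t 18 = rv u 18" "ra t = ra u" "sa t = sa u"
   "sv t Fst = sv u Fst" "rm t = rm u"
   using 4(2) R(7) f by (simp_all add: fr_def fun_eq_iff)
   have k: "q0 + k = length (bQ st')" using 4(1,3) g by simp
   have sv: "sv t Snd 4 = S - set (bQ st')" "sv t Snd 2 = sv u Snd 2" "clk t = clk u + 3 * k" using 4(1) k by simp_all
   define t2 where "t2 = t(|rv := (rv t)(20 := Suc i), clk := Suc (Suc (clk t))|)"
   have b2: "brel S st' t2" using u(1) g sv unfolding brel_def tree_def t2_def by simp
   have lei: "ALL a:set (bQ st'). blev st' a < Suc i" using bfs_invD(13)[OF BID(1)[OF u(2)]] by (simp add: less_Suc_eq_le)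
   have last: "Binv S L d (Suc i) st' t2 & bkt t2 S st' (Suc i) 0 d" if nf': "bfnd st' = None"
   proof -
   obtain bk where bk1: "!!k. i <= k ==> k <= d ==> distinct (bk k) & set (bk k) <= {..<n} - S & length (bk k) = ra u 6 k &
   (ALL x<length (bk k). rm u 2 k x = bk k ! x)"
   and bk2: "!!k. i < k ==> k <= d ==> set (bk k) = {b : {..<n} - S. blev st' b = k}"
   and bk3: "set (drop (rv u 22) (bk i)) = {b : {..<n} - S - set (bD st'). blev st' b = i}"
   by (rule bktE[OF uk]) blast
   have "length (bk i) <= rv u 22" using bk1[of i] i ex nf' by simp
   hence e: "{b : {..<n} - S - set (bD st'). blev st' b = i} = {}" using bk3 by simp
   have BI2: "BI S L st' (Suc i)" by (rule BI_next[OF u(2) nf' e])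
   have Q2: "{a : set (bQ st'). blev st' a < Suc i} = set (bQ st')" using lei by auto
   have Db: "blev st' x <= i" if "x : set (bD st')" for x using bfs_invD(14)[OF BID(1)[OF u(2)] that] .
   have "bkt t2 S st' (Suc i) 0 d" unfolding bkt_def
   proof (rule exI[of _ bk], intro conjI allI impI)
   show "set (drop 0 (bk (Suc i))) = {b : {..<n} - S - set (bD st'). blev st' b = Suc i}"
   using bk2[of "Suc i"] i Db by force
   next
   fix k assume "Suc i <= k & k <= d"
   thus "set (bk k) <= {..<n} - S" using bk1[of k] by auto
   qed (use bk1 bk2 g in \<open>simp_all add: t2_def\<close>)
   thus ?thesis unfolding Binv_def using b2 BI2 u(3) sv Q2 by (simp add: t2_def)
   qed
   have "clk t2 + Psi d S st' <= clk s + Psi d S st + 7 + 3 * (length (bQ st') - length (bQ st))"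
   using uc sv k unfolding t2_def q0_def by simp
   moreover have "rv t2 20 = Suc i" unfolding t2_def by simp
   ultimately have "EX st'. brel S st' t2 & (ALL b:{..<n} - S. blev st' b <= d) & rv t2 20 = Suc i & BI S L st' i &
   (bfnd st' = None --> Binv S L d (Suc i) st' t2 & bkt t2 S st' (Suc i) 0 d & (ALL a:set (bQ st'). blev st' a < Suc i)) &
   length (bQ st) <= length (bQ st') & clk t2 + Psi d S st' <= clk s + Psi d S st + 7 + 3 * (length (bQ st') - length (bQ st))"
   using b2 u(2,3,5) last lei q0_def by (intro exI[of _ st']) simp
   thus ?case using g nB i by (simp add: t2_def)
  qed
 qed
 thus ?thesis unfolding blevel_def es1 by simp
qed

lemma bfs_inv_init: "common S ==> bfs_inv S (|bQ = [], bD = [], blev = f, bnxt = g, bfnd = None|) 0"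
 unfolding bfs_inv_def by simp

text \<open>The cost of one search apart from what the decrease of \<open>lsum\<close> pays; the
  part in \<open>d\<close> is for clearing buckets and for passing empty levels.\<close>

definition CB :: "nat => nat" where
 "CB d = (n + 1) * (10 * m + 100) + 11 * (d + 1)"

lemma bbfs_T:
 assumes v: "Bok S L d" and a: "ALL v<n. ra s 2 v = of_bool (v : S)" "rv s 2 = Z" "ALL v<n. ra s 5 v < (n + 2) ^ 3"
  "ALL b:{..<n} - S. ra s 5 b = L b" and d: "rv s 6 = d" "d < (n + 2) ^ 3"
 shows "T bbfs s (%t. EX st i. brel S st t & BI S L st i & (ALL b:{..<n} - S. blev st b <= d) & (bfnd st = None --> i = d) &
  (bfnd st ~= None --> i < d) & clk t + 20 * lsum d S (blev st) <= clk s + 20 * lsum d S L + CB d)" (is "T _ _ ?Q")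
proof -
 have nB: "n < B" "d + 4 < B" "2 * n + 10 < B" using B_Z LB d B_lin by linarith+
 have vl: "valid_labels S L" and Ld: "ALL b:{..<n} - S. L b <= d" using v unfolding Bok_def by blast+
 have c: "common S" using vl unfolding valid_labels_def by blast
 define st0 where "st0 = (|bQ = [], bD = [], blev = ra s 5, bnxt = ra s 8, bfnd = None|)"
 have ld: "ALL b:{..<n} - S. blev st0 b <= d" using a Ld by (simp add: st0_def)
 have BI0: "BI S L st0 0" unfolding BI_def using bfs_inv_init[OF c] a by (simp add: st0_def)
 have ls: "lsum d S (blev st0) = lsum d S L" unfolding lsum_def using a by (intro sum.cong) (auto simp: st0_def)
 have cS: "card S <= n" using card_mono[of "{..<n}" S] common_sub[OF c] by simp
 have P0: "Psi d S st0 <= (7 * m + 50) * n + 20 * lsum d S L"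
 proof -
  have "(7 * m + 30) * card S <= (7 * m + 30) * n" using cS by simp
  thus ?thesis unfolding Psi_def pot_def ls by (simp add: st0_def algebra_simps)
 qed
 show ?thesis unfolding bbfs_def
 proof (rule T_SeqI, rule T_conseq[OF bsetup_T[OF c a(1-3)]], goal_cases)
  case (1 t)
  have t: "brel S st0 t" "clk t <= clk s + (n + 1) * (3 * m + 40)" using 1(1) unfolding st0_def by blast+
  have t6: "rv t 6 = d" using 1(2) d by (simp add: fr_def)
  let ?t = "t(|sv := (sv t)(Snd := (sv t Snd)(4 := S)), clk := Suc (clk t)|)"
  have t1: "brel S st0 ?t" using t(1) unfolding brel_def tree_def by simp
  have D0: "bD st0 = []" "bQ st0 = []" "bfnd st0 = None" unfolding st0_def by simp_all
  have bf: "T bfill ?t (%t. bkt t S st0 0 0 d & clk t <= clk ?t + 8 + 3 * d + 5 * n)"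
   by (rule bfill_T[OF t1 D0(1) ld _ d(2)]) (use t6 in simp)
  have "T bfill ?t (%t. T (Assign 20 (N 0) ;; While (Op Mul (Op Sub (V 6) (V 20)) (NotE (V 17))) blevel) t
   ?Q)"
  proof (rule T_conseq[OF bf], goal_cases)
   case (1 u)
   define u2 where "u2 = u(|rv := (rv u)(20 := 0), clk := Suc (clk u)|)"
   have bu: "brel S st0 u2" by (rule brel_cong[OF t1]) (use 1(2) in \<open>simp_all add: fr_def u2_def fun_eq_iff\<close>)
   have u6: "rv u2 6 = d" "sv u2 Snd 4 = S" using 1(2) t6 by (simp_all add: fr_def u2_def)
   have bk: "bkt u2 S st0 0 0 d" by (rule bkt_cong[of _ u]) (use 1(1) in \<open>simp_all add: u2_def\<close>)
   have cu: "clk u2 <= clk t + 10 + 3 * d + 5 * n" using 1(1) by (simp add: u2_def)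
   define W where "W t st i = (brel S st t & (ALL b:{..<n} - S. blev st b <= d) & rv t 20 <= d &
   clk t + Psi d S st + 3 * (n - length (bQ st)) + 8 * (d - rv t 20) <= clk u2 + Psi d S st0 + 3 * n + 8 * d &
   (bfnd st = None --> Binv S L d i st t & bkt t S st i 0 d & (ALL a:set (bQ st). blev st a < i)) &
   (bfnd st ~= None --> BI S L st i & i < d))" for t :: st and st i
   have "T (While (Op Mul (Op Sub (V 6) (V 20)) (NotE (V 17))) blevel) u2
   ?Q"
   proof (rule T_While[where I = "%t. EX st i. W t st i" and K = "clk u2 + Psi d S st0 + 3 * n + 8 * d"], goal_cases)
   case 1
   have "Binv S L d 0 st0 u2" unfolding Binv_def using bu BI0 ld u6 D0 by (simp add: u2_def)
   hence "W u2 st0 0" unfolding W_def using bu ld bk D0 by (simp add: u2_def)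
   thus ?case by blast
   next
   case (2 t')
   then obtain st i where "W t' st i" by blast
   hence k: "clk t' + Psi d S st + 3 * (n - length (bQ st)) + 8 * (d - rv t' 20) <= clk u2 + Psi d S st0 + 3 * n + 8 * d" unfolding W_def by blast
   have f: "rv t' 6 = d" using 2(2) u6 by (simp add: fr_def)
   have "(d - rv t' 20) * (Suc 0 - rv t' 17) <= d * 1" by (intro mult_le_mono) auto
   thus ?case using k f nB by simp
   next
   case (3 t')
   then obtain st i where w: "W t' st i" by blast
   note w' = w[unfolded W_def]
   have f: "rv t' 6 = d" using 3(2) u6 by (simp add: fr_def)
   have nf: "bfnd st = None" using 3(3) w' brelD(14)[of S st t'] by (cases "bfnd st") auto
   have Bi: "Binv S L d i st t'" "bkt t' S st i 0 d" "ALL a:set (bQ st). blev st a < i" using w' nf by blast+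
   have i20: "rv t' 20 = i" using Bi(1) unfolding Binv_def by blast
   have i: "i < d" using 3(3) f i20 by simp
   have Bi2: "Binv S L d i st (tick t')" using Bi(1) unfolding Binv_def by simp
   have bk2: "bkt (tick t') S st i 0 d" by (rule bkt_cong[OF _ _ Bi(2)]) simp_all
   show ?case
   proof (rule T_conseq[OF blevel_T[OF Bi2 nf bk2 Bi(3) i d(2) vl]], goal_cases)
   case (1 x)
   from 1(1) obtain st' where x: "brel S st' x" "ALL b:{..<n} - S. blev st' b <= d" "rv x 20 = Suc i" "BI S L st' i"
   "bfnd st' = None --> Binv S L d (Suc i) st' x & bkt x S st' (Suc i) 0 d & (ALL a:set (bQ st'). blev st' a < Suc i)"
   "length (bQ st) <= length (bQ st')" "clk x + Psi d S st' <= clk (tick t') + Psi d S st + 7 + 3 * (length (bQ st') - length (bQ st))"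
   by (elim exE conjE)
   have Ql: "length (bQ st') <= n" using brelD(18,19)[OF x(1)] by linarith
   have kk: "clk t' + Psi d S st + 3 * (n - length (bQ st)) + 8 * (d - i) <= clk u2 + Psi d S st0 + 3 * n + 8 * d" using w' i20 by blast
   have "8 * (d - i) = 8 + 8 * (d - Suc i)" using i by simp
   moreover have "clk (tick t') = Suc (clk t')" by simp
   moreover have "3 * (n - length (bQ st)) = 3 * (n - length (bQ st')) + 3 * (length (bQ st') - length (bQ st))" using Ql x(6) by simp
   ultimately have cx: "clk x + Psi d S st' + 3 * (n - length (bQ st')) + 8 * (d - rv x 20) <= clk u2 + Psi d S st0 + 3 * n + 8 * d"
   using x(7) kk unfolding x(3) by linarith
   show ?case
   proof (cases "bfnd st' = None")
   case True
   hence "W x st' (Suc i)" unfolding W_def using x cx i by simp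
   thus ?thesis by blast
   next
   case False
   hence "W x st' i" unfolding W_def using x(1-4) cx i by auto
   thus ?thesis by blast
   qed
   qed
   next
   case (4 t')
   then obtain st i where w: "W t' st i" by blast
   note w' = w[unfolded W_def]
   have f: "rv t' 6 = d" using 4(2) u6 by (simp add: fr_def)
   have cl: "clk (tick t') + 20 * lsum d S (blev st) <= clk s + 20 * lsum d S L + CB d"
   proof -
   have "clk t' + Psi d S st <= clk u2 + Psi d S st0 + 3 * n + 8 * d" using w' by linarith
   moreover have "20 * lsum d S (blev st) <= Psi d S st" unfolding Psi_def by simp
   ultimately have "clk t' + 20 * lsum d S (blev st) <= clk s + (n + 1) * (3 * m + 40) + 10 + 3 * d + 5 * n + (7 * m + 50) * n + 20 * lsum d S L + 3 * n + 8 * d"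
   using cu t(2) P0 by linarith
   moreover have "(n + 1) * (3 * m + 40) + 10 + 3 * d + 5 * n + (7 * m + 50) * n + 3 * n + 8 * d + 1 <= CB d"
   unfolding CB_def by (simp add: algebra_simps)
   ultimately show ?thesis by simp
   qed
   show ?case
   proof (cases "bfnd st = None")
   case True
   hence Bi: "Binv S L d i st t'" using w' by blast
   have i20: "rv t' 20 = i" and BIi: "BI S L st i" using Bi unfolding Binv_def by blast+
   have "rv t' 17 = 0" using brelD(14)[of S st t'] w' True by simp
   hence "i = d" using 4(3) f i20 w' by simp
   thus ?thesis using BIi True w' cl by (intro exI[of _ st] exI[of _ i]) simp
   next
   case False
   thus ?thesis using w' cl by (intro exI[of _ st] exI[of _ i]) simp
   qed
   qed
   thus ?case using u2_def by simp
  qed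
  thus ?case using brelD(4)[OF t(1)] by simp
 qed
qed

text \<open>The deficit allows at most \<open>2 * d\<close> augmentations, followed by one failing
  search. Over all searches labels are raised at most \<open>n * d\<close> times, because
  augmentations do not increase \<open>lsum\<close>.\<close>

lemma phaseB_T:
 assumes c: "common S0" and a: "ALL v<n. ra s 2 v = of_bool (v : S0)" "rv s 2 = Z" "ALL v<n. ra s 5 v = 0"
  and d: "rv s 6 = d" "0 < d" "d < (n + 2) ^ 3" and opt: "!!X. common X ==> card X <= card S0 + 2 * d"
 shows "T phaseB s (%t. EX S. (ALL v<n. ra t 2 v = of_bool (v : S)) & common S & (ALL X. common X --> d * card X <= d * card S + card S) &
  (ALL v<n. ra t 5 v < (n + 2) ^ 3) & clk t <= clk s + 2 + 20 * n * d + (2 * d + 1) * (CB d + 10 * n + 14))"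
proof -
 define Y where "Y = CB d + 10 * n + 14"
 define W where "W t S L k = (common S & (ALL v<n. ra t 2 v = of_bool (v : S)) & (ALL v<n. ra t 5 v < (n + 2) ^ 3) & k <= 2 * d &
  card S = card S0 + k &
  (rv t 11 ~= 0 --> Bok S L d & (ALL b:{..<n} - S. ra t 5 b = L b) & clk t + 20 * lsum d S L <= clk s + 1 + 20 * n * d + k * Y) &
  (rv t 11 = 0 --> (ALL X. common X --> d * card X <= d * card S + card S) & clk t <= clk s + 1 + 20 * n * d + (k + 1) * Y))" for t :: st and S L k
 have "(0::nat) < (n + 2) ^ 3" by simp
 have W0: "W (s(|rv := (rv s)(11 := 1), clk := Suc (clk s)|)) S0 (%_. 0) 0"
 proof -
  have "lsum d S0 (%_. 0) <= n * d" unfolding lsum_def using card_mono[of "{..<n}" "{..<n} - S0"] by simp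
  moreover have "Bok S0 (%_. 0) d" unfolding Bok_def valid_labels_def using c by auto
  ultimately show ?thesis unfolding W_def using c a by simp
 qed
 have kY: "k * Y <= 2 * d * Y" "(k + 1) * Y <= (2 * d + 1) * Y" if "k <= 2 * d" for k using that by simp_all
 have "T (While (V 11) (bbfs ;; If (V 17) walk (Assign 11 (N 0)))) (s(|rv := (rv s)(11 := 1), clk := Suc (clk s)|))
  (%t. EX S. (ALL v<n. ra t 2 v = of_bool (v : S)) & common S & (ALL X. common X --> d * card X <= d * card S + card S) &
  (ALL v<n. ra t 5 v < (n + 2) ^ 3) & clk t <= clk s + 2 + 20 * n * d + (2 * d + 1) * Y)"
 proof (rule T_While[where I = "%t. EX S L k. W t S L k" and K = "clk s + 1 + 20 * n * d + (2 * d + 1) * Y"], goal_cases)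
  case 1
  thus ?case using W0 by blast
 next
  case (2 t)
  then obtain S L k where w: "W t S L k" by blast
  hence k: "k <= 2 * d" unfolding W_def by blast
  have "(2 * d + 1) * Y = 2 * d * Y + Y" by simp
  moreover have "clk t <= clk s + 1 + 20 * n * d + k * Y | clk t <= clk s + 1 + 20 * n * d + (k + 1) * Y"
   using w unfolding W_def by (metis add_leD1)
  ultimately have "clk t <= clk s + 1 + 20 * n * d + (2 * d + 1) * Y" using kY[OF k] by linarith
  thus ?case by simp
 next
  case (3 t)
  then obtain S L k where w: "W t S L k" by blast
  have r11: "rv t 11 ~= 0" using 3(3) by simp
  have w1: "common S" "ALL v<n. ra t 2 v = of_bool (v : S)" "ALL v<n. ra t 5 v < (n + 2) ^ 3" "k <= 2 * d" "card S = card S0 + k"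
   "Bok S L d" "ALL b:{..<n} - S. ra t 5 b = L b" "clk t + 20 * lsum d S L <= clk s + 1 + 20 * n * d + k * Y"
   using w r11 unfolding W_def by simp_all
  have f: "rv t 2 = Z" "rv t 6 = d" using 3(2) a d by (simp_all add: fr_def)
  show ?case
  proof (rule T_SeqI, rule T_conseq[OF bbfs_T[OF w1(6)]], goal_cases)
   case (7 u)
   from 7(1) obtain st i where u: "brel S st u" "BI S L st i" "ALL b:{..<n} - S. blev st b <= d" "bfnd st = None --> i = d"
   "bfnd st ~= None --> i < d" "clk u + 20 * lsum d S (blev st) <= clk (tick t) + 20 * lsum d S L + CB d" by (elim exE conjE)
   note R = brelD[OF u(1)]
   have u11: "rv u 11 ~= 0" using 7(2) r11 by (simp add: fr_def)
   show ?case
   proof (cases "bfnd st")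
   case None
   have BId: "BI S L st d" using u(2,4) None by simp
   have fin: "ALL X. common X --> d * card X <= d * card S + card S" using B_final[OF BId w1(6) _ d(2)] by blast
   have "clk u + 2 <= clk s + 1 + 20 * n * d + (k + 1) * Y" using u(6) w1(8) unfolding Y_def by (simp add: algebra_simps)
   hence "W (u(|rv := (rv u)(11 := 0), clk := Suc (Suc (clk u))|)) S L k"
   unfolding W_def using w1(1,4,5) R(5,9,10) fin by simp
   thus ?thesis using R(14) None by auto
   next
   case (Some b)
   have i: "i < d" using u(5) Some by simp
   obtain L' where L': "Bok (bwalk S st) L' d" "ALL x:{..<n} - bwalk S st. L' x = blev st x"
   "card (bwalk S st) = Suc (card S)" "lsum d (bwalk S st) L' <= lsum d S (blev st)"
   using B_augment[OF u(2) w1(6) i Some] u(3) by blast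
   have cw: "common (bwalk S st)" using L'(1) unfolding Bok_def valid_labels_def by blast
   have kl: "Suc k <= 2 * d" using opt[OF cw] L'(3) w1(5) by simp
   have bt: "brel S st (tick u)" using u(1) by simp
   have "T walk (tick u) (%t. EX S L k. W t S L k)"
   proof (rule T_conseq[OF walk_T[OF bt Some]], goal_cases)
   case (1 x)
   have g: "ra x 5 = ra u 5" "rv x 11 = rv u 11" using 1(2) by (simp_all add: fr_def)
   have "clk x + 20 * lsum d (bwalk S st) L' <= clk s + 1 + 20 * n * d + Suc k * Y"
   using 1(1)[THEN conjunct2] u(6) w1(8) L'(4) unfolding Y_def by (simp add: algebra_simps)
   hence "W x (bwalk S st) L' (Suc k)" unfolding W_def using cw 1(1) g R(9,10) kl L' w1(5) u11 by simp
   thus ?case by blast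
   qed
   thus ?thesis using R(14) Some by simp
   qed
  qed (use w1 f d in simp_all)
 next
  case (4 t)
  then obtain S L k where w: "W t S L k" by blast
  have r11: "rv t 11 = 0" using 4(3) by simp
  have w1: "common S" "ALL v<n. ra t 2 v = of_bool (v : S)" "ALL v<n. ra t 5 v < (n + 2) ^ 3" "k <= 2 * d"
   "ALL X. common X --> d * card X <= d * card S + card S" "clk t <= clk s + 1 + 20 * n * d + (k + 1) * Y"
   using w r11 unfolding W_def by blast+
  have "clk (tick t) = Suc (clk t)" by simp
  hence "clk (tick t) <= clk s + 2 + 20 * n * d + (2 * d + 1) * Y" using w1(6) kY(2)[OF w1(4)] by linarith
  thus ?case using w1 by (intro exI[of _ S]) simp
 qed
 thus ?thesis unfolding phaseB_def Y_def by simp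
qed

end

section \<open>Augmentation with sampling\<close>

context prog
begin

definition cdisc :: "nat set => nat => nat => bst => bst" where
 "cdisc S l b st = (if b : set (bD st) then st else bdisc S b l st)"

definition cproc :: "nat set => bst => nat => bst" where
 "cproc S st a = fold (cdisc S (Suc (blev st a))) (filter (%b. b ~: S & insert b (S - {a}) : J Snd) [0..<n]) st"

text \<open>The canonical search: queue elements are processed in order and their partners in
  increasing order of number. No sample occurs here, so the states to which the sampling argument
  refers are fixed before any coin is tossed.\<close>

primrec cst :: "nat set => nat => bst" where
 "cst S 0 = fold (cdisc S 0) (filter (%b. b ~: S & insert b S : J Snd) [0..<n])
  (|bQ = [], bD = [], blev = (%_. 0), bnxt = (%_. 0), bfnd = None|)"
| "cst S (Suc p) = (let st = cst S p in
  if p < length (bQ st) & bfnd st = None then cproc S st (bQ st ! p) else st)"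

text \<open>Being a function of \<open>S\<close> alone, it determines the sets of all later searches
  from the first one.\<close>

definition nextS :: "nat set => nat set" where
 "nextS S = (if bfnd (cst S n) = None then S else bwalk S (cst S n))"

lemma cdisc_D: "set (bD st) <= set (bD (cdisc S l b st))" "set (bD (cdisc S l b st)) <= insert b (set (bD st))"
 "bfnd (cdisc S l b st) = None ==> bfnd st = None & b : set (bD (cdisc S l b st))"
 "EX xs. bQ (cdisc S l b st) = bQ st @ xs"
 unfolding cdisc_def bdisc_def by (auto split: if_splits)

lemma cdisc_found: "bfnd st ~= None ==> cdisc S l b st = st"
 unfolding cdisc_def bdisc_def by auto

lemma cfold_D: "set (bD st) <= set (bD (fold (cdisc S l) xs st))"
 "bfnd (fold (cdisc S l) xs st) = None ==> bfnd st = None & set xs <= set (bD (fold (cdisc S l) xs st))"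
 "EX ys. bQ (fold (cdisc S l) xs st) = bQ st @ ys"
proof (induction xs arbitrary: st)
 case (Cons b xs)
 {
  case (1 st)
  show ?case using Cons(1)[of "cdisc S l b st"] cdisc_D(1)[of st S l b] by auto
 next
  case (2 st)
  hence f: "bfnd (fold (cdisc S l) xs (cdisc S l b st)) = None" by simp
  show ?case using Cons(2)[OF f] cdisc_D(3)[of S l b st] Cons(1)[of "cdisc S l b st"] by auto
 next
  case (3 st)
  obtain ys where ys: "bQ (fold (cdisc S l) xs (cdisc S l b st)) = bQ (cdisc S l b st) @ ys" using Cons(3) by blast
  obtain zs where "bQ (cdisc S l b st) = bQ st @ zs" using cdisc_D(4) by blast
  thus ?case using ys by simp
 }
qed simp_all

text \<open>Reached elements are ignored by \<open>cdisc\<close>, so a list that omits some of them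
  leads to the same state as a full scan. This makes the state independent of the way in which
  partners were found.\<close>

lemma cfold_filter:
 assumes "ALL x:set xs. ~ P x --> x : set (bD st)"
 shows "fold (cdisc S l) (filter P xs) st = fold (cdisc S l) xs st"
 using assms
proof (induction xs arbitrary: st)
 case (Cons b xs)
 have "ALL x:set xs. ~ P x --> x : set (bD (cdisc S l b st))" using Cons(2) cdisc_D(1)[of st S l b] by auto
 note I = Cons(1)[OF this]
 show ?case
 proof (cases "P b")
  case False
  hence "cdisc S l b st = st" using Cons(2) unfolding cdisc_def by simp
  thus ?thesis using I False by simp
 qed (use I in simp)
qed simp

lemma cdisc_lev:
 assumes i: "bfs_inv S st k" and b: "b ~: S" and a: "a : set (bQ st)"
 shows "blev (cdisc S l b st) a = blev st a"
 using bnew_set(1)[OF bfs_invD(1)[OF i], of b st] bfs_invD(3)[OF i] a b unfolding cdisc_def bdisc_def by auto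

lemma cdisc_new:
 assumes "a : set (bQ (cdisc S l b st))" "a ~: set (bQ st)"
 shows "blev (cdisc S l b st) a = l"
 using assms unfolding cdisc_def bdisc_def by (auto split: if_splits)

text \<open>Elements queued by \<open>cdisc\<close> get level \<open>l\<close>, while
  \<open>reach2\<close> for level \<open>l\<close> only speaks of queue elements below it.\<close>

lemma reach2_cdisc:
 assumes i: "bfs_inv S st l" and b: "b ~: S" and r: "reach2 S (bQ st) (blev st) x l"
 shows "reach2 S (bQ (cdisc S l b st)) (blev (cdisc S l b st)) x l"
proof -
 let ?st = "cdisc S l b st"
 have sub: "set (bQ st) <= set (bQ ?st)" using cdisc_D(4)[of S l b st] by auto
 note lv = cdisc_lev[OF i b, of _ l] and nw = cdisc_new[of _ S l b st]
 have e: "{x : set (bQ ?st). blev ?st x < k} = {x : set (bQ st). blev st x < k}" if "k <= l" for k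
  using lv nw that sub by fastforce
 show ?thesis unfolding reach2_def
 proof (intro conjI allI impI)
  show "insert x S : J Snd" if "l = 0" using r that unfolding reach2_def by blast
  fix i assume l: "l = Suc i"
  obtain a where a: "a : set (bQ st)" "blev st a = i" "insert x (S - {a}) : J Snd" using r l unfolding reach2_def by blast
  thus "EX a:set (bQ ?st). blev ?st a = i & insert x (S - {a}) : J Snd" using lv[OF a(1)] sub by (intro bexI[of _ a]) auto
  have "i <= l" using l by simp
  thus "insert x (S - {x : set (bQ ?st). blev ?st x < i}) ~: J Snd" using r l unfolding e[OF \<open>i <= l\<close>] reach2_def by blast
 qed
qed

lemma cfold_inv:
 assumes "bfs_inv S st l" "ALL b:set xs. b < n & b ~: S & (b ~: set (bD st) --> reach2 S (bQ st) (blev st) b l)"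
 shows "bfs_inv S (fold (cdisc S l) xs st) l & (ALL a:set (bQ st). blev (fold (cdisc S l) xs st) a = blev st a)"
 using assms
proof (induction xs arbitrary: st)
 case (Cons b xs)
 let ?st = "cdisc S l b st"
 have b: "b < n" "b ~: S" using Cons(3) by auto
 have i: "bfs_inv S ?st l"
 proof (cases "bfnd st = None")
  case True
  thus ?thesis using bdisc_inv[OF Cons(2) True b] Cons(2,3) unfolding cdisc_def by auto
 next
  case False
  thus ?thesis using cdisc_found[OF False] Cons(2) by simp
 qed
 have "ALL x:set xs. x < n & x ~: S & (x ~: set (bD ?st) --> reach2 S (bQ ?st) (blev ?st) x l)"
  using Cons(3) reach2_cdisc[OF Cons(2) b(2)] cdisc_D(1)[of st S l b] by auto
 note I = Cons(1)[OF i this]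
 have "set (bQ st) <= set (bQ ?st)" using cdisc_D(4)[of S l b st] by auto
 thus ?case using I cdisc_lev[OF Cons(2) b(2), of _ l] by auto
qed simp

text \<open>\<open>p\<close> counts the queue elements processed. For an unfinished search the last
  two clauses say that no arc leads from the sources or from the processed part to an unreached
  element.\<close>

definition Cinv :: "nat set => bst => nat => nat => bool" where
 "Cinv S st p l \<longleftrightarrow> bfs_inv S st l & l <= p & (bfnd st = None -->
  (ALL i<length (bQ st). p <= i --> l <= Suc (blev st (bQ st ! i))) &
  (ALL b:{..<n} - S. insert b S : J Snd --> b : set (bD st)) &
  (ALL i<p. i < length (bQ st) --> (ALL b:{..<n} - S. insert b (S - {bQ st ! i}) : J Snd --> b : set (bD st))))"

lemma CinvD:
 assumes "Cinv S st p l"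
 shows "bfs_inv S st l" "l <= p" "!!i. bfnd st = None ==> i < length (bQ st) ==> p <= i ==> l <= Suc (blev st (bQ st ! i))"
  "!!b. bfnd st = None ==> b : {..<n} - S ==> insert b S : J Snd ==> b : set (bD st)"
  "!!i b. bfnd st = None ==> i < p ==> i < length (bQ st) ==> b : {..<n} - S ==> insert b (S - {bQ st ! i}) : J Snd ==> b : set (bD st)"
 using assms unfolding Cinv_def by simp_all

lemma Cinv_step:
 assumes C: "Cinv S st p l" and p: "p < length (bQ st)" and nf: "bfnd st = None"
 shows "Cinv S (cproc S st (bQ st ! p)) (Suc p) (Suc (blev st (bQ st ! p)))"
proof -
 note D = CinvD[OF C] and I = bfs_invD[OF CinvD(1)[OF C]]
 define a where "a = bQ st ! p"
 define k where "k = blev st a"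
 define xs where "xs = filter (%b. b ~: S & insert b (S - {a}) : J Snd) [0..<n]"
 let ?st = "fold (cdisc S (Suc k)) xs st"
 have e: "cproc S st a = ?st" unfolding cproc_def xs_def k_def ..
 have aQ: "a : set (bQ st)" using p unfolding a_def by simp
 have i0: "bfs_inv S st (Suc k)" using bfs_inv_mono[OF D(1) _ nf] D(3)[OF nf p] unfolding a_def k_def by simp
 have srt: "blev st (bQ st ! i) <= blev st (bQ st ! j)" if "i <= j" "j < length (bQ st)" for i j
  using sorted_nth_mono[OF I(12), of i j] that by simp
 have r: "ALL b:set xs. b < n & b ~: S & (b ~: set (bD st) --> reach2 S (bQ st) (blev st) b (Suc k))"
 proof (intro ballI conjI impI)
  fix b assume b: "b : set xs"
  thus bn: "b < n" "b ~: S" unfolding xs_def by auto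
  assume bD: "b ~: set (bD st)"
  have nS: "insert b S ~: J Snd" using D(4)[OF nf] bn bD by blast
  \<comment> \<open>A partner on a lower level stands earlier in the queue, so \<open>b\<close>
    would have been reached when that partner was processed.\<close>
  have "insert b (S - {x : set (bQ st). blev st x < k}) ~: J Snd"
  proof
   assume "insert b (S - {x : set (bQ st). blev st x < k}) : J Snd"
   then obtain x where x: "x : set (bQ st)" "blev st x < k" "insert b (S - {x}) : J Snd"
   using matroid.swap_iff[OF matJ common_sub(2)[OF I(1)] _ nS, of "{x : set (bQ st). blev st x < k}"] bn I(3) by auto
   obtain j where j: "j < length (bQ st)" "x = bQ st ! j" using x(1) by (auto simp: in_set_conv_nth)
   have "j < p" using srt[of p j] j x(2) unfolding k_def a_def by (metis not_le_imp_less not_less)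
   thus False using D(5)[OF nf _ j(1)] j bn bD x(3) by blast
  qed
  moreover have "insert b (S - {a}) : J Snd" using b unfolding xs_def by auto
  ultimately show "reach2 S (bQ st) (blev st) b (Suc k)" unfolding reach2_def using aQ k_def by auto
 qed
 note F = cfold_inv[OF i0 r]
 obtain ys where ys: "bQ ?st = bQ st @ ys" using cfold_D(3) by blast
 have kp: "Suc k <= Suc p" using I(13)[OF aQ] D(2) unfolding k_def by simp
 have "Cinv S ?st (Suc p) (Suc k)" unfolding Cinv_def
 proof (intro conjI impI allI)
  show "bfs_inv S ?st (Suc k)" using F by blast
  show "Suc k <= Suc p" by (rule kp)
  fix i assume i: "i < length (bQ ?st)" "Suc p <= i"
  have "blev ?st (bQ ?st ! p) <= blev ?st (bQ ?st ! i)"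
   using sorted_nth_mono[OF bfs_invD(12)[OF F[THEN conjunct1]], of p i] i by simp
  moreover have "blev ?st (bQ ?st ! p) = k" using F aQ p ys unfolding k_def a_def by (simp add: nth_append)
  ultimately show "Suc k <= Suc (blev ?st (bQ ?st ! i))" by simp
 next
  assume "bfnd ?st = None"
  thus "ALL b:{..<n} - S. insert b S : J Snd --> b : set (bD ?st)"
   using D(4)[OF nf] cfold_D(1)[of st S "Suc k" xs] by blast
 next
  fix i assume f: "bfnd ?st = None" and i: "i < Suc p"
  have Qi: "bQ ?st ! i = bQ st ! i" using i p ys by (simp add: nth_append)
  show "ALL b:{..<n} - S. insert b (S - {bQ ?st ! i}) : J Snd --> b : set (bD ?st)"
  proof (cases "i = p")
   case True
   have "b : set xs" if "b : {..<n} - S" "insert b (S - {bQ st ! p}) : J Snd" for b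
   using that unfolding xs_def a_def by auto
   thus ?thesis using cfold_D(2)[OF f] True unfolding Qi by blast
  next
   case False
   hence "i < p" "i < length (bQ st)" using i p by auto
   thus ?thesis using D(5)[OF nf] cfold_D(1)[of st S "Suc k" xs] unfolding Qi by blast
  qed
 qed
 thus ?thesis using e unfolding a_def k_def by simp
qed

lemma cst_inv: "common S ==> EX l. Cinv S (cst S p) p l"
proof (induction p)
 case 0
 let ?st = "(|bQ = [], bD = [], blev = (%_. 0), bnxt = (%_. 0), bfnd = None|)"
 let ?xs = "filter (%b. b ~: S & insert b S : J Snd) [0..<n]"
 have r: "ALL b:set ?xs. b < n & b ~: S & (b ~: set (bD ?st) --> reach2 S (bQ ?st) (blev ?st) b 0)"
  unfolding reach2_def by auto
 have F: "bfs_inv S (cst S 0) 0" using cfold_inv[OF bfs_inv_init[OF 0] r] by simp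
 have "Cinv S (cst S 0) 0 0" unfolding Cinv_def
 proof (intro conjI impI F)
  assume "bfnd (cst S 0) = None"
  thus "ALL b:{..<n} - S. insert b S : J Snd --> b : set (bD (cst S 0))"
   using cfold_D(2)[of S 0 ?xs ?st] by auto
 qed auto
 thus ?case by blast
next
 case (Suc p)
 then obtain l where C: "Cinv S (cst S p) p l" by blast
 show ?case
 proof (cases "p < length (bQ (cst S p)) & bfnd (cst S p) = None")
  case True
  thus ?thesis using Cinv_step[OF C] by (auto simp: Let_def)
 next
  case False
  have "Cinv S (cst S p) (Suc p) l" unfolding Cinv_def
  proof (intro conjI impI allI)
   fix i assume f: "bfnd (cst S p) = None" "i < length (bQ (cst S p))" "Suc p <= i"
   thus "l <= Suc (blev (cst S p) (bQ (cst S p) ! i))" using False by simp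
  next
   fix i assume f: "bfnd (cst S p) = None" "i < Suc p" "i < length (bQ (cst S p))"
   hence "i < p" using False by linarith
   thus "ALL b:{..<n} - S. insert b (S - {bQ (cst S p) ! i}) : J Snd --> b : set (bD (cst S p))"
   using CinvD(5)[OF C f(1) _ f(3)] by blast
  qed (use CinvD(1,2,4)[OF C] in auto)
  thus ?thesis using False by (auto simp: Let_def)
 qed
qed

lemma cst_const:
 assumes "length (bQ (cst S p)) <= p | bfnd (cst S p) ~= None" "p <= k"
 shows "cst S k = cst S p"
 using assms(2)
proof (induction rule: dec_induct)
 case (step j)
 thus ?case using assms(1) unfolding cst.simps Let_def step(3) by auto
qed simp

text \<open>An exhausted queue is an exact cut: the queued part of \<open>S\<close> spans the
  reached elements in the first matroid, and the rest of \<open>S\<close> spans the unreached ones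
  in the second.\<close>

lemma C_opt:
 assumes C: "Cinv S st p l" and nf: "bfnd st = None" and p: "length (bQ st) <= p" and X: "common X"
 shows "card X <= card S"
proof -
 note D = CinvD[OF C] and I = bfs_invD[OF CinvD(1)[OF C]]
 have Q: "set (bQ st) : J Fst" "S - set (bQ st) : J Snd"
  using J_mono[OF common_sub(2)[OF I(1)]] I(3) by auto
 have "card X <= card (set (bQ st)) + card (S - set (bQ st))"
 proof (rule card_le_two_closures[OF X Q])
  fix x assume x: "x : X"
  hence xn: "x < n" using common_sub(1)[OF X] by auto
  show "x : M1.cl (set (bQ st)) | x : M2.cl (S - set (bQ st))"
  proof (cases "x : S")
   case True
   thus ?thesis using xn unfolding M1.cl_def M2.cl_def by auto
  next
   case xS: False
   show ?thesis
   proof (cases "x : set (bD st)")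
   case True
   hence "insert x {a : set (bQ st). blev st a <= blev st x} ~: J Fst" using I(11) nf by simp
   hence "insert x (set (bQ st)) ~: J Fst" using up2[of x _ Fst "set (bQ st)"] by blast
   thus ?thesis using xn unfolding M1.cl_def by auto
   next
   case False
   have nS: "insert x S ~: J Snd" using D(4)[OF nf] xn xS False by blast
   have "insert x (S - {a}) ~: J Snd" if "a : set (bQ st)" for a
   using that D(5)[OF nf, of _ x] xn xS False p by (auto simp: in_set_conv_nth)
   hence "insert x (S - set (bQ st)) ~: J Snd"
   using matroid.swap_iff[OF matJ common_sub(2)[OF I(1)] _ nS I(3)] xn by auto
   thus ?thesis using xn unfolding M2.cl_def by auto
   qed
  qed
 qed
 also have "... = card S" using I(3) common_sub(3)[OF I(1)]
  by (metis card_Diff_subset card_mono finite_subset le_add_diff_inverse)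
 finally show ?thesis .
qed

lemma C_aug:
 assumes C: "Cinv S st p l" and f: "bfnd st = Some b"
 shows "common (bwalk S st)" "card (bwalk S st) = Suc (card S)"
proof -
 let ?L = "capL S st l"
 note I = bfs_invD[OF CinvD(1)[OF C]]
 obtain pa pe where p: "aug_path S ?L l pa pe" "bwalk S st = (S - pa ` {..<l}) Un pe ` {..l}"
  using bwalk_aug[OF CinvD(1)[OF C] f, of ?L] unfolding capL_def by auto
 show "common (bwalk S st)" "card (bwalk S st) = Suc (card S)"
  unfolding p(2) using augment_common[OF p(1)] by auto
qed

lemma nextS_common: "common S ==> common ((nextS ^^ i) S)"
proof (induction i)
 case (Suc i)
 hence c: "common ((nextS ^^ i) S)" by blast
 obtain l where "Cinv ((nextS ^^ i) S) (cst ((nextS ^^ i) S) n) n l" using cst_inv[OF c] by blast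
 thus ?case using c C_aug(1) unfolding funpow.simps o_def nextS_def by auto
qed simp

section \<open>Full scans, stored partner lists and pointers into the sample\<close>

definition scanp :: "sexp => com" where
 "scanp e = For 27 Sz (When (NotE (Get 9 (V 27))) (When (Qry Snd (SIns (V 27) e)) (Assign 13 (V 27) ;; disc)))"

definition listp :: com where
 "listp = For 27 (Get 12 (V 29)) (Assign 13 (Get2 3 (V 29) (V 27)) ;; When (NotE (Get 9 (V 13))) disc)"

text \<open>Array \<open>13\<close> is the sample and array \<open>11\<close> gives each
  \<open>a\<close> a pointer into it. The pointer passes entries that are not unreached partners of
  \<open>a\<close>; reached elements stay reached, so it never has to go back. The remainder turns a
  draw below \<open>2 ^ m\<close> into an element number.\<close>

definition advp :: com where
 "advp = While (Op Mul (Op Sub (V 25) (Get 11 (V 28)))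
   (NotE (Op Mul (Qry Snd (SIns (Op Mod (Get 13 (Get 11 (V 28))) Sz) (SDel (V 28) (SV 2))))
   (NotE (Get 9 (Op Mod (Get 13 (Get 11 (V 28))) Sz))))))
  (Put 11 (V 28) (Op Add (Get 11 (V 28)) (N 1)))"

lemma mods_C1 [simp]:
 "mr (scanp e) = {12, 13, 14, 15, 16, 17, 18, 24, 27}" "ma (scanp e) = {5, 7, 8, 9, 14}" "mm (scanp e) = {}" "ms (scanp e) = {}"
 "mz (scanp e) = {(Fst, 3)}" "~ mo (scanp e)" "~ mt (scanp e)"
 "mr listp = {12, 13, 14, 15, 16, 17, 18, 24, 27}" "ma listp = {5, 7, 8, 9, 14}" "mm listp = {}" "ms listp = {}"
 "mz listp = {(Fst, 3)}" "~ mo listp" "~ mt listp"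
 "mr advp = {}" "ma advp = {11}" "mm advp = {}" "ms advp = {}" "mz advp = {}" "~ mo advp" "~ mt advp"
 unfolding scanp_def listp_def advp_def by auto

lemma scanp_T:
 assumes r: "brel S st s" and l: "rv s 19 = l" "l < (n + 2) ^ 3"
  and e: "!!t. sv t = sv s ==> rv t 29 = rv s 29 ==> sok e Snd t & sev e Snd t = Y"
 defines "F == %i. fold (cdisc S l) (filter (%b. b ~: S & insert b Y : J Snd) [0..<i]) st"
 shows "T (scanp e) s (%t. brel S (F n) t & clk t + pot S (F n) <= clk s + pot S st + 17 * n + 2)"
 unfolding scanp_def
proof (rule T_For[where m = n and P = "%i t. brel S (F i) t & clk t + pot S (F i) <= clk s + 1 + pot S st + 17 * i"], goal_cases)
 case 3
 have "brel S st (s(|rv := (rv s)(27 := 0), clk := Suc (clk s)|))" by (rule brel_cong[OF r]) simp_all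
 thus ?case by (simp add: F_def)
next
 case (5 i t)
 have b: "brel S (F i) t" and c: "clk t + pot S (F i) <= clk s + 1 + pot S st + 17 * i" using 5(1) by blast+
 note R = brelD[OF b]
 have i: "i < n" "i < B" using 5(4) B_Z by auto
 have FS: "F (Suc i) = (if i ~: S & insert i Y : J Snd then cdisc S l i (F i) else F i)" unfolding F_def by simp
 have f: "rv t 19 = l" "rv t 29 = rv s 29" "sv t = sv s" "rv t 27 = i" using 5(2,3) l by (simp_all add: fr_def fun_eq_iff)
 have same: ?case if "F (Suc i) = F i" "i : S Un set (bD (F i)) | insert i Y ~: J Snd"
 proof -
  have bb: "brel S (F i) (t(|clk := k, rv := (rv t)(27 := Suc i)|))" for k by (rule brel_cong[OF b]) simp_all
  show ?thesis
  proof (cases "i : S Un set (bD (F i))")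
   case True
   thus ?thesis using that f i c R(13)[OF i(1)] bb by simp
  next
   case False
   thus ?thesis using that f i c R(13)[OF i(1)] e[of "tick t"] e[of "tick (tick t)"] bb by simp
  qed
 qed
 show ?case
 proof (cases "i : S Un set (bD (F i)) | insert i Y ~: J Snd")
  case True
  moreover have "F (Suc i) = F i" using True unfolding FS cdisc_def by auto
  ultimately show ?thesis using same by blast
 next
  case False
  hence eq: "F (Suc i) = bdisc S i l (F i)" unfolding FS cdisc_def by auto
  define u where "u = t(|rv := (rv t)(13 := i), clk := Suc (Suc (Suc (Suc (clk t))))|)"
  have bu: "brel S (F i) u" by (rule brel_cong[OF b]) (simp_all add: u_def)
  have "T disc u (%t. brel S (F (Suc i)) t & clk t + pot S (F (Suc i)) <= clk u + 12 + pot S (F i))"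
   unfolding eq by (rule disc_T[OF bu]) (use False i f l in \<open>simp_all add: u_def\<close>)
  hence "T disc u (%w. brel S (F (Suc i)) (w(|rv := (rv w)(27 := Suc i), clk := Suc (clk w)|)) &
   Suc (clk w) + pot S (F (Suc i)) <= clk s + 1 + pot S st + 17 * Suc i)"
  proof (rule T_conseq, goal_cases)
   case (1 w)
   have "brel S (F (Suc i)) (w(|rv := (rv w)(27 := Suc i), clk := Suc (clk w)|))"
   by (rule brel_cong[OF 1(1)[THEN conjunct1]]) simp_all
   moreover have "clk u = clk t + 4" by (simp add: u_def)
   ultimately show ?case using 1(1) c by simp
  qed
  thus ?thesis using False i f R(13)[OF i(1)] e[of "tick t"] e[of "tick (tick t)"] by (simp add: u_def)
 qed
qed (use B_Z in simp_all)

lemma listp_T: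
 assumes r: "brel S st s" and l: "rv s 19 = l" "l < (n + 2) ^ 3" and a: "rv s 29 = a" "a < n"
  and xs: "ra s 12 a = length xs" "length xs <= n" "ALL i<length xs. rm s 3 a i = xs ! i" "ALL x:set xs. x < n & x ~: S"
 defines "F == %i. fold (cdisc S l) (take i xs) st"
 shows "T listp s (%t. brel S (F (length xs)) t & clk t + pot S (F (length xs)) <= clk s + pot S st + 17 * length xs + 2)"
 unfolding listp_def
proof (rule T_For[where m = "length xs" and P = "%i t. brel S (F i) t & clk t + pot S (F i) <= clk s + 1 + pot S st + 17 * i"], goal_cases)
 case 2
 thus ?case using xs B_Z by simp
next
 case 3
 have "brel S st (s(|rv := (rv s)(27 := 0), clk := Suc (clk s)|))" by (rule brel_cong[OF r]) simp_all
 thus ?case by (simp add: F_def)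
next
 case (4 i t)
 thus ?case using a xs B_Z by (simp add: fr_def)
next
 case (5 i t)
 have b: "brel S (F i) t" and c: "clk t + pot S (F i) <= clk s + 1 + pot S st + 17 * i" using 5(1) by blast+
 note R = brelD[OF b]
 define x where "x = xs ! i"
 have "x : set xs" using 5(4) x_def by simp
 hence x: "x < n" "x ~: S" using xs by auto
 hence x: "x < n" "x ~: S" "x < B" "i < n" "a < B" using 5(4) xs(2) B_Z a by linarith+
 have FS: "F (Suc i) = cdisc S l x (F i)" unfolding F_def x_def using 5(4) by (simp add: take_Suc_conv_app_nth)
 have f: "rv t 19 = l" "rv t 29 = a" "rv t 27 = i" "rm t 3 a i = x" using 5(2-4) l a xs x_def by (simp_all add: fr_def)
 define u where "u = t(|rv := (rv t)(13 := x), clk := Suc (Suc (Suc (clk t)))|)"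
 have bu: "brel S (F i) u" by (rule brel_cong[OF b]) (simp_all add: u_def)
 show ?case
 proof (cases "x : set (bD (F i))")
  case True
  hence eq: "F (Suc i) = F i" unfolding FS cdisc_def by simp
  have "brel S (F i) (t(|clk := k, rv := (rv t)(13 := x, 27 := Suc i)|))" for k by (rule brel_cong[OF b]) simp_all
  thus ?thesis using f x c R(13)[OF x(1)] True unfolding eq by (simp add: u_def)
 next
  case False
  hence eq: "F (Suc i) = bdisc S x l (F i)" unfolding FS cdisc_def by auto
  have "T disc u (%t. brel S (F (Suc i)) t & clk t + pot S (F (Suc i)) <= clk u + 12 + pot S (F i))"
   unfolding eq by (rule disc_T[OF bu]) (use False x f l in \<open>simp_all add: u_def\<close>)
  hence "T disc u (%w. brel S (F (Suc i)) (w(|rv := (rv w)(27 := Suc i), clk := Suc (clk w)|)) &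
   Suc (clk w) + pot S (F (Suc i)) <= clk s + 1 + pot S st + 17 * Suc i)"
  proof (rule T_conseq, goal_cases)
   case (1 w)
   have "brel S (F (Suc i)) (w(|rv := (rv w)(27 := Suc i), clk := Suc (clk w)|))"
   by (rule brel_cong[OF 1(1)[THEN conjunct1]]) simp_all
   moreover have "clk u = clk t + 3" by (simp add: u_def)
   ultimately show ?case using 1(1) c by simp
  qed
  thus ?thesis using False x f R(13)[OF x(1)] by (simp add: u_def)
 qed
qed simp_all

definition hit :: "nat set => bst => (nat => nat) => nat => nat => bool" where
 "hit S st ky a k \<longleftrightarrow> ky k ~: S Un set (bD st) & insert (ky k) (S - {a}) : J Snd"

lemma advp_T:
 assumes r: "brel S st s" and a: "rv s 28 = a" "a : S" and q: "rv s 25 = q" "q + 1 < B" and w: "ra s 11 a = w0" "w0 <= q"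
  and ky: "ALL k<q. ra s 13 k mod n = ky k"
 shows "T advp s (%t. EX w. ra t 11 = (ra s 11)(a := w) & w0 <= w & w <= q & (ALL k. w0 <= k & k < w --> ~ hit S st ky a k) &
  (w < q --> hit S st ky a w) & clk t = clk s + 1 + 2 * (w - w0))"
proof -
 note R = brelD[OF r]
 have an: "a < n" "a < B" "0 < n" using a R(20) B_Z by auto
 have b01: "(1 - x * (1 - y)) = of_bool (~ (x = 1 & y = 0))" if "x <= 1" "y <= 1" for x y :: nat
  using that by (cases x; cases y) auto
 show ?thesis unfolding advp_def
 proof (rule T_Loop[where K = q and I = "%k t. w0 + k <= q & ra t 11 = (ra s 11)(a := w0 + k) & (ALL i. w0 <= i & i < w0 + k --> ~ hit S st ky a i) &
   clk t = clk s + 2 * k"], goal_cases)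
  case 1
  thus ?case using w by auto
 next
  case (2 k t)
  have f: "rv t 25 = q" "rv t 28 = a" using 2(2) a q by (simp_all add: fr_def)
  have "ra t 11 a = w0 + k" "w0 + k <= q" using 2(1) by simp_all
  moreover have "of_bool z * (Suc 0 - y) < B" for z and y :: nat
  proof -
   have "of_bool z * (Suc 0 - y) <= 1" by (cases z) auto
   thus ?thesis using q by linarith
  qed
  moreover have "(q - (w0 + k)) * (Suc 0 - y) < B" for y :: nat
  proof -
   have "(q - (w0 + k)) * (Suc 0 - y) <= q * 1" by (intro mult_le_mono) auto
   thus ?thesis using q by linarith
  qed
  moreover have "x mod n < n" "x mod n < B" for x using an B_Z less_trans[of "x mod n" n B] by auto
  ultimately show ?case using f an q by simp
 next
  case (3 k t)
  have f: "rv t 25 = q" "rv t 28 = a" "sv t = sv s" "ra t 13 = ra s 13" "ra t 9 = ra s 9" using 3(2) a q by (simp_all add: fr_def fun_eq_iff)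
  have g: "ra t 11 a = w0 + k" "ra t 11 = (ra s 11)(a := w0 + k)" "w0 + k < q" using 3(1,3) f by auto
  have km: "ra s 13 (w0 + k) mod n = ky (w0 + k)" "ky (w0 + k) < n" using ky g(3) an by (simp, metis mod_less_divisor)
  have "~ hit S st ky a (w0 + k)" using 3(3) f g km R(4) R(13)[OF km(2)] unfolding hit_def by (auto split: if_splits)
  hence "ALL i. w0 <= i & i < Suc (w0 + k) --> ~ hit S st ky a i" using 3(1) by (auto simp: less_Suc_eq)
  thus ?case using f g an q 3(1) by simp
 next
  case (4 k t)
  have f: "rv t 25 = q" "rv t 28 = a" "sv t = sv s" "ra t 13 = ra s 13" "ra t 9 = ra s 9" using 4(2) a q by (simp_all add: fr_def fun_eq_iff)
  have g: "ra t 11 a = w0 + k" "ra t 11 = (ra s 11)(a := w0 + k)" using 4(1) by auto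
  have "hit S st ky a (w0 + k)" if "w0 + k < q"
  proof -
   have km: "ra s 13 (w0 + k) mod n = ky (w0 + k)" "ky (w0 + k) < n" using ky that an by (simp, metis mod_less_divisor)
   show ?thesis using 4(3) that f g km R(4) R(13)[OF km(2)] unfolding hit_def
   by (cases "insert (ky (w0 + k)) (S - {a}) : J Snd"; cases "ky (w0 + k) : S Un set (bD st)") simp_all
  qed
  thus ?case using 4(1) g by (intro exI[of _ "w0 + k"]) simp
 qed
qed

end

context prog
begin

text \<open>Elements of \<open>S\<close> whose pointer arrives at the end of the sample are made
  ready together. They form the active set of a tree, and every unreached element enumerates its
  partners among them, which are then activated again for the next element. The lists cost one pass
  plus a tree search per entry.\<close>

definition batchp :: com where
 "batchp = tinit Snd ;;
  For 28 Sz (When (Get 2 (V 28)) (When (NotE (Get 10 (V 28))) (advp ;;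
   When (NotE (Op Sub (V 25) (Get 11 (V 28)))) (Assign 12 (V 28) ;; tupd Snd False ;; Put 10 (V 28) (N 1))))) ;;
  For 27 Sz (When (NotE (Get 9 (V 27))) (Assign 13 (V 27) ;; enum Snd ;;
   For 24 (V 15) (Assign 12 (Get 14 (V 24)) ;; Put2 3 (V 12) (Get 12 (V 12)) (V 13) ;;
   Put 12 (V 12) (Op Add (Get 12 (V 12)) (N 1)) ;; tupd Snd False)))"

definition popp :: com where
 "popp = Assign 29 (Get 7 (V 26)) ;; Assign 28 (V 29) ;; Assign 19 (Op Add (Get 5 (V 29)) (N 1)) ;;
  When (NotE (Get 10 (V 28))) (advp ;; When (NotE (Op Sub (V 25) (Get 11 (V 28)))) batchp) ;;
  If (Get 10 (V 29)) listp (scanp (SDel (V 29) (SV 2))) ;; Assign 26 (Op Add (V 26) (N 1))"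

definition cbfs :: com where
 "cbfs = For 7 Sz (Put 5 (V 7) (N 0) ;; Put 10 (V 7) (N 0) ;; Put 11 (V 7) (N 0) ;; Put 12 (V 7) (N 0)) ;;
  bsetup ;; Assign 19 (N 0) ;; scanp (SV 2) ;; Assign 26 (N 0) ;;
  While (Op Mul (Op Sub (V 16) (V 26)) (NotE (V 17))) popp"

definition phaseC :: com where
 "phaseC = Assign 11 (N 1) ;; While (V 11) (cbfs ;; If (V 17) walk (Assign 11 (N 0)))"

lemma mods_C [simp]:
 "mr batchp = {7, 12, 13, 14, 15, 24, 27, 28}" "ma batchp = {10, 11, 12, 14}" "mm batchp = {3}" "ms batchp = {}"
 "mz batchp = {(Snd, 3)}" "~ mo batchp" "~ mt batchp"
 "mr popp = {7, 12, 13, 14, 15, 16, 17, 18, 19, 24, 26, 27, 28, 29}" "ma popp = {5, 7, 8, 9, 10, 11, 12, 14}" "mm popp = {3}" "ms popp = {}"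
 "mz popp = {(Fst, 3), (Snd, 3)}" "~ mo popp" "~ mt popp"
 "mr cbfs = {7, 12, 13, 14, 15, 16, 17, 18, 19, 24, 26, 27, 28, 29}" "ma cbfs = {5, 7, 8, 9, 10, 11, 12, 14}" "mm cbfs = {3}"
 "ms cbfs = {(Fst, 2), (Snd, 2)}" "mz cbfs = {(Fst, 3), (Snd, 3)}" "~ mo cbfs" "~ mt cbfs"
 "mr phaseC = {7, 11, 12, 13, 14, 15, 16, 17, 18, 19, 21, 24, 26, 27, 28, 29}" "ma phaseC = {2, 5, 7, 8, 9, 10, 11, 12, 14}" "mm phaseC = {3}"
 "ms phaseC = {(Fst, 2), (Snd, 2)}" "mz phaseC = {(Fst, 3), (Snd, 3)}" "~ mo phaseC" "~ mt phaseC"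
 unfolding phaseC_def cbfs_def popp_def batchp_def by auto

text \<open>\<open>D\<close> is the set reached when the list was made. Entries reached later stay
  in the list and are skipped when it is read.\<close>

definition cl2 :: "nat set => nat set => nat => nat => nat list" where
 "cl2 S D a i = filter (%b. b ~: D) (filter (%b. b ~: S & insert b (S - {a}) : J Snd) [0..<i])"

definition und :: "nat set => bst => (nat => nat) => nat => nat set" where
 "und S st ky q = ky ` {..<q} - S - set (bD st)"

definition rdyP :: "nat set => bst => nat => st => nat => bool" where
 "rdyP S st Ld t a \<longleftrightarrow> ra t 10 a = 1 & (EX D<=set (bD st). length (cl2 S D a n) <= Ld & ra t 12 a = length (cl2 S D a n) &
  (ALL i<length (cl2 S D a n). rm t 3 a i = cl2 S D a n ! i))"

text \<open>\<open>u\<close> is the number of unreached sample elements at the last batch. An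
  unready element without a hit is possible only after that number has dropped, so the next batch
  can be charged to the drop.\<close>

definition unrP :: "nat set => bst => (nat => nat) => nat => nat => st => nat => bool" where
 "unrP S st ky q u t a \<longleftrightarrow> ra t 10 a = 0 & ra t 12 a = 0 & ra t 11 a <= q & (ALL k<ra t 11 a. ~ hit S st ky a k) &
  ((EX k<q. hit S st ky a k) | card (und S st ky q) < u)"

definition Crel :: "nat set => bst => (nat => nat) => nat => nat => nat => st => bool" where
 "Crel S st ky q Ld u t \<longleftrightarrow> brel S st t & rv t 25 = q & (ALL k<q. ra t 13 k mod n = ky k) & card (und S st ky q) <= u &
  (ALL a:S. rdyP S st Ld t a | unrP S st ky q u t a)"

lemma CrelD:
 assumes "Crel S st ky q Ld u t"
 shows "brel S st t" "rv t 25 = q" "ALL k<q. ra t 13 k mod n = ky k" "card (und S st ky q) <= u"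
  "!!a. a : S ==> rdyP S st Ld t a | unrP S st ky q u t a"
 using assms unfolding Crel_def by simp_all

lemma cl2_length: "length (cl2 S D a i) <= i"
 unfolding cl2_def by (metis (no_types, lifting) diff_zero length_filter_le length_upt order_trans)

lemma und_fin: "finite (und S st ky q)" "card (und S st ky q) <= q"
proof -
 show "finite (und S st ky q)" unfolding und_def by simp
 have "card (und S st ky q) <= card (ky ` {..<q})" unfolding und_def by (intro card_mono) auto
 also have "... <= q" using card_image_le[of "{..<q}" ky] by simp
 finally show "card (und S st ky q) <= q" .
qed

lemma und_drop:
 assumes "set (bD st) <= set (bD st')" "k < q" "hit S st ky a k" "~ hit S st' ky a k"
 shows "card (und S st' ky q) < card (und S st ky q)"
proof (rule psubset_card_mono[OF und_fin(1)])
 have "ky k : und S st ky q" "ky k ~: und S st' ky q" using assms unfolding hit_def und_def by auto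
 moreover have "und S st' ky q <= und S st ky q" using assms(1) unfolding und_def by auto
 ultimately show "und S st' ky q \<subset> und S st ky q" by blast
qed

lemma und_mono: "set (bD st) <= set (bD st') ==> card (und S st' ky q) <= card (und S st ky q)"
 by (rule card_mono[OF und_fin(1)]) (auto simp: und_def)

text \<open>If the hit of an unready element disappears, the sample element in question has been
  reached, so the number of unreached ones has fallen below \<open>u\<close>.\<close>

lemma Crel_mono:
 assumes C: "Crel S st ky q Ld u s" and D: "set (bD st) <= set (bD st')" and b: "brel S st' t"
  and e: "rv t 25 = rv s 25" "ra t 10 = ra s 10" "ra t 11 = ra s 11" "ra t 12 = ra s 12" "ra t 13 = ra s 13" "rm t 3 = rm s 3"
 shows "Crel S st' ky q Ld u t"
proof -
 note CD = CrelD[OF C]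
 have "rdyP S st' Ld t a | unrP S st' ky q u t a" if a: "a : S" for a
 proof (cases "rdyP S st Ld s a")
  case True
  hence "rdyP S st' Ld t a" unfolding rdyP_def e using D by blast
  thus ?thesis by blast
 next
  case False
  hence n: "unrP S st ky q u s a" using CD(5)[OF a] by blast
  have h: "~ hit S st ky a k ==> ~ hit S st' ky a k" for k using D unfolding hit_def by auto
  have "(EX k<q. hit S st' ky a k) | card (und S st' ky q) < u"
   using n und_drop[OF D, of _ q S ky a] und_mono[OF D, of S ky q] CD(4) unfolding unrP_def by (meson le_less_trans less_le_trans)
  thus ?thesis using n h unfolding unrP_def e by blast
 qed
 thus ?thesis unfolding Crel_def using b CD(2-4) e und_mono[OF D, of S ky q] by simp
qed

definition wsum :: "nat set => nat => st => nat" where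
 "wsum S q t = (SUM a:S. q - ra t 11 a)"

definition ur :: "nat set => st => nat" where
 "ur S t = card {a : S. ra t 10 a = 0}"

lemma wsum_adv:
 assumes "finite S" "a : S" "ra t 11 = (ra s 11)(a := w)" "ra s 11 a <= w" "w <= q"
 shows "wsum S q t + (w - ra s 11 a) = wsum S q s"
proof -
 have "wsum S q t = (q - w) + (SUM x:S - {a}. q - ra s 11 x)"
  unfolding wsum_def using assms by (subst sum.remove[of _ a]) (auto intro!: sum.cong)
 moreover have "wsum S q s = (q - ra s 11 a) + (SUM x:S - {a}. q - ra s 11 x)"
  unfolding wsum_def using assms by (subst sum.remove[of _ a]) auto
 ultimately show ?thesis using assms by simp
qed

text \<open>\<open>CbT\<close> is the cost of a batch without pointer moves and list entries;
  \<open>CeT\<close> pays for one list entry, and \<open>CsT\<close>, defined later, for a full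
  scan.\<close>

definition CbT :: nat where "CbT = (n + 1) * (3 * m + 50)"

definition CeT :: nat where "CeT = 10 * m + 40"

lemma mark_T:
 assumes C: "Crel S st ky q Ld u s" and q: "q + 1 < B"
 defines "nh == %a. ALL k<q. ~ hit S st ky a k"
 shows "T (tinit Snd ;; For 28 Sz (When (Get 2 (V 28)) (When (NotE (Get 10 (V 28))) (advp ;;
   When (NotE (Op Sub (V 25) (Get 11 (V 28)))) (Assign 12 (V 28) ;; tupd Snd False ;; Put 10 (V 28) (N 1)))))) s
  (%t. brel S st t & (ALL a:S. ra t 10 a = (if ra s 10 a = 0 & nh a then 1 else ra s 10 a)) &
   (ALL a:S. ra s 10 a = 0 --> ra t 11 a <= q & (ALL k<ra t 11 a. ~ hit S st ky a k)) &
   tree t Snd S {a : S. ra s 10 a = 0 & nh a} & clk t + 2 * wsum S q t <= clk s + 2 * wsum S q s + 4 + 6 * Z + (3 * m + 14) * n)"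
proof -
 note CD = CrelD[OF C] and R = brelD[OF CrelD(1)[OF C]]
 define W where "W i t = ((ALL a:S. ra t 10 a = (if a < i & ra s 10 a = 0 & nh a then 1 else ra s 10 a)) &
   (ALL a:S. ra s 10 a = 0 --> ra t 11 a <= q & (ALL k<ra t 11 a. ~ hit S st ky a k)) &
   tree t Snd S {a : S. a < i & ra s 10 a = 0 & nh a} &
   clk t + 2 * wsum S q t <= clk s + 2 * wsum S q s + 3 + 6 * Z + (3 * m + 14) * i)" for i :: nat and t :: st
 have s10: "ra s 10 a = 0 | ra s 10 a = 1" if "a : S" for a using CD(5)[OF that] unfolding rdyP_def unrP_def by auto
 have W11: "ra s 11 a <= q & (ALL k<ra s 11 a. ~ hit S st ky a k)" if "a : S" "ra s 10 a = 0" for a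
  using CD(5)[OF that(1)] that(2) unfolding rdyP_def unrP_def by auto
 show ?thesis
 proof (rule T_SeqI, rule T_conseq[OF tinit_T[OF R(2,4,20)]], goal_cases)
  case (1 s')
  have tr: "tree s' Snd S {}" and cs: "clk s' <= clk s + 2 + 6 * Z" using 1(1) by blast+
  have fs: "ra s' = ra s" "rv s' 25 = q" "sv s' = sv s" "sa s' Fst = sa s Fst" "rv s' 2 = Z" "rv s' 16 = rv s 16" "rv s' 17 = rv s 17" "rv s' 18 = rv s 18"
   using 1(2) CD(2) R(2) by (simp_all add: fr_def fun_eq_iff)
  have ws: "wsum S q s' = wsum S q s" unfolding wsum_def fs ..
  have bs: "brel S st s'" by (rule brel_cong[OF CD(1)]) (simp_all add: fs R(2))
  show ?case
  proof (rule T_For[where m = n and P = W], goal_cases)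
   case 3
   have "{a : S. a < 0 & ra s 10 a = 0 & nh a} = {}" by simp
   thus ?case unfolding W_def using tr cs ws W11 by (simp add: fs wsum_def)
  next
   case (5 i t)
   have i: "i < n" "i < B" "rv t 28 = i" using 5(3,4) B_Z by auto
   have f: "ra t 2 = ra s 2" "ra t 5 = ra s 5" "ra t 7 = ra s 7" "ra t 8 = ra s 8" "ra t 9 = ra s 9" "ra t 13 = ra s 13" "rv t 25 = q" "sv t = sv s"
   "sa t Fst = sa s Fst" "rv t 2 = Z" "rv t 16 = rv s 16" "rv t 17 = rv s 17" "rv t 18 = rv s 18"
   using 5(2) fs by (simp_all add: fr_def fun_eq_iff)
   have bt: "brel S st t" by (rule brel_cong[OF CD(1)]) (simp_all add: f R(2))
   note w = 5(1)[unfolded W_def]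
   have w1: "ra t 10 a = (if a < i & ra s 10 a = 0 & nh a then 1 else ra s 10 a)" if "a : S" for a using w that by blast
   have w2: "ra t 11 a <= q & (ALL k<ra t 11 a. ~ hit S st ky a k)" if "a : S" "ra s 10 a = 0" for a using w that by blast
   have w3: "tree t Snd S {a : S. a < i & ra s 10 a = 0 & nh a}" using w by blast
   have w4: "clk t + 2 * wsum S q t <= clk s + 2 * wsum S q s + 3 + 6 * Z + (3 * m + 14) * i" using w by blast
   have rec: "a < Suc i & Pp \<longleftrightarrow> (a < i & Pp) | (a = i & Pp)" for a Pp by auto
   have skip: "W (Suc i) (t(|rv := f', clk := k|))" if "i ~: S | ra s 10 i = 1" "k <= clk t + 4" for k f'
   proof -
   have e: "{a : S. a < Suc i & ra s 10 a = 0 & nh a} = {a : S. a < i & ra s 10 a = 0 & nh a}" using that by (auto simp: less_Suc_eq)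
   have "ra t 10 a = (if a < Suc i & ra s 10 a = 0 & nh a then 1 else ra s 10 a)" if "a : S" for a
   using w1[OF that] \<open>i ~: S | _\<close> that by (auto simp: less_Suc_eq)
   thus ?thesis unfolding W_def e using w2 w3 w4 that(2) by (simp add: wsum_def)
   qed
   show ?case
   proof (cases "i : S & ra s 10 i = 0")
   case False
   hence o: "i ~: S | ra s 10 i = 1" using s10 by blast
   have t10: "i : S ==> ra t 10 i = 1" using w1[of i] False s10[of i] by auto
   show ?thesis using R(5)[OF i(1)] f(1) i skip[OF o] t10 by (cases "i : S") simp_all
   next
   case True
   hence iS: "i : S" and i0: "ra s 10 i = 0" by auto
   have t10: "ra t 10 i = 0" using w1[OF iS] i0 by simp
   define t1 where "t1 = t(|clk := Suc (Suc (Suc (clk t)))|)"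
   have b1: "brel S st t1" using bt unfolding t1_def by simp
   have av: "T advp t1 (%t'. EX w. ra t' 11 = (ra t1 11)(i := w) & ra t1 11 i <= w & w <= q & (ALL k. ra t1 11 i <= k & k < w --> ~ hit S st ky i k) &
   (w < q --> hit S st ky i w) & clk t' = clk t1 + 1 + 2 * (w - ra t1 11 i))"
   by (rule advp_T[OF b1 _ iS _ q refl]) (use i f w2[OF iS i0] CD(3) in \<open>simp_all add: t1_def\<close>)
   have "T advp t1 (%x. T (When (NotE (Op Sub (V 25) (Get 11 (V 28)))) (Assign 12 (V 28) ;; tupd Snd False ;; Put 10 (V 28) (N 1))) x
   (%y. W (Suc i) (y(|rv := (rv y)(28 := Suc i), clk := Suc (clk y)|))))"
   proof (rule T_conseq[OF av], goal_cases)
   case (1 x)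
   from 1(1) obtain v where v: "ra x 11 = (ra t1 11)(i := v)" "ra t1 11 i <= v" "v <= q" "ALL k. ra t1 11 i <= k & k < v --> ~ hit S st ky i k"
   "v < q --> hit S st ky i v" "clk x = clk t1 + 1 + 2 * (v - ra t1 11 i)" by (elim exE conjE)
   have g: "rv x = rv t" "sa x = sa t" "ra x 10 = ra t 10" using 1(2) by (simp_all add: fr_def fun_eq_iff t1_def)
   have wx: "wsum S q x + (v - ra t1 11 i) = wsum S q t" using wsum_adv[OF R(21) iS v(1,2,3)] by (simp add: wsum_def t1_def)
   have cx: "clk x + 2 * wsum S q x = clk t + 4 + 2 * wsum S q t" using v(6) wx by (simp add: t1_def)
   have bad: "~ hit S st ky i k" if "k < v" for k using v(4) w2[OF iS i0] that by (cases "k < ra t1 11 i") (auto simp: t1_def)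
   have x2: "ra x 11 a <= q & (ALL k<ra x 11 a. ~ hit S st ky a k)" if "a : S" "ra s 10 a = 0" for a
   using v(1,3) bad w2[OF that] by (simp add: t1_def)
   have nhi: "nh i \<longleftrightarrow> v = q" unfolding nh_def using v(3,5) bad by (auto simp: le_less)
   have x11: "ra x 11 i = v" using v(1) by simp
   show ?case
   proof (cases "v = q")
   case False
   hence lt: "v < q" using v(3) by simp
   have e: "{a : S. a < Suc i & ra s 10 a = 0 & nh a} = {a : S. a < i & ra s 10 a = 0 & nh a}" using nhi False by (auto simp: less_Suc_eq)
   have a10: "ra x 10 a = (if a < Suc i & ra s 10 a = 0 & nh a then 1 else ra s 10 a)" if "a : S" for a
   unfolding g using w1[OF that] nhi False by (auto simp: less_Suc_eq)
   have "W (Suc i) (x(|rv := (rv x)(28 := Suc i), clk := Suc (Suc (clk x))|))"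
   unfolding W_def e using a10 x2 w3 w4 cx tree_cong[of x Snd t] g by (simp add: wsum_def)
   thus ?thesis using g i f lt x11 by simp
   next
   case True
   define x1 where "x1 = x(|rv := (rv x)(12 := i), clk := Suc (Suc (clk x))|)"
   have tu: "T (tupd Snd False) x1 (%y. tree y Snd S (insert i {a : S. a < i & ra s 10 a = 0 & nh a}) & clk y <= clk x1 + 3 * m + 5)"
   using tupd_tree[of x1 i Snd S "{a : S. a < i & ra s 10 a = 0 & nh a}" False] g f w3 iS tree_cong[of x Snd t] unfolding x1_def by simp
   have e: "insert i {a : S. a < i & ra s 10 a = 0 & nh a} = {a : S. a < Suc i & ra s 10 a = 0 & nh a}"
   using nhi True iS i0 by (auto simp: less_Suc_eq)
   have "T (tupd Snd False) x1 (%y. T (Put 10 (V 28) (N 1)) y (%y. W (Suc i) (y(|rv := (rv y)(28 := Suc i), clk := Suc (clk y)|))))"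
   proof (rule T_conseq[OF tu], goal_cases)
   case (1 y)
   have y: "ra y = ra x" "rv y 28 = i" using 1(2) g i by (simp_all add: fr_def fun_eq_iff x1_def)
   have a10: "((ra x 10)(i := 1)) a = (if a < Suc i & ra s 10 a = 0 & nh a then 1 else ra s 10 a)" if "a : S" for a
   unfolding g using w1[OF that] nhi True iS i0 by (auto simp: less_Suc_eq)
   have "clk y <= clk x + 3 * m + 7" using 1(1) by (simp add: x1_def)
   hence c: "Suc (Suc (clk y)) + 2 * wsum S q x <= clk s + 2 * wsum S q s + 3 + 6 * Z + (3 * m + 14) * Suc i" using cx w4 by simp
   have "W (Suc i) (y(|ra := (ra y)(10 := (ra y 10)(i := 1)), rv := (rv y)(28 := Suc i), clk := Suc (Suc (clk y))|))"
   unfolding W_def using a10 x2 1(1) c y e by (simp add: wsum_def)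
   thus ?case using y i by simp
   qed
   thus ?thesis using g i f True x11 by (simp add: x1_def)
   qed
   qed
   thus ?thesis using R(5)[OF i(1)] f(1) i iS t10 by (simp add: t1_def)
   qed
  next
   case (6 t)
   have f: "ra t 2 = ra s 2" "ra t 5 = ra s 5" "ra t 7 = ra s 7" "ra t 8 = ra s 8" "ra t 9 = ra s 9" "sv t = sv s"
   "sa t Fst = sa s Fst" "rv t 2 = Z" "rv t 16 = rv s 16" "rv t 17 = rv s 17" "rv t 18 = rv s 18"
   using 6(2) fs by (simp_all add: fr_def fun_eq_iff)
   have bt: "brel S st (tick t)" by (rule brel_cong[OF CD(1)]) (simp_all add: f R(2))
   note w = 6(1)[unfolded W_def]
   have an: "a < n" if "a : S" for a using R(20) that by auto
   have e: "{a : S. a < n & ra s 10 a = 0 & nh a} = {a : S. ra s 10 a = 0 & nh a}" using an by auto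
   have "ALL a:S. ra t 10 a = (if ra s 10 a = 0 & nh a then 1 else ra s 10 a)" using w an by simp
   moreover have "clk (tick t) + 2 * wsum S q (tick t) <= clk s + 2 * wsum S q s + 4 + 6 * Z + (3 * m + 14) * n" using w by (simp add: wsum_def)
   moreover have "tree (tick t) Snd S {a : S. ra s 10 a = 0 & nh a}" using w e by simp
   ultimately show ?case using bt w by simp
  qed (use B_Z in simp_all)
 qed
qed

lemma cl2_Suc: "cl2 S D a (Suc i) = cl2 S D a i @ (if i ~: S & i ~: D & insert i (S - {a}) : J Snd then [i] else [])"
 unfolding cl2_def by simp

lemma fill_T:
 assumes b: "brel S st s" and R: "tree s Snd S R" and nf: "ALL b:{..<n} - S - set (bD st). insert b S ~: J Snd"
  and z: "ALL a:R. ra s 12 a = 0"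
 defines "c == cl2 S (set (bD st))"
 shows "T (For 27 Sz (When (NotE (Get 9 (V 27))) (Assign 13 (V 27) ;; enum Snd ;;
   For 24 (V 15) (Assign 12 (Get 14 (V 24)) ;; Put2 3 (V 12) (Get 12 (V 12)) (V 13) ;;
   Put 12 (V 12) (Op Add (Get 12 (V 12)) (N 1)) ;; tupd Snd False)))) s
  (%t. (ALL a:R. ra t 12 a = length (c a n) & (ALL i<length (c a n). rm t 3 a i = c a n ! i)) &
   (ALL a. a ~: R --> ra t 12 a = ra s 12 a & rm t 3 a = rm s 3 a) & clk t <= clk s + 2 + 10 * n + CeT * (SUM a:R. length (c a n)))"
proof -
 note Rb = brelD[OF b]
 have RS: "R <= S" "finite R" "R <= {..<n}" using R Rb(20,21) finite_subset unfolding tree_def by auto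
 define W where "W i t = ((ALL a:R. ra t 12 a = length (c a i) & (ALL k<length (c a i). rm t 3 a k = c a i ! k)) &
   (ALL a. a ~: R --> ra t 12 a = ra s 12 a & rm t 3 a = rm s 3 a) & tree t Snd S R &
   clk t <= clk s + 1 + 10 * i + CeT * (SUM a:R. length (c a i)))" for i :: nat and t :: st
 show ?thesis
 proof (rule T_For[where m = n and P = W], goal_cases)
  case 3
  show ?case unfolding W_def using z R by (simp add: c_def cl2_def)
 next
  case (5 i t)
  have i: "i < n" "i < B" "rv t 27 = i" using 5(3,4) B_Z by auto
  have f: "ra t 9 = ra s 9" "rv t 2 = Z" using 5(2) Rb(2) by (simp_all add: fr_def)
  note w = 5(1)[unfolded W_def]
  have w1: "ra t 12 a = length (c a i)" "!!k. k < length (c a i) ==> rm t 3 a k = c a i ! k" if "a : R" for a using w that by blast+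
  have w2: "ra t 12 a = ra s 12 a" "rm t 3 a = rm s 3 a" if "a ~: R" for a using w that by blast+
  have w3: "tree t Snd S R" using w by blast
  have w4: "clk t <= clk s + 1 + 10 * i + CeT * (SUM a:R. length (c a i))" using w by blast
  show ?case
  proof (cases "i : S Un set (bD st)")
   case True
   hence e: "c a (Suc i) = c a i" for a unfolding c_def cl2_Suc by auto
   have "W (Suc i) (t(|rv := (rv t)(27 := Suc i), clk := Suc (Suc (Suc (clk t)))|))" unfolding W_def e using w1 w2 w3 w4 by simp
   thus ?thesis using True i f Rb(13)[OF i(1)] by simp
  next
   case False
   define L where "L = sorted_list_of_set (circ Snd S i Int R)"
   have L: "set L = circ Snd S i Int R" "distinct L" unfolding L_def using RS by auto
   have LR: "set L <= R" using L by blast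
   have e: "c a (Suc i) = c a i @ (if a : set L then [i] else [])" if "a : R" for a
   unfolding c_def cl2_Suc L circ_def using False RS that by auto
   have lenL: "length L <= n" using distinct_card[OF L(2)] card_mono[of "{..<n}" "set L"] LR RS by auto
   \<comment> \<open>Element \<open>i\<close> is appended to the lists of exactly the elements
     enumerated in \<open>L\<close>, so the number of tree searches equals the number of new
     entries.\<close>
   have sm: "(SUM a:R. length (c a (Suc i))) = (SUM a:R. length (c a i)) + length L"
   proof -
   have "(SUM a:R. length (c a (Suc i))) = (SUM a:R. length (c a i) + of_bool (a : set L))" using e by (intro sum.cong) auto
   also have "... = (SUM a:R. length (c a i)) + card (R Int set L)" using RS by (simp add: sum.distrib)
   also have "R Int set L = set L" using LR by blast
   finally show ?thesis using distinct_card[OF L(2)] by simp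
   qed
   define t1 where "t1 = t(|rv := (rv t)(13 := i), clk := Suc (Suc (Suc (clk t)))|)"
   have SJ: "S : J Snd" using common_sub(2)[OF Rb(1)] .
   have en: "T (enum Snd) t1 (%x. tree x Snd S (R - set L) & rv x 15 = length L & (ALL i<length L. ra x 14 i = L ! i) &
   clk x <= clk t1 + 3 + length L * (7 * m + 12))"
   unfolding L_def by (rule enum_T) (use f i w3 SJ nf False in \<open>simp_all add: t1_def\<close>)
   have "T (enum Snd) t1 (%x. T (For 24 (V 15) (Assign 12 (Get 14 (V 24)) ;; Put2 3 (V 12) (Get 12 (V 12)) (V 13) ;;
   Put 12 (V 12) (Op Add (Get 12 (V 12)) (N 1)) ;; tupd Snd False)) x (%y. W (Suc i) (y(|rv := (rv y)(27 := Suc i), clk := Suc (clk y)|))))"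
   proof (rule T_conseq[OF en], goal_cases)
   case (1 x)
   have x: "tree x Snd S (R - set L)" "rv x 15 = length L" "!!i. i < length L ==> ra x 14 i = L ! i" "clk x <= clk t1 + 3 + length L * (7 * m + 12)"
   using 1(1) by blast+
   have g: "ra x 12 = ra t 12" "rm x 3 = rm t 3" "rv x 13 = i" "rv x 2 = Z" "rv x 27 = i" using 1(2) f i by (simp_all add: fr_def t1_def)
   define V where "V k y = ((ALL a:R. ra y 12 a = length (c a i) + of_bool (a : set (take k L)) &
   (ALL j<length (c a i) + of_bool (a : set (take k L)). rm y 3 a j = (if j < length (c a i) then c a i ! j else i))) &
   (ALL a. a ~: R --> ra y 12 a = ra s 12 a & rm y 3 a = rm s 3 a) & tree y Snd S (R - set L Un set (take k L)) &
   clk y <= clk x + 1 + (3 * m + 10) * k)" for k :: nat and y :: st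
   show ?case
   proof (rule T_For[where m = "length L" and P = V], goal_cases)
   case 2
   thus ?case using lenL B_Z by simp
   next
   case 3
   show ?case unfolding V_def using g x(1) w1 w2 by simp
   next
   case (4 k y)
   thus ?case using x by (simp add: fr_def)
   next
   case (5 k y)
   have h: "ra y 14 = ra x 14" "rv y 13 = i" "rv y 2 = Z" using 5(2) g by (simp_all add: fr_def)
   define a where "a = L ! k"
   have aL: "a : set L" using 5(4) a_def by simp
   hence aR: "a : R" "a : S" "a < n" "a < B" using LR RS B_Z by (auto intro: less_trans)
   have atk: "a ~: set (take k L)" using L(2) 5(4) unfolding a_def by (metis distinct_take in_set_conv_nth length_take min.strict_order_iff nth_eq_iff_index_eq nth_take order_less_trans less_irrefl min.absorb4)
   have tk: "set (take (Suc k) L) = insert a (set (take k L))" using 5(4) a_def by (simp add: take_Suc_conv_app_nth)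
   note v = 5(1)[unfolded V_def]
   have v1: "ra y 12 e = length (c e i) + of_bool (e : set (take k L))"
   "!!j. j < length (c e i) + of_bool (e : set (take k L)) ==> rm y 3 e j = (if j < length (c e i) then c e i ! j else i)" if "e : R" for e
   using v that by blast+
   have v2: "ALL a. a ~: R --> ra y 12 a = ra s 12 a & rm y 3 a = rm s 3 a" using v by blast
   have v3: "tree y Snd S (R - set L Un set (take k L))" using v by blast
   have v4: "clk y <= clk x + 1 + (3 * m + 10) * k" using v by blast
   define w where "w = length (c a i)"
   have ya: "ra y 12 a = w" using v1(1)[OF aR(1)] atk w_def by simp
   have wi: "w < n" "Suc w < B" using cl2_length[of S "set (bD st)" a i] i B_lin unfolding w_def c_def by linarith+
   define y1 where "y1 = y(|rv := (rv y)(12 := a), rm := (rm y)(3 := (rm y 3)(a := (rm y 3 a)(w := i))),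
   ra := (ra y)(12 := (ra y 12)(a := Suc w)), clk := Suc (Suc (Suc (Suc (clk y))))|)"
   have tu: "T (tupd Snd False) y1 (%u. tree u Snd S (insert a (R - set L Un set (take k L))) & clk u <= clk y1 + 3 * m + 5)"
   using tupd_tree[of y1 a Snd S "R - set L Un set (take k L)" False] h v3 aR(2) unfolding y1_def by simp
   have e2: "insert a (R - set L Un set (take k L)) = R - set L Un set (take (Suc k) L)" using tk by auto
   have "T (tupd Snd False) y1 (%u. V (Suc k) (u(|rv := (rv u)(24 := Suc k), clk := Suc (clk u)|)))"
   proof (rule T_conseq[OF tu], goal_cases)
   case (1 u)
   have u: "ra u 12 = (ra y 12)(a := Suc w)" "rm u 3 = (rm y 3)(a := (rm y 3 a)(w := i))" using 1(2) by (simp_all add: fr_def y1_def)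
   have p1: "ra u 12 e = length (c e i) + of_bool (e : set (take (Suc k) L))" if "e : R" for e
   unfolding u tk using v1(1)[OF that] w_def by auto
   have p2: "rm u 3 e j = (if j < length (c e i) then c e i ! j else i)" if "e : R" "j < length (c e i) + of_bool (e : set (take (Suc k) L))" for e j
   proof (cases "e = a")
   case True
   hence "j <= w" using that(2) unfolding w_def by (cases "a : set (take (Suc k) L)") auto
   thus ?thesis unfolding u True using v1(2)[OF aR(1), of j] w_def by (auto simp: le_less)
   next
   case False
   thus ?thesis unfolding u using v1(2)[OF that(1), of j] that(2) tk by simp
   qed
   have p3: "ALL a. a ~: R --> ra u 12 a = ra s 12 a & rm u 3 a = rm s 3 a" unfolding u using v2 aR(1) by auto
   have "clk u + 1 <= clk x + 1 + (3 * m + 10) * Suc k" using 1(1)[THEN conjunct2] v4 by (simp add: y1_def)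
   thus ?case unfolding V_def using p1 p2 p3 1(1)[THEN conjunct1] e2 by simp
   qed
   thus ?case using h x(3)[OF 5(4)] 5(3,4) lenL B_Z aR wi ya i unfolding y1_def a_def[symmetric] by simp
   next
   case (6 y)
   have y27: "rv y 27 = i" using 6(2) g by (simp add: fr_def)
   note v = 6(1)[unfolded V_def]
   have q1: "ra y 12 a = length (c a (Suc i)) & (ALL j<length (c a (Suc i)). rm y 3 a j = c a (Suc i) ! j)" if "a : R" for a
   using v that unfolding e[OF that] by (auto simp: nth_append)
   have q2: "R - set L Un set L = R" using LR by blast
   have "clk y <= clk x + 1 + (3 * m + 10) * length L" using v by simp
   hence "clk y + 2 <= clk s + 1 + 10 * Suc i + CeT * (SUM a:R. length (c a (Suc i)))"
   using x(4) w4 unfolding sm CeT_def t1_def by (simp add: algebra_simps)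
   thus ?case unfolding W_def using q1 v q2 by simp
   qed simp
   qed
   thus ?thesis using False i f Rb(13)[OF i(1)] unfolding t1_def by simp
  qed
 next
  case (6 t)
  thus ?case unfolding W_def by simp
 qed (use B_Z in simp_all)
qed

lemma batchp_T:
 assumes C: "Crel S st ky q Ld u s" and q: "q + 1 < B" and nf: "ALL b:{..<n} - S - set (bD st). insert b S ~: J Snd"
  and good: "!!a. a : S ==> (ALL k<q. ~ hit S st ky a k) ==> length (cl2 S (set (bD st)) a n) <= Ld"
 shows "T batchp s (%t. Crel S st ky q Ld (card (und S st ky q)) t &
  (ALL a:S. (ALL k<q. ~ hit S st ky a k) --> ra t 10 a = 1) &
  clk t + 2 * wsum S q t + CeT * Ld * ur S t <= clk s + 2 * wsum S q s + CeT * Ld * ur S s + CbT)"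
proof -
 note CD = CrelD[OF C] and Rb = brelD[OF CrelD(1)[OF C]]
 define nh where "nh a = (ALL k<q. ~ hit S st ky a k)" for a
 define R where "R = {a : S. ra s 10 a = 0 & nh a}"
 let ?c = "cl2 S (set (bD st))"
 have z: "ra s 12 a = 0" if "a : S" "ra s 10 a = 0" for a using CD(5)[OF that(1)] that(2) unfolding rdyP_def unrP_def by auto
 have fin: "finite S" "finite R" "R <= S" using Rb(21) unfolding R_def by auto
 let ?l1 = "For 28 Sz (When (Get 2 (V 28)) (When (NotE (Get 10 (V 28))) (advp ;;
   When (NotE (Op Sub (V 25) (Get 11 (V 28)))) (Assign 12 (V 28) ;; tupd Snd False ;; Put 10 (V 28) (N 1)))))"
 let ?l2 = "For 27 Sz (When (NotE (Get 9 (V 27))) (Assign 13 (V 27) ;; enum Snd ;;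
   For 24 (V 15) (Assign 12 (Get 14 (V 24)) ;; Put2 3 (V 12) (Get 12 (V 12)) (V 13) ;;
   Put 12 (V 12) (Op Add (Get 12 (V 12)) (N 1)) ;; tupd Snd False)))"
 have "T ((tinit Snd ;; ?l1) ;; ?l2) s (%t. Crel S st ky q Ld (card (und S st ky q)) t &
  (ALL a:S. nh a --> ra t 10 a = 1) &
  clk t + 2 * wsum S q t + CeT * Ld * ur S t <= clk s + 2 * wsum S q s + CeT * Ld * ur S s + CbT)"
 proof (rule T_SeqI, rule T_conseq[OF mark_T[OF C q]], goal_cases)
  case (1 t)
  have t: "brel S st t" "!!a. a : S ==> ra t 10 a = (if ra s 10 a = 0 & nh a then 1 else ra s 10 a)"
   "!!a. a : S ==> ra s 10 a = 0 ==> ra t 11 a <= q & (ALL k<ra t 11 a. ~ hit S st ky a k)"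
   "tree t Snd S R" "clk t + 2 * wsum S q t <= clk s + 2 * wsum S q s + 4 + 6 * Z + (3 * m + 14) * n"
   using 1(1) unfolding nh_def R_def by blast+
  have f: "ra t 12 = ra s 12" "rm t 3 = rm s 3" "ra t 13 = ra s 13" "rv t 25 = q" using 1(2) CD(2) by (simp_all add: fr_def)
  have zR: "ALL a:R. ra t 12 a = 0" using z f unfolding R_def by simp
  show ?case
  proof (rule T_conseq[OF fill_T[OF t(1,4) nf zR]], goal_cases)
   case (1 x)
   have x: "!!a. a : R ==> ra x 12 a = length (?c a n) & (ALL i<length (?c a n). rm x 3 a i = ?c a n ! i)"
   "!!a. a ~: R ==> ra x 12 a = ra t 12 a & rm x 3 a = rm t 3 a" "clk x <= clk t + 2 + 10 * n + CeT * (SUM a:R. length (?c a n))"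
   using 1(1) by blast+
   have g: "ra x 10 = ra t 10" "ra x 11 = ra t 11" "ra x 13 = ra s 13" "rv x 25 = q" "rv x 2 = rv t 2" "rv x 16 = rv t 16" "rv x 17 = rv t 17" "rv x 18 = rv t 18"
   "sv x = sv t" "sa x Fst = sa t Fst" "ra x 2 = ra t 2" "ra x 5 = ra t 5" "ra x 7 = ra t 7" "ra x 8 = ra t 8" "ra x 9 = ra t 9"
   using 1(2) f by (simp_all add: fr_def fun_eq_iff)
   have bx: "brel S st x" by (rule brel_cong[OF t(1)]) (simp_all add: g)
   have lR: "length (?c a n) <= Ld" if "a : R" for a using good[of a] that unfolding R_def nh_def by blast
   have a: "rdyP S st Ld x a | unrP S st ky q (card (und S st ky q)) x a" if "a : S" for a
   proof (cases "a : R")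
   case True
   hence "ra x 10 a = 1" using t(2)[OF that] g unfolding R_def by simp
   hence "rdyP S st Ld x a" unfolding rdyP_def using x(1)[OF True] lR[OF True] by blast
   thus ?thesis ..
   next
   case False
   note k = x(2)[OF False]
   show ?thesis
   proof (cases "ra s 10 a = 0")
   case True
   have nn: "~ nh a" using False True that unfolding R_def by simp
   hence "EX k<q. hit S st ky a k" unfolding nh_def by blast
   moreover have "ra x 10 a = 0" "ra x 12 a = 0" using t(2)[OF that] g nn True k f z[OF that True] by simp_all
   moreover have "ra x 11 a <= q & (ALL k<ra x 11 a. ~ hit S st ky a k)" using t(3)[OF that True] g by simp
   ultimately show ?thesis unfolding unrP_def by blast
   next
   case F: False
   hence "rdyP S st Ld s a" using CD(5)[OF that] unfolding unrP_def by simp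
   moreover have "ra x 10 a = ra s 10 a" using t(2)[OF that] g F by simp
   ultimately show ?thesis using k unfolding rdyP_def f by simp
   qed
   qed
   have Cx: "Crel S st ky q Ld (card (und S st ky q)) x" unfolding Crel_def using bx g a CD(3) by simp
   have rd: "ra x 10 a = 1" if "a : S" "nh a" for a
   using t(2)[OF that(1)] that(2) g CD(5)[OF that(1)] unfolding rdyP_def unrP_def by auto
   have urs: "ur S s = ur S x + card R"
   proof -
   have x10: "ra x 10 a = 0 \<longleftrightarrow> ra s 10 a = 0 & ~ nh a" if "a : S" for a using t(2)[OF that] g(1) by simp
   have "{a : S. ra s 10 a = 0} = {a : S. ra x 10 a = 0} Un R" using x10 unfolding R_def by blast
   moreover have "{a : S. ra x 10 a = 0} Int R = {}" using x10 unfolding R_def by blast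
   ultimately show ?thesis unfolding ur_def using fin by (simp add: card_Un_disjoint)
   qed
   have "(SUM a:R. length (?c a n)) <= Ld * card R" using sum_mono[of R "%a. length (?c a n)" "%_. Ld"] lR by (simp add: mult.commute)
   hence "CeT * (SUM a:R. length (?c a n)) <= CeT * (Ld * card R)" by (rule mult_le_mono2)
   moreover have "CeT * Ld * ur S s = CeT * Ld * ur S x + CeT * (Ld * card R)" unfolding urs by (simp add: algebra_simps)
   moreover have "wsum S q x = wsum S q t" unfolding wsum_def g ..
   moreover have "4 + 6 * Z + (3 * m + 14) * n + 2 + 10 * n <= CbT" unfolding CbT_def using Z(3) by (simp add: algebra_simps)
   ultimately have "clk x + 2 * wsum S q x + CeT * Ld * ur S x <= clk s + 2 * wsum S q s + CeT * Ld * ur S s + CbT"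
   using x(3) t(5) by linarith
   thus ?case using Cx rd by blast
  qed
 qed
 thus ?thesis unfolding batchp_def nh_def T_simps(8)[of "tinit Snd"] T_simps(8)[of "tinit Snd ;; a" for a]
  T_simps(8)[of "Seq (tinit a) b" for a b] by (simp only: T_simps(8))
qed

definition CsT :: nat where "CsT = 17 * n + 2"

text \<open>After the queue potential the summands pay for pointer moves, full scans, batches and
  list construction. A full scan reaches the sample element that caused it and is paid by the drop
  of \<open>und\<close>, unless it ends the search, for which the extra unit is kept.\<close>

definition PHI :: "nat set => bst => (nat => nat) => nat => nat => nat => st => nat" where
 "PHI S st ky q Ld u t = pot S st + 2 * wsum S q t + CsT * (card (und S st ky q) + of_bool (bfnd st = None)) + CbT * u + CeT * Ld * ur S t"

text \<open>The states quantified over are canonical, so for given \<open>S\<close> this is a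
  property of the sample alone.\<close>

definition goodS :: "(nat => nat) => nat => nat => nat set => bool" where
 "goodS ky q Ld S \<longleftrightarrow> (ALL p<=n. ALL a:S. (ALL k<q. ~ hit S (cst S p) ky a k) --> length (cl2 S (set (bD (cst S p))) a n) <= Ld)"

lemma ready_T:
 assumes C: "Crel S st ky q Ld u s" and q: "q + 1 < B" and nf: "ALL b:{..<n} - S - set (bD st). insert b S ~: J Snd"
  and good: "!!a. a : S ==> (ALL k<q. ~ hit S st ky a k) ==> length (cl2 S (set (bD st)) a n) <= Ld"
  and a: "rv s 28 = a" "a : S"
 shows "T (When (NotE (Get 10 (V 28))) (advp ;; When (NotE (Op Sub (V 25) (Get 11 (V 28)))) batchp)) s
  (%t. EX u'. Crel S st ky q Ld u' t & (ra t 10 a = 1 | ra t 10 a = 0 & (EX k<q. hit S st ky a k)) &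
   clk t + 2 * wsum S q t + CbT * u' + CeT * Ld * ur S t <= clk s + 2 * wsum S q s + CbT * u + CeT * Ld * ur S s + 4)" (is "T _ _ ?Q")
proof -
 note CD = CrelD[OF C] and Rb = brelD[OF CrelD(1)[OF C]]
 have an: "a < n" "a < B" using a Rb(20) B_Z by auto
 have st: "Crel S st ky q Ld u (s(|clk := k|))" for k by (rule Crel_mono[OF C]) (use CD(1) in simp_all)
 show ?thesis
 proof (cases "ra s 10 a = 0")
  case False
  hence 1: "ra s 10 a = 1" using CD(5)[OF a(2)] unfolding rdyP_def unrP_def by simp
  thus ?thesis using a an st by (auto intro!: exI[of _ u] simp: wsum_def ur_def)
 next
  case True
  hence un: "unrP S st ky q u s a" using CD(5)[OF a(2)] unfolding rdyP_def by simp
  have b1: "brel S st (tick s)" using CD(1) by simp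
  have av: "T advp (tick s) (%t'. EX w. ra t' 11 = (ra (tick s) 11)(a := w) & ra (tick s) 11 a <= w & w <= q &
   (ALL k. ra (tick s) 11 a <= k & k < w --> ~ hit S st ky a k) &
   (w < q --> hit S st ky a w) & clk t' = clk (tick s) + 1 + 2 * (w - ra (tick s) 11 a))"
   by (rule advp_T[OF b1 _ a(2) _ q refl]) (use a un CD(2,3) in \<open>simp_all add: unrP_def\<close>)
  have "T advp (tick s) (%x. T (When (NotE (Op Sub (V 25) (Get 11 (V 28)))) batchp) x ?Q)"
  proof (rule T_conseq[OF av], goal_cases)
   case (1 x)
   from 1(1) obtain v where v: "ra x 11 = (ra s 11)(a := v)" "ra s 11 a <= v" "v <= q" "ALL k. ra s 11 a <= k & k < v --> ~ hit S st ky a k"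
   "v < q --> hit S st ky a v" "clk x = clk s + 2 + 2 * (v - ra s 11 a)" by (auto simp: numeral_2_eq_2)
   have g: "rv x = rv s" "ra x 10 = ra s 10" "ra x 12 = ra s 12" "ra x 13 = ra s 13" "rm x = rm s" "sv x = sv s" "sa x = sa s"
   "ra x 2 = ra s 2" "ra x 5 = ra s 5" "ra x 7 = ra s 7" "ra x 8 = ra s 8" "ra x 9 = ra s 9"
   using 1(2) by (simp_all add: fr_def fun_eq_iff)
   have wx: "wsum S q x + (v - ra s 11 a) = wsum S q s" using wsum_adv[OF Rb(21) a(2) v(1,2,3)] .
   have ux: "ur S x = ur S s" unfolding ur_def g ..
   have bx: "brel S st (tick x)" by (rule brel_cong[OF CD(1)]) (simp_all add: g)
   have bad: "~ hit S st ky a k" if "k < v" for k using v(4) un that unfolding unrP_def by (cases "k < ra s 11 a") auto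
   have each: "rdyP S st Ld (tick x) e | unrP S st ky q u (tick x) e" if "e : S" for e
   proof (cases "e = a")
   case True
   thus ?thesis using un bad v(1,3) g unfolding unrP_def by simp
   next
   case False
   thus ?thesis using CD(5)[OF that] v(1) unfolding rdyP_def unrP_def by (simp add: g)
   qed
   have Cx: "Crel S st ky q Ld u (tick x)" unfolding Crel_def using bx CD(2-4) g each by simp
   have cl: "clk x + 2 * wsum S q x = clk s + 2 + 2 * wsum S q s" using v(6) wx by simp
   have x11: "ra x 11 a = v" using v(1) by simp
   have e1: "wsum S q (tick x) = wsum S q x" "ur S (tick x) = ur S x" unfolding wsum_def ur_def by simp_all
   show ?case
   proof (cases "v < q")
   case lt: True
   have "ra (tick x) 10 a = 0 & (EX k<q. hit S st ky a k)" using True g v(5) lt by auto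
   moreover have "clk (tick x) + 2 * wsum S q (tick x) + CbT * u + CeT * Ld * ur S (tick x) <= clk s + 2 * wsum S q s + CbT * u + CeT * Ld * ur S s + 4"
   using cl ux e1 by simp
   ultimately have "EX u'. Crel S st ky q Ld u' (tick x) & (ra (tick x) 10 a = 1 | ra (tick x) 10 a = 0 & (EX k<q. hit S st ky a k)) &
   clk (tick x) + 2 * wsum S q (tick x) + CbT * u' + CeT * Ld * ur S (tick x) <= clk s + 2 * wsum S q s + CbT * u + CeT * Ld * ur S s + 4"
   using Cx by blast
   thus ?thesis using g a an CD(2) x11 lt by simp
   next
   case False
   hence vq: "v = q" using v(3) by simp
   have nh: "ALL k<q. ~ hit S st ky a k" using bad vq by simp
   \<comment> \<open>This is the only case that calls a batch, and the strict drop below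
     \<open>u\<close> pays for it.\<close>
   hence cu: "card (und S st ky q) < u" using un unfolding unrP_def by blast
   have "T batchp (tick x) ?Q"
   proof (rule T_conseq[OF batchp_T[OF Cx q nf good]], goal_cases)
   case (3 t)
   have t: "Crel S st ky q Ld (card (und S st ky q)) t" "ra t 10 a = 1"
   "clk t + 2 * wsum S q t + CeT * Ld * ur S t <= clk (tick x) + 2 * wsum S q (tick x) + CeT * Ld * ur S (tick x) + CbT"
   using 3(1) nh a(2) by blast+
   have "CbT * card (und S st ky q) + CbT <= CbT * u" using mult_le_mono2[of "Suc (card (und S st ky q))" u CbT] cu by simp
   moreover have "clk (tick x) = Suc (clk x)" by simp
   ultimately have "clk t + 2 * wsum S q t + CbT * card (und S st ky q) + CeT * Ld * ur S t <= clk s + 2 * wsum S q s + CbT * u + CeT * Ld * ur S s + 4"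
   using t(3) cl unfolding e1 ux by linarith
   thus ?case using t(1,2) by blast
   qed simp_all
   thus ?thesis using g a an CD(2) x11 vq by simp
   qed
  qed
  thus ?thesis using a an True by simp
 qed
qed

text \<open>A ready element is processed from its list of at most \<open>Ld\<close> entries; an
  unready one has a hit and pays for its full scan with it. Both ways lead to the same canonical
  state.\<close>

lemma popp_T:
 assumes c: "common S" and C: "Crel S (cst S p) ky q Ld u s" and p: "rv s 26 = p" "p < length (bQ (cst S p))" and nf: "bfnd (cst S p) = None"
  and q: "q + 1 < B" and good: "goodS ky q Ld S"
 shows "T popp s (%t. EX u'. Crel S (cst S (Suc p)) ky q Ld u' t & rv t 26 = Suc p &
  clk t + PHI S (cst S (Suc p)) ky q Ld u' t <= clk s + PHI S (cst S p) ky q Ld u s + 17 * Ld + 11)"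
proof -
 define st where "st = cst S p"
 note CD = CrelD[OF C[folded st_def]] and Rb = brelD[OF CrelD(1)[OF C[folded st_def]]]
 obtain l where CI: "Cinv S st p l" using cst_inv[OF c] unfolding st_def by blast
 note D = CinvD[OF CI] and I = bfs_invD[OF CinvD(1)[OF CI]]
 define a where "a = bQ st ! p"
 have aQ: "a : set (bQ st)" using p unfolding a_def st_def by simp
 have a: "a : S" "a < n" "a < B" using Rb(17,20) aQ B_Z by auto
 define l1 where "l1 = Suc (blev st a)"
 have pn: "p < n" "p + 1 < B" using p Rb(18,19) B_lin unfolding st_def by linarith+
 have "l1 <= n" using I(13)[OF aQ] D(2) pn unfolding l1_def by simp
 moreover have "n + 2 <= (n + 2) ^ 3" by (rule self_le_power) auto
 ultimately have l1: "l1 < (n + 2) ^ 3" "l1 < B" using B_lin by linarith+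
 have nxt: "cst S (Suc p) = cproc S st a" using p nf unfolding st_def a_def by (simp add: Let_def)
 have nfr: "ALL b:{..<n} - S - set (bD st). insert b S ~: J Snd" using D(4) nf unfolding st_def by blast
 have gd: "length (cl2 S (set (bD st)) e n) <= Ld" if "e : S" "ALL k<q. ~ hit S st ky e k" for e
  using good that pn unfolding goodS_def st_def by simp
 let ?st = "cproc S st a"
 have Dst: "set (bD st) <= set (bD ?st)" unfolding cproc_def by (rule cfold_D(1))
 define s1 where "s1 = s(|rv := (rv s)(29 := a, 28 := a, 19 := l1), clk := Suc (Suc (Suc (clk s)))|)"
 have b1: "brel S st s1" by (rule brel_cong[OF CD(1)]) (simp_all add: s1_def)
 have C1: "Crel S st ky q Ld u s1" by (rule Crel_mono[OF C[folded st_def] _ b1]) (simp_all add: s1_def)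
 have e1: "wsum S q s1 = wsum S q s" "ur S s1 = ur S s" unfolding wsum_def ur_def s1_def by simp_all
 have r28: "rv s1 28 = a" by (simp add: s1_def)
 have "T (When (NotE (Get 10 (V 28))) (advp ;; When (NotE (Op Sub (V 25) (Get 11 (V 28)))) batchp)) s1 (%x.
  T (If (Get 10 (V 29)) listp (scanp (SDel (V 29) (SV 2))) ;; Assign 26 (Op Add (V 26) (N 1))) x
  (%t. EX u'. Crel S ?st ky q Ld u' t & rv t 26 = Suc p &
  clk t + PHI S ?st ky q Ld u' t <= clk s + PHI S st ky q Ld u s + 17 * Ld + 11))"
 proof (rule T_conseq[OF ready_T[OF C1 q nfr gd r28 a(1)]], goal_cases)
  case (3 x)
  from 3(1) obtain u' where x: "Crel S st ky q Ld u' x" "ra x 10 a = 1 | ra x 10 a = 0 & (EX k<q. hit S st ky a k)"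
   "clk x + 2 * wsum S q x + CbT * u' + CeT * Ld * ur S x <= clk s1 + 2 * wsum S q s1 + CbT * u + CeT * Ld * ur S s1 + 4" by (elim exE conjE)
  have f: "rv x 29 = a" "rv x 19 = l1" "rv x 26 = p" using 3(2) p by (simp_all add: fr_def s1_def)
  note XD = CrelD[OF x(1)]
  have bx: "brel S st (tick x)" using XD(1) by simp
  note Rx = brelD[OF XD(1)]
  have fin: "EX u'. Crel S ?st ky q Ld u' t2 & rv t2 26 = Suc p & clk t2 + PHI S ?st ky q Ld u' t2 <= clk s + PHI S st ky q Ld u s + 17 * Ld + 11"
   if y: "brel S ?st y" and fy: "ra y 10 = ra x 10" "ra y 11 = ra x 11" "ra y 12 = ra x 12" "ra y 13 = ra x 13" "rm y 3 = rm x 3" "rv y 25 = rv x 25"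
   and cy: "clk y + pot S ?st + CsT * (card (und S ?st ky q) + of_bool (bfnd ?st = None)) <=
   Suc (clk x) + pot S st + CsT * (card (und S st ky q) + of_bool (bfnd st = None)) + 17 * Ld + 2"
   and t2: "t2 = y(|rv := (rv y)(26 := Suc p), clk := Suc (clk y)|)" for y t2
  proof -
   have b2: "brel S ?st t2" by (rule brel_cong[OF y]) (simp_all add: t2)
   have C2: "Crel S ?st ky q Ld u' t2" by (rule Crel_mono[OF x(1) Dst b2]) (simp_all add: t2 fy)
   have e2: "wsum S q t2 = wsum S q x" "ur S t2 = ur S x" unfolding wsum_def ur_def t2 by (simp_all add: fy)
   have "clk t2 = Suc (clk y)" "clk s1 = clk s + 3" by (simp_all add: t2 s1_def)
   hence "clk t2 + PHI S ?st ky q Ld u' t2 <= clk s + PHI S st ky q Ld u s + 17 * Ld + 11"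
   using cy x(3) unfolding PHI_def e1 e2 by linarith
   thus ?thesis using C2 t2 by auto
  qed
  show ?case
  proof (cases "ra x 10 a = 1")
   case True
   hence "rdyP S st Ld x a" using XD(5)[OF a(1)] unfolding unrP_def by auto
   then obtain D0 where D0: "D0 <= set (bD st)" "length (cl2 S D0 a n) <= Ld" "ra x 12 a = length (cl2 S D0 a n)"
   "ALL i<length (cl2 S D0 a n). rm x 3 a i = cl2 S D0 a n ! i" unfolding rdyP_def by blast
   define xs where "xs = cl2 S D0 a n"
   have xs: "ra (tick x) 12 a = length xs" "length xs <= n" "ALL i<length xs. rm (tick x) 3 a i = xs ! i" "ALL x:set xs. x < n & x ~: S"
   using D0 cl2_length[of S D0 a n] unfolding xs_def by (auto simp: cl2_def)
   have eq: "fold (cdisc S l1) xs st = ?st"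
   unfolding xs_def cl2_def cproc_def l1_def by (rule cfold_filter) (use D0(1) in auto)
   have lp: "T listp (tick x) (%y. brel S ?st y & clk y + pot S ?st <= clk (tick x) + pot S st + 17 * length xs + 2)"
   using listp_T[OF bx _ l1(1) _ a(2) xs] f unfolding take_all[OF order_refl] eq by simp
   have "T listp (tick x) (%y. T (Assign 26 (Op Add (V 26) (N 1))) y (%t. EX u'. Crel S ?st ky q Ld u' t & rv t 26 = Suc p &
   clk t + PHI S ?st ky q Ld u' t <= clk s + PHI S st ky q Ld u s + 17 * Ld + 11))"
   proof (rule T_conseq[OF lp], goal_cases)
   case (1 y)
   have fy: "ra y 10 = ra x 10" "ra y 11 = ra x 11" "ra y 12 = ra x 12" "ra y 13 = ra x 13" "rm y 3 = rm x 3" "rv y 25 = rv x 25" "rv y 26 = p"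
   using 1(2) f by (simp_all add: fr_def)
   have "card (und S ?st ky q) + of_bool (bfnd ?st = None) <= card (und S st ky q) + of_bool (bfnd st = None)"
   using und_mono[OF Dst, of S ky q] nf unfolding st_def by (intro add_mono) auto
   hence "CsT * (card (und S ?st ky q) + of_bool (bfnd ?st = None)) <= CsT * (card (und S st ky q) + of_bool (bfnd st = None))" by (rule mult_le_mono2)
   moreover have "17 * length xs <= 17 * Ld" using D0(2) xs_def by simp
   moreover have "clk (tick x) = Suc (clk x)" by simp
   ultimately have "clk y + pot S ?st + CsT * (card (und S ?st ky q) + of_bool (bfnd ?st = None)) <=
   Suc (clk x) + pot S st + CsT * (card (und S st ky q) + of_bool (bfnd st = None)) + 17 * Ld + 2" using 1(1) by linarith
   from fin[OF 1(1)[THEN conjunct1] fy(1-6) this refl] show ?case using fy pn by simp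
   qed
   thus ?thesis using f a True by simp
  next
   case False
   then obtain k where k: "k < q" "hit S st ky a k" and x0: "ra x 10 a = 0" using x(2) by blast
   have kn: "ky k < n" "ky k ~: S" using k(2) M2.indep_subset unfolding hit_def by auto
   have sq: "sok (SDel (V 29) (SV 2)) Snd t & sev (SDel (V 29) (SV 2)) Snd t = S - {a}"
   if "sv t = sv (tick x)" "rv t 29 = rv (tick x) 29" for t using that f a Rx(4) by simp
   have rx19: "rv (tick x) 19 = l1" using f by simp
   have sp: "T (scanp (SDel (V 29) (SV 2))) (tick x) (%y. brel S ?st y & clk y + pot S ?st <= clk (tick x) + pot S st + 17 * n + 2)"
   using scanp_T[OF bx rx19 l1(1) sq] unfolding cproc_def l1_def .
   have "T (scanp (SDel (V 29) (SV 2))) (tick x) (%y. T (Assign 26 (Op Add (V 26) (N 1))) y (%t. EX u'. Crel S ?st ky q Ld u' t & rv t 26 = Suc p &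
   clk t + PHI S ?st ky q Ld u' t <= clk s + PHI S st ky q Ld u s + 17 * Ld + 11))"
   proof (rule T_conseq[OF sp], goal_cases)
   case (1 y)
   have fy: "ra y 10 = ra x 10" "ra y 11 = ra x 11" "ra y 12 = ra x 12" "ra y 13 = ra x 13" "rm y 3 = rm x 3" "rv y 25 = rv x 25" "rv y 26 = p"
   using 1(2) f by (simp_all add: fr_def)
   have "Suc (card (und S ?st ky q) + of_bool (bfnd ?st = None)) <= card (und S st ky q) + of_bool (bfnd st = None)"
   proof (cases "bfnd ?st = None")
   case True
   have "ky k : set (filter (%b. b ~: S & insert b (S - {a}) : J Snd) [0..<n])" using kn k(2) unfolding hit_def by simp
   hence "ky k : set (bD ?st)" using cfold_D(2)[OF True[unfolded cproc_def]] unfolding cproc_def by blast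
   hence "~ hit S ?st ky a k" unfolding hit_def by simp
   thus ?thesis using und_drop[OF Dst k] nf unfolding st_def by simp
   next
   case False
   then obtain b where "bfnd ?st = Some b" by blast
   thus ?thesis using und_mono[OF Dst, of S ky q] nf unfolding st_def by simp
   qed
   hence "CsT * Suc (card (und S ?st ky q) + of_bool (bfnd ?st = None)) <= CsT * (card (und S st ky q) + of_bool (bfnd st = None))" by (rule mult_le_mono2)
   moreover have "CsT * Suc (card (und S ?st ky q) + of_bool (bfnd ?st = None)) = CsT * (card (und S ?st ky q) + of_bool (bfnd ?st = None)) + (17 * n + 2)"
   unfolding CsT_def by simp
   moreover have "clk (tick x) = Suc (clk x)" by simp
   ultimately have "clk y + pot S ?st + CsT * (card (und S ?st ky q) + of_bool (bfnd ?st = None)) <=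
   Suc (clk x) + pot S st + CsT * (card (und S st ky q) + of_bool (bfnd st = None)) + 17 * Ld + 2" using 1(1) by linarith
   from fin[OF 1(1)[THEN conjunct1] fy(1-6) this refl] show ?case using fy pn by simp
   qed
   thus ?thesis using f a x0 by simp
  qed
 qed simp_all
 moreover have "ra s 7 p = a" "ra s 5 a = blev st a" using Rb(8,9) p a unfolding a_def st_def by simp_all
 ultimately show ?thesis unfolding popp_def nxt st_def[symmetric] using p pn a l1 by (simp add: s1_def l1_def del: T_simps(9))
qed

text \<open>The summands are setup and queue, pointer moves, scans and batches, list construction,
  and list traversal; \<open>k\<close> stands for the size of \<open>S\<close>.\<close>

definition CCT :: "nat => nat => nat => nat" where
 "CCT q Ld k = (n + 1) * (10 * m + 100) + 2 * (k * q) + (CsT + CbT) * (q + 1) + CeT * Ld * k + (17 * Ld + 12) * k"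

lemma cbfs_T:
 assumes c: "common S" and a: "ALL v<n. ra s 2 v = of_bool (v : S)" "rv s 2 = Z" and q: "rv s 25 = q" "q + 1 < B"
  and ky: "ALL k<q. ra s 13 k mod n = ky k" and good: "goodS ky q Ld S"
 shows "T cbfs s (%t. brel S (cst S n) t & (bfnd (cst S n) = None --> (ALL X. common X --> card X <= card S)) &
  clk t <= clk s + CCT q Ld (card S))" (is "T _ _ ?Q")
proof -
 have nB: "n < B" using B_Z by simp
 have S: "finite S" "S <= {..<n}" "card S <= n" using common_sub[OF c] card_mono[of "{..<n}" S] by auto
 show ?thesis unfolding cbfs_def
 proof (rule T_SeqI, rule T_For[where m = n and P = "%i t. (ALL v<i. ra t 5 v = 0 & ra t 10 v = 0 & ra t 11 v = 0 & ra t 12 v = 0) & clk t <= clk s + 1 + 6 * i"], goal_cases)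
  case (5 i t)
  thus ?case using nB by (simp add: less_Suc_eq)
 next
  case (6 t0)
  define t where "t = tick t0"
  have t: "ALL v<n. ra t 5 v = 0 & ra t 10 v = 0 & ra t 11 v = 0 & ra t 12 v = 0" "clk t <= clk s + 2 + 6 * n" using 6(1) by (simp_all add: t_def)
  have f: "ra t 2 = ra s 2" "rv t 2 = Z" "rv t 25 = q" "ra t 13 = ra s 13" using 6(2) a q by (simp_all add: fr_def t_def)
  let ?e = "(|bQ = [], bD = [], blev = (%_. 0), bnxt = (%_. 0), bfnd = None|)"
  have bs: "T bsetup t (%x. brel S (|bQ = [], bD = [], blev = ra t 5, bnxt = ra t 8, bfnd = None|) x & clk x <= clk t + (n + 1) * (3 * m + 40))"
   by (rule bsetup_T[OF c]) (use a f t in simp_all)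
  have "T bsetup t (%x. T (Assign 19 (N 0) ;; scanp (SV 2) ;; Assign 26 (N 0) ;; While (Op Mul (Op Sub (V 16) (V 26)) (NotE (V 17))) popp) x
   ?Q)"
  proof (rule T_conseq[OF bs], goal_cases)
   case (1 x)
   have x: "brel S (|bQ = [], bD = [], blev = ra t 5, bnxt = ra t 8, bfnd = None|) x" "clk x <= clk t + (n + 1) * (3 * m + 40)" using 1(1) by blast+
   have fx: "rv x 25 = q" "ra x 13 = ra s 13" "ra x 10 = ra t 10" "ra x 11 = ra t 11" "ra x 12 = ra t 12" using 1(2) f by (simp_all add: fr_def)
   define x1 where "x1 = x(|rv := (rv x)(19 := 0), clk := Suc (clk x)|)"
   have bx: "brel S ?e x1" using x(1) t(1) unfolding brel_def tree_def x1_def by simp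
   have svx: "sv x1 Snd 2 = S" using brelD(4)[OF bx] .
   have sc: "T (scanp (SV 2)) x1 (%y. brel S (cst S 0) y & clk y + pot S (cst S 0) <= clk x1 + pot S ?e + 17 * n + 2)"
   using scanp_T[OF bx, of 0 "SV 2" S] svx by (simp add: x1_def)
   have "T (scanp (SV 2)) x1 (%y. T (Assign 26 (N 0) ;; While (Op Mul (Op Sub (V 16) (V 26)) (NotE (V 17))) popp) y
   ?Q)"
   proof (rule T_conseq[OF sc], goal_cases)
   case (1 y)
   define y1 where "y1 = y(|rv := (rv y)(26 := 0), clk := Suc (clk y)|)"
   have fy: "rv y1 25 = q" "ra y1 13 = ra s 13" "ra y1 10 = ra t 10" "ra y1 11 = ra t 11" "ra y1 12 = ra t 12" "rv y1 26 = 0"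
   using 1(2) fx by (simp_all add: fr_def x1_def y1_def)
   have by1: "brel S (cst S 0) y1" by (rule brel_cong[OF 1(1)[THEN conjunct1]]) (simp_all add: y1_def)
   \<comment> \<open>The start value \<open>u = q + 1\<close> makes the unready clause true without
     any test, because there are fewer than \<open>q + 1\<close> unreached sample elements.\<close>
   have C0: "Crel S (cst S 0) ky q Ld (q + 1) y1" unfolding Crel_def
   proof (intro conjI ballI)
   show "card (und S (cst S 0) ky q) <= q + 1" using und_fin(2)[of S "cst S 0" ky q] by simp
   fix e assume "e : S"
   hence "e < n" using S by auto
   hence "unrP S (cst S 0) ky q (q + 1) y1 e" unfolding unrP_def using fy t(1) und_fin(2)[of S "cst S 0" ky q] by simp
   thus "rdyP S (cst S 0) Ld y1 e | unrP S (cst S 0) ky q (q + 1) y1 e" by blast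
   qed (use by1 fy ky in auto)
   have P0: "PHI S (cst S 0) ky q Ld (q + 1) y1 <= pot S (cst S 0) + 2 * (card S * q) + (CsT + CbT) * (q + 1) + CeT * Ld * card S"
   proof -
   have "wsum S q y1 <= card S * q" unfolding wsum_def using sum_mono[of S "%a. q - ra y1 11 a" "%_. q"] by simp
   moreover have "ur S y1 <= card S" unfolding ur_def using S by (intro card_mono) auto
   hence "CeT * Ld * ur S y1 <= CeT * Ld * card S" by (rule mult_le_mono2)
   moreover have "card (und S (cst S 0) ky q) + of_bool (bfnd (cst S 0) = None) <= q + 1" using und_fin(2)[of S "cst S 0" ky q] by (intro add_mono) auto
   hence "CsT * (card (und S (cst S 0) ky q) + of_bool (bfnd (cst S 0) = None)) <= CsT * (q + 1)" by (rule mult_le_mono2)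
   moreover have "(CsT + CbT) * (q + 1) = CsT * (q + 1) + CbT * (q + 1)" by (rule distrib_right)
   ultimately show ?thesis unfolding PHI_def by linarith
   qed
   define M where "M = clk y1 + PHI S (cst S 0) ky q Ld (q + 1) y1"
   have "T (While (Op Mul (Op Sub (V 16) (V 26)) (NotE (V 17))) popp) y1
   ?Q"
   proof (rule T_Loop[where K = n and I = "%p w. p <= length (bQ (cst S p)) & rv w 26 = p &
   (EX u. Crel S (cst S p) ky q Ld u w & clk w + PHI S (cst S p) ky q Ld u w <= M + (17 * Ld + 12) * p)"], goal_cases)
   case 1
   thus ?case using C0 fy M_def by auto
   next
   case (2 p w)
   then obtain u where u: "p <= length (bQ (cst S p))" "Crel S (cst S p) ky q Ld u w" by blast
   note Rw = brelD[OF CrelD(1)[OF u(2)]]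
   have ln: "length (bQ (cst S p)) <= n" using Rw(18,19) by linarith
   have "(length (bQ (cst S p)) - z) * (Suc 0 - z') <= n * 1" for z z' using ln by (intro mult_le_mono) auto
   hence "(length (bQ (cst S p)) - z) * (Suc 0 - z') < B" for z z' using nB le_less_trans by fastforce
   thus ?case using u(1) ln Rw(7) by simp
   next
   case (3 p w)
   then obtain u where u: "p <= length (bQ (cst S p))" "rv w 26 = p" "Crel S (cst S p) ky q Ld u w"
   "clk w + PHI S (cst S p) ky q Ld u w <= M + (17 * Ld + 12) * p" by blast
   note Rw = brelD[OF CrelD(1)[OF u(3)]]
   have pl: "p < length (bQ (cst S p))" using 3(3) u(2) Rw(7) by simp
   have nf: "bfnd (cst S p) = None" using 3(3) Rw(14) by (cases "bfnd (cst S p)") simp_all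
   have bw: "brel S (cst S p) (tick w)" using CrelD(1)[OF u(3)] by simp
   have Cw: "Crel S (cst S p) ky q Ld u (tick w)" by (rule Crel_mono[OF u(3) _ bw]) simp_all
   have rw: "rv (tick w) 26 = p" using u(2) by simp
   have ph: "PHI S (cst S p) ky q Ld u (tick w) = PHI S (cst S p) ky q Ld u w" unfolding PHI_def wsum_def ur_def by simp
   have "cst S (Suc p) = cproc S (cst S p) (bQ (cst S p) ! p)" using pl nf by (simp add: Let_def)
   hence len: "length (bQ (cst S p)) <= length (bQ (cst S (Suc p)))" unfolding cproc_def
   using cfold_D(3)[of S "Suc (blev (cst S p) (bQ (cst S p) ! p))"
   "filter (%b. b ~: S & insert b (S - {bQ (cst S p) ! p}) : J Snd) [0..<n]" "cst S p"] by (elim exE) simp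
   show ?case
   proof (rule T_conseq[OF popp_T[OF c Cw rw pl nf q(2) good]], goal_cases)
   case (1 v)
   from 1(1) obtain u' where v: "Crel S (cst S (Suc p)) ky q Ld u' v" "rv v 26 = Suc p"
   "clk v + PHI S (cst S (Suc p)) ky q Ld u' v <= clk (tick w) + PHI S (cst S p) ky q Ld u (tick w) + 17 * Ld + 11" by (elim exE conjE)
   have "(17 * Ld + 12) * Suc p = (17 * Ld + 12) * p + 17 * Ld + 12" by simp
   moreover have "clk (tick w) = Suc (clk w)" by simp
   ultimately have "clk v + PHI S (cst S (Suc p)) ky q Ld u' v <= M + (17 * Ld + 12) * Suc p" using v(3) u(4) unfolding ph by linarith
   thus ?case using v(1,2) len pl by (intro conjI exI[of _ u']) simp_all
   qed
   next
   case (4 p w)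
   then obtain u where u: "p <= length (bQ (cst S p))" "rv w 26 = p" "Crel S (cst S p) ky q Ld u w"
   "clk w + PHI S (cst S p) ky q Ld u w <= M + (17 * Ld + 12) * p" by blast
   note Rw = brelD[OF CrelD(1)[OF u(3)]]
   have pS: "p <= card S" "p <= n" using u(1) Rw(18,19) by linarith+
   have stop: "length (bQ (cst S p)) <= p | bfnd (cst S p) ~= None" using 4(3) u(2) Rw(7,14) by auto
   have cn: "cst S n = cst S p" by (rule cst_const[OF stop pS(2)])
   obtain l where CI: "Cinv S (cst S p) p l" using cst_inv[OF c] by blast
   have "ALL X. common X --> card X <= card S" if "bfnd (cst S n) = None" using C_opt[OF CI] stop that unfolding cn by auto
   moreover have "clk (tick w) <= clk s + CCT q Ld (card S)"
   proof -
   have "(17 * Ld + 12) * p <= (17 * Ld + 12) * card S" using pS(1) by (rule mult_le_mono2)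
   hence "clk w <= clk y1 + pot S (cst S 0) + 2 * (card S * q) + (CsT + CbT) * (q + 1) + CeT * Ld * card S + (17 * Ld + 12) * card S"
   using u(4) P0 unfolding M_def by linarith
   moreover have "pot S ?e <= (7 * m + 30) * n" using S(3) unfolding pot_def by simp
   moreover have "clk y1 = Suc (clk y)" "clk x1 = Suc (clk x)" by (simp_all add: y1_def x1_def)
   moreover have "2 + 6 * n + (n + 1) * (3 * m + 40) + 1 + (7 * m + 30) * n + 17 * n + 2 + 1 + 1 <= (n + 1) * (10 * m + 100)" by (simp add: algebra_simps)
   moreover have "clk (tick w) = Suc (clk w)" by simp
   ultimately show ?thesis using 1(1) x(2) t(2) unfolding CCT_def by linarith
   qed
   ultimately show ?case using CrelD(1)[OF u(3)] cn by simp
   qed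
   thus ?case by (simp add: y1_def)
   qed
   thus ?case by (simp add: x1_def)
  qed
  thus ?case by (simp add: t_def)
 qed (use nB in simp_all)
qed

lemma CCT_mono: "k <= k' ==> CCT q Ld k <= CCT q Ld k'"
 unfolding CCT_def by (intro add_mono mult_le_mono order_refl)

lemma phaseC_T:
 assumes c: "common S0" and a: "ALL v<n. ra s 2 v = of_bool (v : S0)" "rv s 2 = Z" and q: "rv s 25 = q" "q + 1 < B"
  and ky: "ALL k<q. ra s 13 k mod n = ky k" and good: "!!i. i <= H ==> goodS ky q Ld ((nextS ^^ i) S0)"
  and opt: "!!X. common X ==> card X <= card S0 + H" and rr: "!!X. common X ==> card X <= rr"
 shows "T phaseC s (%t. EX S. (ALL v<n. ra t 2 v = of_bool (v : S)) & common S & (ALL X. common X --> card X <= card S) &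
  clk t <= clk s + 2 + (H + 1) * (CCT q Ld rr + 10 * n + 14))"
proof -
 define Y where "Y = CCT q Ld rr + 10 * n + 14"
 define W where "W t S k = (common S & (ALL v<n. ra t 2 v = of_bool (v : S)) & k <= H & S = (nextS ^^ k) S0 &
  card S = card S0 + k & (rv t 11 ~= 0 --> clk t <= clk s + 1 + k * Y) &
  (rv t 11 = 0 --> (ALL X. common X --> card X <= card S) & clk t <= clk s + 1 + (k + 1) * Y))" for t :: st and S k
 have kY: "k * Y <= H * Y" "(k + 1) * Y <= (H + 1) * Y" if "k <= H" for k using mult_le_mono1[OF that, of Y] by simp_all
 have "T (While (V 11) (cbfs ;; If (V 17) walk (Assign 11 (N 0)))) (s(|rv := (rv s)(11 := 1), clk := Suc (clk s)|))
  (%t. EX S. (ALL v<n. ra t 2 v = of_bool (v : S)) & common S & (ALL X. common X --> card X <= card S) &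
  clk t <= clk s + 2 + (H + 1) * Y)"
 proof (rule T_While[where I = "%t. EX S k. W t S k" and K = "clk s + 1 + (H + 1) * Y"], goal_cases)
  case 1
  have "W (s(|rv := (rv s)(11 := 1), clk := Suc (clk s)|)) S0 0" unfolding W_def using c a by simp
  thus ?case by blast
 next
  case (2 t)
  then obtain S k where w: "W t S k" by blast
  hence k: "k <= H" unfolding W_def by blast
  have "(H + 1) * Y = H * Y + Y" by simp
  moreover have "clk t <= clk s + 1 + k * Y | clk t <= clk s + 1 + (k + 1) * Y" using w unfolding W_def by blast
  ultimately have "clk t <= clk s + 1 + (H + 1) * Y" using kY[OF k] by linarith
  thus ?case by simp
 next
  case (3 t)
  then obtain S k where w: "W t S k" by blast
  have r11: "rv t 11 ~= 0" using 3(3) by simp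
  have w1: "common S" "ALL v<n. ra t 2 v = of_bool (v : S)" "k <= H" "S = (nextS ^^ k) S0" "card S = card S0 + k" "clk t <= clk s + 1 + k * Y"
   using w r11 unfolding W_def by blast+
  have f: "rv t 2 = Z" "rv t 25 = q" "ra t 13 = ra s 13" using 3(2) a q by (simp_all add: fr_def)
  have gd: "goodS ky q Ld S" using good[OF w1(3)] w1(4) by simp
  have cm: "CCT q Ld (card S) <= CCT q Ld rr" by (rule CCT_mono[OF rr[OF w1(1)]])
  show ?case
  proof (rule T_SeqI, rule T_conseq[OF cbfs_T[OF w1(1) _ _ _ q(2) _ gd]], goal_cases)
   case (5 u)
   let ?st = "cst S n"
   have u: "brel S ?st u" "bfnd ?st = None --> (ALL X. common X --> card X <= card S)" "clk u <= clk (tick t) + CCT q Ld (card S)" using 5(1) by blast+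
   note R = brelD[OF u(1)]
   have u11: "rv u 11 ~= 0" using 5(2) r11 by (simp add: fr_def)
   have ct: "clk (tick t) = Suc (clk t)" by simp
   have SY: "(k + 1) * Y = k * Y + Y" by simp
   show ?case
   proof (cases "bfnd ?st")
   case None
   have "clk u + 2 <= clk s + 1 + (k + 1) * Y" using u(3) w1(6) cm ct SY unfolding Y_def by linarith
   hence "W (u(|rv := (rv u)(11 := 0), clk := Suc (Suc (clk u))|)) S k"
   unfolding W_def using w1(1,3,4,5) R(5) u(2) None by simp
   thus ?thesis using R(14) None by auto
   next
   case (Some b)
   obtain l where CI: "Cinv S ?st n l" using cst_inv[OF w1(1)] by blast
   note A = C_aug[OF CI Some]
   have kl: "Suc k <= H" using opt[OF A(1)] A(2) w1(5) by simp
   have bt: "brel S ?st (tick u)" using u(1) by simp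
   have "T walk (tick u) (%t. EX S k. W t S k)"
   proof (rule T_conseq[OF walk_T[OF bt Some]], goal_cases)
   case (1 x)
   have g: "rv x 11 = rv u 11" using 1(2) by (simp add: fr_def)
   have "clk (tick u) = Suc (clk u)" by simp
   hence "clk x <= clk s + 1 + (k + 1) * Y"
   using 1(1)[THEN conjunct2] u(3) w1(6) cm ct SY unfolding Y_def by linarith
   moreover have "bwalk S ?st = (nextS ^^ Suc k) S0" using w1(4) Some by (simp add: nextS_def)
   ultimately have "W x (bwalk S ?st) (Suc k)" unfolding W_def using A 1(1) g kl w1(5) u11 by simp
   thus ?case by blast
   qed
   thus ?thesis using R(14) Some by simp
   qed
  qed (use w1 f ky in simp_all)
 next
  case (4 t)
  then obtain S k where w: "W t S k" by blast
  have r11: "rv t 11 = 0" using 4(3) by simp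
  have w1: "common S" "ALL v<n. ra t 2 v = of_bool (v : S)" "k <= H" "ALL X. common X --> card X <= card S" "clk t <= clk s + 1 + (k + 1) * Y"
   using w r11 unfolding W_def by blast+
  have "clk (tick t) = Suc (clk t)" by simp
  hence "clk (tick t) <= clk s + 2 + (H + 1) * Y" using w1(5) kY(2)[OF w1(3)] by linarith
  thus ?case using w1 by (intro exI[of _ S]) simp
 qed
 thus ?thesis unfolding phaseC_def Y_def by simp
qed

end

section \<open>The complete algorithm\<close>

text \<open>The binary value of a bit list with the most significant bit first, as it is built up by
  doubling in \<open>drawp\<close>.\<close>

definition bval :: "bool list => nat" where
 "bval bs = foldl (%x b. x + x + of_bool b) 0 bs"

lemma bval_snoc: "bval (bs @ [b]) = bval bs + bval bs + of_bool b"
 unfolding bval_def by simp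

lemma bval_surj: "v < 2 ^ m ==> EX bs. length bs = m & bval bs = v"
proof (induction m arbitrary: v)
 case 0
 thus ?case by (simp add: bval_def)
next
 case (Suc m)
 have "v div 2 < 2 ^ m" using Suc.prems by simp
 then obtain bs where bs: "length bs = m" "bval bs = v div 2" using Suc.IH by blast
 have "bval (bs @ [odd v]) = v" unfolding bval_snoc bs by (cases "even v") (auto elim!: evenE oddE)
 thus ?case using bs by (intro exI[of _ "bs @ [odd v]"]) simp
qed

abbreviation coinl :: "nat => bool list pmf" where
 "coinl L == replicate_pmf L (bernoulli_pmf (1/2))"

lemma pmf_coinl: "pmf (coinl (length bs)) bs = (1/2) ^ length bs"
proof (induction bs)
 case (Cons b bs)
 have "coinl (Suc (length bs)) = map_pmf (%(x, xs). x # xs) (pair_pmf (bernoulli_pmf (1/2)) (coinl (length bs)))"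
  by (simp add: pair_pmf_def map_bind_pmf map_pmf_def bind_assoc_pmf bind_return_pmf)
 moreover have "inj (%(x, xs). x # xs)" by (auto simp: inj_def)
 ultimately have "pmf (coinl (Suc (length bs))) (b # bs) = pmf (pair_pmf (bernoulli_pmf (1/2)) (coinl (length bs))) (b, bs)"
  using pmf_map_inj'[of "%(x, xs). x # xs" _ "(b, bs)"] by simp
 thus ?case using Cons by (cases b) (simp_all add: pmf_pair)
qed simp

text \<open>Every value below \<open>2 ^ m\<close> is represented by some bit list of length
  \<open>m\<close>; one list per value suffices for a lower bound.\<close>

lemma prob_bval:
 assumes "VV <= {..<2 ^ m}"
 shows "measure_pmf.prob (coinl m) {bs. bval bs : VV} >= real (card VV) / 2 ^ m"
proof -
 define g where "g v = (SOME bs. length bs = m & bval bs = v)" for v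
 have g: "length (g v) = m & bval (g v) = v" if "v : VV" for v
  unfolding g_def by (rule someI_ex) (use bval_surj[of v m] assms that in auto)
 have fin: "finite VV" using assms finite_subset by blast
 have inj: "inj_on g VV" using g by (metis inj_onI)
 have "measure_pmf.prob (coinl m) (g ` VV) = (SUM bs:g ` VV. pmf (coinl m) bs)"
  using fin by (intro measure_measure_pmf_finite) simp
 also have "... = (SUM bs:g ` VV. (1/2) ^ m)" using g pmf_coinl by (intro sum.cong) auto
 also have "... = real (card VV) / 2 ^ m" using card_image[OF inj] by (simp add: power_one_over divide_simps)
 finally have "measure_pmf.prob (coinl m) (g ` VV) = real (card VV) / 2 ^ m" .
 moreover have "measure_pmf.prob (coinl m) (g ` VV) <= measure_pmf.prob (coinl m) {bs. bval bs : VV}"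
  using g by (intro measure_pmf.finite_measure_mono) auto
 ultimately show ?thesis by simp
qed

section \<open>A random sample misses no large set\<close>

definition draw :: "nat => bool list => nat => nat" where
 "draw m cs k = bval (take m (drop (k * m) cs))"

text \<open>Consecutive blocks of \<open>m\<close> coins are independent: splitting off the first
  block shifts the numbering of the draws by one.\<close>

lemma prob_miss:
 assumes "measure_pmf.prob (coinl m) {bs. bval bs : VV} >= x" "0 <= x"
 shows "measure_pmf.prob (coinl (q * m)) {cs. ALL k<q. draw m cs k ~: VV} <= (1 - x) ^ q"
proof (induction q)
 case (Suc q)
 have x1: "x <= 1" using assms(1) measure_pmf.prob_le_1 order_trans by blast
 let ?A = "%q. {cs. ALL k<q. draw m cs k ~: VV}"
 have "coinl (Suc q * m) = bind_pmf (coinl m) (%xs. map_pmf ((@) xs) (coinl (q * m)))"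
  unfolding mult_Suc by (subst replicate_pmf_distrib) (simp add: map_pmf_def)
 hence "measure_pmf.prob (coinl (Suc q * m)) (?A (Suc q)) = (\<integral>xs. measure_pmf.prob (coinl (q * m)) ((@) xs -` ?A (Suc q)) \<partial>coinl m)"
  by (simp add: prob_bind_pmf)
 also have "... = (\<integral>xs. indicator {bs. bval bs ~: VV} xs * measure_pmf.prob (coinl (q * m)) (?A q) \<partial>coinl m)"
 proof (rule integral_cong_AE)
  show "AE xs in measure_pmf (coinl m). measure_pmf.prob (coinl (q * m)) ((@) xs -` ?A (Suc q)) = indicator {bs. bval bs ~: VV} xs * measure_pmf.prob (coinl (q * m)) (?A q)"
   unfolding AE_measure_pmf_iff
  proof
   fix xs assume "xs : set_pmf (coinl m)"
   hence l: "length xs = m" by (simp add: set_replicate_pmf)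
   have d0: "draw m (xs @ ys) 0 = bval xs" for ys using l by (simp add: draw_def)
   have dS: "draw m (xs @ ys) (Suc k) = draw m ys k" for ys k using l by (simp add: draw_def)
   have "(@) xs -` ?A (Suc q) = (if bval xs ~: VV then ?A q else {})"
   proof -
   have "(ALL k<Suc q. draw m (xs @ ys) k ~: VV) \<longleftrightarrow> bval xs ~: VV & (ALL k<q. draw m ys k ~: VV)" for ys
   unfolding All_less_Suc2 d0 dS ..
   thus ?thesis by auto
   qed
   thus "measure_pmf.prob (coinl (q * m)) ((@) xs -` ?A (Suc q)) = indicator {bs. bval bs ~: VV} xs * measure_pmf.prob (coinl (q * m)) (?A q)"
   by simp
  qed
 qed simp_all
 also have "... = measure_pmf.prob (coinl m) {bs. bval bs ~: VV} * measure_pmf.prob (coinl (q * m)) (?A q)" by simp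
 also have "... <= (1 - x) * (1 - x) ^ q"
 proof (rule mult_mono)
  have "measure_pmf.prob (coinl m) (UNIV - {bs. bval bs : VV}) = 1 - measure_pmf.prob (coinl m) {bs. bval bs : VV}"
   using measure_pmf.prob_compl[of "{bs. bval bs : VV}" "coinl m"] by simp
  moreover have "UNIV - {bs. bval bs : VV} = {bs. bval bs ~: VV}" by auto
  ultimately show "measure_pmf.prob (coinl m) {bs. bval bs ~: VV} <= 1 - x" using assms(1) by simp
 qed (use Suc x1 in auto)
 finally show ?case by simp
qed simp

text \<open>A union bound over the sets that are missed, with
  \<open>(1 - x) ^ q <= exp (- x * q)\<close>.\<close>

lemma all_draws_hit:
 assumes fin: "finite FF" and F: "!!W. W : FF ==> W <= {..<2 ^ m} & x * 2 ^ m <= real (card W)" and x: "0 <= x"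
  and c: "real (card FF) * exp (- x * real q) <= e"
 shows "measure_pmf.prob (coinl (q * m)) {cs. ALL W:FF. EX k<q. draw m cs k : W} >= 1 - e"
proof -
 let ?bad = "%W. {cs. ALL k<q. draw m cs k ~: W}"
 have b: "measure_pmf.prob (coinl (q * m)) (?bad W) <= exp (- x * real q)" if W: "W : FF" for W
 proof -
  have p: "x <= measure_pmf.prob (coinl m) {bs. bval bs : W}"
   using prob_bval[of W m] F[OF W] by (smt (verit) pos_le_divide_eq zero_less_power)
  have "x <= 1" using p measure_pmf.prob_le_1 order_trans by blast
  hence "(1 - x) ^ q <= exp (- x) ^ q" using exp_ge_add_one_self[of "- x"] by (intro power_mono) auto
  also have "... = exp (- x * real q)" by (simp add: exp_of_nat_mult[symmetric] mult.commute)
  finally show ?thesis using prob_miss[OF p x, of q] by linarith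
 qed
 have "measure_pmf.prob (coinl (q * m)) (UN W:FF. ?bad W) <= (SUM W:FF. measure_pmf.prob (coinl (q * m)) (?bad W))"
  by (rule measure_pmf.finite_measure_subadditive_finite[OF fin]) auto
 also have "... <= (SUM W:FF. exp (- x * real q))" using b by (intro sum_mono) auto
 also have "... <= e" using c by simp
 finally have "measure_pmf.prob (coinl (q * m)) (UN W:FF. ?bad W) <= e" .
 moreover have "{cs. ALL W:FF. EX k<q. draw m cs k : W} = UNIV - (UN W:FF. ?bad W)" by auto
 moreover have "measure_pmf.prob (coinl (q * m)) (UNIV - (UN W:FF. ?bad W)) = 1 - measure_pmf.prob (coinl (q * m)) (UN W:FF. ?bad W)"
  using measure_pmf.prob_compl[of "UN W:FF. ?bad W" "coinl (q * m)"] by simp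
 ultimately show ?thesis by simp
qed

context lang
begin

lemma ev_coins [simp]: "ev e (s(|coins := cs|)) = ev e s" "sev f j (s(|coins := cs|)) = sev f j s"
 by (induction e and f arbitrary: and j) auto

lemma ok_coins [simp]: "ok e (s(|coins := cs|)) = ok e s" "sok f j (s(|coins := cs|)) = sok f j s"
 by (induction e and f arbitrary: and j) (auto split: arith.splits)

lemma upd_coins:
 "s(|coins := cs, rv := a|) = s(|rv := a, coins := cs|)" "s(|coins := cs, ra := b|) = s(|ra := b, coins := cs|)"
 "s(|coins := cs, rm := c|) = s(|rm := c, coins := cs|)" "s(|coins := cs, sv := d|) = s(|sv := d, coins := cs|)"
 "s(|coins := cs, sa := e|) = s(|sa := e, coins := cs|)" "s(|coins := cs, out := f|) = s(|out := f, coins := cs|)"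
 "s(|coins := cs, clk := k|) = s(|clk := k, coins := cs|)"
 by simp_all

text \<open>The phases before the draws toss no coin, so their result is the same for every tape.
  The union bound needs this, since the starting set of the sampling phase must be fixed before the
  sample.\<close>

lemma big_coins: "big c s t ==> ~ mt c ==> big c (s(|coins := cs|)) (t(|coins := cs|))"
proof (induction rule: big.induct)
 case (Skip s)
 show ?case by (rule big.Skip)
next
 case (Assign e s x)
 thus ?case using big.Assign[of e "s(|coins := cs|)" x] by (simp add: upd_coins)
next
 case (SAssign q j s x)
 thus ?case using big.SAssign[of q j "s(|coins := cs|)" x] by (simp add: upd_coins)
next
 case (Put e s f a)
 thus ?case using big.Put[of e "s(|coins := cs|)" f a] by (simp add: upd_coins)
next
 case (Put2 e s f g a)
 thus ?case using big.Put2[of e "s(|coins := cs|)" f g a] by (simp add: upd_coins)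
next
 case (SPut e s q j a)
 thus ?case using big.SPut[of e "s(|coins := cs|)" q j a] by (simp add: upd_coins)
next
 case (Outp e s f)
 thus ?case using big.Outp[of e "s(|coins := cs|)" f] by (simp add: upd_coins)
next
 case (Seq c s t d u)
 thus ?case using big.Seq by auto
next
 case (IfT e s c t d)
 thus ?case using big.IfT[of e "s(|coins := cs|)" c "t(|coins := cs|)" d] by (simp add: upd_coins)
next
 case (IfF e s d t c)
 thus ?case using big.IfF[of e "s(|coins := cs|)" d "t(|coins := cs|)" c] by (simp add: upd_coins)
next
 case (WhileT e s c t u)
 thus ?case using big.WhileT[of e "s(|coins := cs|)" c "t(|coins := cs|)" "u(|coins := cs|)"] by (simp add: upd_coins)
next
 case (WhileF e s c)
 thus ?case using big.WhileF[of e "s(|coins := cs|)" c] by (simp add: upd_coins)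
qed simp

end

lemma bval_less: "bval bs < 2 ^ length bs"
proof (induction bs rule: rev_induct)
 case (snoc b bs)
 thus ?case unfolding bval_snoc by (cases b) auto
qed (simp add: bval_def)

section \<open>The remaining programs and their composition\<close>

context prog
begin

definition zp :: com where
 "zp = Assign 2 (N 1) ;; Assign 3 (N 0) ;;
  While (Op Sub Sz (V 2)) (Assign 2 (Op Add (V 2) (V 2)) ;; Assign 3 (Op Add (V 3) (N 1)))"

text \<open>A greedy base of the second matroid. Its size bounds every common independent set and is
  at most the larger of the two ranks, so it may stand in for that rank.\<close>

definition rp :: com where
 "rp = SAssign Snd 2 SEmp ;; Assign 4 (N 0) ;;
  For 7 Sz (When (Qry Snd (SIns (V 7) (SV 2))) (SAssign Snd 2 (SIns (V 7) (SV 2)) ;; Assign 4 (Op Add (V 4) (N 1))))"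

text \<open>Variable \<open>5\<close> becomes the least \<open>h >= 1\<close> with
  \<open>r <= h ^ 4\<close>; variable \<open>25\<close> becomes the sample size, whose constant is
  explained by \<open>prob_good\<close>.\<close>

definition hp :: "nat => com" where
 "hp c = Assign 5 (N 1) ;;
  While (Op Sub (V 4) (Op Mul (Op Mul (V 5) (V 5)) (Op Mul (V 5) (V 5)))) (Assign 5 (Op Add (V 5) (N 1))) ;;
  Assign 6 (Op Mul (V 5) (Op Mul (V 5) (V 5))) ;;
  Assign 25 (Op Mul (N (3 * (c + 3))) (Op Mul (Op Mul (V 5) (V 5)) (Op Add (V 3) (N 2))))"

definition drawp :: com where
 "drawp = For 26 (V 25) (Assign 27 (N 0) ;;
  For 28 (V 3) (Toss 29 ;; Assign 27 (Op Add (Op Add (V 27) (V 27)) (V 29))) ;; Put 13 (V 26) (V 27))"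

definition outp :: com where
 "outp = Assign 26 (N 0) ;; For 7 Sz (When (Get 2 (V 7)) (Outp (V 26) (V 7) ;; Assign 26 (Op Add (V 26) (N 1))))"

lemma mods_main [simp]:
 "mr zp = {2, 3}" "ma zp = {}" "mm zp = {}" "ms zp = {}" "mz zp = {}" "~ mo zp" "~ mt zp"
 "mr rp = {4, 7}" "ma rp = {}" "mm rp = {}" "ms rp = {(Snd, 2)}" "mz rp = {}" "~ mo rp" "~ mt rp"
 "mr (hp c) = {5, 6, 25}" "ma (hp c) = {}" "mm (hp c) = {}" "ms (hp c) = {}" "mz (hp c) = {}" "~ mo (hp c)" "~ mt (hp c)"
 "mr drawp = {26, 27, 28, 29}" "ma drawp = {13}" "mm drawp = {}" "ms drawp = {}" "mz drawp = {}" "~ mo drawp"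
 unfolding zp_def rp_def hp_def drawp_def by auto

lemma zp_T:
 assumes least: "ALL k<m. 2 ^ k < n"
 shows "T zp s (%t. rv t 2 = Z & rv t 3 = m & clk t <= clk s + 3 + 3 * m)"
proof -
 have mZ: "m < Z" using Z(1) by simp
 have "T (While (Op Sub Sz (V 2)) (Assign 2 (Op Add (V 2) (V 2)) ;; Assign 3 (Op Add (V 3) (N 1)))) (s(|rv := (rv s)(2 := 1, 3 := 0), clk := Suc (Suc (clk s))|))
  (%t. rv t 2 = Z & rv t 3 = m & clk t <= clk s + 3 + 3 * m)"
 proof (rule T_Loop[where K = m and I = "%k t. k <= m & rv t 2 = 2 ^ k & rv t 3 = k & clk t = clk s + 2 + 3 * k"], goal_cases)
  case (3 k t)
  have "2 ^ k < n" using 3 by simp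
  hence k: "k < m" using Z(1,2) by (metis leD le_neq_implies_less 3(1) less_le_trans)
  have "2 * 2 ^ k <= Z" using power_increasing[of "Suc k" m "2::nat"] k Z(1) by simp
  moreover have "Suc k < B" using k mZ B_Z by linarith
  ultimately show ?case using 3(1) k B_Z by simp
 next
  case (4 k t)
  have "~ 2 ^ k < n" using 4 by simp
  hence "k = m" using least 4(1) by (meson le_neq_implies_less)
  thus ?case using 4(1) Z(1) by simp
 qed simp_all
 thus ?thesis unfolding zp_def using B_lin by simp
qed

lemma rp_T:
 "T rp s (%t. (ALL X:J Snd. card X <= rv t 4) & (EX X:J Snd. card X = rv t 4) & rv t 4 <= n & clk t <= clk s + 4 + 5 * n)" (is "T _ _ ?Q")
proof -
 have nB: "n < B" "n + 1 < B" using B_lin by linarith+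
 define W where "W i t = (EX X. sv t Snd 2 = X & X : J Snd & X <= {..<i} & rv t 4 = card X & (ALL v<i. v ~: X --> insert v X ~: J Snd) &
  clk t <= clk s + 3 + 5 * i)" for i :: nat and t :: st
 let ?s = "s(|sv := (sv s)(Snd := (sv s Snd)(2 := {})), rv := (rv s)(4 := 0), clk := Suc (Suc (clk s))|)"
 have "T (For 7 Sz (When (Qry Snd (SIns (V 7) (SV 2))) (SAssign Snd 2 (SIns (V 7) (SV 2)) ;; Assign 4 (Op Add (V 4) (N 1))))) ?s
  ?Q"
 proof (rule T_For[where m = n and P = W], goal_cases)
  case 3
  show ?case unfolding W_def using M2.indep_empty by simp
 next
  case (5 i t)
  from 5(1) obtain X where X: "sv t Snd 2 = X" "X : J Snd" "X <= {..<i}" "rv t 4 = card X" "ALL v<i. v ~: X --> insert v X ~: J Snd" "clk t <= clk s + 3 + 5 * i"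
   unfolding W_def by blast
  have fX: "finite X" "i ~: X" using X(3) finite_subset by auto
  have cX: "card X <= i" using card_mono[OF _ X(3)] by simp
  show ?case
  proof (cases "insert i X : J Snd")
   case True
   have "insert v (insert i X) ~: J Snd" if "v < Suc i" "v ~: insert i X" for v
   using X(5) that J_mono[of "insert v (insert i X)" Snd "insert v X"] by (auto simp: less_Suc_eq)
   thus ?thesis using True X 5(3,4) nB fX cX unfolding W_def by (auto simp: less_Suc_eq)
  next
   case False
   thus ?thesis using X 5(3,4) nB unfolding W_def by (auto simp: less_Suc_eq)
  qed
 next
  case (6 t)
  from 6(1) obtain X where X: "X : J Snd" "X <= {..<n}" "rv t 4 = card X" "ALL v<n. v ~: X --> insert v X ~: J Snd" "clk t <= clk s + 3 + 5 * n"
   unfolding W_def by blast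
  have "card Y <= card X" if Y: "Y : J Snd" for Y
  proof (rule ccontr)
   assume "~ card Y <= card X"
   then obtain y where "y : Y - X" "insert y X : J Snd" using M2.augment[OF X(1) Y] by auto
   thus False using X(4) M2.indep_subset[OF Y] by auto
  qed
  moreover have "card X <= n" using card_mono[OF _ X(2)] by simp
  ultimately show ?case using X by auto
 qed (use nB in simp_all)
 thus ?thesis unfolding rp_def by simp
qed

lemma hp_T:
 assumes r: "rv s 4 = r" "r <= n" and m3: "rv s 3 = m" and cB: "(3 * (c + 3)) * (n + 2) ^ 4 < B"
 shows "T (hp c) s (%t. EX h. rv t 5 = h & rv t 6 = h ^ 3 & rv t 25 = 3 * (c + 3) * (h * h * (m + 2)) & 1 <= h & h <= n + 1 & r <= h ^ 4 &
  (h = 1 | (h - 1) ^ 4 < r) & clk t <= clk s + 5 + 2 * h)" (is "T _ _ ?Q")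
proof -
 define W where "W k t = (rv t 5 = Suc k & (k = 0 | k ^ 4 < r) & clk t = clk s + 1 + 2 * k)" for k and t :: st
 have kn: "k <= n" if "W k t" for k t
 proof (cases "k = 0")
  case False
  hence "k <= k ^ 4" by (simp add: self_le_power)
  thus ?thesis using that r False unfolding W_def by auto
 qed simp
 have p4: "x * x * (x * x) = x ^ 4" "x * (x * x) = x ^ 3" for x :: nat by (simp_all add: eval_nat_numeral)
 have b4: "x ^ 4 < B" "x * x < B" "x ^ 3 < B" if "x <= n + 1" for x
 proof -
  have a: "x ^ 4 <= (n + 2) ^ 4" "x * x <= (n + 2) ^ 2" "x ^ 3 <= (n + 2) ^ 3"
   using that power_mono[of x "n + 2" 4] power_mono[of x "n + 2" 3] power_mono[of x "n + 2" 2] by (simp_all add: power2_eq_square)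
  have b: "(n + 2) ^ 2 <= (n + 2) ^ 4" "(n + 2) ^ 3 <= (n + 2) ^ 4" by (simp_all add: power_increasing)
  show "x ^ 4 < B" "x * x < B" "x ^ 3 < B" using a b Bn by linarith+
 qed
 have mn: "m + 2 <= (n + 2) ^ 2"
 proof -
  have "m < Z" using Z(1) by simp
  hence "m + 2 <= 2 * n + 3" using Z(3) by simp
  also have "... <= (n + 2) ^ 2" by (simp add: power2_eq_square)
  finally show ?thesis .
 qed
 have "T (While (Op Sub (V 4) (Op Mul (Op Mul (V 5) (V 5)) (Op Mul (V 5) (V 5)))) (Assign 5 (Op Add (V 5) (N 1)))) (s(|rv := (rv s)(5 := 1), clk := Suc (clk s)|))
  (%t. T (Assign 6 (Op Mul (V 5) (Op Mul (V 5) (V 5))) ;; Assign 25 (Op Mul (N (3 * (c + 3))) (Op Mul (Op Mul (V 5) (V 5)) (Op Add (V 3) (N 2))))) t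
  ?Q)"
 proof (rule T_Loop[where K = n and I = W], goal_cases)
  case 1
  thus ?case unfolding W_def by simp
 next
  case (2 k t)
  have "rv t 5 = Suc k" using 2(1) unfolding W_def by blast
  thus ?case using kn[OF 2(1)] b4[of "Suc k"] p4[of "Suc k"] by (simp del: mult_Suc mult_Suc_right)
 next
  case (3 k t)
  have w: "rv t 5 = Suc k" "clk t = clk s + 1 + 2 * k" using 3(1) unfolding W_def by blast+
  have r4: "rv t 4 = r" using 3(2) r by (simp add: fr_def)
  have "Suc k ^ 4 < r" using 3(3) w r4 p4[of "Suc k"] by (simp del: mult_Suc mult_Suc_right)
  moreover have "Suc (Suc k) < B" using kn[OF 3(1)] B_lin by linarith
  ultimately show ?case unfolding W_def using w by simp
 next
  case (4 k t)
  define h where "h = Suc k"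
  have w: "rv t 5 = h" "clk t = clk s + 1 + 2 * k" "k = 0 | k ^ 4 < r" using 4(1) unfolding W_def h_def by blast+
  have f: "rv t 4 = r" "rv t 3 = m" using 4(2) r m3 by (simp_all add: fr_def)
  have hn: "h <= n + 1" using kn[OF 4(1)] h_def by simp
  have rh: "r <= h ^ 4" using 4(3) w f p4[of h] by (simp del: mult_Suc mult_Suc_right)
  have hh: "h * h * (m + 2) <= (n + 2) ^ 4"
  proof -
   have "h * h <= (n + 2) ^ 2" using power_mono[of h "n + 2" 2] hn by (simp add: power2_eq_square)
   hence "h * h * (m + 2) <= (n + 2) ^ 2 * (n + 2) ^ 2" using mn by (rule mult_le_mono)
   thus ?thesis by (simp add: power_add[symmetric])
  qed
  have q1: "h * h * (m + 2) < B" using hh Bn by linarith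
  have "3 * (c + 3) * (h * h * (m + 2)) <= 3 * (c + 3) * (n + 2) ^ 4" using hh by (rule mult_le_mono2)
  hence q2: "3 * (c + 3) * (h * h * (m + 2)) < B" using cB by linarith
  have q3: "m + 2 < B" using mn b4(2)[of 1] LB power_increasing[of 2 3 "n + 2"] by linarith
  have e: "h = 1 | (h - 1) ^ 4 < r" "1 <= h" using w(3) unfolding h_def by auto
  show ?case using w f b4[OF hn] p4[of h] q1 q2 q3 hn rh e by (simp add: h_def[symmetric] del: mult_Suc mult_Suc_right One_nat_def) (simp add: h_def)
 qed
 thus ?thesis unfolding hp_def using B_lin by simp
qed

lemma drawp_T:
 assumes q: "rv s 25 = q" "q < B" and m3: "rv s 3 = m" and cs: "coins s = cs" "length cs = q * m"
 shows "T drawp s (%t. (ALL k<q. ra t 13 k = draw m cs k) & clk t <= clk s + 2 + q * (4 * m + 6))"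
 unfolding drawp_def
proof (rule T_For[where m = q and P = "%k t. coins t = drop (k * m) cs & (ALL i<k. ra t 13 i = draw m cs i) & clk t <= clk s + 1 + k * (4 * m + 6)"], goal_cases)
 case 3
 thus ?case using cs by simp
next
 case (4 k t)
 thus ?case using q by (simp add: fr_def)
next
 case (5 k t)
 have mB: "m < B" using Z(1) B_Z less_exp[of m] by linarith
 have f: "rv t 3 = m" "rv t 26 = k" using 5(2,3) m3 by (simp_all add: fr_def)
 let ?t = "t(|rv := (rv t)(27 := 0), clk := Suc (Suc (clk t))|)"
 have "T (For 28 (V 3) (Toss 29 ;; Assign 27 (Op Add (Op Add (V 27) (V 27)) (V 29)))) ?t (%u. T (Put 13 (V 26) (V 27)) u (%u. coins u = drop (Suc k * m) cs &
  (ALL i<Suc k. ra u 13 i = draw m cs i) & clk u + 1 <= clk s + 1 + Suc k * (4 * m + 6)))"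
 proof (rule T_For[where m = m and P = "%j u. rv u 27 = bval (take j (drop (k * m) cs)) & coins u = drop (k * m + j) cs & clk u = clk t + 3 + 4 * j"], goal_cases)
  case 3
  thus ?case using 5(1) by (simp add: bval_def)
 next
  case (4 j u)
  thus ?case using f by (simp add: fr_def)
 next
  case (5 j u)
  have le: "k * m + j < length cs"
  proof -
   have "Suc k * m <= q * m" using \<open>k < q\<close> by (intro mult_le_mono1) simp
   thus ?thesis using 5(4) cs by simp
  qed
  have cc: "coins (tick u) = cs ! (k * m + j) # drop (k * m + Suc j) cs" using 5(1) le by (simp add: Cons_nth_drop_Suc)
  have tk: "take (Suc j) (drop (k * m) cs) = take j (drop (k * m) cs) @ [cs ! (k * m + j)]" using le by (simp add: take_Suc_conv_app_nth)
  have "bval (take j (drop (k * m) cs)) < 2 ^ j" using bval_less[of "take j (drop (k * m) cs)"]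
   by (rule less_le_trans) (simp add: power_increasing)
  also have "2 ^ j <= Z" unfolding Z(1) using 5(4) by (intro power_increasing) auto
  finally have bb: "2 * bval (take j (drop (k * m) cs)) + 2 < B" using B_Z by linarith
  show ?case
  proof (rule T_SeqI, rule T_Toss[OF cc], goal_cases)
   case 1
   show ?case using 5(1) bb by (cases "cs ! (k * m + j)") (simp_all add: tk bval_snoc)
  qed
 next
  case (6 u)
  have g: "rv u 26 = k" "ra u 13 = ra t 13" using 6(2) f by (simp_all add: fr_def)
  show ?case using 6(1) g \<open>k < q\<close> q(2) 5(1) by (simp add: draw_def less_Suc_eq add.commute)
 qed (use mB in simp_all)
 thus ?case using B_lin by simp
next
 case (6 t)
 thus ?case by simp
qed (use q in simp_all)

lemma outp_T:
 assumes a: "ALL v<n. ra s 2 v = of_bool (v : S)" and S: "S <= {..<n}"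
 shows "T outp s (%t. out t ` {..<rv t 26} = S & rv t 26 <= n & clk t <= clk s + 3 + 5 * n)" (is "T _ _ ?Q")
proof -
 have nB: "n + 1 < B" using B_lin by linarith
 have "T (For 7 Sz (When (Get 2 (V 7)) (Outp (V 26) (V 7) ;; Assign 26 (Op Add (V 26) (N 1))))) (s(|rv := (rv s)(26 := 0), clk := Suc (clk s)|))
  ?Q"
 proof (rule T_For[where m = n and P = "%i t. out t ` {..<rv t 26} = S Int {..<i} & rv t 26 <= i & clk t <= clk s + 2 + 5 * i"], goal_cases)
  case (5 i t)
  have r: "ra t 2 i = of_bool (i : S)" using 5(2,4) a by (simp add: fr_def)
  show ?case
  proof (cases "i : S")
   case True
   have "S Int {..<Suc i} = insert i (S Int {..<i})" using True by auto
   moreover have "((out t)(rv t 26 := i)) ` {..<Suc (rv t 26)} = insert i (out t ` {..<rv t 26})"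
   by (auto simp: lessThan_Suc image_iff)
   ultimately show ?thesis using True r 5 nB by simp
  next
   case False
   hence "S Int {..<Suc i} = S Int {..<i}" by (auto simp: less_Suc_eq)
   thus ?thesis using False r 5 nB by simp
  qed
 next
  case (6 t)
  moreover have "S Int {..<n} = S" using S by auto
  ultimately show ?case by simp
 qed (use nB in simp_all)
 thus ?thesis unfolding outp_def by simp
qed

definition prep :: "nat => com" where
 "prep c = zp ;; rp ;; hp c ;; phaseA ;; phaseB"

definition postp :: com where
 "postp = drawp ;; phaseC ;; outp"

lemma mods_prep [simp]: "~ mt (prep c)"
 unfolding prep_def by simp

text \<open>The fourth root of \<open>r\<close> rounded up, but at least one.\<close>

definition fourth_root :: "nat => nat => bool" where
 "fourth_root h r \<longleftrightarrow> 1 <= h & h <= n + 1 & r <= h ^ 4 & (h = 1 | (h - 1) ^ 4 < r)"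

definition tpre :: "nat => nat" where
 "tpre h = 20 + 3 * m + 5 * n + 2 * h + (h ^ 2 + 1) * (h * (24 * n + 13) + 10) + 20 * n * h ^ 3 + (2 * h ^ 3 + 1) * (CB (h ^ 3) + 10 * n + 14)"

lemma prep_T:
 assumes least: "ALL k<m. 2 ^ k < n" and cB: "(3 * (c + 3)) * (n + 2) ^ 4 < B"
  and z: "ALL a i. ra s a i = 0" "ALL i. sa s Snd 2 i = {}"
 shows "T (prep c) s (%t. EX S h r. (ALL v<n. ra t 2 v = of_bool (v : S)) & common S & rv t 2 = Z & rv t 3 = m &
  rv t 25 = 3 * (c + 3) * (h * h * (m + 2)) & fourth_root h r & r <= n & (ALL X:J Snd. card X <= r) & (EX X:J Snd. card X = r) &
  (ALL X. common X --> h ^ 3 * card X <= h ^ 3 * card S + card S) & clk t <= clk s + tpre h)"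
 unfolding prep_def
proof (rule T_SeqI, rule T_conseq[OF zp_T[OF least]], goal_cases)
 case (1 s1)
 note s1 = 1(1)[THEN conjunct1] 1(1)[THEN conjunct2, THEN conjunct1] 1(1)[THEN conjunct2, THEN conjunct2]
 have f1: "ra s1 = ra s" "sa s1 = sa s" using 1(2) by (simp_all add: fr_def fun_eq_iff)
 show ?case
 proof (rule T_SeqI, rule T_conseq[OF rp_T], goal_cases)
  case (1 s2)
  define r where "r = rv s2 4"
  have s2: "ALL X:J Snd. card X <= r" "EX X:J Snd. card X = r" "r <= n" "clk s2 <= clk s1 + 4 + 5 * n" using 1(1) unfolding r_def by blast+
  have f2: "ra s2 = ra s" "sa s2 = sa s" "rv s2 2 = Z" "rv s2 3 = m" using 1(2) f1 s1 by (simp_all add: fr_def fun_eq_iff)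
  show ?case
  proof (rule T_SeqI, rule T_conseq[OF hp_T[OF r_def[symmetric] s2(3) f2(4) cB]], goal_cases)
   case (1 s3)
   from 1(1) obtain h where h: "rv s3 5 = h" "rv s3 6 = h ^ 3" "rv s3 25 = 3 * (c + 3) * (h * h * (m + 2))" "1 <= h" "h <= n + 1" "r <= h ^ 4"
   "h = 1 | (h - 1) ^ 4 < r" "clk s3 <= clk s2 + 5 + 2 * h" by (elim exE conjE)
   have f3: "ra s3 = ra s" "sa s3 = sa s" "rv s3 2 = Z" "rv s3 3 = m" using 1(2) f2 by (simp_all add: fr_def fun_eq_iff)
   have hr: "card X <= h ^ 4" if "X : J Snd" for X using s2(1) that h(6) by (meson le_trans)
   show ?case
   proof (rule T_SeqI, rule T_conseq[OF phaseA_T[OF _ _ _ _ h(4,5,1,2) hr]], goal_cases)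
   case (6 s4)
   from 6(1) obtain S where S: "ALL v<n. ra s4 2 v = of_bool (v : S)" "common S" "ALL X. common X --> card X <= card S + 2 * h ^ 3"
   "clk s4 <= clk s3 + 3 + (h ^ 2 + 1) * (h * (24 * n + 13) + 10)" by (elim exE conjE)
   have f4: "rv s4 2 = Z" "rv s4 3 = m" "rv s4 6 = h ^ 3" "rv s4 25 = 3 * (c + 3) * (h * h * (m + 2))" "ra s4 5 = ra s 5"
   using 6(2) f3 h by (simp_all add: fr_def)
   have d: "0 < h ^ 3" "h ^ 3 < (n + 2) ^ 3" using h(4,5) power_strict_mono[of h "n + 2" 3] by simp_all
   have z5: "ALL v<n. ra s4 5 v = 0" using f4(5) z(1) by simp
   have o: "card X <= card S + 2 * h ^ 3" if "common X" for X using S(3) that by blast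
   show ?case
   proof (rule T_conseq[OF phaseB_T[OF S(2,1) f4(1) z5 f4(3) d o]], goal_cases)
   case (2 s5)
   from 2(1) obtain S' where S': "ALL v<n. ra s5 2 v = of_bool (v : S')" "common S'" "ALL X. common X --> h ^ 3 * card X <= h ^ 3 * card S' + card S'"
   "clk s5 <= clk s4 + 2 + 20 * n * h ^ 3 + (2 * h ^ 3 + 1) * (CB (h ^ 3) + 10 * n + 14)" by (elim exE conjE)
   have f5: "rv s5 2 = Z" "rv s5 3 = m" "rv s5 25 = 3 * (c + 3) * (h * h * (m + 2))" using 2(2) f4 by (simp_all add: fr_def)
   have "clk s5 <= clk s + tpre h" using S'(4) S(4) h(8) s2(4) s1(3) unfolding tpre_def by linarith
   thus ?case using S' f5 h s2 unfolding fourth_root_def by (intro exI[of _ S'] exI[of _ h] exI[of _ r]) blast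
   qed
   qed (use z f3 in simp_all)
  qed
 qed
qed

definition tpost :: "nat => nat => nat => nat" where
 "tpost q h r = 10 + q * (4 * m + 6) + (h + 1) * (CCT q (n div h ^ 2) r + 10 * n + 14) + 5 * n"

lemma postp_T:
 assumes c: "common S" and a: "ALL v<n. ra s 2 v = of_bool (v : S)" "rv s 2 = Z" "rv s 3 = m"
  and q: "rv s 25 = q" "q + 1 < B" and h: "fourth_root h r" and r: "ALL X:J Snd. card X <= r"
  and opt: "ALL X. common X --> h ^ 3 * card X <= h ^ 3 * card S + card S"
  and cs: "coins s = cs" "length cs = q * m"
  and good: "!!i. i <= h ==> goodS (%k. draw m cs k mod n) q (n div h ^ 2) ((nextS ^^ i) S)"
 shows "T postp s (%t. EX S. common S & (ALL X. common X --> card X <= card S) & out t ` {..<rv t 26} = S & rv t 26 <= n &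
  clk t <= clk s + tpost q h r)"
proof -
 have qB: "q < B" using q by simp
 have h1: "1 <= h" "r <= h ^ 4" using h unfolding fourth_root_def by auto
 have rc: "card X <= r" if "common X" for X using r common_sub(2)[OF that, of Snd] by blast
 \<comment> \<open>A deficit above \<open>h\<close> would give
   \<open>h ^ 4 + h ^ 3 <= card S\<close>, while \<open>card S <= r <= h ^ 4\<close>.\<close>
 have H: "card X <= card S + h" if X: "common X" for X
 proof (rule ccontr)
  assume "~ card X <= card S + h"
  hence "card S + h + 1 <= card X" by simp
  hence "h ^ 3 * (card S + h + 1) <= h ^ 3 * card X" by (rule mult_le_mono2)
  also have "... <= h ^ 3 * card S + card S" using opt X by blast
  finally have "h ^ 3 * h + h ^ 3 <= card S" by (simp add: algebra_simps)
  moreover have "h ^ 3 * h = h ^ 4" by (simp add: eval_nat_numeral)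
  moreover have "0 < h ^ 3" using h1 by simp
  ultimately show False using rc[OF c] h1(2) by linarith
 qed
 show ?thesis unfolding postp_def
 proof (rule T_SeqI, rule T_conseq[OF drawp_T[OF q(1) qB a(3) cs]], goal_cases)
  case (1 s1)
  have k: "ALL k<q. ra s1 13 k mod n = draw m cs k mod n" "clk s1 <= clk s + 2 + q * (4 * m + 6)" using 1(1) by simp_all
  have f: "ra s1 2 = ra s 2" "rv s1 2 = Z" "rv s1 25 = q" using 1(2) a q by (simp_all add: fr_def)
  have a1: "ALL v<n. ra s1 2 v = of_bool (v : S)" using a f by simp
  show ?case
  proof (rule T_SeqI, rule T_conseq[OF phaseC_T[OF c a1 f(2,3) q(2) k(1) good H rc]], goal_cases)
   case (4 s2)
   from 4(1) obtain S' where S': "ALL v<n. ra s2 2 v = of_bool (v : S')" "common S'" "ALL X. common X --> card X <= card S'"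
   "clk s2 <= clk s1 + 2 + (h + 1) * (CCT q (n div h ^ 2) r + 10 * n + 14)" by (elim exE conjE)
   show ?case
   proof (rule T_conseq[OF outp_T[OF S'(1) common_sub(1)[OF S'(2)]]], goal_cases)
   case (1 s3)
   thus ?case using S' k(2) unfolding tpost_def by (intro exI[of _ S']) auto
   qed
  qed simp_all
 qed
qed

text \<open>Only sets with more than \<open>n / h ^ 2\<close> elements have to be hit. A draw that
  lands in such a set is below \<open>n\<close>, so the remainder does not change it.\<close>

lemma goodS_of_hits:
 assumes "common S" "1 <= h"
  and "!!p a. p <= n ==> a : S ==> n < card {b : {..<n} - S - set (bD (cst S p)). insert b (S - {a}) : J Snd} * h ^ 2 ==>
   EX k<q. \<delta> k : {b : {..<n} - S - set (bD (cst S p)). insert b (S - {a}) : J Snd}"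
 shows "goodS (%k. \<delta> k mod n) q (n div h ^ 2) S"
 unfolding goodS_def
proof (intro allI impI ballI)
 fix p a assume p: "p <= n" and a: "a : S" and nh: "ALL k<q. ~ hit S (cst S p) (%k. \<delta> k mod n) a k"
 let ?W = "{b : {..<n} - S - set (bD (cst S p)). insert b (S - {a}) : J Snd}"
 have "~ n < card ?W * h ^ 2"
 proof
  assume "n < card ?W * h ^ 2"
  then obtain k where "k < q" "\<delta> k : ?W" using assms(3)[OF p a] by blast
  hence "hit S (cst S p) (%k. \<delta> k mod n) a k" unfolding hit_def by auto
  thus False using nh \<open>k < q\<close> by blast
 qed
 hence "card ?W <= n div h ^ 2" using assms(2) by (simp add: less_eq_div_iff_mult_less_eq)
 moreover have "set (cl2 S (set (bD (cst S p))) a n) = ?W" "distinct (cl2 S (set (bD (cst S p))) a n)" unfolding cl2_def by auto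
 hence "length (cl2 S (set (bD (cst S p))) a n) = card ?W" using distinct_card by metis
 ultimately show "length (cl2 S (set (bD (cst S p))) a n) <= n div h ^ 2" by simp
qed

text \<open>A set of more than \<open>n / h ^ 2\<close> elements has density at least
  \<open>1 / (3 * h ^ 2)\<close> among the values below \<open>2 ^ m <= 3 * n\<close>. With this
  \<open>q\<close> the exponent is \<open>(c + 3) * (m + 2)\<close>, and
  \<open>n + 2 <= exp (m + 2)\<close>; three of the \<open>c + 3\<close> factors pay for the union
  bound over search, position and element.\<close>

lemma prob_good:
 assumes S: "common S" and h: "1 <= h" "h <= n + 1" and q: "q = 3 * (c + 3) * (h * h * (m + 2))"
 shows "measure_pmf.prob (coinl (q * m)) {cs. ALL i<=h. goodS (%k. draw m cs k mod n) q (n div h ^ 2) ((nextS ^^ i) S)} >= 1 - 1 / real (n + 2) ^ c"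
proof -
 define Wf where "Wf = (%(i, p, a). let S' = (nextS ^^ i) S in {b : {..<n} - S' - set (bD (cst S' p)). insert b (S' - {a}) : J Snd})"
 define FF where "FF = {W : Wf ` ({..h} \<times> {..n} \<times> {..<n}). n < card W * h ^ 2}"
 have fin: "finite FF" unfolding FF_def by simp
 have "card FF <= card (Wf ` ({..h} \<times> {..n} \<times> {..<n}))" unfolding FF_def by (intro card_mono) auto
 also have "... <= card ({..h} \<times> {..n} \<times> {..<n})" by (intro card_image_le) simp
 also have "... = (h + 1) * ((n + 1) * n)" by (simp add: card_cartesian_product)
 also have "... <= (n + 2) * ((n + 2) * (n + 2))" using h by (intro mult_le_mono) auto
 finally have cF: "card FF <= (n + 2) ^ 3" by (simp add: eval_nat_numeral)
 define x where "x = 1 / (3 * real h ^ 2)"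
 have x0: "0 <= x" unfolding x_def by simp
 have hp: "0 < real h ^ 2" using h by simp
 have F: "W <= {..<2 ^ m} & x * 2 ^ m <= real (card W)" if "W : FF" for W
 proof
  have sub: "W <= {..<n}" using that unfolding FF_def Wf_def by (auto simp: Let_def)
  thus "W <= {..<2 ^ m}" using Z(1,2) by auto
  have W: "n < card W * h ^ 2" using that unfolding FF_def by blast
  have "card W ~= 0" using W by (cases "card W") auto
  hence "n ~= 0" using sub by (cases "n = 0") auto
  hence "2 ^ m <= 3 * n" using Z(1,3) by simp
  hence "2 ^ m <= 3 * (card W * h ^ 2)" using W by linarith
  hence "real (2 ^ m) <= real (3 * (card W * h ^ 2))" by (rule of_nat_mono)
  thus "x * 2 ^ m <= real (card W)" unfolding x_def using hp by (simp add: field_simps)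
 qed
 have e: "real (card FF) * exp (- x * real q) <= 1 / real (n + 2) ^ c"
 proof -
  have "real h ~= 0" using h by simp
  moreover have "real q = real (c + 3) * real (m + 2) * (3 * real h ^ 2)" unfolding q by (simp add: power2_eq_square algebra_simps)
  ultimately have "x * real q = real (c + 3) * real (m + 2)" unfolding x_def by simp
  hence "exp (- x * real q) = (1 / exp (real (m + 2))) ^ (c + 3)"
   by (simp add: exp_of_nat_mult[symmetric] exp_minus inverse_eq_divide power_one_over del: of_nat_add)
  moreover have "real (n + 2) <= exp (real (m + 2))"
  proof -
   have "n + 2 <= 4 * Z" using Z(2) B_Z(5) by linarith
   hence "n + 2 <= 2 ^ (m + 2)" unfolding Z(1) by (simp add: power_add)
   hence "real (n + 2) <= 2 ^ (m + 2)" by (metis of_nat_mono of_nat_numeral of_nat_power)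
   also have "... <= exp 1 ^ (m + 2)" using exp_ge_add_one_self[of 1] by (intro power_mono) auto
   also have "... = exp (real (m + 2))" using exp_of_nat_mult[of "m + 2" "1::real"] by simp
   finally show ?thesis .
  qed
  hence "(1 / exp (real (m + 2))) ^ (c + 3) <= (1 / real (n + 2)) ^ (c + 3)" by (intro power_mono divide_left_mono) auto
  ultimately have "real (card FF) * exp (- x * real q) <= real ((n + 2) ^ 3) * (1 / real (n + 2)) ^ (c + 3)"
   using cF by (intro mult_mono) (simp_all only: of_nat_le_iff of_nat_0_le_iff, simp_all)
  also have "... = 1 / real (n + 2) ^ c" by (simp add: power_add power_one_over field_simps)
  finally show ?thesis .
 qed
 have "1 - 1 / real (n + 2) ^ c <= measure_pmf.prob (coinl (q * m)) {cs. ALL W:FF. EX k<q. draw m cs k : W}"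
  by (rule all_draws_hit[OF fin F x0 e])
 also have "... <= measure_pmf.prob (coinl (q * m)) {cs. ALL i<=h. goodS (%k. draw m cs k mod n) q (n div h ^ 2) ((nextS ^^ i) S)}"
 proof (intro measure_pmf.finite_measure_mono subsetI CollectI allI impI)
  fix cs i assume cs: "cs : {cs. ALL W:FF. EX k<q. draw m cs k : W}" and i: "i <= h"
  show "goodS (%k. draw m cs k mod n) q (n div h ^ 2) ((nextS ^^ i) S)"
  proof (rule goodS_of_hits[OF nextS_common[OF S] h(1)], goal_cases)
   case (1 p a)
   have "a < n" using common_sub(1)[OF nextS_common[OF S]] 1(2) by auto
   hence "Wf (i, p, a) : FF" unfolding FF_def using i 1 by (auto simp: Wf_def Let_def)
   thus ?case using cs unfolding Wf_def by (auto simp: Let_def)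
  qed
 qed simp
 finally show ?thesis .
qed

end

section \<open>Running time and success probability\<close>

definition st0 :: "bool list => st" where
 "st0 cs = (|rv = (%_. 0), ra = (%_ _. 0), rm = (%_ _ _. 0), sv = (%_ _. {}), sa = (%_ _ _. {}), out = (%_. 0), coins = cs, clk = 0|)"

context prog
begin

text \<open>For \<open>h >= 2\<close> one has \<open>h <= 2 * (h - 1)\<close> and
  \<open>(h - 1) ^ 4 < r <= n\<close>.\<close>

lemma fourth_root_cube:
 assumes "fourth_root h r" "r <= n"
 shows "h ^ 3 <= 8 * (n + 2)"
proof (cases "h = 1")
 case False
 hence h: "2 <= h" "(h - 1) ^ 4 < r" using assms unfolding fourth_root_def by auto
 have "h <= 2 * (h - 1)" using h by simp
 hence "h ^ 3 <= (2 * (h - 1)) ^ 3" by (rule power_mono) simp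
 also have "... = 8 * (h - 1) ^ 3" by (simp add: power_mult_distrib)
 also have "... <= 8 * (h - 1) ^ 4" using h by (intro mult_le_mono2 power_increasing) auto
 finally have "h ^ 3 <= 8 * (h - 1) ^ 4" .
 moreover have "8 * (h - 1) ^ 4 <= 8 * n" using h(2) assms(2) by (intro mult_le_mono2) simp
 ultimately show ?thesis by simp
qed simp

lemma m_bound: "m + 2 <= 2 * (n + 2)"
proof -
 have "m < Z" using Z(1) by simp
 thus ?thesis using Z(3) by simp
qed

text \<open>\<open>G\<close> is the target, and \<open>P\<close> with \<open>h * P = G\<close> is
  the allowance for one search of the last phase; the factor \<open>h + 1\<close> is put back at the
  end.\<close>

lemma time_bound:
 assumes h: "fourth_root h r" "r <= n" and q: "q = 3 * (c + 3) * (h * h * (m + 2))"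
 shows "tpre h + tpost q h r <= 2000 * (c + 3) * ((n + 2) * h ^ 3 * (m + 2) ^ 2)"
proof -
 define nn my e where "nn = n + 2" and "my = m + 2" and "e = c + 3"
 have b: "1 <= h" "2 <= nn" "2 <= my" "1 <= e" "n + 2 = nn" "m + 2 = my" "n = nn - 2" "m = my - 2" "r <= h ^ 4" "r <= nn"
  using h unfolding nn_def my_def e_def fourth_root_def by auto
 have q': "q = 3 * e * (h * h * my)" unfolding q e_def my_def ..
 define G where "G = nn * h ^ 3 * my ^ 2"
 define P where "P = nn * h ^ 2 * my ^ 2"
 have hP: "h * P = G" unfolding G_def P_def by (simp add: eval_nat_numeral algebra_simps)
 have one: "1 <= h ^ 2" "1 <= h ^ 3" "1 <= my ^ 2" "1 <= my" using b by simp_all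
 have d8: "h ^ 3 <= 8 * nn" using fourth_root_cube[OF h] nn_def by simp
 have PG: "P <= G" using b(1) hP by (metis mult_le_mono1 nat_mult_1)
 have my2: "my <= my ^ 2" using one(4) by (simp add: power2_eq_square)
 have nP: "nn * my <= P"
 proof -
  have "nn * 1 * my <= nn * h ^ 2 * my ^ 2" using one my2 by (intro mult_le_mono) auto
  thus ?thesis unfolding P_def by simp
 qed
 have nmu: "nn * 2 <= nn * my" using b(3) by (rule mult_le_mono2)
 have hG: "h <= G"
 proof -
  have "h * 1 <= h * P" using nP nmu b(2) by (intro mult_le_mono2) linarith
  thus ?thesis using hP by simp
 qed
 have myP: "my <= P"
 proof -
  have "1 * my <= nn * my" using b(2) by (intro mult_le_mono1) simp
  thus ?thesis using nP by linarith
 qed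
 have A: "(h ^ 2 + 1) * (h * (24 * n + 13) + 10) <= 48 * G"
 proof -
  have "h * 10 + h * (24 * n + 13) <= h * (24 * nn)" unfolding distrib_left[symmetric] using nn_def by (intro mult_le_mono2) simp
  hence "h * (24 * n + 13) + 10 <= h * (24 * nn)" using b(1) by linarith
  hence "(h ^ 2 + 1) * (h * (24 * n + 13) + 10) <= (2 * h ^ 2) * (h * (24 * nn))" using one by (intro mult_le_mono) auto
  also have "... = 48 * (nn * h ^ 3)" by (simp add: eval_nat_numeral algebra_simps)
  also have "nn * h ^ 3 <= nn * h ^ 3 * my ^ 2" using one(3) by (metis mult_le_mono2 nat_mult_1_right)
  finally show ?thesis unfolding G_def by simp
 qed
 have nh3: "nn * h ^ 3 * my <= G" unfolding G_def using my2 by (rule mult_le_mono2)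
 have B1: "20 * n * h ^ 3 <= 20 * G"
 proof -
  have "n * h ^ 3 <= nn * h ^ 3" unfolding nn_def by (rule mult_le_mono1) simp
  also have "... <= nn * h ^ 3 * my" using one(4) by (metis mult_le_mono2 nat_mult_1_right)
  finally have "n * h ^ 3 <= G" using nh3 by (rule order_trans)
  thus ?thesis by simp
 qed
 \<comment> \<open>The number \<open>h ^ 3\<close> of levels is linear in \<open>n\<close> by
   \<open>fourth_root_cube\<close>, so visiting all levels in every search is harmless.\<close>
 have B2: "(2 * h ^ 3 + 1) * (CB (h ^ 3) + 10 * n + 14) <= 453 * G"
 proof -
  have "(n + 1) * (10 * m + 100) <= nn * (50 * my)" unfolding nn_def my_def by (intro mult_le_mono) auto
  hence "CB (h ^ 3) + 10 * n + 14 <= 50 * (nn * my) + 88 * nn + 11 + 10 * n + 14" unfolding CB_def using d8 by simp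
  also have "... <= 151 * (nn * my)" using nmu nn_def by linarith
  finally have "CB (h ^ 3) + 10 * n + 14 <= 151 * (nn * my)" .
  hence "(2 * h ^ 3 + 1) * (CB (h ^ 3) + 10 * n + 14) <= (3 * h ^ 3) * (151 * (nn * my))" using one by (intro mult_le_mono) auto
  also have "... = 453 * (nn * h ^ 3 * my)" by (simp add: algebra_simps)
  finally show ?thesis using nh3 by linarith
 qed
 have pre: "tpre h <= 600 * G"
 proof -
  have "2 * h <= 2 * G" "3 * m <= 3 * G" "5 * n <= 5 * G" "20 <= 20 * G"
   using hG myP PG nP nmu nn_def my_def b(1) by linarith+
  thus ?thesis using A B1 B2 unfolding tpre_def by linarith
 qed
 have q4: "q + 1 <= 4 * e * (h * h * my)"
 proof -
  have "1 * (1 * 1 * 1) <= e * (h * h * my)" using b by (intro mult_le_mono) auto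
  thus ?thesis unfolding q' by simp
 qed
 have eP: "P <= e * P" using mult_le_mono1[OF b(4), of P] by simp
 have C1: "(n + 1) * (10 * m + 100) <= 50 * (e * P)"
 proof -
  have "(n + 1) * (10 * m + 100) <= nn * (50 * my)" unfolding nn_def my_def by (intro mult_le_mono) auto
  also have "... = 50 * (nn * my)" by simp
  finally show ?thesis using nP eP by linarith
 qed
 have nhm: "nn * (h * h * my) <= P"
 proof -
  have "nn * (h * h * my) <= nn * (h * h * my ^ 2)" using my2 by (intro mult_le_mono2)
  thus ?thesis unfolding P_def by (simp add: power2_eq_square algebra_simps)
 qed
 have C2: "2 * (r * q) <= 6 * (e * P)"
 proof -
  have "r * q <= nn * q" using b(10) by (rule mult_le_mono1)
  also have "... = 3 * (e * (nn * (h * h * my)))" unfolding q' by (simp add: algebra_simps)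
  also have "... <= 3 * (e * P)" using nhm by (intro mult_le_mono2)
  finally show ?thesis by linarith
 qed
 have C3: "(CsT + CbT) * (q + 1) <= 136 * (e * P)"
 proof -
  have "(n + 1) * (3 * m + 50) <= nn * (25 * my)" unfolding nn_def my_def by (intro mult_le_mono) auto
  hence "CsT + CbT <= 34 * (nn * my)" unfolding CsT_def CbT_def using nmu nn_def by linarith
  hence "(CsT + CbT) * (q + 1) <= (34 * (nn * my)) * (4 * e * (h * h * my))" using q4 by (rule mult_le_mono)
  also have "... = 136 * (e * P)" unfolding P_def by (simp add: power2_eq_square algebra_simps)
  finally show ?thesis .
 qed
 \<comment> \<open>Here the threshold for lists is balanced against \<open>r <= h ^ 4\<close>: all
   lists of a search together have at most \<open>n * h ^ 2\<close> entries.\<close>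
 have Lr: "(n div h ^ 2) * r <= nn * h ^ 2"
 proof -
  have "(n div h ^ 2) * r <= (n div h ^ 2) * h ^ 4" using b(9) by (rule mult_le_mono2)
  also have "... = (n div h ^ 2 * h ^ 2) * h ^ 2" by (simp add: eval_nat_numeral algebra_simps)
  also have "... <= nn * h ^ 2" unfolding nn_def by (intro mult_le_mono1) (meson div_times_less_eq_dividend le_trans le_add1)
  finally show ?thesis .
 qed
 have nhP: "nn * h ^ 2 * my <= P" unfolding P_def using my2 by (rule mult_le_mono2)
 have nh: "nn * h ^ 2 <= P" using nhP one(4) by (metis mult_le_mono2 nat_mult_1_right order_trans)
 have C4: "CeT * (n div h ^ 2) * r <= 20 * (e * P)"
 proof -
  have "CeT <= 20 * my" unfolding CeT_def my_def by simp
  hence "CeT * ((n div h ^ 2) * r) <= (20 * my) * (nn * h ^ 2)" using Lr by (rule mult_le_mono)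
  also have "... = 20 * (nn * h ^ 2 * my)" by (simp add: algebra_simps)
  finally have "CeT * ((n div h ^ 2) * r) <= 20 * (e * P)" using nhP eP by linarith
  thus ?thesis by (simp only: mult.assoc)
 qed
 have C5: "(17 * (n div h ^ 2) + 12) * r <= 29 * (e * P)"
 proof -
  have "(17 * (n div h ^ 2) + 12) * r = 17 * ((n div h ^ 2) * r) + 12 * r" by (simp add: algebra_simps)
  moreover have "r <= P" using b(10) nP nmu by linarith
  ultimately show ?thesis using Lr nh eP by linarith
 qed
 have C6: "10 * n + 14 <= 10 * (e * P)" using nP nmu eP nn_def by linarith
 have "CCT q (n div h ^ 2) r + 10 * n + 14 <= 251 * (e * P)" unfolding CCT_def using C1 C2 C3 C4 C5 C6 by linarith
 hence "(h + 1) * (CCT q (n div h ^ 2) r + 10 * n + 14) <= (2 * h) * (251 * (e * P))" using b(1) by (intro mult_le_mono) auto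
 also have "... = 502 * (e * G)" unfolding hP[symmetric] by (simp add: algebra_simps)
 finally have C: "(h + 1) * (CCT q (n div h ^ 2) r + 10 * n + 14) <= 502 * (e * G)" .
 have Q: "q * (4 * m + 6) <= 12 * (e * G)"
 proof -
  have "q * (4 * m + 6) <= (3 * e * (h * h * my)) * (4 * my)" unfolding q' my_def by (intro mult_le_mono) auto
  also have "... = 12 * (e * (1 * h ^ 2 * my ^ 2))" by (simp add: power2_eq_square algebra_simps)
  also have "... <= 12 * (e * P)" unfolding P_def using b(2) by (intro mult_le_mono order_refl) simp
  also have "... <= 12 * (e * G)" using PG by (intro mult_le_mono2)
  finally show ?thesis .
 qed
 have eG: "G <= e * G" using mult_le_mono1[OF b(4), of G] by simp
 have "5 * n <= 5 * G" "10 <= 10 * G" using nP nmu PG nn_def by linarith+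
 hence "tpost q h r <= 529 * (e * G)" unfolding tpost_def using C Q eG by linarith
 hence "tpre h + tpost q h r <= 2000 * (e * G)" using pre eG by linarith
 thus ?thesis unfolding e_def G_def nn_def my_def by (simp only: mult.assoc)
qed

text \<open>\<open>prep\<close> is analysed once, on the empty tape, to obtain \<open>S\<close>,
  \<open>h\<close> and \<open>r\<close>; \<open>big_coins\<close> transfers its result to every
  tape. So \<open>q\<close> and the family of sets to be hit are fixed outside the
  probability.\<close>

lemma main_prob:
 assumes least: "ALL k<m. 2 ^ k < n" and cB: "(3 * (c + 3) + 1) * (n + 2) ^ 4 < B"
 shows "EX q h r. fourth_root h r & r <= n & (EX X:J Snd. card X = r) &
  measure_pmf.prob (coinl (q * m)) {cs. EX u. big (prep c ;; postp) (st0 cs) u &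
   (EX S. common S & (ALL X. common X --> card X <= card S) & out u ` {..<rv u 26} = S) & rv u 26 <= n &
   clk u <= 2000 * (c + 3) * ((n + 2) * h ^ 3 * (m + 2) ^ 2)} >= 1 - 1 / real (n + 2) ^ c"
proof -
 have cB': "3 * (c + 3) * (n + 2) ^ 4 < B" using cB by (simp add: add_mult_distrib)
 have "T (prep c) (st0 []) (%t. EX S h r. (ALL v<n. ra t 2 v = of_bool (v : S)) & common S & rv t 2 = Z & rv t 3 = m &
  rv t 25 = 3 * (c + 3) * (h * h * (m + 2)) & fourth_root h r & r <= n & (ALL X:J Snd. card X <= r) & (EX X:J Snd. card X = r) &
  (ALL X. common X --> h ^ 3 * card X <= h ^ 3 * card S + card S) & clk t <= clk (st0 []) + tpre h)"
  by (rule prep_T[OF least cB']) (simp_all add: st0_def)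
 then obtain t S h r where t: "big (prep c) (st0 []) t" "ALL v<n. ra t 2 v = of_bool (v : S)" "common S" "rv t 2 = Z" "rv t 3 = m"
  "rv t 25 = 3 * (c + 3) * (h * h * (m + 2))" "fourth_root h r" "r <= n" "ALL X:J Snd. card X <= r" "EX X:J Snd. card X = r"
  "ALL X. common X --> h ^ 3 * card X <= h ^ 3 * card S + card S" "clk t <= clk (st0 []) + tpre h" unfolding T_def by (elim exE conjE)
 define q where "q = 3 * (c + 3) * (h * h * (m + 2))"
 have h: "1 <= h" "h <= n + 1" using t(7) unfolding fourth_root_def by auto
 have qB: "q + 1 < B"
 proof -
  have "h * h <= (n + 2) ^ 2" using mult_le_mono[of h "n + 2" h "n + 2"] h by (simp add: power2_eq_square)
  moreover have "m + 2 <= (n + 2) ^ 2" using m_bound by (simp add: power2_eq_square)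
  ultimately have "h * h * (m + 2) <= (n + 2) ^ 2 * (n + 2) ^ 2" by (rule mult_le_mono)
  hence le: "q <= 3 * (c + 3) * ((n + 2) ^ 2 * (n + 2) ^ 2)" unfolding q_def by (rule mult_le_mono2)
  define y where "y = (n + 2) ^ 4"
  have "(n + 2) ^ 2 * (n + 2) ^ 2 = y" unfolding y_def by (simp add: power_add[symmetric])
  hence "q <= 3 * (c + 3) * y" using le by simp
  moreover have "1 <= y" unfolding y_def by simp
  moreover have "3 * (c + 3) * y + y < B" using cB unfolding y_def[symmetric] by (simp add: add_mult_distrib)
  ultimately show ?thesis by linarith
 qed
 have run: "EX u. big (prep c ;; postp) (st0 cs) u & (EX S. common S & (ALL X. common X --> card X <= card S) & out u ` {..<rv u 26} = S) & rv u 26 <= n &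
   clk u <= 2000 * (c + 3) * ((n + 2) * h ^ 3 * (m + 2) ^ 2)"
  if cs: "length cs = q * m" "ALL i<=h. goodS (%k. draw m cs k mod n) q (n div h ^ 2) ((nextS ^^ i) S)" for cs
 proof -
  let ?t = "t(|coins := cs|)"
  have "big (prep c) (st0 [](|coins := cs|)) ?t" by (rule big_coins[OF t(1) mods_prep])
  moreover have "st0 [](|coins := cs|) = st0 cs" unfolding st0_def by simp
  ultimately have b1: "big (prep c) (st0 cs) ?t" by simp
  have g: "goodS (%k. draw m cs k mod n) q (n div h ^ 2) ((nextS ^^ i) S)" if "i <= h" for i using cs(2) that by blast
  have "T postp ?t (%t'. EX S. common S & (ALL X. common X --> card X <= card S) & out t' ` {..<rv t' 26} = S & rv t' 26 <= n & clk t' <= clk ?t + tpost q h r)"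
   by (rule postp_T[OF t(3) _ _ _ _ qB t(7,9,11) _ cs(1) g]) (use t q_def in simp_all)
  then obtain u S' where u: "big postp ?t u" "common S'" "ALL X. common X --> card X <= card S'" "out u ` {..<rv u 26} = S'" "rv u 26 <= n" "clk u <= clk ?t + tpost q h r"
   unfolding T_def by blast
  have "clk (st0 []) = 0" "clk ?t = clk t" by (simp_all add: st0_def)
  hence "clk u <= 2000 * (c + 3) * ((n + 2) * h ^ 3 * (m + 2) ^ 2)" using u(6) t(12) time_bound[OF t(7,8) q_def] by linarith
  moreover have "big (prep c ;; postp) (st0 cs) u" by (rule big.Seq[OF b1 u(1)])
  ultimately show ?thesis using u by blast
 qed
 have "1 - 1 / real (n + 2) ^ c <= measure_pmf.prob (coinl (q * m)) {cs. ALL i<=h. goodS (%k. draw m cs k mod n) q (n div h ^ 2) ((nextS ^^ i) S)}"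
  by (rule prob_good[OF t(3) h q_def])
 also have "... = measure_pmf.prob (coinl (q * m)) ({cs. ALL i<=h. goodS (%k. draw m cs k mod n) q (n div h ^ 2) ((nextS ^^ i) S)} Int set_pmf (coinl (q * m)))"
  by (rule measure_Int_set_pmf[symmetric])
 also have "... <= measure_pmf.prob (coinl (q * m)) {cs. EX u. big (prep c ;; postp) (st0 cs) u &
   (EX S. common S & (ALL X. common X --> card X <= card S) & out u ` {..<rv u 26} = S) & rv u 26 <= n &
   clk u <= 2000 * (c + 3) * ((n + 2) * h ^ 3 * (m + 2) ^ 2)}"
  by (rule measure_pmf.finite_measure_mono) (use run in \<open>auto simp: set_replicate_pmf\<close>)
 finally show ?thesis using t(7,8,10) by blast
qed

end

section \<open>The theorem\<close>

text \<open>The preamble fills the constant registers; register \<open>5\<close> is zero already.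
  The epilogue moves the length of the output to register \<open>0\<close>.\<close>

definition full :: "nat => com => nat => instr list" where
 "full M c x = [Const 4 1, Const 3 (4 * M), Arith Add 6 0 4] @ comp 3 c @ [Arith Add 0 (vr x) 5, Halt]"

context compiled
begin

lemma full_run:
 assumes P: "P = full M c x" and b: "big c (st0 cs) u" and w: "wf M (2 ^ w) c" and K: "kc c <= KP" "1 + KP * clk u <= 2 ^ w"
 shows "EX t H zs. t <= KP * clk u + 4 & reach (init_config (length us)) cs t H zs & halted P H & regs H 0 = rv u x &
  (ALL i<length us. mem H i = out u i)"
proof -
 note sb = small_bounds
 define H3 :: "'a config" where "H3 = (init_config (length us))(|pc := 3, regs := (%_. 0)(0 := length us, 4 := 1, 3 := 4 * M, 6 := Suc (length us))|)"
 have c0: "code_at 0 ([Const 4 1, Const 3 (4 * M), Arith Add 6 0 4] @ comp 3 c @ [Arith Add 0 (vr x) 5, Halt])"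
  using P unfolding code_at_def full_def by (intro exI[of _ "[]"]) simp
 have l3: "0 + length [Const 4 1, Const 3 (4 * M), Arith Add 6 0 4] = 3" by simp
 have c1: "code_at 0 [Const 4 1, Const 3 (4 * M), Arith Add 6 0 4]" "code_at 3 (comp 3 c)" "code_at (3 + length (comp 3 c)) [Arith Add 0 (vr x) 5, Halt]"
  using c0 unfolding code_at_append l3 by blast+
 have r1: "reach (init_config (length us)) cs 3 H3 cs"
 proof -
  let ?s0 = "init_config (length us) :: 'a config"
  let ?s1 = "set_reg 4 1 ?s0" and ?s2 = "set_reg 3 (4 * M) (set_reg 4 1 ?s0)"
  have p: "P ! 0 = Const 4 1" "P ! 1 = Const 3 (4 * M)" "P ! 2 = Arith Add 6 0 4" "2 < length P" "P ~= []" unfolding P full_def by simp_all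
  have w0: "w ~= 0" using sb(4) by (cases w) auto
  have a3: "reach ?s2 cs (Suc 0) (set_reg 6 (Suc (length us)) ?s2) cs"
   by (rule reach_det[OF _ _ _ reach_refl]) (use p sb in \<open>simp_all add: set_reg_def init_config_def numeral_2_eq_2\<close>)
  have a2: "reach ?s1 cs (Suc (Suc 0)) (set_reg 6 (Suc (length us)) ?s2) cs"
   by (rule reach_det[OF _ _ _ a3]) (use p sb in \<open>simp_all add: set_reg_def init_config_def\<close>)
  have a1: "reach ?s0 cs (Suc (Suc (Suc 0))) (set_reg 6 (Suc (length us)) ?s2) cs"
   by (rule reach_det[OF _ _ _ a2]) (use p sb w0 in \<open>simp_all add: set_reg_def init_config_def\<close>)
  moreover have "set_reg 6 (Suc (length us)) ?s2 = H3" unfolding H3_def set_reg_def init_config_def by (simp add: fun_upd_twist)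
  ultimately show ?thesis by (simp add: numeral_3_eq_3)
 qed
 have vne: "vr y ~= 0" "vr y ~= 3" "vr y ~= 4" "vr y ~= 6" "vs j y ~= 0" "vs j y ~= 3" "vs j y ~= 4" "vs j y ~= 6" for y j
  by (simp_all add: vr_def)
 have rel0: "rel (st0 cs) H3" unfolding rel_def hrep_def H3_def st0_def init_config_def using vne by simp
 have "EX t H'. t <= KP * (clk u - clk (st0 cs)) & reach H3 (coins (st0 cs)) t H' (coins u) & rel u H' & pc H' = pc H3 + length (comp (pc H3) c)"
  by (rule comp_correct[OF b w rel0 _ K(1)]) (use c1 K(2) in \<open>simp_all add: H3_def st0_def init_config_def\<close>)
 then obtain t H' where t: "t <= KP * clk u" "reach H3 cs t H' (coins u)" "rel u H'" "pc H' = 3 + length (comp 3 c)"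
  by (auto simp: H3_def st0_def init_config_def)
 let ?H = "set_reg 0 (rv u x) H'"
 have v: "regs H' (vr x) = rv u x" "rv u x < 2 ^ w" "regs H' 5 = 0" "ALL i<length us. mem H' i = out u i" using t(3) unfolding rel_def by auto
 have ce: "code_at (pc H') [Arith Add 0 (vr x) 5, Halt]" using c1(3) t(4) by simp
 have "reach H' (coins u) (Suc 0) ?H (coins u)"
  by (rule reach_exec[OF ce _ _ reach_refl]) (use v in simp_all)
 hence "reach (init_config (length us)) cs (3 + (t + Suc 0)) ?H (coins u)" by (intro reach_trans[OF r1] reach_trans[OF t(2)])
 moreover have "halted P ?H" using ce unfolding halted_def code_at_Cons by (simp add: set_reg_def)
 moreover have "3 + (t + Suc 0) <= KP * clk u + 4" using t(1) by simp
 moreover have "regs ?H 0 = rv u x" "ALL i<length us. mem ?H i = out u i" using v by (simp_all add: set_reg_def)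
 ultimately show ?thesis by blast
qed

end

lemma matroid_transport:
 assumes M: "matroid U I" and us: "distinct us" "set us = U"
 shows "matroid {..<length us} {X. X <= {..<length us} & (!) us ` X : I}"
proof -
 interpret matroid U I by (rule M)
 have inj: "inj_on ((!) us) X" if "X <= {..<length us}" for X
  using us(1) that by (meson inj_on_nth inj_on_subset lessThan_iff subsetD)
 show ?thesis
 proof
  fix X Y assume X: "X : {X. X <= {..<length us} & (!) us ` X : I}" and Y: "Y <= X"
  thus "Y : {X. X <= {..<length us} & (!) us ` X : I}" using indep_mono[of "(!) us ` X" "(!) us ` Y"] by auto
 next
  fix X Y assume X: "X : {X. X <= {..<length us} & (!) us ` X : I}" and Y: "Y : {X. X <= {..<length us} & (!) us ` X : I}"
   and c: "card X < card Y"
  have "card ((!) us ` X) < card ((!) us ` Y)" using X Y c inj by (simp add: card_image)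
  then obtain y where y: "y : (!) us ` Y - (!) us ` X" "insert y ((!) us ` X) : I" using augment[of "(!) us ` X" "(!) us ` Y"] X Y by auto
  then obtain i where "i : Y" "y = us ! i" by blast
  thus "EX y:Y - X. insert y X : {X. X <= {..<length us} & (!) us ` X : I}" using y X Y by (intro bexI[of _ i]) auto
 qed (use indep_empty in auto)
qed

lemma rank_ge:
 assumes M: "matroid U I" and X: "X : I"
 shows "card X <= matroid_rank I"
proof -
 interpret matroid U I by (rule M)
 have "I <= Pow U" using indep_subset by auto
 hence "finite I" using finite_ground by (simp add: finite_subset)
 thus ?thesis unfolding matroid_rank_def using X by (intro Max_ge) auto
qed

lemma two_power_ceillog2: "x ^ b <= 2 ^ (b * ceillog2 x)" if "0 < x" for x b :: nat
proof -
 have "x <= 2 ^ ceillog2 x" using ceillog2_le_iff[OF that, of "ceillog2 x"] by simp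
 hence "x ^ b <= (2 ^ ceillog2 x) ^ b" by (rule power_mono) simp
 thus ?thesis by (simp add: power_mult[symmetric] mult.commute)
qed

lemma exists_level: "EX m. n <= (2::nat) ^ m & 2 ^ m <= 2 * n + 1 & (ALL k<m. 2 ^ k < n)"
proof -
 have ex: "EX m. n <= (2::nat) ^ m" using less_exp[of n] less_imp_le by blast
 define m where "m = (LEAST m. n <= (2::nat) ^ m)"
 have 1: "n <= 2 ^ m" unfolding m_def using ex by (rule LeastI_ex)
 have 2: "2 ^ k < n" if "k < m" for k using not_less_Least[of k "%m. n <= 2 ^ m"] that unfolding m_def by simp
 have "2 ^ m <= 2 * n + 1"
 proof (cases m)
  case (Suc k)
  thus ?thesis using 2[of k] by simp
 qed simp
 thus ?thesis using 1 2 by blast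
qed

text \<open>Since \<open>h - 1\<close> is at most the fourth root of \<open>R\<close> unless
  \<open>h = 1\<close>, \<open>h\<close> is at most twice the fourth root of \<open>max R 1\<close>;
  the maximum covers rank zero.\<close>

lemma cube_le_powr:
 assumes h: "1 <= h" "h = 1 | (h - 1) ^ 4 < r" and r: "r <= R"
 shows "real h ^ 3 <= 8 * real (max R 1) powr (3 / 4)"
proof -
 define y where "y = real (max R 1) powr (1 / 4)"
 have y1: "1 <= y" unfolding y_def by (simp add: ge_one_powr_ge_zero)
 have y4: "y ^ 4 = real (max R 1)" unfolding y_def by (simp add: powr_power)
 have y3: "y ^ 3 = real (max R 1) powr (3 / 4)" unfolding y_def by (simp add: powr_power)
 have "real h <= 2 * y"
 proof (cases "h = 1")
  case False
  hence "(h - 1) ^ 4 <= max R 1" using h r by auto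
  hence "real (h - 1) ^ 4 <= y ^ 4" unfolding y4 by (metis of_nat_mono of_nat_power)
  hence "real (h - 1) <= y" by (rule power_le_imp_le_base[of _ 3, simplified]) (use y1 in simp)
  thus ?thesis using h False y1 by linarith
 qed (use y1 in simp)
 hence "real h ^ 3 <= (2 * y) ^ 3" by (rule power_mono) simp
 thus ?thesis using y3 by (simp add: power_mult_distrib)
qed

text \<open>From \<open>2 ^ m <= (n + 2) ^ 2\<close> and \<open>ln 2 >= 1 / 2\<close> both
  \<open>m\<close> and \<open>2\<close> are at most \<open>4 * ln (n + 2)\<close>.\<close>

lemma level_le_ln:
 assumes "2 ^ m <= 2 * n + (1::nat)"
 shows "real (m + 2) <= 8 * ln (real (n + 2))"
proof -
 have l2: "1 / 2 <= ln (2::real)" by (rule iffD2[OF ln_ge_iff[OF zero_less_numeral] exp_half_le2])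
 have "2 ^ m <= (n + 2) ^ 2" using assms by (simp add: power2_eq_square)
 hence "real (2 ^ m) <= real ((n + 2) ^ 2)" by (rule of_nat_mono)
 hence "ln (2 ^ m :: real) <= ln (real (n + 2) ^ 2)" by simp
 hence "real m * ln 2 <= 2 * ln (real (n + 2))" by (simp add: ln_realpow)
 moreover have "real m * (1 / 2) <= real m * ln 2" using l2 by (intro mult_left_mono) auto
 ultimately have "real m <= 4 * ln (real (n + 2))" by simp
 moreover have "1 / 2 <= ln (real (n + 2))" 
 proof -
  have "ln 2 <= ln (real (n + 2))" by (subst ln_le_cancel_iff) auto
  thus ?thesis using l2 by linarith
 qed
 ultimately show ?thesis by simp
qed

theorem theoremC2:
  "\<forall>c :: nat. \<exists>(P :: instr list) (b :: nat) (C :: real) (k :: nat). b \<ge> 1 \<and>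
    (\<forall>(U :: 'a set) (I\<^sub>1 :: 'a set set) (I\<^sub>2 :: 'a set set) (us :: 'a list).
      matroid U I\<^sub>1 \<and> matroid U I\<^sub>2 \<and> distinct us \<and> set us = U \<longrightarrow>
      (let n = card U;
           r = max (matroid_rank I\<^sub>1) (matroid_rank I\<^sub>2);
           w = b * ceillog2 (n + 2);
           T = nat \<lfloor>C * (real (n + 2) * real (max r 1) powr (3 / 4) * ln (real (n + 2)) ^ k)\<rfloor>
       in measure_pmf.prob (run P w us (case_side I\<^sub>1 I\<^sub>2) T)
            {s. halted P s \<and>
                (\<exists>S. outputs us s S \<and> is_arg_max card (\<lambda>S. S \<in> I\<^sub>1 \<inter> I\<^sub>2) S)}
          \<ge> 1 - 1 / real (n + 2) ^ c))"
  (is "ALL c. EX P b C k. ?A c P b C k")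
proof (rule allI)
 fix c :: nat
 define p where "p = (prog.prep c ;; prog.postp)"
 obtain M0 where M0: "ALL M>=M0. wf M M p" using wf_ev by blast
 define M where "M = max M0 1"
 define KP where "KP = max 1 (kc p)"
 \<comment> \<open>\<open>B = E1 * nn ^ 4\<close> has to exceed both \<open>8 * nn ^ 4\<close> and
   the bound \<open>(3 * (c + 3) + 1) * nn ^ 4\<close> for the sample size.\<close>
 define E1 where "E1 = 3 * (c + 3) + 9"
 \<comment> \<open>The summands cover memory addresses, the number of created sets and the constants
   of the program, each up to a factor \<open>nn ^ 5\<close>. As \<open>E < 2 ^ E <= nn ^ E\<close>,
   a word of \<open>5 + E\<close> times the logarithm of \<open>nn\<close> suffices.\<close>
 define E where "E = 4 * M * E1 + KP * (2000 * (c + 3) * 32) + M + 2"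
 define P where "P = full M p 26"
 define D where "D = KP * 2000 * (c + 3) + 4"
 \<comment> \<open>The factor \<open>512\<close> is \<open>8 * 64\<close>, from
   \<open>h ^ 3 <= 8 * r powr (3 / 4)\<close> with \<open>r\<close> at least one and from
   \<open>(m + 2) ^ 2 <= 64 * ln (n + 2) ^ 2\<close>.\<close>
 have "?A c P (5 + E) (real D * 512) 2"
 proof (intro conjI allI impI)
  fix U :: "'a set" and I1 I2 :: "'a set set" and us :: "'a list"
  assume "matroid U I1 & matroid U I2 & distinct us & set us = U"
  hence MM: "matroid U I1" "matroid U I2" and us: "distinct us" "set us = U" by auto
  have cU: "card U = length us" using us distinct_card by metis
  define R where "R = max (matroid_rank I1) (matroid_rank I2)"
  define w where "w = (5 + E) * ceillog2 (length us + 2)"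
  define tt where "tt = nat \<lfloor>(real D * 512) * (real (length us + 2) * real (max R 1) powr (3 / 4) * ln (real (length us + 2)) ^ 2)\<rfloor>"
  define G where "G = {s. halted P s & (EX S. outputs us s S & is_arg_max card (%S. S : I1 Int I2) S)}"
  define nn where "nn = length us + 2"
  obtain m where m: "length us <= (2::nat) ^ m" "2 ^ m <= 2 * length us + 1" "ALL k<m. 2 ^ k < length us" using exists_level by blast
  define B where "B = E1 * nn ^ 4"
  let ?J = "%j. {X. X <= {..<length us} & (!) us ` X : case_side I1 I2 j}"
  have n1: "1 <= nn ^ 4" "1 <= nn ^ 5" unfolding nn_def by simp_all
  have bounds: "nn ^ 4 * 8 < B" "(3 * (c + 3) + 1) * nn ^ 4 < B" "0 < B"
  proof -
   have "nn ^ 4 * 8 < nn ^ 4 * E1" "nn ^ 4 * (3 * (c + 3) + 1) < nn ^ 4 * E1" unfolding E1_def nn_def by simp_all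
   thus "nn ^ 4 * 8 < B" "(3 * (c + 3) + 1) * nn ^ 4 < B" "0 < B" unfolding B_def by (simp_all add: mult.commute)
  qed
  have mJ: "matroid {..<length us} (?J j)" for j
   using matroid_transport[OF MM(1) us] matroid_transport[OF MM(2) us] by (cases j) simp_all
  interpret pr: prog "length us" B ?J m "2 ^ m"
   by (intro prog.intro matroid_pair.intro prog_axioms.intro mJ refl m(1,2) bounds(1)[unfolded nn_def])
  have Ew: "E * nn ^ 5 < 2 ^ w"
  proof -
   have "E * nn ^ 5 < 2 ^ E * nn ^ 5" using less_exp[of E] unfolding nn_def by simp
   also have "... <= nn ^ E * nn ^ 5" unfolding nn_def by (intro mult_le_mono1 power_mono) auto
   also have "... = nn ^ (5 + E)" by (simp add: power_add)
   also have "... <= 2 ^ w" unfolding w_def nn_def by (rule two_power_ceillog2) simp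
   finally show ?thesis .
  qed
  have EE: "E <= 2 ^ w" using Ew n1(2) by (metis less_imp_le_nat mult_le_mono2 nat_mult_1_right order_trans)
  have WB: "length us + B * Suc (length us) * (4 * M) < 2 ^ w"
  proof -
   have "B * Suc (length us) * (4 * M) <= E1 * nn ^ 4 * nn * (4 * M)" unfolding B_def nn_def by (intro mult_le_mono) auto
   also have "... = 4 * M * E1 * nn ^ 5" by (simp add: eval_nat_numeral algebra_simps)
   finally have "B * Suc (length us) * (4 * M) <= 4 * M * E1 * nn ^ 5" .
   moreover have "length us <= 1 * nn ^ 5" unfolding nn_def using self_le_power[of "length us + 2" 5] by simp
   ultimately have "length us + B * Suc (length us) * (4 * M) <= (4 * M * E1 + 1) * nn ^ 5" by (simp add: add_mult_distrib)
   also have "... <= E * nn ^ 5" unfolding E_def by (intro mult_le_mono1) simp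
   finally show ?thesis using Ew by linarith
  qed
  interpret cm: compiled P w us "case_side I1 I2" M B
   by unfold_locales (use us bounds(3) WB in \<open>simp_all add: M_def\<close>)
  have wfp: "wf M (2 ^ w) p"
  proof -
   have "M <= 2 ^ w" using EE unfolding E_def by linarith
   moreover have "wf M M p" using M0 unfolding M_def by simp
   ultimately show ?thesis using wf_mono[OF order_refl] by blast
  qed
  obtain q h r where hr: "pr.fourth_root h r" "r <= length us" "EX X:?J Snd. card X = r"
   and pb: "measure_pmf.prob (coinl (q * m)) {cs. EX u. pr.big p (st0 cs) u &
   (EX S. pr.common S & (ALL X. pr.common X --> card X <= card S) & out u ` {..<rv u 26} = S) & rv u 26 <= length us &
   clk u <= 2000 * (c + 3) * ((length us + 2) * h ^ 3 * (m + 2) ^ 2)} >= 1 - 1 / real (length us + 2) ^ c"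
   using pr.main_prob[OF m(3) bounds(2)[unfolded nn_def]] unfolding p_def by (elim exE conjE) blast
  have inj: "inj_on ((!) us) X" if "X <= {..<length us}" for X
   using us(1) that by (meson inj_on_nth inj_on_subset lessThan_iff subsetD)
  have rR: "r <= R"
  proof -
   obtain X where X: "X : ?J Snd" "card X = r" using hr(3) by blast
   hence "card ((!) us ` X) = r" using inj card_image by auto
   hence "r <= matroid_rank I2" using rank_ge[OF MM(2), of "(!) us ` X"] X(1) by simp
   thus ?thesis unfolding R_def by simp
  qed
  have h: "1 <= h" "h = 1 | (h - 1) ^ 4 < r" using hr(1) unfolding pr.fourth_root_def by auto
  define G0 where "G0 = nn * h ^ 3 * (m + 2) ^ 2"
  have G1: "1 <= G0" 
  proof -
   have "1 * 1 * 1 <= nn * h ^ 3 * (m + 2) ^ 2" using h unfolding nn_def by (intro mult_le_mono) auto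
   thus ?thesis unfolding G0_def by simp
  qed
  have G4: "G0 <= 32 * nn ^ 4"
  proof -
   have "h ^ 3 <= 8 * nn" using pr.fourth_root_cube[OF hr(1,2)] unfolding nn_def .
   moreover have "(m + 2) ^ 2 <= (2 * nn) ^ 2" using pr.m_bound unfolding nn_def by (intro power_mono) auto
   ultimately have "G0 <= nn * (8 * nn) * (2 * nn) ^ 2" unfolding G0_def by (intro mult_le_mono) auto
   thus ?thesis by (simp add: eval_nat_numeral algebra_simps)
  qed
  have T1: "KP * clk u + 4 <= tt" and T2: "1 + KP * clk u <= 2 ^ w" if u: "clk u <= 2000 * (c + 3) * G0" for u :: st
  proof -
   have k: "KP * clk u <= KP * (2000 * (c + 3) * G0)" using u by (rule mult_le_mono2)
   define y where "y = KP * (2000 * (c + 3) * G0)"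
   have "D * G0 = y + 4 * G0" unfolding D_def y_def add_mult_distrib by (simp only: mult.assoc)
   hence "KP * clk u + 4 <= D * G0" using k G1 unfolding y_def[symmetric] by linarith
   hence "real (KP * clk u + 4) <= real D * real G0" by (metis of_nat_mono of_nat_mult)
   also have "real G0 <= 512 * (real nn * real (max R 1) powr (3 / 4) * ln (real nn) ^ 2)"
   proof -
   have a: "real h ^ 3 <= 8 * real (max R 1) powr (3 / 4)" by (rule cube_le_powr[OF h rR])
   have b: "real (m + 2) ^ 2 <= (8 * ln (real nn)) ^ 2" using level_le_ln[OF m(2)] unfolding nn_def by (intro power_mono) auto
   have "real G0 = real nn * (real h ^ 3 * real (m + 2) ^ 2)" unfolding G0_def by simp
   also have "... <= real nn * ((8 * real (max R 1) powr (3 / 4)) * (8 * ln (real nn)) ^ 2)"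
   using a b by (intro mult_left_mono mult_mono) auto
   finally show ?thesis by (simp add: power_mult_distrib algebra_simps)
   qed
   finally have "real (KP * clk u + 4) <= (real D * 512) * (real nn * real (max R 1) powr (3 / 4) * ln (real nn) ^ 2)"
   by (simp add: mult_left_mono mult.assoc)
   thus "KP * clk u + 4 <= tt" unfolding tt_def nn_def by (rule le_nat_floor)
   have "KP * (2000 * (c + 3) * G0) <= KP * (2000 * (c + 3) * (32 * nn ^ 4))" using G4 by (intro mult_le_mono2)
   also have "... <= KP * (2000 * (c + 3) * (32 * nn ^ 5))" unfolding nn_def by (intro mult_le_mono2 power_increasing) auto
   also have "... = (KP * (2000 * (c + 3) * 32)) * nn ^ 5" by (simp only: mult.assoc)
   finally have "1 + KP * clk u <= (KP * (2000 * (c + 3) * 32) + 1) * nn ^ 5" using k n1(2) unfolding add_mult_distrib by linarith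
   also have "... <= E * nn ^ 5" unfolding E_def by (intro mult_le_mono1) linarith
   finally show "1 + KP * clk u <= 2 ^ w" using Ew by linarith
  qed
  have reachG: "EX t<=tt. EX H:G. EX zs. cm.reach (init_config (length us)) cs t H zs"
   if b: "pr.big p (st0 cs) u" and S: "pr.common S" "ALL X. pr.common X --> card X <= card S" "out u ` {..<rv u 26} = S"
   and r26: "rv u 26 <= length us" and ck: "clk u <= 2000 * (c + 3) * G0" for cs u S
  proof -
   obtain t H zs where t: "t <= KP * clk u + 4" "cm.reach (init_config (length us)) cs t H zs" "halted P H" "regs H 0 = rv u 26"
   "ALL i<length us. mem H i = out u i"
   using cm.full_run[OF P_def b wfp _ T2[OF ck]] unfolding KP_def by auto
   have Sn: "S <= {..<length us}" using pr.common_sub(1)[OF S(1)] .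
   have mo: "mem H i = out u i" "out u i : S" if "i < rv u 26" for i using t(5) that r26 S(3) by auto
   have "outputs us H ((!) us ` S)" unfolding outputs_def t(4)
   proof
   show "ALL i<rv u 26. mem H i < length us" using mo Sn by auto
   have "(%i. us ! mem H i) ` {..<rv u 26} = (!) us ` (out u ` {..<rv u 26})" unfolding image_image using mo by (intro image_cong) auto
   thus "(!) us ` S = (%i. us ! mem H i) ` {..<rv u 26}" using S(3) by simp
   qed
   moreover have "is_arg_max card (%S. S : I1 Int I2) ((!) us ` S)" unfolding is_arg_max_def
   proof
   show "(!) us ` S : I1 Int I2" using S(1) unfolding pr.common_def by auto
   show "\<nexists>Y. Y : I1 Int I2 & card ((!) us ` S) < card Y"
   proof
   assume "EX Y. Y : I1 Int I2 & card ((!) us ` S) < card Y"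
   then obtain Y where Y: "Y : I1" "Y : I2" "card ((!) us ` S) < card Y" by blast
   define X where "X = {i. i < length us & us ! i : Y}"
   have YU: "Y <= set us" using matroid.indep_subset[OF MM(1) Y(1)] us(2) by simp
   have XY: "(!) us ` X = Y"
   proof
   show "Y <= (!) us ` X"
   proof
   fix x assume "x : Y"
   then obtain i where "i < length us" "us ! i = x" using YU by (metis in_set_conv_nth subsetD)
   thus "x : (!) us ` X" using \<open>x : Y\<close> unfolding X_def by blast
   qed
   qed (auto simp: X_def)
   have Xn: "X <= {..<length us}" unfolding X_def by auto
   have "pr.common X" unfolding pr.common_def using XY Xn Y by simp
   hence "card X <= card S" using S(2) by blast
   moreover have "card Y = card X" "card ((!) us ` S) = card S" using card_image[OF inj[OF Xn]] card_image[OF inj[OF Sn]] XY by simp_all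
   ultimately show False using Y(3) by simp
   qed
   qed
   ultimately have "H : G" unfolding G_def using t(3) by blast
   thus ?thesis using t(1,2) T1[OF ck] by (meson order_trans)
  qed
  have "1 - 1 / real (length us + 2) ^ c <= measure_pmf.prob (coinl (q * m)) {zs. EX t<=tt. EX H':G. EX zs'. cm.reach (init_config (length us)) zs t H' zs'}"
   by (rule order_trans[OF pb], rule measure_pmf.finite_measure_mono) (use reachG in \<open>auto simp: G0_def nn_def\<close>)
  also have "... <= measure_pmf.prob (cm.runs tt (init_config (length us))) G" by (rule cm.prob_runs_ge) (simp add: G_def)
  also have "... = measure_pmf.prob (run P w us (case_side I1 I2) tt) G" by (simp add: cm.run_eq_runs)
  finally show "let n = card U; r = max (matroid_rank I1) (matroid_rank I2); w = (5 + E) * ceillog2 (n + 2);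
   T = nat \<lfloor>(real D * 512) * (real (n + 2) * real (max r 1) powr (3 / 4) * ln (real (n + 2)) ^ 2)\<rfloor>
   in measure_pmf.prob (run P w us (case_side I1 I2) T)
   {s. halted P s & (EX S. outputs us s S & is_arg_max card (%S. S : I1 Int I2) S)}
   >= 1 - 1 / real (n + 2) ^ c"
   unfolding Let_def cU G_def w_def tt_def R_def by blast
 qed simp
 thus "EX P b C k. ?A c P b C k" by blast
qed

end
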